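(* Let $p\in(1,\infty)$. Then for every $f\in\mathfrak C_0\cap\Lambda_1$, $$\mathrm{dist}\left(f,W^{1,p}\cap\Lambda_1\right)_{\Lambda_1}\sim\inf\left\{\varepsilon\in(0,\infty):\left\|\left[\int_0^1\mathbf 1_{\{(x,y)\in\mathbb R^n\times(0,1]:\,y^{-1}\Delta_2f(x,y)>\varepsilon\}}(\cdot,y)\frac{dy}{y}\right]^{1/2}\right\|_{L^p(\mathbb R^n)}<\infty\right\}$$ with positive equivalence constants independent of $f$.
   Context: $\mathfrak C_0$ is the space of continuous functions on $\mathbb R^n$ with $\lim_{|x|\to\infty}f(x)=0$. $\Delta_hf(x):=f(x+h/2)-f(x-h/2)$, $\Delta^2_h:=\Delta_h\Delta_h$, $\Delta_2f(x,y):=\sup_{h\in\mathbb R^n,|h|=y}|\Delta_h^2f(x)|$. $\Lambda_1$: bounded continuous $f$ with $\|f\|_{\Lambda_1}:=\|f\|_{L^\infty}+\sup_{x\in\mathbb R^n,y\in(0,1]}\Delta_2f(x,y)/y<\infty$. $W^{1,p}$ is the usual Sobolev space. $\mathrm{dist}(f,V)_{\Lambda_1}:=\inf_{g\in V}\|f-g\|_{\Lambda_1}$. *)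

theory Defs
  imports "HOL-Analysis.Analysis"
begin

definition C0 :: "('a::euclidean_space \<Rightarrow> real) set" where
  "C0 = {f. continuous_on UNIV f \<and> (f \<longlongrightarrow> 0) at_infinity}"

definition Dh :: "'a::euclidean_space \<Rightarrow> ('a \<Rightarrow> real) \<Rightarrow> 'a \<Rightarrow> real" where
  "Dh h f x = f (x + (1/2) *\<^sub>R h) - f (x - (1/2) *\<^sub>R h)"

definition Dh2 :: "'a::euclidean_space \<Rightarrow> ('a \<Rightarrow> real) \<Rightarrow> 'a \<Rightarrow> real" where
  "Dh2 h f = Dh h (Dh h f)"

definition Delta2 :: "('a::euclidean_space \<Rightarrow> real) \<Rightarrow> 'a \<Rightarrow> real \<Rightarrow> real" where
  "Delta2 f x y = (SUP h\<in>{h. norm h = y}. \<bar>Dh2 h f x\<bar>)"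

definition Lambda1 :: "('a::euclidean_space \<Rightarrow> real) set" where
  "Lambda1 = {f. continuous_on UNIV f \<and> bounded (range f) \<and>
      bdd_above {Delta2 f x y / y | x y. y \<in> {0<..1}}}"

definition Lambda1_norm :: "('a::euclidean_space \<Rightarrow> real) \<Rightarrow> real" where
  "Lambda1_norm f = (SUP x. \<bar>f x\<bar>) + (SUP (x,y)\<in>UNIV \<times> {0<..1}. Delta2 f x y / y)"

definition pderiv_dir :: "'a::euclidean_space \<Rightarrow> ('a \<Rightarrow> real) \<Rightarrow> 'a \<Rightarrow> real" where
  "pderiv_dir i \<phi> x = deriv (\<lambda>t. \<phi> (x + t *\<^sub>R i)) 0"

(* C_c^\<infinity> test functions: compact support and all iterated partial derivatives
   exist everywhere and are continuous *)
definition test_function :: "('a::euclidean_space \<Rightarrow> real) \<Rightarrow> bool" where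
  "test_function \<phi> \<longleftrightarrow> compact (closure {x. \<phi> x \<noteq> 0}) \<and>
     (\<exists>D :: 'a list \<Rightarrow> 'a \<Rightarrow> real. D [] = \<phi> \<and> (\<forall>\<alpha>. continuous_on UNIV (D \<alpha>)) \<and>
        (\<forall>\<alpha>. \<forall>i\<in>Basis. \<forall>x. ((\<lambda>t. D \<alpha> (x + t *\<^sub>R i)) has_real_derivative D (i # \<alpha>) x) (at 0)))"

definition Lp :: "real \<Rightarrow> ('a::euclidean_space \<Rightarrow> real) set" where
  "Lp p = {f. f \<in> borel_measurable lebesgue \<and> integrable lebesgue (\<lambda>x. \<bar>f x\<bar> powr p)}"

definition weak_pderiv :: "'a::euclidean_space \<Rightarrow> ('a \<Rightarrow> real) \<Rightarrow> ('a \<Rightarrow> real) \<Rightarrow> bool" where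
  "weak_pderiv i f g \<longleftrightarrow> (\<forall>\<phi>. test_function \<phi> \<longrightarrow>
      integral\<^sup>L lebesgue (\<lambda>x. f x * pderiv_dir i \<phi> x) = - integral\<^sup>L lebesgue (\<lambda>x. g x * \<phi> x))"

definition W1p :: "real \<Rightarrow> ('a::euclidean_space \<Rightarrow> real) set" where
  "W1p p = {f. f \<in> Lp p \<and> (\<forall>i\<in>Basis. \<exists>g. g \<in> Lp p \<and> weak_pderiv i f g)}"

definition dist_Lambda1 :: "('a::euclidean_space \<Rightarrow> real) \<Rightarrow> ('a \<Rightarrow> real) set \<Rightarrow> real" where
  "dist_Lambda1 f V = (INF g\<in>V. Lambda1_norm (\<lambda>x. f x - g x))"

definition sq_inner :: "('a::euclidean_space \<Rightarrow> real) \<Rightarrow> real \<Rightarrow> 'a \<Rightarrow> ennreal" where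
  "sq_inner f \<epsilon> x = (\<integral>\<^sup>+ y. indicator {y \<in> {0<..1}. Delta2 f x y / y > \<epsilon>} y * ennreal (1 / y) \<partial>lborel)"

definition enn_powr :: "ennreal \<Rightarrow> real \<Rightarrow> ennreal" where
  "enn_powr a r = (if a = \<infinity> then \<infinity> else ennreal (enn2real a powr r))"

(* ||[...]^{1/2}||_{L^p} < \<infinity>  iff  \<integral> [...]^{p/2} < \<infinity> *)
definition sq_Lp_finite :: "real \<Rightarrow> ('a::euclidean_space \<Rightarrow> real) \<Rightarrow> real \<Rightarrow> bool" where
  "sq_Lp_finite p f \<epsilon> \<longleftrightarrow> (\<integral>\<^sup>+ x. enn_powr (sq_inner f \<epsilon> x) (p / 2) \<partial>lebesgue) < \<infinity>"

definition eps_Lambda :: "real \<Rightarrow> ('a::euclidean_space \<Rightarrow> real) \<Rightarrow> real" where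
  "eps_Lambda p f = Inf {\<epsilon>. \<epsilon> > 0 \<and> sq_Lp_finite p f \<epsilon>}"

end

theory Submission
  imports Defs "HOL-Probability.Probability" "HOL-Computational_Algebra.Polynomial"
begin

text \<open>
  Both halves rest on the comparison, in \<open>L\<^sup>p\<close>, of a dyadic martingale whose jumps are bounded by 1 with
  the number of its large (respectively nonzero) jumps; the comparison is obtained from explicit Bellman functions.

  Lower bound. For \<open>g\<close> in \<open>W\<^sup>1\<^sup>,\<^sup>p\<close> and in the Zygmund class, the dyadic slopes of \<open>g\<close> along a line form a
  martingale whose jumps are second differences of \<open>g\<close> and which is closed by the directional derivative of \<open>g\<close>.
  Hence the number of scales with a large second difference is controlled in \<open>L\<^sup>p\<^sup>/\<^sup>2\<close>, first for second differences
  taken at dyadic cells and then, averaging over the translates of the dyadic grid, at every point. If \<open>f - g\<close> has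
  norm below \<open>\<epsilon>\<close>, a second difference quotient of \<open>f\<close> beyond \<open>2 \<epsilon>\<close> forces one of \<open>g\<close> beyond \<open>\<epsilon>\<close>.

  Upper bound. Let \<open>B\<^sub>k\<close> be the average at scale \<open>2\<^sup>-\<^sup>k\<close> against the tent kernel. Telescoping gives
  \<open>f = \<Sum>\<^sub>k B\<^sub>k a\<^sub>k\<close> with \<open>a\<^sub>k = B\<^sub>k\<^sub>+\<^sub>1 f - B\<^sub>k\<^sub>-\<^sub>1 f\<close>, an average of second differences of \<open>f\<close>. The part of \<open>a\<^sub>k\<close> below
  a multiple of \<open>\<epsilon> 2\<^sup>-\<^sup>k\<close> sums to a function of norm \<open>O(\<epsilon>)\<close>. Let \<open>b\<^sub>k\<close> be the remaining part. The derivative of the tent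
  is a Haar function averaged over the position of the cell, so the derivative of \<open>\<Sum>\<^sub>k B\<^sub>k b\<^sub>k\<close> is an average of
  martingales, and its \<open>L\<^sup>p\<close> norm is bounded by the number of scales at which the support of \<open>b\<^sub>k\<close> is near. That number
  is dominated by the square function of \<open>f\<close> at level \<open>\<epsilon>\<close>, because second differences of a Zygmund
  function vary slowly on their own scale.
\<close>

section \<open>Bellman functions\<close>

lemma Dh2_eq: "Dh2 h f x = f (x + h) - 2 * f x + f (x - h)"
proof -
  have "x + (1/2) *\<^sub>R h + (1/2) *\<^sub>R h = x + h" "x - (1/2) *\<^sub>R h - (1/2) *\<^sub>R h = x - h"
    by (simp_all only: add.assoc diff_diff_eq scaleR_add_left[symmetric]) simp_all
  then show ?thesis by (simp only: Dh2_def Dh_def) simp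
qed

lemma Dh2_mean_value:
  fixes f f' f'' :: "real \<Rightarrow> real"
  assumes f_derivative: "\<And>y. (f has_real_derivative f' y) (at y)"
    and f'_derivative: "\<And>y. (f' has_real_derivative f'' y) (at y)"
  obtains y z where "\<bar>y - x\<bar> \<le> \<bar>a\<bar>" "\<bar>z - x\<bar> \<le> \<bar>a\<bar>" "Dh2 a f x = (f'' y + f'' z) / 2 * a\<^sup>2"
proof (cases "a = 0")
  case True
  then show ?thesis using that[of x x] by (simp add: Dh2_eq)
next
  case False
  define g where "g = (\<lambda>t. f (x + t) + f (x - t))"
  define d where "d = (\<lambda>m::nat. if m = 0 then g else if m = 1 then (\<lambda>t. f' (x + t) - f' (x - t))
     else (\<lambda>t. f'' (x + t) + f'' (x - t)))"
  have "\<exists>t>0. t < \<bar>a\<bar> \<and> g \<bar>a\<bar> = (\<Sum>m<2. d m 0 / fact m * \<bar>a\<bar> ^ m) + d 2 t / fact 2 * \<bar>a\<bar> ^ 2"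
  proof (rule Maclaurin)
    show "\<forall>m t. m < 2 \<and> 0 \<le> t \<and> t \<le> \<bar>a\<bar> \<longrightarrow> (d m has_real_derivative d (Suc m) t) (at t)"
    proof (intro allI impI)
      fix m :: nat and t :: real assume range: "m < 2 \<and> 0 \<le> t \<and> t \<le> \<bar>a\<bar>"
      have "(g has_real_derivative (f' (x + t) - f' (x - t))) (at t)"
        unfolding g_def
        by (rule derivative_eq_intros DERIV_chain2[OF f_derivative] refl | simp)+
      moreover have "((\<lambda>t. f' (x + t) - f' (x - t)) has_real_derivative (f'' (x + t) + f'' (x - t))) (at t)"
        by (rule derivative_eq_intros DERIV_chain2[OF f'_derivative] refl | simp)+
      ultimately show "(d m has_real_derivative d (Suc m) t) (at t)"
        using range by (cases m) (auto simp: d_def)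
    qed
  qed (use False in \<open>auto simp: d_def\<close>)
  then obtain t where t_bounds: "0 < t" "t < \<bar>a\<bar>"
    and taylor: "g \<bar>a\<bar> = (\<Sum>m<2. d m 0 / fact m * \<bar>a\<bar> ^ m) + d 2 t / fact 2 * \<bar>a\<bar> ^ 2" by auto
  have "(\<Sum>m<2. d m 0 / fact m * \<bar>a\<bar> ^ m) = 2 * f x"
    by (simp add: d_def g_def numeral_2_eq_2)
  moreover have "g \<bar>a\<bar> = f (x + a) + f (x - a)" by (auto simp: g_def abs_if)
  ultimately have "Dh2 a f x = (f'' (x + t) + f'' (x - t)) / 2 * a\<^sup>2"
    using taylor by (simp add: d_def Dh2_eq)
  then show ?thesis using t_bounds that[of "x + t" "x - t"] by auto
qed

definition quad_powr :: "real \<Rightarrow> real \<Rightarrow> real \<Rightarrow> real" where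
  "quad_powr q m x = (m + x\<^sup>2) powr q"

lemma quad_powr_nonneg [simp]: "0 \<le> quad_powr q m x"
  by (simp add: quad_powr_def)

lemma quad_powr_has_derivative:
  assumes "0 < m"
  shows "(quad_powr q m has_real_derivative 2 * q * x * quad_powr (q - 1) m x) (at x)"
proof -
  have "0 < m + x\<^sup>2" using assms by (simp add: add_pos_nonneg)
  moreover have "((\<lambda>x. m + x\<^sup>2) has_real_derivative 2 * x) (at x)"
    by (auto intro!: derivative_eq_intros)
  ultimately show ?thesis
    using DERIV_fun_powr[of "\<lambda>x. m + x\<^sup>2" "2 * x" x q] by (simp add: quad_powr_def[abs_def] mult_ac)
qed

lemma quad_powr_has_second_derivative:
  assumes "0 < m"
  shows "((\<lambda>x. 2 * q * x * quad_powr (q - 1) m x) has_real_derivative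
    2 * q * quad_powr (q - 1) m x * ((m + (2 * q - 1) * x\<^sup>2) / (m + x\<^sup>2))) (at x)"
proof -
  have pos: "0 < m + x\<^sup>2" using assms by (simp add: add_pos_nonneg)
  then have pred: "quad_powr (q - 2) m x = quad_powr (q - 1) m x / (m + x\<^sup>2)"
    using powr_diff[of "m + x\<^sup>2" "q - 1" 1] by (simp add: quad_powr_def)
  have "((\<lambda>x. 2 * q * x) has_real_derivative 2 * q) (at x)"
    by (auto intro!: derivative_eq_intros)
  from DERIV_mult[OF this quad_powr_has_derivative[OF assms, of "q - 1" x]]
  show ?thesis
    by (rule DERIV_cong) (use pos in \<open>simp add: pred field_simps power2_eq_square\<close>)
qed

lemma powr_le_cmult_powr:
  fixes u v r :: real
  assumes "0 < u" "0 < v" "1 \<le> w" "u \<le> w * v" "v \<le> w * u"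
  shows "u powr r \<le> w powr \<bar>r\<bar> * v powr r"
proof (cases "r \<ge> 0")
  case True
  then have "u powr r \<le> (w * v) powr r" using assms by (intro powr_mono2) auto
  then show ?thesis using True assms by (simp add: powr_mult)
next
  case False
  then have "u powr r \<le> (v / w) powr r"
    using assms by (intro powr_mono2') (auto simp: field_simps)
  also have "\<dots> = w powr \<bar>r\<bar> * v powr r"
    using False assms by (simp add: powr_divide powr_minus field_simps)
  finally show ?thesis .
qed

lemma quad_powr_le_nearby:
  assumes m_ge_1: "1 \<le> m" and near: "\<bar>y - x\<bar> \<le> 1"
  shows "quad_powr r m y \<le> 3 powr \<bar>r\<bar> * quad_powr r m x"
proof -
  have "u\<^sup>2 \<le> 2 * v\<^sup>2 + 2" if "\<bar>u - v\<bar> \<le> 1" for u v :: real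
  proof -
    have "(u - v)\<^sup>2 \<le> 1" using that by (simp add: abs_square_le_1)
    moreover have "0 \<le> (u - 2 * v)\<^sup>2" by simp
    moreover have "u\<^sup>2 = 2 * v\<^sup>2 + 2 * (u - v)\<^sup>2 - (u - 2 * v)\<^sup>2"
      by (simp add: power2_eq_square algebra_simps)
    ultimately show ?thesis by linarith
  qed
  from this[of x y] this[of y x] near m_ge_1 have "m + y\<^sup>2 \<le> 3 * (m + x\<^sup>2)" "m + x\<^sup>2 \<le> 3 * (m + y\<^sup>2)"
    by (auto simp: abs_minus_commute) (smt (verit) zero_le_power2)+
  then show ?thesis
    unfolding quad_powr_def using m_ge_1 by (intro powr_le_cmult_powr) (auto intro: add_pos_nonneg)
qed

definition curvature_min :: "real \<Rightarrow> real" where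
  "curvature_min q = min 1 (2 * q - 1) * q / 3 powr \<bar>q - 1\<bar>"

definition curvature_max :: "real \<Rightarrow> real" where
  "curvature_max q = max 1 (2 * q - 1) * q * 3 powr \<bar>q - 1\<bar>"

lemma curvature_pos:
  assumes "1/2 < q"
  shows "0 < curvature_min q" "0 < curvature_max q"
  using assms by (auto simp: curvature_min_def curvature_max_def intro!: divide_pos_pos mult_pos_pos)

lemma quad_powr_second_derivative_bounds:
  assumes q_gt_half: "1/2 < q" and m_ge_1: "1 \<le> m" and near: "\<bar>y - x\<bar> \<le> 1"
  defines "D \<equiv> 2 * q * quad_powr (q - 1) m y * ((m + (2 * q - 1) * y\<^sup>2) / (m + y\<^sup>2))"
  shows "2 * curvature_min q * quad_powr (q - 1) m x \<le> D"
    and "D \<le> 2 * curvature_max q * quad_powr (q - 1) m x"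
proof -
  let ?k = "min 1 (2 * q - 1)" and ?l = "max 1 (2 * q - 1)" and ?w = "3 powr \<bar>q - 1\<bar> :: real"
  let ?r = "(m + (2 * q - 1) * y\<^sup>2) / (m + y\<^sup>2)"
  have "?k * m \<le> m" "?k * y\<^sup>2 \<le> (2 * q - 1) * y\<^sup>2" "m \<le> ?l * m" "(2 * q - 1) * y\<^sup>2 \<le> ?l * y\<^sup>2"
    using m_ge_1 by (auto intro!: mult_right_mono)
  moreover have "0 < m + y\<^sup>2" using m_ge_1 by (simp add: add_pos_nonneg)
  ultimately have ratio: "?k \<le> ?r" "?r \<le> ?l" by (simp_all add: field_simps)
  have "2 * curvature_min q * quad_powr (q - 1) m x \<le> 2 * curvature_min q * (?w * quad_powr (q - 1) m y)"
    using quad_powr_le_nearby[OF m_ge_1, of x y "q - 1"] near curvature_pos[OF q_gt_half]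
    by (intro mult_left_mono) (auto simp: abs_minus_commute)
  also have "\<dots> = 2 * q * quad_powr (q - 1) m y * ?k" by (simp add: curvature_min_def)
  also have "\<dots> \<le> D" unfolding D_def using ratio(1) q_gt_half by (intro mult_left_mono) auto
  finally show "2 * curvature_min q * quad_powr (q - 1) m x \<le> D" .
  have "D \<le> 2 * q * quad_powr (q - 1) m y * ?l"
    unfolding D_def using ratio(2) q_gt_half by (intro mult_left_mono) auto
  also have "\<dots> \<le> 2 * q * (?w * quad_powr (q - 1) m x) * ?l"
    using quad_powr_le_nearby[OF m_ge_1 near] q_gt_half by (intro mult_left_mono mult_right_mono) auto
  finally show "D \<le> 2 * curvature_max q * quad_powr (q - 1) m x"
    by (simp add: curvature_max_def mult_ac)
qed

lemma Dh2_quad_powr_bounds: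
  assumes q_gt_half: "1/2 < q" and m_ge_1: "1 \<le> m" and a_le_1: "\<bar>a\<bar> \<le> 1"
  shows "2 * curvature_min q * a\<^sup>2 * quad_powr (q - 1) m x \<le> Dh2 a (quad_powr q m) x"
    and "Dh2 a (quad_powr q m) x \<le> 2 * curvature_max q * a\<^sup>2 * quad_powr (q - 1) m x"
proof -
  define D where "D = (\<lambda>y. 2 * q * quad_powr (q - 1) m y * ((m + (2 * q - 1) * y\<^sup>2) / (m + y\<^sup>2)))"
  have "0 < m" using m_ge_1 by simp
  from Dh2_mean_value[OF quad_powr_has_derivative[OF this] quad_powr_has_second_derivative[OF this]]
  obtain y z where between: "\<bar>y - x\<bar> \<le> \<bar>a\<bar>" "\<bar>z - x\<bar> \<le> \<bar>a\<bar>"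
    and Dh2_eq_mean: "Dh2 a (quad_powr q m) x = (D y + D z) / 2 * a\<^sup>2"
    unfolding D_def by metis
  have bounds: "2 * curvature_min q * quad_powr (q - 1) m x \<le> D t"
    "D t \<le> 2 * curvature_max q * quad_powr (q - 1) m x"
    if "\<bar>t - x\<bar> \<le> \<bar>a\<bar>" for t
    unfolding D_def using quad_powr_second_derivative_bounds[OF q_gt_half m_ge_1, of t x] that a_le_1 by auto
  have "2 * curvature_min q * quad_powr (q - 1) m x * a\<^sup>2 \<le> (D y + D z) / 2 * a\<^sup>2"
    using bounds[OF between(1)] bounds[OF between(2)] by (intro mult_right_mono) auto
  then show "2 * curvature_min q * a\<^sup>2 * quad_powr (q - 1) m x \<le> Dh2 a (quad_powr q m) x"
    by (simp add: Dh2_eq_mean mult_ac)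
  have "(D y + D z) / 2 * a\<^sup>2 \<le> 2 * curvature_max q * quad_powr (q - 1) m x * a\<^sup>2"
    using bounds[OF between(1)] bounds[OF between(2)] by (intro mult_right_mono) auto
  then show "Dh2 a (quad_powr q m) x \<le> 2 * curvature_max q * a\<^sup>2 * quad_powr (q - 1) m x"
    by (simp add: Dh2_eq_mean mult_ac)
qed

lemma Dh2_quad_powr_le:
  assumes "1/2 < q" "1 \<le> m" "\<bar>a\<bar> \<le> 1"
  shows "Dh2 a (quad_powr q m) x \<le> 2 * curvature_max q * quad_powr (q - 1) m x"
proof -
  have "2 * curvature_max q * a\<^sup>2 * quad_powr (q - 1) m x \<le> 2 * curvature_max q * 1 * quad_powr (q - 1) m x"
    using assms curvature_pos by (intro mult_right_mono mult_left_mono) (auto simp: abs_square_le_1 less_imp_le)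
  then show ?thesis using Dh2_quad_powr_bounds(2)[OF assms, of x] by simp
qed

lemma powr_increment:
  fixes x y r :: real
  assumes "0 \<le> x" "x < y" "0 < r"
  obtains z where "x < z" "z < y" "y powr r - x powr r = r * (y - x) * z powr (r - 1)"
proof -
  have deriv: "DERIV (\<lambda>z. z powr r) z :> r * z powr (r - 1)" if "x < z" for z
    using that assms has_real_derivative_powr by auto
  have "\<exists>l z. x < z \<and> z < y \<and> DERIV (\<lambda>z. z powr r) z :> l \<and> y powr r - x powr r = (y - x) * l"
  proof (rule MVT)
    show "continuous_on {x..y} (\<lambda>z. z powr r)"
      using assms by (intro continuous_on_powr') (auto intro!: continuous_intros)
  qed (use assms deriv in \<open>auto simp: real_differentiable_def\<close>)
  then obtain l z where "x < z" "z < y" "DERIV (\<lambda>z. z powr r) z :> l" "y powr r - x powr r = (y - x) * l"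
    by blast
  then show ?thesis using that deriv[of z] DERIV_unique by (force simp: mult_ac)
qed

lemma powr_increment_le:
  fixes x y r :: real
  assumes "0 \<le> x" "x < y" "1 \<le> r"
  shows "y powr r - x powr r \<le> r * (y - x) * y powr (r - 1)"
proof -
  have "0 < r" using assms by simp
  then obtain z where "x < z" "z < y" "y powr r - x powr r = r * (y - x) * z powr (r - 1)"
    using assms powr_increment by metis
  then show ?thesis using assms by (auto intro!: mult_left_mono powr_mono2)
qed

lemma powr_increment_concave:
  fixes x y r :: real
  assumes "0 \<le> x" "x < y" "0 < r" "r \<le> 1"
  shows powr_increment_concave_ge: "r * (y - x) * y powr (r - 1) \<le> y powr r - x powr r"
    and powr_increment_concave_le: "0 < x \<Longrightarrow> y powr r - x powr r \<le> r * (y - x) * x powr (r - 1)"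
proof -
  obtain z where "x < z" "z < y" "y powr r - x powr r = r * (y - x) * z powr (r - 1)"
    using assms powr_increment by metis
  then show "r * (y - x) * y powr (r - 1) \<le> y powr r - x powr r"
    "0 < x \<Longrightarrow> y powr r - x powr r \<le> r * (y - x) * x powr (r - 1)"
    using assms by (auto intro!: mult_left_mono powr_mono2')
qed

lemma powr_mult_diff_one: "x * x powr (r - 1) = x powr r" if "0 \<le> x" for x r :: real
  using that by (cases "x = 0") (auto simp: powr_diff)

lemma mult_powr_diff_one_le:
  fixes x y r c :: real
  assumes "0 \<le> x" "0 \<le> y" "1 \<le> r" "0 < c"
  shows "c * x * y powr (r - 1) \<le> y powr r / 2 + c * (2 * c) powr (r - 1) * x powr r"
proof (cases "c * x \<le> y / 2")
  case True
  then have "c * x * y powr (r - 1) \<le> y / 2 * y powr (r - 1)"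
    by (intro mult_right_mono) auto
  also have "\<dots> = y powr r / 2"
    using powr_mult_diff_one[of y r] assms by simp
  finally show ?thesis using assms by (smt (verit) mult_nonneg_nonneg powr_ge_zero)
next
  case False
  have "c * x * y powr (r - 1) \<le> c * x * (2 * c * x) powr (r - 1)"
    using False assms by (intro mult_left_mono powr_mono2) auto
  also have "\<dots> = c * (2 * c) powr (r - 1) * x powr r"
    using assms by (cases "x = 0") (auto simp: powr_mult powr_diff)
  finally show ?thesis using powr_ge_zero[of y r] by linarith
qed

lemma powr_add_le:
  fixes x y q :: real
  assumes "0 \<le> x" "0 \<le> y" "0 < q" "q \<le> 1"
  shows "(x + y) powr q \<le> x powr q + y powr q"
proof (cases "x = 0 \<or> y = 0")
  case False
  then have "(x + y) powr q = x * (x + y) powr (q - 1) + y * (x + y) powr (q - 1)"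
    using assms powr_mult_diff_one[of "x + y" q] by (simp add: distrib_right)
  also have "\<dots> \<le> x * x powr (q - 1) + y * y powr (q - 1)"
    using False assms by (intro add_mono mult_left_mono powr_mono2') auto
  finally show ?thesis using assms by (simp add: powr_mult_diff_one)
qed auto

lemma one_plus_powr_ge:
  fixes y q :: real
  assumes "0 < q" "q \<le> 1" "1 \<le> y"
  shows "q * 2 powr (q - 1) * y powr q \<le> (1 + y) powr q - 1"
proof -
  have "q * 2 powr (q - 1) * y powr q = q * y * (2 * y) powr (q - 1)"
    using assms by (simp add: powr_mult powr_diff)
  also have "\<dots> \<le> q * y * (1 + y) powr (q - 1)"
    using assms by (intro mult_left_mono powr_mono2') auto
  also have "\<dots> \<le> (1 + y) powr q - 1"
    using powr_increment_concave_ge[of 1 "1 + y" q] assms by auto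
  finally show ?thesis .
qed

lemma abs_powr_double: "\<bar>x\<bar> powr (2 * q) = (x\<^sup>2) powr q" for x q :: real
proof (cases "x = 0")
  case False
  then have "\<bar>x\<bar> powr 2 = x\<^sup>2" by simp
  then show ?thesis by (metis powr_powr)
qed simp

definition upper_bellman_concave :: "real \<Rightarrow> real \<Rightarrow> real \<Rightarrow> nat \<Rightarrow> real" where
  "upper_bellman_concave q K x n = quad_powr q (1 + real n) x - 1 - K * ((1 + real n) powr q - 1)"

lemma upper_bellman_concave_step:
  assumes q_bounds: "1/2 < q" "q \<le> 1" and a_le_1: "\<bar>a\<bar> \<le> 1"
  defines "K \<equiv> (curvature_max q + q) / (q * 2 powr (q - 1))"
  defines "U \<equiv> upper_bellman_concave q K"
  shows "U (x + a) (Suc n) + U (x - a) (Suc n) \<le> 2 * U x n"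
proof -
  define m where "m = 1 + real n"
  have m_bounds: "1 \<le> m" "0 < m" "m \<le> m + x\<^sup>2" by (auto simp: m_def)
  have curvature_max_pos: "0 < curvature_max q" using curvature_pos q_bounds by simp
  have "curvature_max q * quad_powr (q - 1) (m + 1) x \<le> curvature_max q * m powr (q - 1)"
    unfolding quad_powr_def using m_bounds q_bounds curvature_max_pos by (intro mult_left_mono powr_mono2') auto
  then have curvature: "Dh2 a (quad_powr q (m + 1)) x \<le> 2 * curvature_max q * m powr (q - 1)"
    using Dh2_quad_powr_le[of q "m + 1" a x] a_le_1 m_bounds q_bounds by linarith
  have "quad_powr q (m + 1) x - quad_powr q m x \<le> q * quad_powr (q - 1) m x"
    using powr_increment_concave_le[of "m + x\<^sup>2" "m + 1 + x\<^sup>2" q] m_bounds q_bounds by (simp add: quad_powr_def)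
  also have "\<dots> \<le> q * m powr (q - 1)"
    unfolding quad_powr_def using m_bounds q_bounds by (intro mult_left_mono powr_mono2') auto
  finally have increment: "quad_powr q (m + 1) x - quad_powr q m x \<le> q * m powr (q - 1)" .
  have "(curvature_max q + q) * m powr (q - 1) = K * (q * (2 * m) powr (q - 1))"
    using q_bounds m_bounds by (simp add: K_def powr_mult)
  also have "\<dots> \<le> K * (q * (m + 1) powr (q - 1))"
    using m_bounds q_bounds curvature_max_pos by (intro mult_left_mono powr_mono2') (auto simp: K_def)
  also have "\<dots> \<le> K * ((m + 1) powr q - m powr q)"
    using powr_increment_concave_ge[of m "m + 1" q] m_bounds q_bounds curvature_max_pos
    by (intro mult_left_mono) (auto simp: K_def)
  finally have compensation: "(curvature_max q + q) * m powr (q - 1) \<le> K * ((m + 1) powr q - m powr q)" .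
  have U_Suc: "U y (Suc n) = quad_powr q (m + 1) y - 1 - K * ((m + 1) powr q - 1)" for y
    by (simp add: U_def upper_bellman_concave_def m_def add_ac)
  have U_n: "U x n = quad_powr q m x - 1 - K * (m powr q - 1)"
    by (simp add: U_def upper_bellman_concave_def m_def)
  show ?thesis unfolding U_Suc U_n using curvature increment compensation by (simp add: Dh2_eq algebra_simps)
qed

lemma upper_bellman_concave_ge:
  assumes q_bounds: "1/2 < q" "q \<le> 1" and K_nonneg: "0 \<le> K" and zero: "n = 0 \<Longrightarrow> x = 0"
  shows "q * 2 powr (q - 1) * \<bar>x\<bar> powr (2 * q) \<le> upper_bellman_concave q K x n + K * real n powr q"
proof (cases "n = 0")
  case True
  then show ?thesis using zero by (simp add: upper_bellman_concave_def quad_powr_def)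
next
  case False
  have "1 \<le> real n" using False by simp
  then have base_ge_1: "1 \<le> real n + x\<^sup>2" by (rule order_trans) simp
  have "q * 2 powr (q - 1) * \<bar>x\<bar> powr (2 * q) \<le> q * 2 powr (q - 1) * (real n + x\<^sup>2) powr q"
    unfolding abs_powr_double[of _ q] using q_bounds by (intro mult_left_mono powr_mono2) auto
  also have "\<dots> \<le> quad_powr q (1 + real n) x - 1"
    using one_plus_powr_ge[OF _ _ base_ge_1, of q] q_bounds by (simp add: quad_powr_def add_ac)
  finally have "q * 2 powr (q - 1) * \<bar>x\<bar> powr (2 * q) \<le> quad_powr q (1 + real n) x - 1" .
  moreover have "K * ((1 + real n) powr q - 1) \<le> K * real n powr q"
    using powr_add_le[of 1 "real n" q] q_bounds K_nonneg by (intro mult_left_mono) auto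
  ultimately show ?thesis unfolding upper_bellman_concave_def by linarith
qed

definition upper_bellman_convex :: "real \<Rightarrow> real \<Rightarrow> real \<Rightarrow> nat \<Rightarrow> real" where
  "upper_bellman_convex q b x n =
     quad_powr q (1 + real n) x - 1 - b * real n * quad_powr (q - 1) (1 + real n) x"

(* By AM-GM it suffices that the product of the two bases on the right is at least (m + x\<^sup>2)\<^sup>2; that product is
   (m + 1 + x\<^sup>2 + a\<^sup>2)\<^sup>2 - 4 a\<^sup>2 x\<^sup>2. *)
lemma quad_powr_le_midpoint_Suc:
  assumes r_nonneg: "0 \<le> r" and m_ge_1: "1 \<le> m" and a_le_1: "\<bar>a\<bar> \<le> 1"
  shows "quad_powr r m x \<le> (quad_powr r (m + 1) (x + a) + quad_powr r (m + 1) (x - a)) / 2"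
proof -
  define R where "R = m + x\<^sup>2"
  define u where "u = m + 1 + (x + a)\<^sup>2"
  define v where "v = m + 1 + (x - a)\<^sup>2"
  have pos: "0 < R" "0 < u" "0 < v" using m_ge_1 by (auto simp: R_def u_def v_def intro!: add_pos_nonneg)
  have "u * v = R\<^sup>2 + ((1 + a\<^sup>2)\<^sup>2 + 2 * m * (1 + a\<^sup>2) + 2 * x\<^sup>2 * (1 - a\<^sup>2))"
    unfolding u_def v_def R_def by (simp add: power2_eq_square algebra_simps)
  moreover have "0 \<le> (1 + a\<^sup>2)\<^sup>2" "0 \<le> 2 * m * (1 + a\<^sup>2)" "0 \<le> 2 * x\<^sup>2 * (1 - a\<^sup>2)"
    using a_le_1 m_ge_1 by (auto simp: abs_square_le_1 intro!: mult_nonneg_nonneg)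
  ultimately have "R\<^sup>2 \<le> u * v" by linarith
  have "R powr r = (R\<^sup>2) powr (r / 2)"
    using pos abs_powr_double[of R "r / 2"] by simp
  also have "\<dots> \<le> (u * v) powr (r / 2)"
    using \<open>R\<^sup>2 \<le> u * v\<close> r_nonneg by (intro powr_mono2) auto
  also have "\<dots> = sqrt (u powr r * v powr r)"
    using pos by (simp add: powr_half_sqrt[symmetric] powr_mult powr_powr)
  also have "\<dots> \<le> (u powr r + v powr r) / 2"
    by (rule arith_geo_mean_sqrt) auto
  finally show ?thesis by (simp add: quad_powr_def R_def u_def v_def)
qed

lemma upper_bellman_convex_step:
  assumes q_ge_1: "1 \<le> q" and a_le_1: "\<bar>a\<bar> \<le> 1"
  defines "b \<equiv> (curvature_max q + q) * 2 powr (q - 1)"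
  defines "U \<equiv> upper_bellman_convex q b"
  shows "U (x + a) (Suc n) + U (x - a) (Suc n) \<le> 2 * U x n"
proof -
  define m where "m = 1 + real n"
  define S where "S = quad_powr (q - 1) (m + 1) (x + a) + quad_powr (q - 1) (m + 1) (x - a)"
  have m_ge_1: "1 \<le> m" by (simp add: m_def)
  have base_ge_1: "1 \<le> m + x\<^sup>2" using m_ge_1 by (smt (verit) zero_le_power2)
  have curvature_max_pos: "0 < curvature_max q" using curvature_pos q_ge_1 by simp
  have b_pos: "0 < b" using curvature_max_pos q_ge_1 by (simp add: b_def)
  have curvature: "Dh2 a (quad_powr q (m + 1)) x \<le> 2 * curvature_max q * quad_powr (q - 1) (m + 1) x"
    using Dh2_quad_powr_le[of q "m + 1" a x] a_le_1 m_ge_1 q_ge_1 by simp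
  have increment: "quad_powr q (m + 1) x - quad_powr q m x \<le> q * quad_powr (q - 1) (m + 1) x"
    using powr_increment_le[of "m + x\<^sup>2" "m + 1 + x\<^sup>2" q] base_ge_1 q_ge_1 by (simp add: quad_powr_def)
  have "quad_powr (q - 1) (m + 1) x \<le> (2 * (m + x\<^sup>2)) powr (q - 1)"
    unfolding quad_powr_def using base_ge_1 q_ge_1 by (intro powr_mono2) auto
  also have "\<dots> = 2 powr (q - 1) * quad_powr (q - 1) m x"
    unfolding quad_powr_def using base_ge_1 by (subst powr_mult) auto
  finally have doubling: "(curvature_max q + q) * quad_powr (q - 1) (m + 1) x \<le> b * quad_powr (q - 1) m x"
    using curvature_max_pos q_ge_1 unfolding b_def mult.assoc by (intro mult_left_mono) auto
  have U_Suc: "U y (Suc n) = quad_powr q (m + 1) y - 1 - b * m * quad_powr (q - 1) (m + 1) y" for y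
    by (simp add: U_def upper_bellman_convex_def m_def add_ac)
  have U_n: "U x n = quad_powr q m x - 1 - b * real n * quad_powr (q - 1) m x"
    by (simp add: U_def upper_bellman_convex_def m_def)
  have "b * m * quad_powr (q - 1) m x \<le> b * m * (S / 2)"
    using quad_powr_le_midpoint_Suc[of "q - 1" m a x] q_ge_1 m_ge_1 a_le_1 b_pos
    by (intro mult_left_mono) (auto simp: S_def)
  moreover have "b * m * quad_powr (q - 1) m x = b * quad_powr (q - 1) m x + b * real n * quad_powr (q - 1) m x"
    by (simp add: m_def algebra_simps)
  ultimately show ?thesis
    unfolding U_Suc U_n using curvature increment doubling by (simp add: S_def Dh2_eq algebra_simps)
qed

lemma upper_bellman_convex_ge:
  assumes q_ge_1: "1 \<le> q" and b_pos: "0 < b" and zero: "n = 0 \<Longrightarrow> x = 0"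
  shows "1/2 * \<bar>x\<bar> powr (2 * q)
    \<le> upper_bellman_convex q b x n + (1 + b * (2 * b) powr (q - 1)) * real n powr q"
proof (cases "n = 0")
  case True
  then show ?thesis using zero by (simp add: upper_bellman_convex_def quad_powr_def)
next
  case False
  define R where "R = 1 + real n + x\<^sup>2"
  have R_bounds: "x\<^sup>2 \<le> R" "0 \<le> R" by (auto simp: R_def add_nonneg_nonneg)
  have "b * real n * R powr (q - 1) \<le> R powr q / 2 + b * (2 * b) powr (q - 1) * real n powr q"
    using mult_powr_diff_one_le[of "real n" R q b] q_ge_1 b_pos R_bounds by auto
  moreover have "(x\<^sup>2) powr q \<le> R powr q" using R_bounds q_ge_1 by (intro powr_mono2) auto
  moreover have "1 \<le> real n powr q" using False q_ge_1 by (intro ge_one_powr_ge_zero) auto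
  ultimately show ?thesis
    unfolding abs_powr_double upper_bellman_convex_def quad_powr_def R_def[symmetric]
    by (simp add: algebra_simps)
qed

lemma continuous_on_quad_powr [continuous_intros]:
  "0 < m \<Longrightarrow> continuous_on A (quad_powr q m)"
  by (meson quad_powr_has_derivative DERIV_isCont continuous_at_imp_continuous_on)

lemma upper_bellman_exists:
  fixes q :: real
  assumes q_gt_half: "1/2 < q"
  obtains U :: "real \<Rightarrow> nat \<Rightarrow> real" and c C where "0 < c" "0 \<le> C" "U 0 0 = 0"
    "\<And>n. continuous_on UNIV (\<lambda>x. U x n)"
    "\<And>x n a. \<bar>a\<bar> \<le> 1 \<Longrightarrow> U (x + a) (Suc n) + U (x - a) (Suc n) \<le> 2 * U x n"
    "\<And>x n. (n = 0 \<Longrightarrow> x = 0) \<Longrightarrow> c * \<bar>x\<bar> powr (2 * q) \<le> U x n + C * real n powr q"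
proof (cases "q \<le> 1")
  case True
  define K where "K = (curvature_max q + q) / (q * 2 powr (q - 1))"
  have K_pos: "0 < K" using curvature_pos[OF q_gt_half] q_gt_half by (simp add: K_def)
  show ?thesis
  proof (rule that[of "q * 2 powr (q - 1)" K "upper_bellman_concave q K"])
    show "continuous_on UNIV (\<lambda>x. upper_bellman_concave q K x n)" for n
      unfolding upper_bellman_concave_def by (intro continuous_intros) auto
    show "upper_bellman_concave q K 0 0 = 0"
      by (simp add: upper_bellman_concave_def quad_powr_def)
  qed (use upper_bellman_concave_step[OF q_gt_half True, folded K_def]
    upper_bellman_concave_ge[OF q_gt_half True] q_gt_half K_pos in auto)
next
  case False
  define b where "b = (curvature_max q + q) * 2 powr (q - 1)"
  have q_ge_1: "1 \<le> q" and b_pos: "0 < b" using curvature_pos[OF q_gt_half] q_gt_half False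
    by (auto simp: b_def)
  show ?thesis
  proof (rule that[of "1/2" "1 + b * (2 * b) powr (q - 1)" "upper_bellman_convex q b"])
    show "continuous_on UNIV (\<lambda>x. upper_bellman_convex q b x n)" for n
      unfolding upper_bellman_convex_def by (intro continuous_intros) auto
    show "upper_bellman_convex q b 0 0 = 0"
      by (simp add: upper_bellman_convex_def quad_powr_def)
  qed (use upper_bellman_convex_step[OF q_ge_1, folded b_def] upper_bellman_convex_ge[OF q_ge_1 b_pos] b_pos
    in auto)
qed

definition lower_bellman_concave :: "real \<Rightarrow> real \<Rightarrow> real \<Rightarrow> nat \<Rightarrow> real" where
  "lower_bellman_concave q A x n = A * (quad_powr q 1 x - 1) - (quad_powr q (1 + real n) x - 1)"

lemma lower_bellman_concave_step:
  assumes q_bounds: "1/2 < q" "q \<le> 1" and a_le_1: "\<bar>a\<bar> \<le> 1"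
    and A_bounds: "0 \<le> A" "curvature_max q * a\<^sup>2 + of_bool counted * q \<le> A * curvature_min q * a\<^sup>2"
  defines "U \<equiv> lower_bellman_concave q A"
  fixes n :: nat
  defines "j \<equiv> n + of_bool counted"
  shows "2 * U x n \<le> U (x + a) j + U (x - a) j"
proof -
  define P where "P = quad_powr (q - 1) 1 x"
  have quad_powr_le: "quad_powr (q - 1) (1 + real k) x \<le> P" for k
    unfolding P_def quad_powr_def using q_bounds by (intro powr_mono2') (auto simp: add_pos_nonneg)
  have increment: "quad_powr q (1 + real j) x - quad_powr q (1 + real n) x \<le> of_bool counted * q * P"
  proof (cases counted)
    case True
    have "quad_powr q (1 + real j) x - quad_powr q (1 + real n) x \<le> q * quad_powr (q - 1) (1 + real n) x"
      using powr_increment_concave_le[of "1 + real n + x\<^sup>2" "2 + real n + x\<^sup>2" q] q_bounds True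
      by (auto simp: quad_powr_def j_def add_pos_nonneg)
    also have "\<dots> \<le> q * P" using quad_powr_le[of n] q_bounds by (intro mult_left_mono) auto
    finally show ?thesis using True by simp
  qed (simp add: j_def)
  have "Dh2 a (quad_powr q (1 + real j)) x \<le> 2 * curvature_max q * a\<^sup>2 * quad_powr (q - 1) (1 + real j) x"
    using Dh2_quad_powr_bounds(2) q_bounds a_le_1 by simp
  also have "\<dots> \<le> 2 * curvature_max q * a\<^sup>2 * P"
    using quad_powr_le curvature_pos[OF q_bounds(1)] by (intro mult_left_mono) auto
  finally have curvature: "Dh2 a (quad_powr q (1 + real j)) x \<le> 2 * curvature_max q * a\<^sup>2 * P" .
  have "(curvature_max q * a\<^sup>2 + of_bool counted * q) * P \<le> A * curvature_min q * a\<^sup>2 * P"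
    using A_bounds by (intro mult_right_mono) (auto simp: P_def)
  moreover have "A * (2 * curvature_min q * a\<^sup>2 * P) \<le> A * Dh2 a (quad_powr q 1) x"
    using Dh2_quad_powr_bounds(1)[of q 1 a x] q_bounds a_le_1 A_bounds
    by (intro mult_left_mono) (auto simp: P_def)
  ultimately show ?thesis using curvature increment
    unfolding U_def lower_bellman_concave_def Dh2_eq by (simp add: algebra_simps)
qed

lemma lower_bellman_concave_le:
  assumes q_bounds: "1/2 < q" "q \<le> 1" and A_nonneg: "0 \<le> A"
  shows "lower_bellman_concave q A x n + q * 2 powr (q - 1) * real n powr q \<le> A * \<bar>x\<bar> powr (2 * q)"
proof -
  have "A * (quad_powr q 1 x - 1) \<le> A * (x\<^sup>2) powr q"
    using powr_add_le[of 1 "x\<^sup>2" q] q_bounds A_nonneg by (intro mult_left_mono) (auto simp: quad_powr_def)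
  moreover have "q * 2 powr (q - 1) * real n powr q \<le> (1 + real n) powr q - 1"
    using one_plus_powr_ge[of q "real n"] q_bounds by (cases "n = 0") auto
  moreover have "(1 + real n) powr q \<le> quad_powr q (1 + real n) x"
    unfolding quad_powr_def using q_bounds by (auto intro!: powr_mono2)
  ultimately show ?thesis by (simp add: lower_bellman_concave_def abs_powr_double)
qed

lemma lower_bellman_concave_nonneg:
  assumes "0 \<le> q" "1 \<le> A"
  shows "0 \<le> lower_bellman_concave q A x 0"
proof -
  have "1 * (quad_powr q 1 x - 1) \<le> A * (quad_powr q 1 x - 1)"
    using assms by (intro mult_right_mono) (auto simp: quad_powr_def ge_one_powr_ge_zero)
  then show ?thesis by (simp add: lower_bellman_concave_def)
qed

definition lower_bellman_convex :: "real \<Rightarrow> real \<Rightarrow> real \<Rightarrow> nat \<Rightarrow> real" where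
  "lower_bellman_convex q k x n = k * x\<^sup>2 * real n powr (q - 1) - real n powr q"

lemma lower_bellman_convex_step:
  assumes q_ge_1: "1 \<le> q" and k_bounds: "0 \<le> k" "of_bool counted * q \<le> k * a\<^sup>2"
  defines "U \<equiv> lower_bellman_convex q k"
  fixes n :: nat
  defines "j \<equiv> n + of_bool counted"
  shows "2 * U x n \<le> U (x + a) j + U (x - a) j"
proof -
  have "real j powr q - real n powr q \<le> of_bool counted * q * real j powr (q - 1)"
    using powr_increment_le[of "real n" "real (Suc n)" q] q_ge_1 by (auto simp: j_def add.commute)
  also have "\<dots> \<le> k * a\<^sup>2 * real j powr (q - 1)"
    using k_bounds by (intro mult_right_mono) auto
  finally have "real j powr q - real n powr q \<le> k * a\<^sup>2 * real j powr (q - 1)" .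
  moreover have "k * x\<^sup>2 * real n powr (q - 1) \<le> k * x\<^sup>2 * real j powr (q - 1)"
    using k_bounds q_ge_1 by (intro mult_left_mono powr_mono2) (auto simp: j_def)
  moreover have "U (x + a) j + U (x - a) j = 2 * (k * (x\<^sup>2 + a\<^sup>2) * real j powr (q - 1) - real j powr q)"
    unfolding U_def lower_bellman_convex_def by (simp add: power2_eq_square algebra_simps)
  moreover have "U x n = k * x\<^sup>2 * real n powr (q - 1) - real n powr q"
    by (simp add: U_def lower_bellman_convex_def)
  ultimately show ?thesis by (simp add: algebra_simps)
qed

lemma lower_bellman_convex_le:
  assumes "1 \<le> q" "0 < k"
  shows "lower_bellman_convex q k x n + 1/2 * real n powr q
    \<le> k * (2 * k) powr (q - 1) * \<bar>x\<bar> powr (2 * q)"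
  using mult_powr_diff_one_le[of "x\<^sup>2" "real n" q k] assms
  by (simp add: lower_bellman_convex_def abs_powr_double)

lemma of_bool_mult_le_square_ratio:
  fixes a q \<delta> :: real
  assumes "P \<Longrightarrow> \<delta> \<le> \<bar>a\<bar>" "0 < \<delta>" "0 \<le> q"
  shows "of_bool P * q \<le> q / \<delta>\<^sup>2 * a\<^sup>2"
proof -
  have "of_bool P * \<delta>\<^sup>2 \<le> a\<^sup>2" using assms by (auto simp: abs_le_square_iff[symmetric])
  then show ?thesis using mult_left_mono[of "of_bool P * \<delta>\<^sup>2" "a\<^sup>2" q] assms by (auto simp: field_simps)
qed

lemma lower_bellman_exists:
  fixes q \<delta> :: real
  assumes q_gt_half: "1/2 < q" and \<delta>_pos: "0 < \<delta>"
  obtains U :: "real \<Rightarrow> nat \<Rightarrow> real" and c C where "0 < c" "0 \<le> C" "\<And>x. 0 \<le> U x 0"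
    "\<And>n. continuous_on UNIV (\<lambda>x. U x n)"
    "\<And>x n a counted. \<bar>a\<bar> \<le> 1 \<Longrightarrow> (counted \<Longrightarrow> \<delta> \<le> \<bar>a\<bar>) \<Longrightarrow>
       2 * U x n \<le> U (x + a) (n + of_bool counted) + U (x - a) (n + of_bool counted)"
    "\<And>x n. U x n + c * real n powr q \<le> C * \<bar>x\<bar> powr (2 * q)"
proof (cases "q \<le> 1")
  case True
  define A where "A = 1 + curvature_max q / curvature_min q + q / (curvature_min q * \<delta>\<^sup>2)"
  note pos = curvature_pos[OF q_gt_half]
  have A_ge_1: "1 \<le> A" using pos q_gt_half by (simp add: A_def)
  have "curvature_max q * a\<^sup>2 + of_bool counted * q \<le> A * curvature_min q * a\<^sup>2"
    if "counted \<Longrightarrow> \<delta> \<le> \<bar>a\<bar>" for a counted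
  proof -
    have "of_bool counted * q \<le> q / \<delta>\<^sup>2 * a\<^sup>2"
      using of_bool_mult_le_square_ratio[OF that \<delta>_pos] q_gt_half by simp
    moreover have "A * curvature_min q * a\<^sup>2 = curvature_min q * a\<^sup>2 + curvature_max q * a\<^sup>2 + q / \<delta>\<^sup>2 * a\<^sup>2"
      using pos \<delta>_pos by (simp add: A_def field_simps)
    moreover have "0 \<le> curvature_min q * a\<^sup>2" using pos by simp
    ultimately show ?thesis by linarith
  qed
  moreover have "0 \<le> lower_bellman_concave q A x 0" for x
    using lower_bellman_concave_nonneg A_ge_1 q_gt_half by simp
  moreover have "continuous_on UNIV (\<lambda>x. lower_bellman_concave q A x n)" for n
    unfolding lower_bellman_concave_def by (intro continuous_intros) auto
  ultimately show ?thesis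
    using lower_bellman_concave_step[OF q_gt_half True] lower_bellman_concave_le[OF q_gt_half True] A_ge_1
      q_gt_half
    by (intro that[of "q * 2 powr (q - 1)" A "lower_bellman_concave q A"]) auto
next
  case False
  define k where "k = q / \<delta>\<^sup>2"
  have q_ge_1: "1 \<le> q" and k_pos: "0 < k" using q_gt_half \<delta>_pos False by (auto simp: k_def)
  have "of_bool counted * q \<le> k * a\<^sup>2" if "counted \<Longrightarrow> \<delta> \<le> \<bar>a\<bar>" for a counted
    using of_bool_mult_le_square_ratio[OF that \<delta>_pos] q_gt_half by (simp add: k_def)
  moreover have "continuous_on UNIV (\<lambda>x. lower_bellman_convex q k x n)" for n
    unfolding lower_bellman_convex_def by (intro continuous_intros)
  ultimately show ?thesis
    using lower_bellman_convex_step[OF q_ge_1] lower_bellman_convex_le[OF q_ge_1 k_pos] k_pos q_ge_1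
    by (intro that[of "1/2" "k * (2 * k) powr (q - 1)" "lower_bellman_convex q k"])
      (auto simp: lower_bellman_convex_def)
qed

section \<open>Martingales with a flip symmetry\<close>

definition count_upto :: "(nat \<Rightarrow> 'b \<Rightarrow> bool) \<Rightarrow> nat \<Rightarrow> 'b \<Rightarrow> nat" where
  "count_upto e K \<omega> = card {k. k < K \<and> e k \<omega>}"

lemma count_upto_0 [simp]: "count_upto e 0 \<omega> = 0"
  by (simp add: count_upto_def)

lemma count_upto_Suc: "count_upto e (Suc K) \<omega> = count_upto e K \<omega> + (if e K \<omega> then 1 else 0)"
proof -
  have "{k. k < Suc K \<and> e k \<omega>} = (if e K \<omega> then insert K {k. k < K \<and> e k \<omega>} else {k. k < K \<and> e k \<omega>})"
    by (auto simp: less_Suc_eq)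
  then show ?thesis by (auto simp: count_upto_def)
qed

lemma count_upto_eq_sum: "real (count_upto e K \<omega>) = (\<Sum>k<K. of_bool (e k \<omega>))"
  by (induction K) (auto simp: count_upto_Suc)

lemma count_upto_le: "count_upto e K \<omega> \<le> K"
  by (induction K) (auto simp: count_upto_Suc)

lemma count_upto_mono:
  assumes "\<And>k. k < K \<Longrightarrow> e k \<omega> \<Longrightarrow> e' k \<omega>'"
  shows "count_upto e K \<omega> \<le> count_upto e' K \<omega>'"
  unfolding count_upto_def using assms by (intro card_mono) auto

lemma count_upto_mono_index: "J \<le> K \<Longrightarrow> count_upto e J \<omega> \<le> count_upto e K \<omega>"
  unfolding count_upto_def by (intro card_mono) auto

lemma count_upto_cong:
  assumes "\<And>k. k < K \<Longrightarrow> e k \<omega> = e' k \<omega>'"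
  shows "count_upto e K \<omega> = count_upto e' K \<omega>'"
  using assms by (intro antisym count_upto_mono) auto

lemma measurable_count_upto [measurable]:
  assumes [measurable]: "\<And>k. Measurable.pred M (e k)"
  shows "count_upto e K \<in> measurable M (count_space UNIV)"
proof (induction K)
  case (Suc K)
  note Suc [measurable]
  have "(\<lambda>\<omega>. count_upto e K \<omega> + (if e K \<omega> then 1 else 0)) \<in> measurable M (count_space UNIV)"
    by measurable
  then show ?case by (simp add: count_upto_Suc[abs_def])
qed (simp add: count_upto_def[abs_def])

definition count_moment :: "'b measure \<Rightarrow> real \<Rightarrow> (nat \<Rightarrow> 'b \<Rightarrow> bool) \<Rightarrow> nat \<Rightarrow> ennreal" where
  "count_moment M q e K = (\<integral>\<^sup>+\<omega>. ennreal (real (count_upto e K \<omega>) powr q) \<partial>M)"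

lemma count_moment_mono:
  assumes "0 \<le> q" "\<And>k \<omega>. e k \<omega> \<Longrightarrow> e' k \<omega>"
  shows "count_moment M q e K \<le> count_moment M q e' K"
  unfolding count_moment_def using assms
  by (intro nn_integral_mono ennreal_leI powr_mono2) (auto intro: count_upto_mono)

locale flip_martingale = prob_space M for M :: "'b measure" +
  fixes T :: "nat \<Rightarrow> 'b \<Rightarrow> 'b" and X0 :: "'b \<Rightarrow> real" and d :: "nat \<Rightarrow> 'b \<Rightarrow> real"
    and e :: "nat \<Rightarrow> 'b \<Rightarrow> bool"
  assumes T_measurable [measurable]: "\<And>k. T k \<in> measurable M M"
    and T_distr: "\<And>k. distr M M (T k) = M"
    and X0_measurable [measurable]: "X0 \<in> borel_measurable M"
    and X0_bounded: "\<exists>B. \<forall>\<omega>. \<bar>X0 \<omega>\<bar> \<le> B"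
    and d_measurable [measurable]: "\<And>k. d k \<in> borel_measurable M"
    and d_bounded: "\<And>k \<omega>. \<bar>d k \<omega>\<bar> \<le> 1"
    and e_measurable [measurable]: "\<And>k. Measurable.pred M (e k)"
    and X0_flip: "\<And>k \<omega>. X0 (T k \<omega>) = X0 \<omega>"
    and d_flip: "\<And>k \<omega>. d k (T k \<omega>) = - d k \<omega>"
    and d_flip_less: "\<And>j k \<omega>. j < k \<Longrightarrow> d j (T k \<omega>) = d j \<omega>"
    and e_flip: "\<And>j k \<omega>. j \<le> k \<Longrightarrow> e j (T k \<omega>) = e j \<omega>"
begin

definition X :: "nat \<Rightarrow> 'b \<Rightarrow> real" where
  "X K \<omega> = X0 \<omega> + (\<Sum>k<K. d k \<omega>)"

lemma X_measurable [measurable]: "X K \<in> borel_measurable M"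
  unfolding X_def[abs_def] by measurable

lemma X_Suc: "X (Suc K) \<omega> = X K \<omega> + d K \<omega>"
  by (simp add: X_def)

lemma X_flip: "j \<le> k \<Longrightarrow> X j (T k \<omega>) = X j \<omega>"
  unfolding X_def X0_flip by (auto intro!: sum.cong d_flip_less)

lemma count_flip: "j \<le> Suc k \<Longrightarrow> count_upto e j (T k \<omega>) = count_upto e j \<omega>"
  by (intro count_upto_cong e_flip) auto

lemma integrable_continuous_count:
  fixes U :: "real \<Rightarrow> nat \<Rightarrow> real"
  assumes U_continuous: "\<And>n. continuous_on UNIV (\<lambda>x. U x n)"
    and f_measurable [measurable]: "f \<in> borel_measurable M" and f_bd: "\<And>\<omega>. \<bar>f \<omega>\<bar> \<le> B"
  shows "integrable M (\<lambda>\<omega>. U (f \<omega>) (count_upto e K \<omega>))"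
proof -
  have "\<exists>b. \<forall>x\<in>{-B..B}. \<bar>U x n\<bar> \<le> b" for n
  proof -
    have "compact ((\<lambda>x. U x n) ` {-B..B})"
      using U_continuous by (intro compact_continuous_image) (auto intro: continuous_on_subset)
    then have "bounded ((\<lambda>x. U x n) ` {-B..B})" by (rule compact_imp_bounded)
    then show ?thesis unfolding bounded_iff by auto
  qed
  then obtain b where U_bounded: "\<And>n x. x \<in> {-B..B} \<Longrightarrow> \<bar>U x n\<bar> \<le> b n" by metis
  have U_bd: "\<bar>U (f \<omega>) (count_upto e K \<omega>)\<bar> \<le> (\<Sum>n\<le>K. \<bar>b n\<bar>)" for \<omega>
  proof -
    have "\<bar>U (f \<omega>) (count_upto e K \<omega>)\<bar> \<le> b (count_upto e K \<omega>)"
      using f_bd[of \<omega>] by (intro U_bounded) auto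
    also have "\<dots> \<le> \<bar>b (count_upto e K \<omega>)\<bar>" by simp
    also have "\<dots> \<le> (\<Sum>n\<le>K. \<bar>b n\<bar>)"
      using count_upto_le by (intro member_le_sum) auto
    finally show ?thesis .
  qed
  have [measurable]: "(\<lambda>x. U x n) \<in> borel_measurable borel" for n
    using U_continuous by (rule borel_measurable_continuous_onI)
  have "(\<lambda>\<omega>. U (f \<omega>) (count_upto e K \<omega>)) \<in> borel_measurable M"
    by (rule measurable_compose_countable[where g="count_upto e K" and f="\<lambda>n \<omega>. U (f \<omega>) n"]) measurable
  then show ?thesis
    using U_bd by (intro integrable_const_bound[where B="\<Sum>n\<le>K. \<bar>b n\<bar>"]) auto
qed

lemma X_bounded: "\<exists>B. \<forall>\<omega>. \<bar>X K \<omega>\<bar> \<le> B"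
proof -
  obtain B where X0_le: "\<And>\<omega>. \<bar>X0 \<omega>\<bar> \<le> B" using X0_bounded by auto
  have "\<bar>X K \<omega>\<bar> \<le> B + real K" for \<omega>
  proof -
    have "\<bar>X K \<omega>\<bar> \<le> \<bar>X0 \<omega>\<bar> + (\<Sum>k<K. \<bar>d k \<omega>\<bar>)"
      unfolding X_def by (rule order_trans[OF abs_triangle_ineq]) (simp add: sum_abs)
    also have "\<dots> \<le> B + (\<Sum>k<K. 1)" using X0_le d_bounded by (intro add_mono sum_mono) auto
    finally show ?thesis by simp
  qed
  then show ?thesis by blast
qed

lemma integrable_bellman:
  fixes U :: "real \<Rightarrow> nat \<Rightarrow> real"
  assumes "\<And>n. continuous_on UNIV (\<lambda>x. U x n)"
  shows "integrable M (\<lambda>\<omega>. U (X K \<omega>) (count_upto e K \<omega>))"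
proof -
  obtain B where "\<And>\<omega>. \<bar>X K \<omega>\<bar> \<le> B" using X_bounded by blast
  then show ?thesis using assms by (intro integrable_continuous_count) auto
qed

(* Averaging over the flip T K replaces the conditional expectation given the past. *)
lemma bellman_increase:
  fixes U :: "real \<Rightarrow> nat \<Rightarrow> real"
  assumes U_continuous: "\<And>n. continuous_on UNIV (\<lambda>x. U x n)"
    and step: "\<And>k \<omega>. 2 * U (X k \<omega>) (count_upto e k \<omega>)
      \<le> U (X k \<omega> + d k \<omega>) (count_upto e (Suc k) \<omega>) + U (X k \<omega> - d k \<omega>) (count_upto e (Suc k) \<omega>)"
  shows "(\<integral>\<omega>. U (X0 \<omega>) 0 \<partial>M) \<le> (\<integral>\<omega>. U (X K \<omega>) (count_upto e K \<omega>) \<partial>M)"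
proof (induction K)
  case 0
  then show ?case by (simp add: X_def)
next
  case (Suc K)
  let ?n = "count_upto e (Suc K)"
  obtain B where X_le: "\<And>\<omega>. \<bar>X K \<omega>\<bar> \<le> B" using X_bounded by blast
  have "\<bar>X K \<omega> + d K \<omega>\<bar> \<le> B + 1" "\<bar>X K \<omega> - d K \<omega>\<bar> \<le> B + 1" for \<omega>
    using X_le[of \<omega>] d_bounded[of K \<omega>] by linarith+
  then have int: "integrable M (\<lambda>\<omega>. U (X K \<omega> + d K \<omega>) (?n \<omega>))" "integrable M (\<lambda>\<omega>. U (X K \<omega> - d K \<omega>) (?n \<omega>))"
    by (intro integrable_continuous_count[OF U_continuous]; auto)+
  have "(\<integral>\<omega>. U (X K \<omega> + d K \<omega>) (?n \<omega>) \<partial>M) = (\<integral>\<omega>. U (X K \<omega> + d K \<omega>) (?n \<omega>) \<partial>distr M M (T K))"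
    by (simp add: T_distr)
  also have "\<dots> = (\<integral>\<omega>. U (X K (T K \<omega>) + d K (T K \<omega>)) (?n (T K \<omega>)) \<partial>M)"
    using int(1) by (intro integral_distr) auto
  also have "\<dots> = (\<integral>\<omega>. U (X K \<omega> - d K \<omega>) (?n \<omega>) \<partial>M)"
    by (simp add: X_flip d_flip count_flip)
  finally have flip: "(\<integral>\<omega>. U (X K \<omega> + d K \<omega>) (?n \<omega>) \<partial>M) = (\<integral>\<omega>. U (X K \<omega> - d K \<omega>) (?n \<omega>) \<partial>M)" .
  have "(\<integral>\<omega>. U (X0 \<omega>) 0 \<partial>M) \<le> (\<integral>\<omega>. U (X K \<omega>) (count_upto e K \<omega>) \<partial>M)" by (rule Suc)
  also have "\<dots> \<le> (\<integral>\<omega>. (U (X K \<omega> + d K \<omega>) (?n \<omega>) + U (X K \<omega> - d K \<omega>) (?n \<omega>)) / 2 \<partial>M)"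
    using int integrable_bellman[of U, OF U_continuous] step[of K]
    by (intro integral_mono) (auto simp: mult.commute)
  also have "\<dots> = (\<integral>\<omega>. U (X K \<omega> + d K \<omega>) (?n \<omega>) \<partial>M)"
    using int flip by simp
  finally show ?case by (simp add: X_Suc)
qed

lemma nn_integral_le_bellman:
  fixes U :: "real \<Rightarrow> nat \<Rightarrow> real" and F G :: "'b \<Rightarrow> real"
  assumes U_continuous: "\<And>n. continuous_on UNIV (\<lambda>x. U x n)"
    and step: "\<And>k \<omega>. 2 * U (X k \<omega>) (count_upto e k \<omega>)
      \<le> U (X k \<omega> + d k \<omega>) (count_upto e (Suc k) \<omega>) + U (X k \<omega> - d k \<omega>) (count_upto e (Suc k) \<omega>)"
    and init: "\<And>\<omega>. 0 \<le> U (X0 \<omega>) 0"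
    and bound: "\<And>\<omega>. U (X K \<omega>) (count_upto e K \<omega>) + c * F \<omega> \<le> C * G \<omega>" and c_C_bounds: "0 < c" "0 \<le> C"
    and F_integrable: "integrable M F" "\<And>\<omega>. 0 \<le> F \<omega>" and G_integrable: "integrable M G" "\<And>\<omega>. 0 \<le> G \<omega>"
  shows "(\<integral>\<^sup>+\<omega>. ennreal (F \<omega>) \<partial>M) \<le> ennreal (C / c) * (\<integral>\<^sup>+\<omega>. ennreal (G \<omega>) \<partial>M)"
proof -
  have "0 \<le> (\<integral>\<omega>. U (X0 \<omega>) 0 \<partial>M)" using init by simp
  also have "\<dots> \<le> (\<integral>\<omega>. U (X K \<omega>) (count_upto e K \<omega>) \<partial>M)" by (rule bellman_increase[OF U_continuous step])
  finally have "c * (\<integral>\<omega>. F \<omega> \<partial>M) \<le> (\<integral>\<omega>. U (X K \<omega>) (count_upto e K \<omega>) + c * F \<omega> \<partial>M)"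
    using F_integrable integrable_bellman[of U, OF U_continuous] by simp
  also have "\<dots> \<le> (\<integral>\<omega>. C * G \<omega> \<partial>M)"
    using bound F_integrable G_integrable integrable_bellman[of U, OF U_continuous]
    by (intro integral_mono) auto
  finally have "(\<integral>\<omega>. F \<omega> \<partial>M) \<le> C / c * (\<integral>\<omega>. G \<omega> \<partial>M)"
    using c_C_bounds by (simp add: field_simps)
  then show ?thesis
    using c_C_bounds F_integrable G_integrable
    by (simp add: nn_integral_eq_integral ennreal_mult[symmetric] ennreal_leI)
qed

lemma integrable_powr:
  shows integrable_count_powr: "0 \<le> r \<Longrightarrow> integrable M (\<lambda>\<omega>. real (count_upto e K \<omega>) powr r)"
    and integrable_X_powr: "0 < r \<Longrightarrow> integrable M (\<lambda>\<omega>. \<bar>X K \<omega>\<bar> powr r)"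
  by (intro integrable_bellman[of "\<lambda>x n. real n powr r"] integrable_bellman[of "\<lambda>x n. \<bar>x\<bar> powr r"]
      continuous_on_powr' continuous_intros; simp)+

end

lemma square_function_upper:
  fixes q :: real
  assumes q_gt_half: "1/2 < q"
  obtains C where "0 \<le> C"
    "\<And>(M :: 'b measure) T d e K. flip_martingale M T (\<lambda>_. 0) d e \<Longrightarrow> (\<And>k \<omega>. \<not> e k \<omega> \<Longrightarrow> d k \<omega> = 0) \<Longrightarrow>
       (\<integral>\<^sup>+\<omega>. ennreal (\<bar>\<Sum>k<K. d k \<omega>\<bar> powr (2 * q)) \<partial>M) \<le> ennreal C * count_moment M q e K"
proof -
  obtain U :: "real \<Rightarrow> nat \<Rightarrow> real" and c C where c_C_bounds: "0 < c" "0 \<le> C" and U_0_0: "U 0 0 = 0"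
    and cont: "\<And>n. continuous_on UNIV (\<lambda>x. U x n)"
    and step: "\<And>x n a. \<bar>a\<bar> \<le> 1 \<Longrightarrow> U (x + a) (Suc n) + U (x - a) (Suc n) \<le> 2 * U x n"
    and U_ge: "\<And>x n. (n = 0 \<Longrightarrow> x = 0) \<Longrightarrow> c * \<bar>x\<bar> powr (2 * q) \<le> U x n + C * real n powr q"
    using upper_bellman_exists[OF q_gt_half] by metis
  show ?thesis
  proof (rule that[of "C / c"])
    fix M :: "'b measure" and T K and d :: "nat \<Rightarrow> 'b \<Rightarrow> real" and e :: "nat \<Rightarrow> 'b \<Rightarrow> bool"
    assume "flip_martingale M T (\<lambda>_. 0) d e" and zero: "\<And>k \<omega>. \<not> e k \<omega> \<Longrightarrow> d k \<omega> = 0"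
    then interpret flip_martingale M T "\<lambda>_. 0" d e by simp
    have "(\<integral>\<^sup>+\<omega>. ennreal (\<bar>X K \<omega>\<bar> powr (2 * q)) \<partial>M)
        \<le> ennreal (C / c) * (\<integral>\<^sup>+\<omega>. ennreal (real (count_upto e K \<omega>) powr q) \<partial>M)"
    proof (rule nn_integral_le_bellman[where U="\<lambda>x n. - U x n"])
      show "2 * - U (X k \<omega>) (count_upto e k \<omega>)
        \<le> - U (X k \<omega> + d k \<omega>) (count_upto e (Suc k) \<omega>) + - U (X k \<omega> - d k \<omega>) (count_upto e (Suc k) \<omega>)" for k \<omega>
        using step[OF d_bounded[of k \<omega>], of "X k \<omega>" "count_upto e k \<omega>"] zero[of k \<omega>]
        by (cases "e k \<omega>") (auto simp: count_upto_Suc)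
      show "- U (X K \<omega>) (count_upto e K \<omega>) + c * \<bar>X K \<omega>\<bar> powr (2 * q) \<le> C * real (count_upto e K \<omega>) powr q"
        for \<omega>
      proof -
        have "X K \<omega> = 0" if "count_upto e K \<omega> = 0"
          using that zero by (auto simp: count_upto_def X_def intro!: sum.neutral)
        then show ?thesis using U_ge[where x="X K \<omega>" and n="count_upto e K \<omega>"] by simp
      qed
    qed (use q_gt_half c_C_bounds U_0_0 in
      \<open>auto intro: integrable_X_powr integrable_count_powr continuous_intros cont\<close>)
    then show "(\<integral>\<^sup>+\<omega>. ennreal (\<bar>\<Sum>k<K. d k \<omega>\<bar> powr (2 * q)) \<partial>M) \<le> ennreal (C / c) * count_moment M q e K"
      by (simp add: X_def count_moment_def)
  qed (use c_C_bounds in simp)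
qed

lemma square_function_lower:
  fixes q \<delta> :: real
  assumes q_gt_half: "1/2 < q" and \<delta>_pos: "0 < \<delta>"
  obtains C where "0 \<le> C"
    "\<And>(M :: 'b measure) T X0 d e K. flip_martingale M T X0 d e \<Longrightarrow> (\<And>k \<omega>. e k \<omega> \<Longrightarrow> \<delta> \<le> \<bar>d k \<omega>\<bar>) \<Longrightarrow>
       count_moment M q e K \<le> ennreal C * (\<integral>\<^sup>+\<omega>. ennreal (\<bar>X0 \<omega> + (\<Sum>k<K. d k \<omega>)\<bar> powr (2 * q)) \<partial>M)"
proof -
  obtain U :: "real \<Rightarrow> nat \<Rightarrow> real" and c C where c_C_bounds: "0 < c" "0 \<le> C" and U_0_nonneg: "\<And>x. 0 \<le> U x 0"
    and cont: "\<And>n. continuous_on UNIV (\<lambda>x. U x n)"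
    and step: "\<And>x n a counted. \<bar>a\<bar> \<le> 1 \<Longrightarrow> (counted \<Longrightarrow> \<delta> \<le> \<bar>a\<bar>) \<Longrightarrow>
       2 * U x n \<le> U (x + a) (n + of_bool counted) + U (x - a) (n + of_bool counted)"
    and U_le: "\<And>x n. U x n + c * real n powr q \<le> C * \<bar>x\<bar> powr (2 * q)"
    using lower_bellman_exists[OF q_gt_half \<delta>_pos] by metis
  show ?thesis
  proof (rule that[of "C / c"])
    fix M :: "'b measure" and T X0 K and d :: "nat \<Rightarrow> 'b \<Rightarrow> real" and e :: "nat \<Rightarrow> 'b \<Rightarrow> bool"
    assume "flip_martingale M T X0 d e" and large: "\<And>k \<omega>. e k \<omega> \<Longrightarrow> \<delta> \<le> \<bar>d k \<omega>\<bar>"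
    then interpret flip_martingale M T X0 d e by simp
    have "(\<integral>\<^sup>+\<omega>. ennreal (real (count_upto e K \<omega>) powr q) \<partial>M)
        \<le> ennreal (C / c) * (\<integral>\<^sup>+\<omega>. ennreal (\<bar>X K \<omega>\<bar> powr (2 * q)) \<partial>M)"
    proof (rule nn_integral_le_bellman[OF cont])
      show "2 * U (X k \<omega>) (count_upto e k \<omega>)
        \<le> U (X k \<omega> + d k \<omega>) (count_upto e (Suc k) \<omega>) + U (X k \<omega> - d k \<omega>) (count_upto e (Suc k) \<omega>)" for k \<omega>
        using step[OF d_bounded[of k \<omega>] large[of k \<omega>],
          where x="X k \<omega>" and n="count_upto e k \<omega>" and counted="e k \<omega>"]
        by (auto simp: count_upto_Suc)
    qed (use q_gt_half c_C_bounds U_0_nonneg U_le in \<open>auto intro: integrable_X_powr integrable_count_powr\<close>)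
    then show "count_moment M q e K
        \<le> ennreal (C / c) * (\<integral>\<^sup>+\<omega>. ennreal (\<bar>X0 \<omega> + (\<Sum>k<K. d k \<omega>)\<bar> powr (2 * q)) \<partial>M)"
      by (simp add: X_def count_moment_def)
  qed (use c_C_bounds in simp)
qed

section \<open>Thinned events\<close>

lemma ennreal_absorb_half:
  fixes a b :: ennreal
  assumes "a \<le> a / 2 + b" "a < \<infinity>"
  shows "a \<le> 2 * b"
proof (cases b)
  case (real r)
  obtain s where a_eq: "a = ennreal s" "s \<ge> 0" using assms(2) by (cases a) auto
  have "ennreal s \<le> ennreal (s / 2 + r)"
    using assms(1) real a_eq by (simp add: ennreal_plus divide_ennreal[symmetric])
  then have "s \<le> s / 2 + r" using a_eq real by (subst (asm) ennreal_le_iff) auto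
  then have "s \<le> 2 * r" by simp
  then show ?thesis using a_eq real by (simp add: ennreal_mult[symmetric] flip: ennreal_numeral)
qed (auto simp: ennreal_mult_top)

lemma sum_of_bool_ennreal:
  assumes "\<And>k. 0 \<le> f k"
  shows "(\<Sum>k\<in>A. of_bool (P k) * ennreal (f k)) = ennreal (\<Sum>k\<in>A. of_bool (P k) * f k)"
proof -
  have "(\<Sum>k\<in>A. of_bool (P k) * ennreal (f k)) = (\<Sum>k\<in>A. ennreal (of_bool (P k) * f k))"
    by (intro sum.cong) (auto simp: of_bool_def)
  also have "\<dots> = ennreal (\<Sum>k\<in>A. of_bool (P k) * f k)"
    using assms by (intro sum_ennreal) auto
  finally show ?thesis .
qed

lemma powr_Suc_increment_le:
  fixes n q :: real
  assumes q_pos: "0 < q" and n_nonneg: "0 \<le> n"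
  shows "(n + 1) powr q - n powr q \<le> max 1 q * (n + 1) powr (q - 1)"
proof (cases "1 \<le> q")
  case True
  then show ?thesis using powr_increment_le[of n "n + 1" q] n_nonneg by auto
next
  case False
  have "n * (n + 1) powr (q - 1) \<le> n powr q"
  proof (cases "n = 0")
    case n0: False
    then have "n * (n + 1) powr (q - 1) \<le> n * n powr (q - 1)"
      using n_nonneg False by (intro mult_left_mono powr_mono2') auto
    then show ?thesis using n_nonneg by (simp add: powr_mult_diff_one)
  qed auto
  moreover have "(n + 1) powr q = n * (n + 1) powr (q - 1) + (n + 1) powr (q - 1)"
    using n_nonneg powr_mult_diff_one[of "n + 1" q] by (simp add: distrib_right)
  ultimately show ?thesis using False by simp
qed

lemma count_powr_le_sum:
  assumes "0 < q"
  shows "real (count_upto e K \<omega>) powr q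
    \<le> (\<Sum>k<K. of_bool (e k \<omega>) * (max 1 q * real (count_upto e (Suc k) \<omega>) powr (q - 1)))"
proof (induction K)
  case (Suc K)
  have "real (count_upto e (Suc K) \<omega>) powr q - real (count_upto e K \<omega>) powr q
     \<le> of_bool (e K \<omega>) * (max 1 q * real (count_upto e (Suc K) \<omega>) powr (q - 1))"
    using powr_Suc_increment_le[OF assms, of "real (count_upto e K \<omega>)"]
    by (auto simp: count_upto_Suc add.commute)
  then show ?case using Suc by simp
qed simp

lemma sum_count_powr_le_concave:
  assumes q_bounds: "0 < q" "q \<le> 1" and sub: "\<And>k. e' k \<omega> \<Longrightarrow> e k \<omega>"
  shows "(\<Sum>k<K. of_bool (e' k \<omega>) * real (count_upto e (Suc k) \<omega>) powr (q - 1))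
    \<le> real (count_upto e' K \<omega>) powr q / q"
proof (induction K)
  case (Suc K)
  have "of_bool (e' K \<omega>) * real (count_upto e (Suc K) \<omega>) powr (q - 1)
    \<le> (real (count_upto e' (Suc K) \<omega>) powr q - real (count_upto e' K \<omega>) powr q) / q"
  proof (cases "e' K \<omega>")
    case True
    define n where "n = real (count_upto e' K \<omega>)"
    have n_bounds: "n \<ge> 0" "real (count_upto e' (Suc K) \<omega>) = n + 1" using True
      by (auto simp: n_def count_upto_Suc)
    have "n + 1 \<le> real (count_upto e (Suc K) \<omega>)"
      unfolding n_bounds(2)[symmetric] of_nat_le_iff using sub by (intro count_upto_mono) auto
    then have "real (count_upto e (Suc K) \<omega>) powr (q - 1) \<le> (n + 1) powr (q - 1)"
      using q_bounds n_bounds by (intro powr_mono2') auto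
    also have "\<dots> \<le> ((n + 1) powr q - n powr q) / q"
      using powr_increment_concave_ge[of n "n + 1" q] n_bounds q_bounds by (simp add: field_simps)
    finally show ?thesis using True n_bounds by (simp add: n_def)
  qed (simp add: count_upto_Suc)
  then show ?case using Suc by (simp add: diff_divide_distrib)
qed simp

lemma sum_count_powr_le_convex:
  assumes "1 \<le> q"
  shows "(\<Sum>k<K. of_bool (e' k \<omega>) * real (count_upto e (Suc k) \<omega>) powr (q - 1))
    \<le> real (count_upto e' K \<omega>) * real (count_upto e K \<omega>) powr (q - 1)"
proof -
  have "(\<Sum>k<K. of_bool (e' k \<omega>) * real (count_upto e (Suc k) \<omega>) powr (q - 1))
     \<le> (\<Sum>k<K. of_bool (e' k \<omega>) * real (count_upto e K \<omega>) powr (q - 1))"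
    using assms by (intro sum_mono mult_left_mono powr_mono2) (auto intro: count_upto_mono_index)
  then show ?thesis by (simp add: count_upto_eq_sum sum_distrib_right)
qed

definition thinning :: "'b measure \<Rightarrow> real \<Rightarrow> (nat \<Rightarrow> 'b \<Rightarrow> bool) \<Rightarrow> (nat \<Rightarrow> 'b \<Rightarrow> bool) \<Rightarrow> bool" where
  "thinning M c e e' \<longleftrightarrow>
    (\<forall>k. Measurable.pred M (e k)) \<and> (\<forall>k. Measurable.pred M (e' k)) \<and> (\<forall>k \<omega>. e' k \<omega> \<longrightarrow> e k \<omega>) \<and>
    (\<forall>k h. (\<integral>\<^sup>+\<omega>. of_bool (e k \<omega>) * h (count_upto e (Suc k) \<omega>) \<partial>M)
       \<le> ennreal c * (\<integral>\<^sup>+\<omega>. of_bool (e' k \<omega>) * h (count_upto e (Suc k) \<omega>) \<partial>M))"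

lemma count_moment_le_thinned_sum:
  assumes q_pos: "0 < q" and c_nonneg: "0 \<le> c" and thin: "thinning M c e e'"
  shows "count_moment M q e K
    \<le> (\<integral>\<^sup>+\<omega>. ennreal (max 1 q * c * (\<Sum>k<K. of_bool (e' k \<omega>) * real (count_upto e (Suc k) \<omega>) powr (q - 1))) \<partial>M)"
proof -
  have [measurable]: "Measurable.pred M (e k)" "Measurable.pred M (e' k)" for k
    using thin by (auto simp: thinning_def)
  have dom: "(\<integral>\<^sup>+\<omega>. of_bool (e k \<omega>) * h (count_upto e (Suc k) \<omega>) \<partial>M)
      \<le> ennreal c * (\<integral>\<^sup>+\<omega>. of_bool (e' k \<omega>) * h (count_upto e (Suc k) \<omega>) \<partial>M)" for k h
    using thin unfolding thinning_def by blast
  let ?h = "\<lambda>n. ennreal (max 1 q * real n powr (q - 1))"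
  have sum_h: "(\<Sum>k<K. of_bool (P k) * ?h (count_upto e (Suc k) \<omega>)) =
     ennreal (\<Sum>k<K. of_bool (P k) * (max 1 q * real (count_upto e (Suc k) \<omega>) powr (q - 1)))" for P \<omega>
    using q_pos by (intro sum_of_bool_ennreal) auto
  have "count_moment M q e K \<le> (\<integral>\<^sup>+\<omega>. (\<Sum>k<K. of_bool (e k \<omega>) * ?h (count_upto e (Suc k) \<omega>)) \<partial>M)"
    unfolding count_moment_def sum_h by (intro nn_integral_mono ennreal_leI count_powr_le_sum[OF q_pos])
  also have "\<dots> = (\<Sum>k<K. \<integral>\<^sup>+\<omega>. of_bool (e k \<omega>) * ?h (count_upto e (Suc k) \<omega>) \<partial>M)"
    by (intro nn_integral_sum) measurable
  also have "\<dots> \<le> (\<Sum>k<K. ennreal c * (\<integral>\<^sup>+\<omega>. of_bool (e' k \<omega>) * ?h (count_upto e (Suc k) \<omega>) \<partial>M))"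
    by (intro sum_mono dom[of _ ?h])
  also have "\<dots> = (\<integral>\<^sup>+\<omega>. ennreal c * (\<Sum>k<K. of_bool (e' k \<omega>) * ?h (count_upto e (Suc k) \<omega>)) \<partial>M)"
    by (subst nn_integral_cmult, measurable, subst nn_integral_sum, measurable)
       (simp add: sum_distrib_left)
  also have "\<dots>
      = (\<integral>\<^sup>+\<omega>. ennreal (max 1 q * c * (\<Sum>k<K. of_bool (e' k \<omega>) * real (count_upto e (Suc k) \<omega>) powr (q - 1))) \<partial>M)"
    unfolding sum_h using c_nonneg
    by (intro nn_integral_cong)
      (simp add: ennreal_mult[symmetric] sum_nonneg sum_distrib_left mult_ac del: sum_of_bool_mult_eq)
  finally show ?thesis .
qed

lemma count_moment_le_thinned_concave:
  assumes q_bounds: "0 < q" "q \<le> 1" and c_pos: "0 < c" and thin: "thinning M c e e'"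
  shows "count_moment M q e K \<le> ennreal (c / q) * count_moment M q e' K"
proof -
  have [measurable]: "Measurable.pred M (e' k)" for k using thin by (simp add: thinning_def)
  have "c * (\<Sum>k<K. of_bool (e' k \<omega>) * real (count_upto e (Suc k) \<omega>) powr (q - 1))
      \<le> c / q * real (count_upto e' K \<omega>) powr q" for \<omega>
    using mult_left_mono[OF sum_count_powr_le_concave[OF q_bounds, of e' \<omega> e K], of c] thin c_pos
    by (auto simp: thinning_def)
  then have "count_moment M q e K \<le> (\<integral>\<^sup>+\<omega>. ennreal (c / q * real (count_upto e' K \<omega>) powr q) \<partial>M)"
    using q_bounds
    by (intro order_trans[OF count_moment_le_thinned_sum[OF q_bounds(1) less_imp_le[OF c_pos] thin]]
      nn_integral_mono ennreal_leI) simp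
  also have "\<dots> = ennreal (c / q) * count_moment M q e' K"
    unfolding count_moment_def using q_bounds c_pos
    by (subst nn_integral_cmult[symmetric]) (auto simp flip: ennreal_mult)
  finally show ?thesis .
qed

lemma (in finite_measure) count_moment_le_thinned_convex:
  assumes q_ge_1: "1 \<le> q" and c_pos: "0 < c" and thin: "thinning M c e e'"
  shows "count_moment M q e K \<le> ennreal (2 * (q * c * (2 * (q * c)) powr (q - 1))) * count_moment M q e' K"
proof -
  have [measurable]: "Measurable.pred M (e k)" "Measurable.pred M (e' k)" for k
    using thin by (auto simp: thinning_def)
  have q_pos: "0 < q" using q_ge_1 by simp
  define A where "A = q * c"
  define B where "B = A * (2 * A) powr (q - 1)"
  have A_pos: "0 < A" and B_nonneg: "0 \<le> B" using q_pos c_pos by (auto simp: A_def B_def)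
  let ?N = "\<lambda>\<omega>. real (count_upto e K \<omega>)" and ?N' = "\<lambda>\<omega>. real (count_upto e' K \<omega>)"
  have "A * (\<Sum>k<K. of_bool (e' k \<omega>) * real (count_upto e (Suc k) \<omega>) powr (q - 1))
      \<le> ?N \<omega> powr q / 2 + B * ?N' \<omega> powr q" for \<omega>
  proof -
    have "A * (\<Sum>k<K. of_bool (e' k \<omega>) * real (count_upto e (Suc k) \<omega>) powr (q - 1))
        \<le> A * (?N' \<omega> * ?N \<omega> powr (q - 1))"
      using A_pos q_ge_1 by (intro mult_left_mono sum_count_powr_le_convex) auto
    also have "\<dots> \<le> ?N \<omega> powr q / 2 + B * ?N' \<omega> powr q"
      using mult_powr_diff_one_le[of "?N' \<omega>" "?N \<omega>" q A] A_pos q_ge_1 by (simp add: B_def mult_ac)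
    finally show ?thesis .
  qed
  then have "count_moment M q e K \<le> (\<integral>\<^sup>+\<omega>. ennreal (?N \<omega> powr q / 2 + B * ?N' \<omega> powr q) \<partial>M)"
    using q_ge_1
    by (intro order_trans[OF count_moment_le_thinned_sum[OF q_pos less_imp_le[OF c_pos] thin]]
      nn_integral_mono ennreal_leI)
      (simp add: A_def)
  also have "\<dots> = (\<integral>\<^sup>+\<omega>. ennreal (?N \<omega> powr q) / 2 + ennreal B * ennreal (?N' \<omega> powr q) \<partial>M)"
    using B_nonneg by (intro nn_integral_cong) (simp add: ennreal_plus ennreal_mult divide_ennreal[symmetric])
  also have "\<dots> = count_moment M q e K / 2 + ennreal B * count_moment M q e' K"
    unfolding count_moment_def by (subst nn_integral_add) (auto simp: nn_integral_cmult nn_integral_divide)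
  finally have "count_moment M q e K \<le> 2 * (ennreal B * count_moment M q e' K)"
  proof (rule ennreal_absorb_half)
    have "count_moment M q e K \<le> (\<integral>\<^sup>+\<omega>. ennreal (real K powr q) \<partial>M)"
      unfolding count_moment_def using q_ge_1
      by (intro nn_integral_mono ennreal_leI powr_mono2) (auto simp: count_upto_le)
    also have "\<dots> < \<infinity>" by (simp add: ennreal_mult_eq_top_iff less_top[symmetric])
    finally show "count_moment M q e K < \<infinity>" .
  qed
  then show ?thesis
    using B_nonneg by (simp add: A_def[symmetric] B_def[symmetric] ennreal_mult mult.assoc)
qed

definition thinning_const :: "real \<Rightarrow> real \<Rightarrow> real" where
  "thinning_const q c = (if q \<le> 1 then c / q else 2 * (q * c * (2 * (q * c)) powr (q - 1)))"

theorem (in finite_measure) count_moment_le_thinned: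
  assumes "0 < q" "0 < c" "thinning M c e e'"
  shows "count_moment M q e K \<le> ennreal (thinning_const q c) * count_moment M q e' K"
  using count_moment_le_thinned_concave[OF _ _ assms(2,3), of q K]
    count_moment_le_thinned_convex[OF _ assms(2,3), of q K] assms(1)
  by (simp add: thinning_const_def)

section \<open>Dyadic cells of the unit cube\<close>

definition unit_cube :: "'a::euclidean_space set" where
  "unit_cube = {u. \<forall>b\<in>Basis. 0 \<le> u \<bullet> b \<and> u \<bullet> b < 1}"

definition cell :: "nat \<Rightarrow> 'a::euclidean_space \<Rightarrow> 'a" where
  "cell k u = (\<Sum>b\<in>Basis. of_int \<lfloor>2 ^ k * (u \<bullet> b)\<rfloor> *\<^sub>R b)"

definition cell_pos :: "nat \<Rightarrow> 'a::euclidean_space \<Rightarrow> 'a" where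
  "cell_pos k u = 2 ^ k *\<^sub>R u - cell k u"

definition cell_centre :: "nat \<Rightarrow> 'a::euclidean_space \<Rightarrow> 'a" where
  "cell_centre k u = (1 / 2 ^ k) *\<^sub>R (cell k u + (1/2) *\<^sub>R One)"

definition cell_flip :: "'a::euclidean_space \<Rightarrow> nat \<Rightarrow> 'a \<Rightarrow> 'a" where
  "cell_flip i k u = (if cell_pos k u \<bullet> i < 1/2 then u + (1 / 2 ^ Suc k) *\<^sub>R i else u - (1 / 2 ^ Suc k) *\<^sub>R i)"

definition cube_measure :: "'a::euclidean_space measure" where
  "cube_measure = density lborel (indicator unit_cube)"

lemma unit_cube_measurable [measurable]: "unit_cube \<in> sets borel"
proof -
  have "unit_cube = (\<Inter>b\<in>Basis. {u :: 'a. 0 \<le> u \<bullet> b \<and> u \<bullet> b < 1})" by (auto simp: unit_cube_def)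
  also have "\<dots> \<in> sets borel" by (intro sets.finite_INT) auto
  finally show ?thesis .
qed

lemma cell_measurable [measurable]: "cell k \<in> borel_measurable borel"
  unfolding cell_def[abs_def] by measurable

lemma cell_pos_measurable [measurable]: "cell_pos k \<in> borel_measurable borel"
  unfolding cell_pos_def[abs_def] by measurable

lemma cell_centre_measurable [measurable]: "cell_centre k \<in> borel_measurable borel"
  unfolding cell_centre_def[abs_def] by measurable

lemma cell_flip_measurable [measurable]: "cell_flip i k \<in> borel_measurable borel"
  unfolding cell_flip_def[abs_def] by measurable

lemma sets_cube_measure [measurable_cong, simp]: "sets cube_measure = sets borel"
  and space_cube_measure [simp]: "space cube_measure = UNIV"
  by (auto simp: cube_measure_def)

lemma nn_integral_cube_measure:
  "f \<in> borel_measurable borel \<Longrightarrow> (\<integral>\<^sup>+u. f u \<partial>cube_measure) = (\<integral>\<^sup>+u. indicator unit_cube u * f u \<partial>lborel)"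
  unfolding cube_measure_def by (subst nn_integral_density) auto

lemma emeasure_unit_cube: "emeasure lborel (unit_cube :: 'a::euclidean_space set) = 1"
proof -
  have "emeasure lborel (box 0 One :: 'a set) \<le> emeasure lborel (unit_cube :: 'a set)"
    by (intro emeasure_mono) (auto simp: unit_cube_def mem_box intro: less_imp_le)
  moreover have "emeasure lborel (unit_cube :: 'a set) \<le> emeasure lborel (cbox 0 One :: 'a set)"
    by (intro emeasure_mono) (auto simp: unit_cube_def mem_box less_imp_le)
  ultimately show ?thesis by (simp add: emeasure_lborel_box_eq emeasure_lborel_cbox_eq)
qed

lemma prob_space_cube_measure: "prob_space (cube_measure :: 'a::euclidean_space measure)"
proof
  show "emeasure (cube_measure :: 'a measure) (space cube_measure) = 1"
    using emeasure_unit_cube[where 'a='a]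
    by (simp add: cube_measure_def emeasure_density)
qed

lemma cell_inner [simp]: "b \<in> Basis \<Longrightarrow> cell k u \<bullet> b = of_int \<lfloor>2 ^ k * (u \<bullet> b)\<rfloor>"
  by (simp add: cell_def)

lemma cell_pos_inner [simp]: "b \<in> Basis \<Longrightarrow> cell_pos k u \<bullet> b = frac (2 ^ k * (u \<bullet> b))"
  by (simp add: cell_pos_def inner_diff_left frac_def)

lemma cell_pos_in_unit_cube [simp]: "cell_pos k u \<in> unit_cube"
  by (auto simp: unit_cube_def frac_lt_1)

lemma cell_eq_iff: "cell k u = cell k v \<longleftrightarrow> (\<forall>b\<in>Basis. \<lfloor>2 ^ k * (u \<bullet> b)\<rfloor> = \<lfloor>2 ^ k * (v \<bullet> b)\<rfloor>)"
  by (simp add: euclidean_eq_iff[of "cell k u"])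

lemma floor_pow2_nested:
  fixes s t :: real
  assumes "\<lfloor>2 ^ k * s\<rfloor> = \<lfloor>2 ^ k * t\<rfloor>" "j \<le> k"
  shows "\<lfloor>2 ^ j * s\<rfloor> = \<lfloor>2 ^ j * t\<rfloor>"
proof -
  have "\<lfloor>2 ^ j * r\<rfloor> = \<lfloor>2 ^ k * r\<rfloor> div 2 ^ (k - j)" for r :: real
  proof -
    have "(2::real) ^ k = 2 ^ j * 2 ^ (k - j)" using assms(2) by (simp add: power_add[symmetric])
    then have "2 ^ j * r = (2 ^ k * r) / real_of_int (2 ^ (k - j))" by simp
    then show ?thesis using floor_divide_real_eq_div[of "2 ^ (k - j)" "2 ^ k * r"] by simp
  qed
  then show ?thesis using assms by simp
qed

lemma cell_nested: "cell k u = cell k v \<Longrightarrow> j \<le> k \<Longrightarrow> cell j u = cell j v"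
  unfolding cell_eq_iff using floor_pow2_nested by blast

lemma cell_centre_diff: "u - cell_centre k u = (1 / 2 ^ k) *\<^sub>R (cell_pos k u - (1/2) *\<^sub>R One)"
proof -
  have "(1 / 2 ^ k) *\<^sub>R (2 ^ k *\<^sub>R u) = u" by simp
  then show ?thesis
    unfolding cell_centre_def cell_pos_def by (simp add: algebra_simps)
qed

lemma unit_cube_cell: "cell k u = cell k v \<Longrightarrow> u \<in> unit_cube \<longleftrightarrow> v \<in> unit_cube"
proof -
  have "u \<in> unit_cube \<longleftrightarrow> cell 0 u = 0" for u :: 'a
    unfolding euclidean_eq_iff[of "cell 0 u" 0]
    by (auto simp: unit_cube_def floor_eq_iff)
  then show "cell k u = cell k v \<Longrightarrow> u \<in> unit_cube \<longleftrightarrow> v \<in> unit_cube"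
    using cell_nested[of k u v 0] by simp
qed

lemma nn_integral_lborel_affine:
  fixes t :: "'a::euclidean_space"
  assumes [measurable]: "f \<in> borel_measurable borel" and c_nonzero: "c \<noteq> 0"
  shows "(\<integral>\<^sup>+x. f x \<partial>lborel) = ennreal (\<bar>c\<bar> ^ DIM('a)) * (\<integral>\<^sup>+x. f (t + c *\<^sub>R x) \<partial>lborel)"
  by (subst lborel_affine[OF c_nonzero, of t])
    (simp add: nn_integral_density nn_integral_distr nn_integral_cmult)

lemma nn_integral_lborel_shift:
  fixes t :: "'a::euclidean_space"
  assumes [measurable]: "f \<in> borel_measurable borel"
  shows "(\<integral>\<^sup>+x. f (x + t) \<partial>lborel) = (\<integral>\<^sup>+x. f x \<partial>lborel)"
  using nn_integral_lborel_affine[OF assms, of 1 t] by (simp add: add.commute)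

lemma nn_integral_same_cell:
  fixes u :: "'a::euclidean_space"
  assumes [measurable]: "G \<in> borel_measurable borel"
  shows "(\<integral>\<^sup>+z. of_bool (cell k z = cell k u) * G (cell_pos k z) \<partial>lborel)
    = ennreal ((1 / 2 ^ k) ^ DIM('a)) * (\<integral>\<^sup>+v. indicator unit_cube v * G v \<partial>lborel)"
proof -
  let ?z = "\<lambda>v::'a. (1 / 2 ^ k) *\<^sub>R cell k u + (1 / 2 ^ k) *\<^sub>R v"
  have inz: "2 ^ k * (?z v \<bullet> b) = of_int \<lfloor>2 ^ k * (u \<bullet> b)\<rfloor> + v \<bullet> b" if "b \<in> Basis" for v b
    using that by (simp add: inner_add_left field_simps)
  have cell_eq_iff: "cell k (?z v) = cell k u \<longleftrightarrow> v \<in> unit_cube" for v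
    unfolding cell_eq_iff unit_cube_def mem_Collect_eq
    by (intro ball_cong refl) (simp only: inz floor_eq_iff, auto)
  have pos: "cell_pos k (?z v) = v" if "v \<in> unit_cube" for v
  proof (rule euclidean_eqI)
    fix b :: 'a assume b_Basis: "b \<in> Basis"
    then have "0 \<le> v \<bullet> b" "v \<bullet> b < 1" using that by (auto simp: unit_cube_def)
    then show "cell_pos k (?z v) \<bullet> b = v \<bullet> b"
      unfolding cell_pos_inner[OF b_Basis] inz[OF b_Basis] frac_def by (simp add: floor_eq_iff)
  qed
  have "(\<integral>\<^sup>+z. of_bool (cell k z = cell k u) * G (cell_pos k z) \<partial>lborel)
      = ennreal (\<bar>1 / 2 ^ k\<bar> ^ DIM('a)) *
        (\<integral>\<^sup>+v. of_bool (cell k (?z v) = cell k u) * G (cell_pos k (?z v)) \<partial>lborel)"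
    by (rule nn_integral_lborel_affine) auto
  also have "(\<integral>\<^sup>+v. of_bool (cell k (?z v) = cell k u) * G (cell_pos k (?z v)) \<partial>lborel)
      = (\<integral>\<^sup>+v. indicator unit_cube v * G v \<partial>lborel)"
    by (intro nn_integral_cong) (auto simp: cell_eq_iff pos indicator_def)
  finally show ?thesis by simp
qed

definition cell_average :: "nat \<Rightarrow> ('a::euclidean_space \<Rightarrow> ennreal) \<Rightarrow> 'a \<Rightarrow> ennreal" where
  "cell_average k f z = ennreal ((2 ^ k) ^ DIM('a)) * (\<integral>\<^sup>+u. of_bool (cell k u = cell k z) * f u \<partial>lborel)"

lemma cell_average_mult_cell:
  assumes "f \<in> borel_measurable borel" and "\<And>u v. cell k u = cell k v \<Longrightarrow> w u = w v"
  shows "cell_average k (\<lambda>u. w u * f u) z = w z * cell_average k f z"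
proof -
  have "(\<integral>\<^sup>+u. of_bool (cell k u = cell k z) * (w u * f u) \<partial>lborel)
      = (\<integral>\<^sup>+u. w z * (of_bool (cell k u = cell k z) * f u) \<partial>lborel)"
  proof (rule nn_integral_cong)
    show "of_bool (cell k u = cell k z) * (w u * f u) = w z * (of_bool (cell k u = cell k z) * f u)" for u
      using assms(2)[of u z] by (cases "cell k u = cell k z") auto
  qed
  then show ?thesis
    using assms(1) by (simp add: cell_average_def nn_integral_cmult mult.left_commute)
qed

lemma cell_average_of_cell_pos:
  fixes F :: "'a::euclidean_space \<Rightarrow> ennreal"
  assumes [measurable]: "F \<in> borel_measurable borel"
  shows "cell_average k (\<lambda>u. F (cell_pos k u)) z = (\<integral>\<^sup>+u. F u \<partial>cube_measure)"
proof -
  have "ennreal ((2 ^ k) ^ DIM('a)) * ennreal ((1 / 2 ^ k) ^ DIM('a)) = 1"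
    by (subst ennreal_mult[symmetric]) (auto simp: power_mult_distrib[symmetric])
  then show ?thesis
    by (simp add: cell_average_def nn_integral_same_cell nn_integral_cube_measure mult.assoc[symmetric])
qed

lemma emeasure_cube_measure_UNIV [simp]: "emeasure (cube_measure :: 'a::euclidean_space measure) UNIV = 1"
  using prob_space.emeasure_space_1[OF prob_space_cube_measure[where 'a='a]] by simp

lemma nn_integral_cell_average:
  fixes f :: "'a::euclidean_space \<Rightarrow> ennreal"
  assumes [measurable]: "f \<in> borel_measurable borel"
  shows "(\<integral>\<^sup>+z. cell_average k f z \<partial>lborel) = (\<integral>\<^sup>+u. f u \<partial>lborel)"
proof -
  let ?c = "ennreal ((2 ^ k) ^ DIM('a))"
  have "(\<integral>\<^sup>+z. cell_average k f z \<partial>lborel)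
      = (\<integral>\<^sup>+z. (\<integral>\<^sup>+u. ?c * (of_bool (cell k u = cell k z) * f u) \<partial>lborel) \<partial>lborel)"
    by (simp add: cell_average_def nn_integral_cmult)
  also have "\<dots> = (\<integral>\<^sup>+u. (\<integral>\<^sup>+z. ?c * (of_bool (cell k u = cell k z) * f u) \<partial>lborel) \<partial>lborel)"
    by (rule lborel_pair.Fubini') measurable
  also have "\<dots> = (\<integral>\<^sup>+u. cell_average k (\<lambda>z. 1) u * f u \<partial>lborel)"
    by (intro nn_integral_cong)
      (simp add: cell_average_def nn_integral_cmult nn_integral_multc
        eq_commute[of "cell k u" "cell k z" for u z] mult.assoc)
  also have "\<dots> = (\<integral>\<^sup>+u. f u \<partial>lborel)"
    using cell_average_of_cell_pos[of "\<lambda>_::'a. 1" k] by simp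
  finally show ?thesis .
qed

lemma indicator_unit_cube_cell:
  "cell k u = cell k v \<Longrightarrow> (indicator unit_cube u :: ennreal) = indicator unit_cube v"
  using unit_cube_cell by (auto simp: indicator_def)

lemma nn_integral_cell_independent:
  fixes Y F :: "'a::euclidean_space \<Rightarrow> ennreal"
  assumes [measurable]: "Y \<in> borel_measurable borel" "F \<in> borel_measurable borel"
    and Y_cell: "\<And>u v. cell k u = cell k v \<Longrightarrow> Y u = Y v"
  shows "(\<integral>\<^sup>+u. Y u * F (cell_pos k u) \<partial>cube_measure) = (\<integral>\<^sup>+u. Y u \<partial>cube_measure) * (\<integral>\<^sup>+u. F u \<partial>cube_measure)"
proof -
  let ?w = "\<lambda>u. indicator unit_cube u * Y u"
  have w_cell: "?w u = ?w v" if "cell k u = cell k v" for u v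
    using Y_cell[OF that] indicator_unit_cube_cell[OF that] by simp
  have "(\<integral>\<^sup>+u. Y u * F (cell_pos k u) \<partial>cube_measure) = (\<integral>\<^sup>+u. ?w u * F (cell_pos k u) \<partial>lborel)"
    by (simp add: nn_integral_cube_measure mult.assoc)
  also have "\<dots> = (\<integral>\<^sup>+z. cell_average k (\<lambda>u. ?w u * F (cell_pos k u)) z \<partial>lborel)"
    by (rule nn_integral_cell_average[symmetric]) measurable
  also have "\<dots> = (\<integral>\<^sup>+z. ?w z * (\<integral>\<^sup>+u. F u \<partial>cube_measure) \<partial>lborel)"
    by (intro nn_integral_cong) (subst cell_average_mult_cell[OF _ w_cell], auto simp: cell_average_of_cell_pos)
  also have "\<dots> = (\<integral>\<^sup>+u. Y u \<partial>cube_measure) * (\<integral>\<^sup>+u. F u \<partial>cube_measure)"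
    by (simp add: nn_integral_multc nn_integral_cube_measure)
  finally show ?thesis .
qed

definition central_box :: "real \<Rightarrow> 'a::euclidean_space set" where
  "central_box \<kappa> = cbox ((1/2 - \<kappa>) *\<^sub>R One) ((1/2 + \<kappa>) *\<^sub>R One)"

lemma central_box_measurable [measurable]: "central_box \<kappa> \<in> sets borel"
  unfolding central_box_def by (intro borel_closed closed_cbox)

lemma central_box_iff: "v \<in> central_box \<kappa> \<longleftrightarrow> (\<forall>b\<in>Basis. \<bar>(v - (1/2) *\<^sub>R One) \<bullet> b\<bar> \<le> \<kappa>)"
proof -
  have "((1/2 - \<kappa>) *\<^sub>R One) \<bullet> b \<le> v \<bullet> b \<and> v \<bullet> b \<le> ((1/2 + \<kappa>) *\<^sub>R One) \<bullet> b
      \<longleftrightarrow> \<bar>(v - (1/2) *\<^sub>R One) \<bullet> b\<bar> \<le> \<kappa>" if "b \<in> Basis" for b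
    using that by (simp add: inner_diff_left abs_le_iff) linarith
  then show ?thesis by (simp add: central_box_def mem_box)
qed

lemma central_box_subset_unit_cube:
  assumes "\<kappa> < 1/2"
  shows "central_box \<kappa> \<subseteq> unit_cube"
proof
  fix v :: 'a assume v_central: "v \<in> central_box \<kappa>"
  have "0 \<le> v \<bullet> b \<and> v \<bullet> b < 1" if "b \<in> Basis" for b
  proof -
    have "\<bar>v \<bullet> b - 1/2\<bar> \<le> \<kappa>" using v_central that by (auto simp: central_box_iff inner_diff_left)
    then show ?thesis using assms by linarith
  qed
  then show "v \<in> unit_cube" by (simp add: unit_cube_def)
qed

lemma emeasure_central_box:
  assumes "0 \<le> \<kappa>" "\<kappa> < 1/2"
  shows "emeasure cube_measure (central_box \<kappa> :: 'a::euclidean_space set) = ennreal ((2 * \<kappa>) ^ DIM('a))"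
proof -
  define lower upper :: 'a where "lower = (1/2 - \<kappa>) *\<^sub>R One" and "upper = (1/2 + \<kappa>) *\<^sub>R One"
  have corner: "lower \<bullet> b = 1/2 - \<kappa>" "upper \<bullet> b = 1/2 + \<kappa>" if "b \<in> Basis" for b
    using that by (simp_all add: lower_def upper_def)
  have "emeasure cube_measure (central_box \<kappa> :: 'a set)
      = (\<integral>\<^sup>+v. indicator (central_box \<kappa> :: 'a set) v \<partial>cube_measure)"
    by (rule nn_integral_indicator[symmetric]) measurable
  also have "\<dots> = (\<integral>\<^sup>+v. indicator unit_cube v * indicator (central_box \<kappa> :: 'a set) v \<partial>lborel)"
    by (rule nn_integral_cube_measure) measurable
  also have "\<dots> = (\<integral>\<^sup>+v. indicator (central_box \<kappa> :: 'a set) v \<partial>lborel)"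
    using central_box_subset_unit_cube[OF assms(2)] by (intro nn_integral_cong) (auto simp: indicator_def)
  also have "\<dots> = emeasure lborel (cbox lower upper)"
    by (subst nn_integral_indicator)
      (auto simp only: central_box_def lower_def upper_def sets_lborel intro: borel_closed closed_cbox)
  also have "\<dots> = ennreal (\<Prod>b\<in>Basis. (upper - lower) \<bullet> b)"
    using corner assms by (intro emeasure_lborel_cbox) simp
  also have "(\<Prod>b\<in>Basis. (upper - lower) \<bullet> b) = (2 * \<kappa>) ^ DIM('a)"
    by (simp add: inner_diff_left corner)
  finally show ?thesis .
qed

lemma norm_diff_cell_centre_le:
  fixes u :: "'a::euclidean_space"
  assumes "cell_pos k u \<in> central_box \<kappa>"
  shows "norm (u - cell_centre k u) \<le> real DIM('a) * \<kappa> / 2 ^ k"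
proof -
  have "norm (cell_pos k u - (1/2) *\<^sub>R One) \<le> (\<Sum>b\<in>Basis. \<bar>(cell_pos k u - (1/2) *\<^sub>R One) \<bullet> b\<bar>)"
    by (rule norm_le_l1)
  also have "\<dots> \<le> (\<Sum>b\<in>(Basis::'a set). \<kappa>)"
    using assms by (intro sum_mono) (auto simp: central_box_iff)
  finally show ?thesis unfolding cell_centre_diff by (simp add: divide_right_mono)
qed

lemma thinning_central_box:
  fixes e :: "nat \<Rightarrow> 'a::euclidean_space \<Rightarrow> bool"
  assumes [measurable]: "\<And>k. Measurable.pred borel (e k)"
    and e_cell: "\<And>k u v. cell k u = cell k v \<Longrightarrow> e k u = e k v" and \<kappa>_bounds: "0 < \<kappa>" "\<kappa> < 1/2"
  shows "thinning cube_measure (1 / (2 * \<kappa>) ^ DIM('a)) e (\<lambda>k u. e k u \<and> cell_pos k u \<in> central_box \<kappa>)"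
proof -
  let ?m = "(2 * \<kappa>) ^ DIM('a)"
  let ?e' = "\<lambda>k u. e k u \<and> cell_pos k u \<in> central_box \<kappa>"
  have dominated: "(\<integral>\<^sup>+u. of_bool (e k u) * h (count_upto e (Suc k) u) \<partial>cube_measure)
      \<le> ennreal (1 / ?m) * (\<integral>\<^sup>+u. of_bool (?e' k u) * h (count_upto e (Suc k) u) \<partial>cube_measure)"
    for k and h :: "nat \<Rightarrow> ennreal"
  proof -
    let ?Y = "\<lambda>u. of_bool (e k u) * h (count_upto e (Suc k) u)"
    have "(\<integral>\<^sup>+u. of_bool (?e' k u) * h (count_upto e (Suc k) u) \<partial>cube_measure)
        = (\<integral>\<^sup>+u. ?Y u * indicator (central_box \<kappa>) (cell_pos k u) \<partial>cube_measure)"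
      by (intro nn_integral_cong) (auto simp: indicator_def)
    also have "\<dots> = (\<integral>\<^sup>+u. ?Y u \<partial>cube_measure) * (\<integral>\<^sup>+u. indicator (central_box \<kappa> :: 'a set) u \<partial>cube_measure)"
    proof (rule nn_integral_cell_independent)
      have [measurable]: "count_upto e (Suc k) \<in> measurable borel (count_space UNIV)"
        by (rule measurable_count_upto) measurable
      have [measurable]: "(\<lambda>u. h (count_upto e (Suc k) u)) \<in> borel_measurable borel"
        by (rule measurable_compose[where N="count_space UNIV"]) auto
      show "?Y \<in> borel_measurable borel" by measurable
      show "?Y u = ?Y v" if "cell k u = cell k v" for u v
      proof -
        have "e j u = e j v" if "j \<le> k" for j
          using e_cell cell_nested[OF \<open>cell k u = cell k v\<close> that] by blast
        then show ?thesis using count_upto_cong[of "Suc k" e u e v] by simp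
      qed
    qed measurable
    also have "(\<integral>\<^sup>+u. indicator (central_box \<kappa> :: 'a set) u \<partial>cube_measure) = ennreal ?m"
      using \<kappa>_bounds by (simp add: emeasure_central_box)
    finally have thinned: "(\<integral>\<^sup>+u. of_bool (?e' k u) * h (count_upto e (Suc k) u) \<partial>cube_measure)
        = (\<integral>\<^sup>+u. ?Y u \<partial>cube_measure) * ennreal ?m" .
    have "ennreal (1 / ?m) * ennreal ?m = 1" using \<kappa>_bounds by (subst ennreal_mult[symmetric]) auto
    then show ?thesis unfolding thinned by (simp only: mult.left_commute[of "ennreal (1 / ?m)"] mult_1_right)
  qed
  show ?thesis
    unfolding thinning_def by (intro conjI allI dominated; (measurable | simp))
qed

lemma cell_flip_inner: "b \<in> Basis \<Longrightarrow> i \<in> Basis \<Longrightarrow> b \<noteq> i \<Longrightarrow> cell_flip i k u \<bullet> b = u \<bullet> b"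
  by (auto simp: cell_flip_def inner_add_left inner_diff_left inner_Basis)

lemma cell_flip_inner_same: "i \<in> Basis \<Longrightarrow>
   2 ^ k * (cell_flip i k u \<bullet> i) = 2 ^ k * (u \<bullet> i) + (if frac (2 ^ k * (u \<bullet> i)) < 1/2 then 1/2 else -1/2)"
  by (auto simp: cell_flip_def inner_add_left inner_diff_left field_simps)

lemma floor_cell_flip:
  assumes i_Basis: "i \<in> Basis"
  shows "\<lfloor>2 ^ k * (cell_flip i k u \<bullet> i)\<rfloor> = \<lfloor>2 ^ k * (u \<bullet> i)\<rfloor>"
proof -
  define t where "t = 2 ^ k * (u \<bullet> i)"
  have "t = of_int \<lfloor>t\<rfloor> + frac t" "0 \<le> frac t" "frac t < 1" by (auto simp: frac_def frac_lt_1 frac_ge_0) linarith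
  then have "\<lfloor>t + (if frac t < 1/2 then 1/2 else -1/2)\<rfloor> = \<lfloor>t\<rfloor>"
    by (cases "frac t < 1/2"; intro floor_unique; simp; linarith)
  then show ?thesis unfolding cell_flip_inner_same[OF i_Basis] t_def .
qed

lemma cell_cell_flip: "i \<in> Basis \<Longrightarrow> j \<le> k \<Longrightarrow> cell j (cell_flip i k u) = cell j u"
proof (rule cell_nested)
  assume i_Basis: "i \<in> Basis"
  show "cell k (cell_flip i k u) = cell k u"
    unfolding cell_eq_iff using floor_cell_flip[OF i_Basis] cell_flip_inner[OF _ i_Basis] by metis
qed

lemma cell_pos_cell_flip_other:
  "b \<in> Basis \<Longrightarrow> i \<in> Basis \<Longrightarrow> b \<noteq> i \<Longrightarrow> cell_pos j (cell_flip i k u) \<bullet> b = cell_pos j u \<bullet> b"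
  by (simp add: cell_flip_inner)

lemma cell_pos_cell_flip_half:
  assumes i_Basis: "i \<in> Basis"
  shows "cell_pos k (cell_flip i k u) \<bullet> i < 1/2 \<longleftrightarrow> \<not> cell_pos k u \<bullet> i < 1/2"
proof -
  have "cell_pos k (cell_flip i k u) \<bullet> i = cell_pos k u \<bullet> i + (if cell_pos k u \<bullet> i < 1/2 then 1/2 else -1/2)"
    using floor_cell_flip[OF i_Basis, of k u] cell_flip_inner_same[OF i_Basis, of k u] i_Basis
    by (auto simp: frac_def)
  moreover have "0 \<le> cell_pos k u \<bullet> i" "cell_pos k u \<bullet> i < 1" using i_Basis by (auto simp: frac_lt_1)
  ultimately show ?thesis by (auto split: if_splits)
qed

lemma frac_half_iff:
  fixes t :: real
  shows "frac (2 ^ j * t) < 1/2 \<longleftrightarrow> \<lfloor>2 ^ Suc j * t\<rfloor> = 2 * \<lfloor>2 ^ j * t\<rfloor>"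
proof -
  define s where "s = 2 ^ j * t"
  have "\<lfloor>2 * s\<rfloor> = 2 * \<lfloor>s\<rfloor> \<longleftrightarrow> frac s < 1/2"
    unfolding floor_eq_iff frac_def by auto
  then show ?thesis by (simp add: s_def mult.assoc)
qed

lemma cell_pos_cell_flip_less:
  assumes i_Basis: "i \<in> Basis" and j_less: "j < k"
  shows "cell_pos j (cell_flip i k u) \<bullet> i < 1/2 \<longleftrightarrow> cell_pos j u \<bullet> i < 1/2"
proof -
  have "cell (Suc j) (cell_flip i k u) = cell (Suc j) u" "cell j (cell_flip i k u) = cell j u"
    using i_Basis j_less by (auto intro!: cell_cell_flip)
  then show ?thesis unfolding cell_pos_inner[OF i_Basis] frac_half_iff using i_Basis by (simp add: cell_eq_iff)
qed

lemma left_half_cell_shift: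
  fixes k :: nat
  assumes i_Basis: "i \<in> Basis"
  defines "h \<equiv> (1 / 2 ^ Suc k) *\<^sub>R i"
  shows "u - h \<in> unit_cube \<and> cell_pos k (u - h) \<bullet> i < 1/2 \<longleftrightarrow> u \<in> unit_cube \<and> \<not> cell_pos k u \<bullet> i < 1/2"
proof (cases "cell_pos k u \<bullet> i < 1/2")
  case True
  have "\<not> cell_pos k (u - h) \<bullet> i < 1/2"
  proof
    assume left: "cell_pos k (u - h) \<bullet> i < 1/2"
    then have "cell_flip i k (u - h) = u" by (simp add: cell_flip_def h_def)
    then show False using cell_pos_cell_flip_half[OF i_Basis, of k "u - h"] True left by simp
  qed
  then show ?thesis using True by simp
next
  case False
  then have "cell_flip i k u = u - h" by (simp add: cell_flip_def h_def)
  then show ?thesis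
    using False cell_pos_cell_flip_half[OF i_Basis, of k u]
      unit_cube_cell[OF cell_cell_flip[OF i_Basis order_refl, of k u]]
    by simp
qed

lemma distr_cell_flip:
  fixes i :: "'a::euclidean_space"
  assumes i_Basis: "i \<in> Basis"
  shows "distr cube_measure cube_measure (cell_flip i k) = cube_measure"
proof (rule measure_eqI)
  fix A :: "'a set" assume "A \<in> sets (distr cube_measure cube_measure (cell_flip i k))"
  then have [measurable]: "A \<in> sets borel" by simp
  define h where "h = (1 / 2 ^ Suc k) *\<^sub>R i"
  let ?L = "\<lambda>u. of_bool (u \<in> unit_cube \<and> cell_pos k u \<bullet> i < 1/2) :: ennreal"
  let ?R = "\<lambda>u. of_bool (u \<in> unit_cube \<and> \<not> cell_pos k u \<bullet> i < 1/2) :: ennreal"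
  let ?A = "indicator A :: 'a \<Rightarrow> ennreal"
  have shift: "?L (u - h) = ?R u" for u
    using left_half_cell_shift[OF i_Basis, of u k] by (simp only: h_def)
  have "emeasure (distr cube_measure cube_measure (cell_flip i k)) A
      = (\<integral>\<^sup>+u. ?A (cell_flip i k u) \<partial>cube_measure)"
    by (subst nn_integral_distr[symmetric, of _ _ cube_measure]) (auto simp: nn_integral_indicator)
  also have "\<dots> = (\<integral>\<^sup>+u. ?L u * ?A (u + h) + ?R u * ?A (u - h) \<partial>lborel)"
    by (simp add: nn_integral_cube_measure)
      (intro nn_integral_cong, auto simp: cell_flip_def h_def indicator_def)
  also have "\<dots> = (\<integral>\<^sup>+u. ?L u * ?A (u + h) \<partial>lborel) + (\<integral>\<^sup>+u. ?R u * ?A (u - h) \<partial>lborel)"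
    by (rule nn_integral_add) measurable
  also have "(\<integral>\<^sup>+u. ?L u * ?A (u + h) \<partial>lborel) = (\<integral>\<^sup>+u. ?R u * ?A u \<partial>lborel)"
    using nn_integral_lborel_shift[of "\<lambda>u. ?L (u - h) * ?A u" h]
    by (simp only: add_diff_cancel_right' shift) measurable
  also have "(\<integral>\<^sup>+u. ?R u * ?A (u - h) \<partial>lborel) = (\<integral>\<^sup>+u. ?L u * ?A u \<partial>lborel)"
    using nn_integral_lborel_shift[of "\<lambda>u. ?R (u + h) * ?A u" "- h"]
    by (simp only: diff_add_cancel shift[symmetric] add_diff_cancel_right' add_uminus_conv_diff) measurable
  also have "(\<integral>\<^sup>+u. ?R u * ?A u \<partial>lborel) + (\<integral>\<^sup>+u. ?L u * ?A u \<partial>lborel)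
     = (\<integral>\<^sup>+u. ?R u * ?A u + ?L u * ?A u \<partial>lborel)"
    by (rule nn_integral_add[symmetric]) measurable
  also have "\<dots> = (\<integral>\<^sup>+u. ?A u \<partial>cube_measure)"
    by (subst nn_integral_cube_measure, measurable) (intro nn_integral_cong, auto simp: indicator_def)
  also have "\<dots> = emeasure cube_measure A" by simp
  finally show "emeasure (distr cube_measure cube_measure (cell_flip i k)) A = emeasure cube_measure A" .
qed simp

section \<open>Second differences and the Zygmund class\<close>

lemma Dh2_diff: "Dh2 h (\<lambda>x. f x - g x) x = Dh2 h f x - Dh2 h g x"
  by (simp add: Dh2_eq)

lemma Dh2_measurable [measurable]:
  assumes [measurable]: "f \<in> borel_measurable borel"
  shows "Dh2 h f \<in> borel_measurable borel"
  unfolding Dh2_eq[abs_def] by measurable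

lemma Dh2_bounded:
  assumes "\<And>x. \<bar>f x\<bar> \<le> S"
  shows "\<bar>Dh2 h f x\<bar> \<le> 4 * S"
  unfolding Dh2_eq using assms[of "x + h"] assms[of x] assms[of "x - h"] by linarith

lemma bdd_above_Dh2:
  assumes "bounded (range f)"
  shows "bdd_above ((\<lambda>h. \<bar>Dh2 h f x\<bar>) ` A)"
proof -
  obtain S where "\<And>x. \<bar>f x\<bar> \<le> S" using assms by (auto simp: bounded_iff)
  from Dh2_bounded[OF this] show ?thesis by (intro bdd_aboveI2[where M="4 * S"])
qed

lemma Delta2_ge:
  assumes "bounded (range f)" "norm h = y"
  shows "\<bar>Dh2 h f x\<bar> \<le> Delta2 f x y"
  unfolding Delta2_def using assms by (intro cSUP_upper bdd_above_Dh2) auto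

lemma Delta2_le:
  fixes f :: "'a::euclidean_space \<Rightarrow> real"
  assumes "0 \<le> y" "\<And>h. norm h = y \<Longrightarrow> \<bar>Dh2 h f x\<bar> \<le> B"
  shows "Delta2 f x y \<le> B"
proof -
  obtain h0 :: 'a where "norm h0 = y" using vector_choose_size[OF assms(1)] by auto
  then show ?thesis unfolding Delta2_def using assms(2) by (intro cSUP_least) auto
qed

lemma less_Delta2D:
  fixes f :: "'a::euclidean_space \<Rightarrow> real"
  assumes "0 \<le> y" "c < Delta2 f x y"
  obtains h where "norm h = y" "c < \<bar>Dh2 h f x\<bar>"
  using Delta2_le[OF assms(1), of f x c] assms(2) by (meson not_le)

lemma Delta2_nonneg:
  fixes f :: "'a::euclidean_space \<Rightarrow> real"
  assumes "bounded (range f)" "0 \<le> y"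
  shows "0 \<le> Delta2 f x y"
proof -
  obtain h0 :: 'a where "norm h0 = y" using vector_choose_size[OF assms(2)] by auto
  from Delta2_ge[OF assms(1) this] show ?thesis by (smt (verit) abs_ge_zero)
qed

lemma Lambda1I:
  fixes f :: "'a::euclidean_space \<Rightarrow> real"
  assumes cont: "continuous_on UNIV f" and f_bounded: "\<And>x. \<bar>f x\<bar> \<le> S"
    and Dh2_bounded_by: "\<And>x h. norm h \<le> 1 \<Longrightarrow> \<bar>Dh2 h f x\<bar> \<le> M * norm h"
  shows "f \<in> Lambda1" and "Lambda1_norm f \<le> S + M"
proof -
  have Delta2_le_M: "Delta2 f x y / y \<le> M" if "y \<in> {0<..1}" for x y
  proof -
    have "Delta2 f x y \<le> M * y"
      using that Dh2_bounded_by by (intro Delta2_le) auto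
    then show ?thesis using that by (simp add: field_simps)
  qed
  have "bounded (range f)" using f_bounded by (auto simp: bounded_iff)
  moreover have "bdd_above {Delta2 f x y / y | x y. y \<in> {0<..1}}"
    by (rule bdd_aboveI[where M=M]) (use Delta2_le_M in auto)
  ultimately show "f \<in> Lambda1" using cont by (simp add: Lambda1_def)
  have "(SUP x. \<bar>f x\<bar>) \<le> S" using f_bounded by (intro cSUP_least) auto
  moreover have "(SUP (x,y)\<in>UNIV \<times> {0<..1}. Delta2 f x y / y) \<le> M"
  proof (rule cSUP_least)
    have "(0, 1) \<in> (UNIV :: 'a set) \<times> {0<..1::real}" by simp
    then show "(UNIV :: 'a set) \<times> {0<..1::real} \<noteq> {}" by blast
  qed (use Delta2_le_M in auto)
  ultimately show "Lambda1_norm f \<le> S + M" by (simp add: Lambda1_norm_def)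
qed

lemma Lambda1D:
  fixes f :: "'a::euclidean_space \<Rightarrow> real"
  assumes f_Lambda1: "f \<in> Lambda1"
  shows Lambda1_norm_ge_abs: "\<bar>f x\<bar> \<le> Lambda1_norm f"
    and Lambda1_norm_ge_Dh2: "norm h \<le> 1 \<Longrightarrow> \<bar>Dh2 h f x\<bar> \<le> Lambda1_norm f * norm h"
proof -
  have f_bounded: "bounded (range f)" and Delta2_bdd_above: "bdd_above {Delta2 f x y / y | x y. y \<in> {0<..1}}"
    using f_Lambda1 by (auto simp: Lambda1_def)
  have image_eq: "(\<lambda>(x, y). Delta2 f x y / y) ` (UNIV \<times> {0<..1}) = {Delta2 f x y / y | x y. y \<in> {0<..1}}"
    by (force simp: image_iff)
  obtain S where "\<And>x. \<bar>f x\<bar> \<le> S" using f_bounded by (auto simp: bounded_iff)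
  then have "bdd_above (range (\<lambda>x. \<bar>f x\<bar>))" by (intro bdd_aboveI2)
  then have abs_le: "\<bar>f x\<bar> \<le> (SUP x. \<bar>f x\<bar>)" for x by (intro cSUP_upper) auto
  have quotient_le: "Delta2 f x y / y \<le> (SUP (x,y)\<in>UNIV \<times> {0<..1}. Delta2 f x y / y)" if "y \<in> {0<..1}" for x y
  proof -
    have "bdd_above ((\<lambda>(x, y). Delta2 f x y / y) ` (UNIV \<times> {0<..1}))" unfolding image_eq
      by (rule Delta2_bdd_above)
    from cSUP_upper[OF _ this, of "(x, y)"] that show ?thesis by auto
  qed
  have quotient_nonneg: "0 \<le> (SUP (x,y)\<in>UNIV \<times> {0<..1}. Delta2 f x y / y)"
    using quotient_le[of 1 0] Delta2_nonneg[OF f_bounded, of 1 0] by simp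
  have abs_nonneg: "0 \<le> (SUP x. \<bar>f x\<bar>)" using abs_le[of 0] by linarith
  show "\<bar>f x\<bar> \<le> Lambda1_norm f" using abs_le[of x] quotient_nonneg by (simp add: Lambda1_norm_def)
  show "\<bar>Dh2 h f x\<bar> \<le> Lambda1_norm f * norm h" if "norm h \<le> 1"
  proof (cases "h = 0")
    case True
    then show ?thesis by (simp add: Dh2_eq)
  next
    case False
    have "\<bar>Dh2 h f x\<bar> \<le> Delta2 f x (norm h)" by (rule Delta2_ge[OF f_bounded]) simp
    also have "\<dots> \<le> (SUP (x,y)\<in>UNIV \<times> {0<..1}. Delta2 f x y / y) * norm h"
      using quotient_le[of "norm h" x] that False by (simp add: field_simps)
    also have "\<dots> \<le> Lambda1_norm f * norm h"
      using abs_nonneg by (intro mult_right_mono) (auto simp: Lambda1_norm_def)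
    finally show ?thesis .
  qed
qed

lemma Lambda1_norm_nonneg: "f \<in> Lambda1 \<Longrightarrow> 0 \<le> Lambda1_norm f"
  using Lambda1_norm_ge_abs[of f 0] by linarith

definition zygmund_bounded :: "real \<Rightarrow> ('a::euclidean_space \<Rightarrow> real) \<Rightarrow> bool" where
  "zygmund_bounded M f \<longleftrightarrow> (\<forall>x h. \<bar>Dh2 h f x\<bar> \<le> M * norm h)"

lemma zygmund_boundedD: "zygmund_bounded M f \<Longrightarrow> \<bar>Dh2 h f x\<bar> \<le> M * norm h"
  by (simp add: zygmund_bounded_def)

lemma Lambda1_zygmund_bounded:
  fixes f :: "'a::euclidean_space \<Rightarrow> real"
  assumes f_Lambda1: "f \<in> Lambda1"
  obtains M where "M \<ge> 1" "zygmund_bounded M f"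
proof (rule that[of "1 + 4 * Lambda1_norm f"])
  have Lambda1_norm_f_nonneg: "0 \<le> Lambda1_norm f" by (rule Lambda1_norm_nonneg[OF f_Lambda1])
  then show "1 \<le> 1 + 4 * Lambda1_norm f" by simp
  have "\<bar>Dh2 h f x\<bar> \<le> (1 + 4 * Lambda1_norm f) * norm h" for x h
  proof (cases "norm h \<le> 1")
    case True
    have "\<bar>Dh2 h f x\<bar> \<le> Lambda1_norm f * norm h" by (rule Lambda1_norm_ge_Dh2[OF f_Lambda1 True])
    also have "\<dots> \<le> (1 + 4 * Lambda1_norm f) * norm h" using Lambda1_norm_f_nonneg
      by (intro mult_right_mono) auto
    finally show ?thesis .
  next
    case False
    have "\<bar>Dh2 h f x\<bar> \<le> 4 * Lambda1_norm f" by (rule Dh2_bounded) (rule Lambda1_norm_ge_abs[OF f_Lambda1])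
    also have "\<dots> \<le> (1 + 4 * Lambda1_norm f) * 1" by simp
    also have "\<dots> \<le> (1 + 4 * Lambda1_norm f) * norm h" using Lambda1_norm_f_nonneg False
      by (intro mult_left_mono) auto
    finally show ?thesis .
  qed
  then show "zygmund_bounded (1 + 4 * Lambda1_norm f) f" by (simp add: zygmund_bounded_def)
qed

lemma Lambda1_diff:
  assumes f_Lambda1: "f \<in> Lambda1" and g_Lambda1: "g \<in> Lambda1"
  shows "(\<lambda>x. f x - g x) \<in> Lambda1"
proof (rule Lambda1I(1))
  show "continuous_on UNIV (\<lambda>x. f x - g x)"
    using f_Lambda1 g_Lambda1 by (intro continuous_intros) (auto simp: Lambda1_def)
  show "\<bar>f x - g x\<bar> \<le> Lambda1_norm f + Lambda1_norm g" for x
    using Lambda1_norm_ge_abs[OF f_Lambda1, of x] Lambda1_norm_ge_abs[OF g_Lambda1, of x] by linarith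
  show "\<bar>Dh2 h (\<lambda>x. f x - g x) x\<bar> \<le> (Lambda1_norm f + Lambda1_norm g) * norm h" if "norm h \<le> 1" for x h
    using Lambda1_norm_ge_Dh2[OF f_Lambda1 that, of x] Lambda1_norm_ge_Dh2[OF g_Lambda1 that, of x]
    unfolding Dh2_diff distrib_right by linarith
qed

lemma first_difference_dyadic_le:
  fixes f :: "'a::euclidean_space \<Rightarrow> real"
  assumes f_zygmund: "zygmund_bounded M f"
  shows "\<bar>(f (x + u) - f x) - (f (x + 2 ^ j *\<^sub>R u) - f x) / 2 ^ j\<bar> \<le> real j * M * norm u / 2"
proof (induction j)
  case (Suc j)
  define U where "U = (2 ^ j) *\<^sub>R u"
  have U_double: "(2 ^ Suc j) *\<^sub>R u = U + U" by (simp add: U_def flip: scaleR_2)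
  have "(f (x + U) - f x) / 2 ^ j - (f (x + (U + U)) - f x) / 2 ^ Suc j = - Dh2 U f (x + U) / 2 ^ Suc j"
    by (simp add: Dh2_eq field_simps)
  then have "\<bar>(f (x + U) - f x) / 2 ^ j - (f (x + (U + U)) - f x) / 2 ^ Suc j\<bar> = \<bar>Dh2 U f (x + U)\<bar> / 2 ^ Suc j"
    by simp
  also have "\<dots> \<le> M * norm U / 2 ^ Suc j"
    by (intro divide_right_mono zygmund_boundedD[OF f_zygmund]) auto
  also have "\<dots> = M * norm u / 2" by (simp add: U_def)
  finally have "\<bar>(f (x + U) - f x) / 2 ^ j - (f (x + (U + U)) - f x) / 2 ^ Suc j\<bar> \<le> M * norm u / 2" .
  moreover have "real (Suc j) * M * norm u / 2 = real j * M * norm u / 2 + M * norm u / 2"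
    by (simp add: field_simps)
  ultimately show ?case using Suc unfolding U_double unfolding U_def[symmetric] by linarith
qed simp

(* In the next two lemmas a first difference over a small step is compared with the one over a dyadic multiple of
  the step: a power of two is gained while only a factor linear in the exponent is lost. *)
lemma Dh2_shift_point_le:
  fixes f :: "'a::euclidean_space \<Rightarrow> real"
  assumes f_zygmund: "zygmund_bounded M f"
  shows "\<bar>Dh2 h f (x + u) - Dh2 h f x\<bar> \<le> M * (2 * real j * norm u + 2 * norm h / 2 ^ j)"
proof -
  define d where "d = (\<lambda>v y. f (y + v) - f y)"
  define U where "U = 2 ^ j *\<^sub>R u"
  have small: "\<bar>d u y - d U y / 2 ^ j\<bar> \<le> real j * M * norm u / 2" for y
    using first_difference_dyadic_le[OF f_zygmund, of y u j] by (simp add: d_def U_def)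
  have split: "Dh2 h f (x + v) - Dh2 h f x = d v (x + h) - 2 * d v x + d v (x - h)" for v
    unfolding d_def Dh2_eq by (simp add: algebra_simps)
  have "\<bar>Dh2 h f (x + U) - Dh2 h f x\<bar> \<le> 2 * (M * norm h)"
    using zygmund_boundedD[OF f_zygmund, of h "x + U"] zygmund_boundedD[OF f_zygmund, of h x] by linarith
  then have "\<bar>(Dh2 h f (x + U) - Dh2 h f x) / 2 ^ j\<bar> \<le> 2 * (M * norm h) / 2 ^ j"
    by (simp add: divide_right_mono)
  moreover have "(Dh2 h f (x + U) - Dh2 h f x) / 2 ^ j
      = d U (x + h) / 2 ^ j - 2 * (d U x / 2 ^ j) + d U (x - h) / 2 ^ j"
    unfolding split by (simp add: add_divide_distrib diff_divide_distrib)
  moreover have "M * (2 * real j * norm u + 2 * norm h / 2 ^ j)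
      = 4 * (real j * M * norm u / 2) + 2 * (M * norm h) / 2 ^ j"
    by (simp add: algebra_simps)
  ultimately show ?thesis
    using small[of "x + h"] small[of x] small[of "x - h"] unfolding split by linarith
qed

lemma Dh2_shift_step_le:
  fixes f :: "'a::euclidean_space \<Rightarrow> real"
  assumes f_zygmund: "zygmund_bounded M f" and M_nonneg: "0 \<le> M"
  shows "\<bar>Dh2 (h + u) f x - Dh2 h f x\<bar> \<le> M * ((real j + 2) * norm u + 2 * norm h / 2 ^ j)"
proof -
  define d where "d = (\<lambda>v y. f (y + v) - f y)"
  define U where "U = 2 ^ j *\<^sub>R u"
  define v where "v = (1/2) *\<^sub>R U"
  define w where "w = (1/2) *\<^sub>R u"
  define y where "y = x + v - w"
  have small: "\<bar>d u z - d U z / 2 ^ j\<bar> \<le> real j * M * norm u / 2" for z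
    using first_difference_dyadic_le[OF f_zygmund, of z u j] by (simp add: d_def U_def)
  have split: "Dh2 (h + u) f x - Dh2 h f x = d u (x + h) - d u (x - h - u)"
    unfolding d_def Dh2_eq by (simp add: algebra_simps)
  have halves: "U = v + v" "u = w + w"
    by (simp_all add: v_def w_def flip: scaleR_left_distrib)
  have corners: "y + (h + (v + w)) = x + h + U" "y - (h + (v + w)) = x - h - u"
    "y + (h - (v - w)) = x + h" "y - (h - (v - w)) = x - h - u + U"
    unfolding y_def halves by (simp_all add: algebra_simps)
  have "Dh2 (h + (v + w)) f y - Dh2 (h - (v - w)) f y = d U (x + h) - d U (x - h - u)"
    unfolding Dh2_eq corners d_def by simp
  then have "\<bar>d U (x + h) - d U (x - h - u)\<bar> \<le> M * norm (h + (v + w)) + M * norm (h - (v - w))"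
    using zygmund_boundedD[OF f_zygmund, of "h + (v + w)" y]
      zygmund_boundedD[OF f_zygmund, of "h - (v - w)" y] by linarith
  also have "\<dots> \<le> M * (norm h + (norm v + norm w)) + M * (norm h + (norm v + norm w))"
    using M_nonneg by (intro add_mono mult_left_mono) norm+
  also have "\<dots> = M * (2 * norm h + (2 ^ j + 1) * norm u)"
    by (simp add: v_def w_def U_def algebra_simps)
  also have "\<dots> \<le> M * (2 * norm h + (2 ^ j + 2 ^ j) * norm u)"
    using M_nonneg by (intro mult_left_mono add_mono mult_right_mono) auto
  finally have "\<bar>(d U (x + h) - d U (x - h - u)) / 2 ^ j\<bar> \<le> M * (2 * norm h + 2 * 2 ^ j * norm u) / 2 ^ j"
    by (simp add: divide_right_mono)
  moreover have "M * ((real j + 2) * norm u + 2 * norm h / 2 ^ j)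
      = 2 * (real j * M * norm u / 2) + M * (2 * norm h + 2 * 2 ^ j * norm u) / 2 ^ j"
    by (simp add: field_simps)
  ultimately show ?thesis
    using small[of "x + h"] small[of "x - h - u"] unfolding split diff_divide_distrib by linarith
qed

definition Dh2_modulus :: "real \<Rightarrow> real \<Rightarrow> real \<Rightarrow> ('a::euclidean_space \<Rightarrow> real) \<Rightarrow> bool" where
  "Dh2_modulus R \<eta> \<kappa> f \<longleftrightarrow> (\<forall>x x' h h' t. 0 < t \<longrightarrow> norm h \<le> R * t \<longrightarrow> norm (x' - x) \<le> \<kappa> * t \<longrightarrow>
     norm (h' - h) \<le> \<kappa> * t \<longrightarrow> \<bar>Dh2 h' f x' - Dh2 h f x\<bar> \<le> \<eta> * t)"

lemma Dh2_modulusD: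
  assumes "Dh2_modulus R \<eta> \<kappa> f" "0 < t" "norm h \<le> R * t" "norm (x' - x) \<le> \<kappa> * t" "norm (h' - h) \<le> \<kappa> * t"
  shows "\<bar>Dh2 h' f x' - Dh2 h f x\<bar> \<le> \<eta> * t"
  using assms unfolding Dh2_modulus_def by blast

lemma Dh2_modulus_antimono:
  assumes "Dh2_modulus R \<eta> \<kappa> f" "\<kappa>' \<le> \<kappa>"
  shows "Dh2_modulus R \<eta> \<kappa>' f"
proof -
  have "\<kappa>' * t \<le> \<kappa> * t" if "0 < t" for t using assms(2) that by (intro mult_right_mono) auto
  then show ?thesis using assms(1) unfolding Dh2_modulus_def by (meson order_trans)
qed

lemma Dh2_modulus_exists:
  fixes f :: "'a::euclidean_space \<Rightarrow> real"
  assumes f_zygmund: "zygmund_bounded M f" and M_nonneg: "0 \<le> M" and R_nonneg: "0 \<le> R" and \<eta>_pos: "0 < \<eta>"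
  obtains \<kappa> where "0 < \<kappa>" "\<kappa> \<le> 1/2" "Dh2_modulus R \<eta> \<kappa> f"
proof -
  have "(\<lambda>j. real j * (1/2) ^ j) \<longlonglongrightarrow> (0::real)"
    using powser_times_n_limit_0[of "1/2 :: real"] by simp
  moreover have "(\<lambda>j. (1/2) ^ j) \<longlonglongrightarrow> (0::real)" by (rule LIMSEQ_realpow_zero) auto
  ultimately have "(\<lambda>j. 3 * M * (real j * (1/2) ^ j) + (4 * R + 2) * M * (1/2) ^ j)
      \<longlonglongrightarrow> 3 * M * 0 + (4 * R + 2) * M * 0"
    by (intro tendsto_add tendsto_mult_left)
  then have "eventually (\<lambda>j. 3 * M * (real j * (1/2) ^ j) + (4 * R + 2) * M * (1/2) ^ j < \<eta>
      \<and> 1 \<le> j) sequentially"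
    using \<eta>_pos eventually_ge_at_top[of 1] by (intro eventually_conj order_tendstoD(2)) auto
  then obtain j :: nat where "3 * M * (real j * (1/2) ^ j) + (4 * R + 2) * M * (1/2) ^ j < \<eta>"
    and j_ge_1: "1 \<le> j"
    by (auto simp: eventually_sequentially)
  then have j_small: "M * ((3 * real j + 4 * R + 2) * (1/2) ^ j) < \<eta>" by (simp add: algebra_simps)
  show ?thesis
  proof (rule that[of "(1/2) ^ j"])
    show "0 < (1/2 :: real) ^ j" by simp
    show "(1/2 :: real) ^ j \<le> 1/2" using power_decreasing[OF j_ge_1, of "1/2 :: real"] by simp
    show "Dh2_modulus R \<eta> ((1/2) ^ j) f"
      unfolding Dh2_modulus_def
    proof (intro allI impI)
      fix x x' h h' :: 'a and t :: real
      assume t_pos: "0 < t" and norm_h_le: "norm h \<le> R * t"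
        and norm_x_diff_le: "norm (x' - x) \<le> (1/2) ^ j * t" and norm_h_diff_le: "norm (h' - h) \<le> (1/2) ^ j * t"
      let ?k = "(1/2 :: real) ^ j"
      have norm_h_dyadic_le: "2 * norm h / 2 ^ j \<le> 2 * R * ?k * t"
        using mult_right_mono[OF norm_h_le, of "2 * ?k"] by (simp add: power_one_over mult_ac)
      have "\<bar>Dh2 h' f x' - Dh2 h f x\<bar>
          \<le> \<bar>Dh2 h f (x + (x' - x)) - Dh2 h f x\<bar> + \<bar>Dh2 (h + (h' - h)) f x' - Dh2 h f x'\<bar>"
        by simp
      also have "\<dots> \<le> M * (2 * real j * norm (x' - x) + 2 * norm h / 2 ^ j)
          + M * ((real j + 2) * norm (h' - h) + 2 * norm h / 2 ^ j)"
        by (intro add_mono Dh2_shift_point_le[OF f_zygmund] Dh2_shift_step_le[OF f_zygmund M_nonneg])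
      also have "\<dots>
          \<le> M * (2 * real j * (?k * t) + 2 * R * ?k * t) + M * ((real j + 2) * (?k * t) + 2 * R * ?k * t)"
        using M_nonneg norm_x_diff_le norm_h_diff_le by (intro add_mono mult_left_mono norm_h_dyadic_le) auto
      also have "\<dots> = M * ((3 * real j + 4 * R + 2) * ?k) * t" by (simp add: algebra_simps)
      also have "\<dots> \<le> \<eta> * t" using j_small t_pos by (intro mult_right_mono) auto
      finally show "\<bar>Dh2 h' f x' - Dh2 h f x\<bar> \<le> \<eta> * t" .
    qed
  qed
qed

lemma enn_powr_ennreal [simp]: "0 \<le> a \<Longrightarrow> enn_powr (ennreal a) r = ennreal (a powr r)"
  by (simp add: enn_powr_def)

lemma enn_powr_top [simp]: "enn_powr \<top> r = \<top>"
  by (simp add: enn_powr_def)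

lemma enn_powr_mono:
  assumes "a \<le> b" "0 \<le> r"
  shows "enn_powr a r \<le> enn_powr b r"
proof (cases b)
  case (real y)
  then obtain x where "a = ennreal x" "0 \<le> x" using assms by (cases a) (auto simp: top_unique)
  then show ?thesis using real assms by (auto intro!: ennreal_leI powr_mono2)
qed simp

lemma enn_powr_powr:
  assumes "0 < r" "0 < s"
  shows "enn_powr (enn_powr a r) s = enn_powr a (r * s)"
  by (cases a) (auto simp: powr_powr)

lemma enn_powr_one [simp]: "enn_powr a 1 = a"
  by (cases a) auto

lemma enn_powr_SUP:
  assumes r_pos: "0 < r"
  shows "enn_powr (SUP n. f n) r = (SUP n. enn_powr (f n) r)"
proof (rule antisym)
  let ?s = "SUP n. enn_powr (f n) r"
  have "f n \<le> enn_powr ?s (1 / r)" for n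
  proof -
    have "f n = enn_powr (enn_powr (f n) r) (1 / r)" using r_pos by (simp add: enn_powr_powr)
    also have "\<dots> \<le> enn_powr ?s (1 / r)" using r_pos by (intro enn_powr_mono SUP_upper) auto
    finally show ?thesis .
  qed
  then have "enn_powr (SUP n. f n) r \<le> enn_powr (enn_powr ?s (1 / r)) r"
    using r_pos by (intro enn_powr_mono SUP_least) auto
  then show "enn_powr (SUP n. f n) r \<le> ?s" using r_pos by (simp add: enn_powr_powr)
  show "?s \<le> enn_powr (SUP n. f n) r" using r_pos by (intro SUP_least enn_powr_mono SUP_upper) auto
qed

lemma enn_powr_cmult:
  assumes "0 < c" "0 < r"
  shows "enn_powr (ennreal c * a) r = ennreal (c powr r) * enn_powr a r"
  using assms by (cases a) (auto simp: ennreal_mult[symmetric] powr_mult ennreal_mult_top)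

lemma enn_powr_sum_le:
  assumes r_pos: "0 < r" and finite_A: "finite A"
  shows "enn_powr (\<Sum>i\<in>A. f i) r \<le> ennreal (real (card A) powr r) * (\<Sum>i\<in>A. enn_powr (f i) r)"
proof (cases "A = {}")
  case True
  then show ?thesis using r_pos enn_powr_ennreal[of 0 r] by simp
next
  case False
  have "Max (f ` A) \<in> f ` A" using finite_A False by (intro Max_in) auto
  then obtain j where j_max: "j \<in> A" "f j = Max (f ` A)" by auto
  have f_le: "f i \<le> f j" if "i \<in> A" for i using finite_A that by (simp add: j_max(2))
  have "(\<Sum>i\<in>A. f i) \<le> of_nat (card A) * f j" using f_le by (intro sum_bounded_above) auto
  then have "enn_powr (\<Sum>i\<in>A. f i) r \<le> enn_powr (ennreal (real (card A)) * f j) r"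
    using r_pos by (intro enn_powr_mono) (auto simp: ennreal_of_nat_eq_real_of_nat)
  also have "\<dots> = ennreal (real (card A) powr r) * enn_powr (f j) r"
    using r_pos finite_A False by (intro enn_powr_cmult) (auto simp: card_gt_0_iff)
  also have "\<dots> \<le> ennreal (real (card A) powr r) * (\<Sum>i\<in>A. enn_powr (f i) r)"
    using j_max finite_A by (intro mult_left_mono member_le_sum) auto
  finally show ?thesis .
qed

lemma enn_powr_measurable [measurable]: "(\<lambda>a. enn_powr a r) \<in> borel_measurable borel"
  unfolding enn_powr_def by measurable

lemma nn_integral_enn_powr_sum_finite:
  assumes finite_I: "finite I" and q_pos: "0 < q" and [measurable]: "\<And>i. i \<in> I \<Longrightarrow> F i \<in> borel_measurable M"
    and powr_finite: "\<And>i. i \<in> I \<Longrightarrow> (\<integral>\<^sup>+x. enn_powr (F i x) q \<partial>M) < \<infinity>"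
  shows "(\<integral>\<^sup>+x. enn_powr (\<Sum>i\<in>I. F i x) q \<partial>M) < \<infinity>"
proof -
  have "(\<integral>\<^sup>+x. enn_powr (\<Sum>i\<in>I. F i x) q \<partial>M)
      \<le> (\<integral>\<^sup>+x. ennreal (real (card I) powr q) * (\<Sum>i\<in>I. enn_powr (F i x) q) \<partial>M)"
    using finite_I q_pos by (intro nn_integral_mono enn_powr_sum_le)
  also have "\<dots> = ennreal (real (card I) powr q) * (\<Sum>i\<in>I. \<integral>\<^sup>+x. enn_powr (F i x) q \<partial>M)"
    by (subst nn_integral_cmult, measurable) (subst nn_integral_sum, auto)
  also have "\<dots> < \<infinity>" using powr_finite finite_I by (auto simp: ennreal_mult_less_top)
  finally show ?thesis .
qed

lemma suminf_of_bool_eq_SUP: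
  "(\<Sum>k. of_bool (e k \<omega>)) = (SUP K. ennreal (real (count_upto e K \<omega>)))"
proof -
  have "(\<Sum>k<K. of_bool (e k \<omega>)) = ennreal (real (count_upto e K \<omega>))" for K
    using sum_of_bool_ennreal[of "\<lambda>_. 1" "\<lambda>k. e k \<omega>" "{..<K}"] by (simp add: count_upto_eq_sum)
  then show ?thesis by (simp add: suminf_eq_SUP)
qed

lemma nn_integral_enn_powr_suminf_of_bool:
  assumes q_pos: "0 < q" and [measurable]: "\<And>k. Measurable.pred M (e k)"
  shows "(\<integral>\<^sup>+\<omega>. enn_powr (\<Sum>k. of_bool (e k \<omega>)) q \<partial>M) = (SUP K. count_moment M q e K)"
proof -
  have "(\<integral>\<^sup>+\<omega>. enn_powr (\<Sum>k. of_bool (e k \<omega>)) q \<partial>M)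
      = (\<integral>\<^sup>+\<omega>. (SUP K. ennreal (real (count_upto e K \<omega>) powr q)) \<partial>M)"
    by (simp add: suminf_of_bool_eq_SUP enn_powr_SUP[OF q_pos])
  also have "\<dots> = (SUP K. count_moment M q e K)"
    unfolding count_moment_def
  proof (rule nn_integral_monotone_convergence_SUP)
    show "incseq (\<lambda>K \<omega>. ennreal (real (count_upto e K \<omega>) powr q))"
      using q_pos by (intro incseq_SucI le_funI ennreal_leI powr_mono2) (auto simp: count_upto_Suc)
  qed measurable
  finally show ?thesis .
qed

section \<open>Dyadic slopes on a line\<close>

lemma powr_above_tangent:
  fixes y m p :: real
  assumes "1 \<le> p" "0 < m" "0 \<le> y"
  shows "m powr p + p * m powr (p - 1) * (y - m) \<le> y powr p"
proof (cases "y = 0")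
  case True
  then show ?thesis using assms by (simp add: powr_diff)
next
  case False
  have "((\<lambda>x. x powr p) has_real_derivative p * m powr (p - 1)) (at m within {0<..})"
    using has_field_derivative_at_within[OF has_real_derivative_powr[OF assms(2)]] .
  moreover have "m \<in> interior {0<..}" "y \<in> {0<..}" "connected {0::real<..}"
    using assms False by (auto simp: interior_open)
  ultimately have "p * m powr (p - 1) * (y - m) \<le> y powr p - m powr p"
    using convex_on_imp_above_tangent[OF powr_convex[OF assms(1)], of m y "p * m powr (p - 1)"] by blast
  then show ?thesis by simp
qed

lemma abs_le_powr_threshold:
  fixes y \<tau> p :: real
  assumes "0 < \<tau>" "1 \<le> p"
  shows "\<bar>y\<bar> \<le> \<tau> + \<tau> powr (1 - p) * \<bar>y\<bar> powr p"
proof (cases "\<bar>y\<bar> \<le> \<tau>")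
  case False
  have "\<bar>y\<bar> = \<bar>y\<bar> powr (1 - p) * \<bar>y\<bar> powr p"
    using False assms by (simp add: powr_add[symmetric])
  also have "\<dots> \<le> \<tau> powr (1 - p) * \<bar>y\<bar> powr p"
    using False assms by (intro mult_right_mono powr_mono2') auto
  finally show ?thesis using assms by simp
qed (use assms in \<open>simp add: add_increasing2\<close>)

lemma abs_le_one_plus_powr: "\<bar>y\<bar> \<le> 1 + \<bar>y\<bar> powr p" if "1 \<le> p" for y p :: real
  using abs_le_powr_threshold[of 1 p y] that by simp

lemma (in prob_space) jensen_powr:
  fixes Y :: "'a \<Rightarrow> real"
  assumes [measurable]: "Y \<in> borel_measurable M" and p_ge_1: "1 \<le> p"
  shows "ennreal (\<bar>\<integral>\<omega>. Y \<omega> \<partial>M\<bar> powr p) \<le> (\<integral>\<^sup>+\<omega>. ennreal (\<bar>Y \<omega>\<bar> powr p) \<partial>M)"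
proof (cases "(\<integral>\<^sup>+\<omega>. ennreal (\<bar>Y \<omega>\<bar> powr p) \<partial>M) = \<infinity>")
  case False
  have int_powr: "integrable M (\<lambda>\<omega>. \<bar>Y \<omega>\<bar> powr p)"
    using False by (intro integrableI_bounded) (auto simp: less_top)
  have int: "integrable M (\<lambda>\<omega>. \<bar>Y \<omega>\<bar>)"
    by (intro Bochner_Integration.integrable_bound[OF
        Bochner_Integration.integrable_add[OF integrable_const[of 1] int_powr]])
      (auto intro: abs_le_one_plus_powr[OF p_ge_1])
  define m where "m = (\<integral>\<omega>. \<bar>Y \<omega>\<bar> \<partial>M)"
  have abs_mean_le: "\<bar>\<integral>\<omega>. Y \<omega> \<partial>M\<bar> \<le> m" unfolding m_def by (rule integral_abs_bound)
  have "m powr p \<le> (\<integral>\<omega>. \<bar>Y \<omega>\<bar> powr p \<partial>M)"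
  proof (cases "m = 0")
    case False
    then have m_pos: "m > 0" using abs_mean_le by linarith
    have "m powr p = (\<integral>\<omega>. m powr p + p * m powr (p - 1) * (\<bar>Y \<omega>\<bar> - m) \<partial>M)"
      using int by (simp add: prob_space m_def[symmetric])
    also have "\<dots> \<le> (\<integral>\<omega>. \<bar>Y \<omega>\<bar> powr p \<partial>M)"
      using int int_powr p_ge_1 m_pos by (intro integral_mono powr_above_tangent) auto
    finally show ?thesis .
  qed auto
  moreover have "\<bar>\<integral>\<omega>. Y \<omega> \<partial>M\<bar> powr p \<le> m powr p" using abs_mean_le p_ge_1 by (intro powr_mono2) auto
  ultimately show ?thesis using int_powr by (simp add: nn_integral_eq_integral ennreal_leI)
qed simp

lemma cell_average_jensen:
  fixes \<psi> :: "'a::euclidean_space \<Rightarrow> real"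
  assumes [measurable]: "\<psi> \<in> borel_measurable borel" and p_ge_1: "1 \<le> p"
  shows "ennreal (\<bar>\<integral>\<tau>. (2 ^ k) ^ DIM('a) * of_bool (cell k \<tau> = cell k u) * \<psi> \<tau> \<partial>lborel\<bar> powr p)
    \<le> cell_average k (\<lambda>\<tau>. ennreal (\<bar>\<psi> \<tau>\<bar> powr p)) u"
proof -
  let ?w = "\<lambda>\<tau>. (2 ^ k) ^ DIM('a) * of_bool (cell k \<tau> = cell k u) :: real"
  define P where "P = density lborel (\<lambda>\<tau>. ennreal (?w \<tau>))"
  have average: "(\<integral>\<^sup>+\<tau>. ennreal (?w \<tau>) * f \<tau> \<partial>lborel) = cell_average k f u"
    if [measurable]: "f \<in> borel_measurable borel" for f :: "'a \<Rightarrow> ennreal"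
    unfolding cell_average_def
    by (subst nn_integral_cmult[symmetric]) (auto intro!: nn_integral_cong simp: of_bool_def)
  interpret P: prob_space P
  proof
    show "emeasure P (space P) = 1"
      using average[of "\<lambda>_. 1"] cell_average_of_cell_pos[of "\<lambda>_::'a. 1" k u]
      unfolding P_def by (subst emeasure_density) auto
  qed
  have [measurable_cong]: "sets P = sets borel" by (simp add: P_def)
  have "(\<integral>\<tau>. ?w \<tau> * \<psi> \<tau> \<partial>lborel) = (\<integral>\<tau>. \<psi> \<tau> \<partial>P)"
    unfolding P_def by (subst integral_density) auto
  then have "ennreal (\<bar>\<integral>\<tau>. ?w \<tau> * \<psi> \<tau> \<partial>lborel\<bar> powr p) \<le> (\<integral>\<^sup>+\<tau>. ennreal (\<bar>\<psi> \<tau>\<bar> powr p) \<partial>P)"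
    using P.jensen_powr[of \<psi> p] p_ge_1 by simp
  also have "\<dots> = cell_average k (\<lambda>\<tau>. ennreal (\<bar>\<psi> \<tau>\<bar> powr p)) u"
    unfolding P_def by (subst nn_integral_density) (auto simp: average)
  finally show ?thesis .
qed

lemma cell_real: "cell k (u::real) = of_int \<lfloor>2 ^ k * u\<rfloor>"
  by (simp add: cell_def)

lemma cell_pos_real: "cell_pos k (u::real) = frac (2 ^ k * u)"
  using cell_pos_inner[of 1 k u] by simp

lemma cell_Suc_real: "cell (Suc k) (u::real) = 2 * cell k u + (if cell_pos k u < 1/2 then 0 else 1)"
proof -
  have "\<lfloor>2 * t\<rfloor> = 2 * \<lfloor>t\<rfloor> + (if frac t < 1/2 then 0 else 1)" for t :: real
    by (auto simp: frac_def floor_eq_iff) linarith+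
  from this[of "2 ^ k * u"] show ?thesis unfolding cell_real cell_pos_real by (simp add: mult.assoc)
qed

lemma cell_centre_real: "cell_centre k (u::real) = (cell k u + 1/2) / 2 ^ k"
  by (simp add: cell_centre_def)

definition line_primitive :: "'a::euclidean_space \<Rightarrow> ('a \<Rightarrow> real) \<Rightarrow> ('a \<Rightarrow> real) \<Rightarrow> bool" where
  "line_primitive w G V \<longleftrightarrow> (\<forall>x a b. a \<le> b \<longrightarrow>
     G (x + b *\<^sub>R w) - G (x + a *\<^sub>R w) = (\<integral>\<tau>. indicator {a..<b} \<tau> * V (x + \<tau> *\<^sub>R w) \<partial>lborel))"

lemma line_primitiveD:
  "line_primitive w G V \<Longrightarrow> a \<le> b \<Longrightarrow>
     G (x + b *\<^sub>R w) - G (x + a *\<^sub>R w) = (\<integral>\<tau>. indicator {a..<b} \<tau> * V (x + \<tau> *\<^sub>R w) \<partial>lborel)"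
  by (simp add: line_primitive_def)

definition large_jump :: "('a::euclidean_space \<Rightarrow> real) \<Rightarrow> 'a \<Rightarrow> real \<Rightarrow> nat \<Rightarrow> 'a \<Rightarrow> bool" where
  "large_jump g w \<delta> k x \<longleftrightarrow> \<delta> / 2 ^ Suc k < \<bar>Dh2 ((1 / 2 ^ Suc k) *\<^sub>R w) g x\<bar>"

lemma large_jump_measurable [measurable]:
  assumes [measurable]: "g \<in> borel_measurable borel" "f \<in> borel_measurable N"
  shows "Measurable.pred N (\<lambda>z. large_jump g w \<delta> k (f z))"
  unfolding large_jump_def Dh2_eq by measurable

definition dyadic_slope :: "(real \<Rightarrow> real) \<Rightarrow> nat \<Rightarrow> real \<Rightarrow> real" where
  "dyadic_slope \<phi> k u = 2 ^ k * (\<phi> ((cell k u + 1) / 2 ^ k) - \<phi> (cell k u / 2 ^ k))"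

definition slope_jump :: "(real \<Rightarrow> real) \<Rightarrow> nat \<Rightarrow> real \<Rightarrow> real" where
  "slope_jump \<phi> k u = (if cell_pos k u < 1/2 then -1 else 1) * 2 ^ k * Dh2 (1 / 2 ^ Suc k) \<phi> (cell_centre k u)"

lemma dyadic_slope_Suc: "dyadic_slope \<phi> (Suc k) u = dyadic_slope \<phi> k u + slope_jump \<phi> k u"
proof -
  define c where "c = cell k u"
  have child_endpoints: "cell_centre k u + 1 / 2 ^ Suc k = (c + 1) / 2 ^ k"
    "cell_centre k u - 1 / 2 ^ Suc k = c / 2 ^ k"
    "(2 * c + 1) / 2 ^ Suc k = cell_centre k u" "2 * c / 2 ^ Suc k = c / 2 ^ k"
    "(2 * c + 1 + 1) / 2 ^ Suc k = (c + 1) / 2 ^ k"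
    unfolding cell_centre_real c_def by (simp_all add: field_simps)
  show ?thesis
  proof (cases "cell_pos k u < 1/2")
    case True
    then have cell_Suc: "cell (Suc k) u = 2 * c" by (simp add: cell_Suc_real c_def)
    show ?thesis
      unfolding dyadic_slope_def slope_jump_def Dh2_eq cell_Suc c_def[symmetric] child_endpoints
      using True by (simp add: algebra_simps)
  next
    case False
    then have cell_Suc: "cell (Suc k) u = 2 * c + 1" by (simp add: cell_Suc_real c_def)
    show ?thesis
      unfolding dyadic_slope_def slope_jump_def Dh2_eq cell_Suc c_def[symmetric] child_endpoints
      using False by (simp add: algebra_simps)
  qed
qed

lemma dyadic_slope_eq_sum: "dyadic_slope \<phi> K u = dyadic_slope \<phi> 0 u + (\<Sum>k<K. slope_jump \<phi> k u)"
  by (induction K) (auto simp: dyadic_slope_Suc)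

lemma abs_slope_jump: "\<bar>slope_jump \<phi> k u\<bar> = 2 ^ k * \<bar>Dh2 (1 / 2 ^ Suc k) \<phi> (cell_centre k u)\<bar>"
  by (simp add: slope_jump_def abs_mult)

lemma cell_centre_cell_flip:
  "i \<in> Basis \<Longrightarrow> j \<le> k \<Longrightarrow> cell_centre j (cell_flip i k u) = cell_centre j u"
  by (simp add: cell_centre_def cell_cell_flip)

lemma slope_jump_flip:
  shows "slope_jump \<phi> k (cell_flip 1 k u) = - slope_jump \<phi> k u"
    and "j < k \<Longrightarrow> slope_jump \<phi> j (cell_flip 1 k u) = slope_jump \<phi> j u"
  unfolding slope_jump_def
  using cell_pos_cell_flip_half[of "1::real" k u] cell_pos_cell_flip_less[of "1::real" j k u]
  by (simp_all add: cell_centre_cell_flip)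

lemma flip_martingale_slope:
  fixes \<phi> :: "real \<Rightarrow> real"
  assumes cont: "continuous_on UNIV \<phi>" and \<phi>_bounded: "\<And>t. \<bar>\<phi> t\<bar> \<le> B"
    and \<phi>_zygmund: "zygmund_bounded M \<phi>" and M_pos: "0 < M"
  shows "flip_martingale cube_measure (cell_flip 1) (\<lambda>u. dyadic_slope \<phi> 0 u / M) (\<lambda>k u. slope_jump \<phi> k u / M)
    (\<lambda>k u. large_jump \<phi> 1 \<delta> k (cell_centre k u))"
proof (rule flip_martingale.intro[OF prob_space_cube_measure], unfold_locales)
  have [measurable]: "\<phi> \<in> borel_measurable borel" using cont by (rule borel_measurable_continuous_onI)
  show "cell_flip 1 k \<in> measurable cube_measure (cube_measure :: real measure)" for k by measurable
  show "distr cube_measure cube_measure (cell_flip (1::real) k) = cube_measure" for k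
    by (rule distr_cell_flip) simp
  show "(\<lambda>u. dyadic_slope \<phi> 0 u / M) \<in> borel_measurable cube_measure"
    unfolding dyadic_slope_def by measurable
  have "\<bar>dyadic_slope \<phi> 0 u / M\<bar> \<le> 2 * B / M" for u
    unfolding dyadic_slope_def abs_divide using M_pos \<phi>_bounded[of "cell 0 u + 1"] \<phi>_bounded[of "cell 0 u"]
    by (simp add: divide_right_mono)
  then show "\<exists>B. \<forall>u. \<bar>dyadic_slope \<phi> 0 u / M\<bar> \<le> B" by blast
  show "(\<lambda>u. slope_jump \<phi> k u / M) \<in> borel_measurable cube_measure" for k
    unfolding slope_jump_def Dh2_eq by measurable
  show "\<bar>slope_jump \<phi> k u / M\<bar> \<le> 1" for k u
  proof -
    have "\<bar>slope_jump \<phi> k u\<bar> \<le> 2 ^ k * (M * norm (1 / 2 ^ Suc k :: real))"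
      unfolding abs_slope_jump by (intro mult_left_mono zygmund_boundedD[OF \<phi>_zygmund]) auto
    also have "\<dots> \<le> M" using M_pos by simp
    finally show ?thesis using M_pos by simp
  qed
  show "Measurable.pred cube_measure (\<lambda>u. large_jump \<phi> 1 \<delta> k (cell_centre k u))" for k by measurable
qed (simp_all add: dyadic_slope_def cell_cell_flip slope_jump_flip cell_centre_cell_flip)

lemma dyadic_slope_eq_integral:
  fixes \<phi> \<psi> :: "real \<Rightarrow> real"
  assumes "line_primitive 1 \<phi> \<psi>"
  shows "dyadic_slope \<phi> K u = (\<integral>\<tau>. 2 ^ K * of_bool (cell K \<tau> = cell K u) * \<psi> \<tau> \<partial>lborel)"
proof -
  have cell_iff: "cell K \<tau> = cell K u \<longleftrightarrow> \<tau> \<in> {cell K u / 2 ^ K..<(cell K u + 1) / 2 ^ K}" for \<tau> :: real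
    unfolding cell_real by (auto simp: floor_eq_iff field_simps)
  have "dyadic_slope \<phi> K u
      = 2 ^ K * (\<integral>\<tau>. indicator {cell K u / 2 ^ K..<(cell K u + 1) / 2 ^ K} \<tau> * \<psi> \<tau> \<partial>lborel)"
    using line_primitiveD[OF assms, of "cell K u / 2 ^ K" "(cell K u + 1) / 2 ^ K" 0]
    by (simp add: dyadic_slope_def divide_right_mono)
  also have "\<dots> = (\<integral>\<tau>. 2 ^ K * of_bool (cell K \<tau> = cell K u) * \<psi> \<tau> \<partial>lborel)"
    by (subst integral_mult_right_zero[symmetric])
      (intro Bochner_Integration.integral_cong, auto simp: cell_iff indicator_def)
  finally show ?thesis .
qed

lemma nn_integral_dyadic_slope_le:
  fixes \<phi> \<psi> :: "real \<Rightarrow> real"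
  assumes [measurable]: "\<phi> \<in> borel_measurable borel" "\<psi> \<in> borel_measurable borel"
    and \<phi>_primitive: "line_primitive 1 \<phi> \<psi>" and p_ge_1: "1 \<le> p"
  shows "(\<integral>\<^sup>+u. ennreal (\<bar>dyadic_slope \<phi> K u\<bar> powr p) \<partial>cube_measure)
    \<le> (\<integral>\<^sup>+\<tau>. ennreal (\<bar>\<psi> \<tau>\<bar> powr p) \<partial>cube_measure)"
proof -
  let ?\<Psi> = "\<lambda>\<tau>. ennreal (\<bar>\<psi> \<tau>\<bar> powr p)"
  have [measurable]: "dyadic_slope \<phi> K \<in> borel_measurable borel" unfolding dyadic_slope_def by measurable
  have "(\<integral>\<^sup>+u. ennreal (\<bar>dyadic_slope \<phi> K u\<bar> powr p) \<partial>cube_measure)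
      = (\<integral>\<^sup>+u. indicator unit_cube u * ennreal (\<bar>dyadic_slope \<phi> K u\<bar> powr p) \<partial>lborel)"
    by (rule nn_integral_cube_measure) measurable
  also have "\<dots> \<le> (\<integral>\<^sup>+u. indicator unit_cube u * cell_average K ?\<Psi> u \<partial>lborel)"
    using cell_average_jensen[of \<psi> p K] p_ge_1
    by (intro nn_integral_mono mult_left_mono) (auto simp: dyadic_slope_eq_integral[OF \<phi>_primitive])
  also have "\<dots> = (\<integral>\<^sup>+u. cell_average K (\<lambda>\<tau>. indicator unit_cube \<tau> * ?\<Psi> \<tau>) u \<partial>lborel)"
    by (intro nn_integral_cong, subst cell_average_mult_cell) (auto intro: indicator_unit_cube_cell)
  also have "\<dots> = (\<integral>\<^sup>+\<tau>. indicator unit_cube \<tau> * ?\<Psi> \<tau> \<partial>lborel)"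
    by (rule nn_integral_cell_average) measurable
  also have "\<dots> = (\<integral>\<^sup>+\<tau>. ?\<Psi> \<tau> \<partial>cube_measure)"
    by (rule nn_integral_cube_measure[symmetric]) measurable
  finally show ?thesis .
qed

lemma large_jump_abs_slope_jump:
  assumes "large_jump \<phi> 1 \<delta> k (cell_centre k u)" "0 < M"
  shows "\<delta> / (2 * M) \<le> \<bar>slope_jump \<phi> k u / M\<bar>"
proof -
  have "\<delta> / (2 * M) = 2 ^ k * (\<delta> / 2 ^ Suc k) / M" by simp
  also have "\<dots> \<le> \<bar>slope_jump \<phi> k u\<bar> / M"
    unfolding abs_slope_jump using assms
    by (intro divide_right_mono mult_left_mono) (auto simp: large_jump_def)
  finally show ?thesis using assms by simp
qed

lemma line_count_moment_le:
  fixes p \<delta> M :: real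
  assumes p_gt_1: "1 < p" and \<delta>_pos: "0 < \<delta>" and M_pos: "0 < M"
  obtains C where "0 \<le> C"
    "\<And>(\<phi> :: real \<Rightarrow> real) \<psi> B K. continuous_on UNIV \<phi> \<Longrightarrow> (\<And>t. \<bar>\<phi> t\<bar> \<le> B) \<Longrightarrow> zygmund_bounded M \<phi> \<Longrightarrow>
      \<psi> \<in> borel_measurable borel \<Longrightarrow> line_primitive 1 \<phi> \<psi> \<Longrightarrow>
      count_moment cube_measure (p / 2) (\<lambda>k u. large_jump \<phi> 1 \<delta> k (cell_centre k u)) K
       \<le> ennreal C * (\<integral>\<^sup>+\<tau>. ennreal (\<bar>\<psi> \<tau>\<bar> powr p) \<partial>cube_measure)"
proof -
  have parameters: "1/2 < p / 2" "0 < \<delta> / (2 * M)" using p_gt_1 \<delta>_pos M_pos by auto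
  obtain C where C_nonneg: "0 \<le> C"
    and square_function: "\<And>(N :: real measure) T X0 d e K. flip_martingale N T X0 d e
        \<Longrightarrow> (\<And>k \<omega>. e k \<omega> \<Longrightarrow> \<delta> / (2 * M) \<le> \<bar>d k \<omega>\<bar>) \<Longrightarrow>
       count_moment N (p / 2) e K \<le> ennreal C * (\<integral>\<^sup>+\<omega>. ennreal (\<bar>X0 \<omega> + (\<Sum>k<K. d k \<omega>)\<bar> powr (2 * (p / 2))) \<partial>N)"
    by (rule square_function_lower[OF parameters, where 'b=real]) (rule that; blast)
  show ?thesis
  proof (rule that[of "C / M powr p"])
    show "0 \<le> C / M powr p" using C_nonneg by simp
    fix \<phi> \<psi> :: "real \<Rightarrow> real" and B K
    assume cont: "continuous_on UNIV \<phi>" and \<phi>_bounded: "\<And>t. \<bar>\<phi> t\<bar> \<le> B" and \<phi>_zygmund: "zygmund_bounded M \<phi>"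
      and [measurable]: "\<psi> \<in> borel_measurable borel" and \<phi>_primitive: "line_primitive 1 \<phi> \<psi>"
    let ?e = "\<lambda>k u. large_jump \<phi> 1 \<delta> k (cell_centre k u)"
    have [measurable]: "\<phi> \<in> borel_measurable borel" using cont by (rule borel_measurable_continuous_onI)
    have [measurable]: "dyadic_slope \<phi> K \<in> borel_measurable borel" unfolding dyadic_slope_def by measurable
    have slope: "dyadic_slope \<phi> 0 u / M + (\<Sum>k<K. slope_jump \<phi> k u / M) = dyadic_slope \<phi> K u / M" for u
      by (simp add: dyadic_slope_eq_sum[of \<phi> K] add_divide_distrib sum_divide_distrib)
    have "count_moment cube_measure (p / 2) ?e K
        \<le> ennreal C * (\<integral>\<^sup>+u. ennreal (\<bar>dyadic_slope \<phi> K u / M\<bar> powr (2 * (p / 2))) \<partial>cube_measure)"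
      using square_function[OF flip_martingale_slope[OF cont \<phi>_bounded \<phi>_zygmund M_pos], of \<delta> K]
        large_jump_abs_slope_jump[OF _ M_pos]
      by (simp only: slope)
    also have "\<dots>
        = ennreal C * (ennreal (1 / M powr p) * (\<integral>\<^sup>+u. ennreal (\<bar>dyadic_slope \<phi> K u\<bar> powr p) \<partial>cube_measure))"
      using M_pos by (subst nn_integral_cmult[symmetric]) (auto simp: powr_divide simp flip: ennreal_mult)
    also have "\<dots> \<le> ennreal C * (ennreal (1 / M powr p) * (\<integral>\<^sup>+\<tau>. ennreal (\<bar>\<psi> \<tau>\<bar> powr p) \<partial>cube_measure))"
      using p_gt_1 by (intro mult_left_mono nn_integral_dyadic_slope_le \<phi>_primitive) auto
    finally show "count_moment cube_measure (p / 2) ?e K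
        \<le> ennreal (C / M powr p) * (\<integral>\<^sup>+\<tau>. ennreal (\<bar>\<psi> \<tau>\<bar> powr p) \<partial>cube_measure)"
      using C_nonneg by (simp add: mult.assoc[symmetric] ennreal_mult[symmetric])
  qed
qed

section \<open>Smooth bump functions\<close>

definition flat_exp :: "real poly \<Rightarrow> real \<Rightarrow> real" where
  "flat_exp P x = (if x > 0 then poly P (1 / x) * exp (- (1 / x)) else 0)"

lemma poly_times_exp_minus_tendsto_0: "((\<lambda>t. poly P t * exp (- t)) \<longlongrightarrow> (0::real)) at_top"
proof -
  have "((\<lambda>t. \<Sum>i\<le>degree P. coeff P i * (t ^ i / exp t)) \<longlongrightarrow> (\<Sum>i\<le>degree P. coeff P i * 0)) at_top"
    by (intro tendsto_intros tendsto_power_div_exp_0)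
  moreover have "poly P t * exp (- t) = (\<Sum>i\<le>degree P. coeff P i * (t ^ i / exp t))" for t
    by (simp add: poly_altdef exp_minus sum_distrib_right divide_inverse mult.assoc)
  ultimately show ?thesis by simp
qed

lemma flat_exp_has_derivative_pos:
  assumes x_pos: "0 < x"
  shows "(flat_exp P has_real_derivative flat_exp (monom 1 2 * (P - Polynomial.pderiv P)) x) (at x)"
proof -
  have inv: "((\<lambda>x::real. 1 / x) has_real_derivative - (1 / x\<^sup>2)) (at x)"
    using x_pos by (auto intro!: derivative_eq_intros simp: power2_eq_square)
  have "((\<lambda>x. poly P (1 / x) * exp (- (1 / x))) has_real_derivative
    (poly (Polynomial.pderiv P) (1 / x) * (- (1 / x\<^sup>2))) * exp (- (1 / x))
      + (exp (- (1 / x)) * (- (- (1 / x\<^sup>2)))) * poly P (1 / x)) (at x)"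
    by (intro DERIV_mult DERIV_chain2[OF poly_DERIV inv] DERIV_chain2[OF DERIV_exp DERIV_minus[OF inv]])
  then have "((\<lambda>x. poly P (1 / x) * exp (- (1 / x))) has_real_derivative
    flat_exp (monom 1 2 * (P - Polynomial.pderiv P)) x) (at x)"
    using x_pos by (simp add: flat_exp_def poly_monom power_one_over algebra_simps)
  moreover have "eventually (\<lambda>y. 0 < y) (nhds x)"
    using x_pos order_tendstoD(1)[OF filterlim_ident[of "nhds x"]] by blast
  then have "eventually (\<lambda>y. poly P (1 / y) * exp (- (1 / y)) = flat_exp P y) (nhds x)"
    by eventually_elim (simp add: flat_exp_def)
  ultimately show ?thesis
    by (subst (asm) DERIV_cong_ev[OF refl _ refl]) auto
qed

lemma flat_exp_has_derivative_zero: "(flat_exp P has_real_derivative 0) (at 0)"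
proof -
  have "((\<lambda>h. flat_exp P h / h) \<longlongrightarrow> 0) (at 0)"
  proof (rule filterlim_split_at)
    have "eventually (\<lambda>h. 0 = flat_exp P h / h) (at_left 0)"
      by (auto simp: eventually_at_left_field flat_exp_def intro!: exI[of _ "-1"])
    then show "((\<lambda>h. flat_exp P h / h) \<longlongrightarrow> 0) (at_left 0)"
      by (rule Lim_transform_eventually[OF tendsto_const])
    have "((\<lambda>h. poly (monom 1 1 * P) (inverse h) * exp (- inverse h)) \<longlongrightarrow> 0) (at_right (0::real))"
      by (rule filterlim_compose[OF poly_times_exp_minus_tendsto_0 filterlim_inverse_at_top_right])
    moreover have "eventually (\<lambda>h. poly (monom 1 1 * P) (inverse h) * exp (- inverse h)
        = flat_exp P h / h) (at_right (0::real))"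
      by (auto simp: eventually_at_right_field flat_exp_def poly_monom field_simps intro!: exI[of _ 1])
    ultimately show "((\<lambda>h. flat_exp P h / h) \<longlongrightarrow> 0) (at_right 0)"
      by (rule Lim_transform_eventually)
  qed
  then show ?thesis by (simp add: DERIV_def flat_exp_def)
qed

lemma flat_exp_has_derivative:
  "(flat_exp P has_real_derivative flat_exp (monom 1 2 * (P - Polynomial.pderiv P)) x) (at x)"
proof -
  consider (pos) "0 < x" | (neg) "x < 0" | (zero) "x = 0" by linarith
  then show ?thesis
  proof cases
    case pos
    then show ?thesis by (rule flat_exp_has_derivative_pos)
  next
    case neg
    then have "eventually (\<lambda>y. y < 0) (nhds x)"
      using order_tendstoD(2)[OF filterlim_ident[of "nhds x"]] by blast
    then have "eventually (\<lambda>y. 0 = flat_exp P y) (nhds x)"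
      by eventually_elim (simp add: flat_exp_def)
    moreover have "((\<lambda>_. 0) has_real_derivative flat_exp (monom 1 2 * (P - Polynomial.pderiv P)) x) (at x)"
      using neg by (simp add: flat_exp_def)
    ultimately show ?thesis by (subst (asm) DERIV_cong_ev[OF refl _ refl]) auto
  next
    case zero
    then show ?thesis using flat_exp_has_derivative_zero by (simp add: flat_exp_def)
  qed
qed

primrec leibniz_sum :: "(nat \<Rightarrow> real \<Rightarrow> real) \<Rightarrow> (nat \<Rightarrow> real \<Rightarrow> real) \<Rightarrow> nat \<Rightarrow> nat \<Rightarrow> nat \<Rightarrow> real \<Rightarrow> real" where
  "leibniz_sum F G 0 i j x = F i x * G j x"
| "leibniz_sum F G (Suc m) i j x = leibniz_sum F G m (Suc i) j x + leibniz_sum F G m i (Suc j) x"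

lemma leibniz_sum_has_derivative:
  assumes "\<And>m x. (F m has_real_derivative F (Suc m) x) (at x)"
    "\<And>m x. (G m has_real_derivative G (Suc m) x) (at x)"
  shows "(leibniz_sum F G m i j has_real_derivative leibniz_sum F G (Suc m) i j x) (at x)"
proof (induction m arbitrary: i j)
  case 0
  have "((\<lambda>x. F i x * G j x) has_real_derivative F (Suc i) x * G j x + G (Suc j) x * F i x) (at x)"
    by (intro DERIV_mult assms)
  moreover have "leibniz_sum F G 0 i j = (\<lambda>x. F i x * G j x)" by auto
  ultimately show ?case by (simp add: mult.commute)
next
  case (Suc m)
  have "leibniz_sum F G (Suc m) i j = (\<lambda>x. leibniz_sum F G m (Suc i) j x + leibniz_sum F G m i (Suc j) x)"
    by auto
  then show ?case using DERIV_add[OF Suc[of "Suc i" j] Suc[of i "Suc j"]] by simp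
qed

lemma smooth_bump:
  fixes r :: real
  assumes r_pos: "r > 0"
  obtains \<psi> :: "nat \<Rightarrow> real \<Rightarrow> real" where "\<And>m x. (\<psi> m has_real_derivative \<psi> (Suc m) x) (at x)"
    "\<And>x. 0 \<le> \<psi> 0 x" "\<And>x. \<psi> 0 x \<noteq> 0 \<longleftrightarrow> \<bar>x\<bar> < r" "\<And>m x. r \<le> \<bar>x\<bar> \<Longrightarrow> \<psi> m x = 0"
proof -
  define P where "P = (\<lambda>m. ((\<lambda>P. monom 1 2 * (P - Polynomial.pderiv P)) ^^ m) (1 :: real poly))"
  define F where "F = (\<lambda>m x. flat_exp (P m) (x + r))"
  define G where "G = (\<lambda>m x. (-1) ^ m * flat_exp (P m) (r - x))"
  have P_Suc: "P (Suc m) = monom 1 2 * (P m - Polynomial.pderiv (P m))" for m by (simp add: P_def)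
  have F_derivative: "(F m has_real_derivative F (Suc m) x) (at x)" for m x
  proof -
    have "((\<lambda>x. x + r) has_real_derivative 1) (at x)" by (auto intro!: derivative_eq_intros)
    from DERIV_chain2[OF flat_exp_has_derivative this, of "P m"] show ?thesis unfolding F_def P_Suc by simp
  qed
  have G_derivative: "(G m has_real_derivative G (Suc m) x) (at x)" for m x
  proof -
    have "((\<lambda>x. r - x) has_real_derivative -1) (at x)" by (auto intro!: derivative_eq_intros)
    from DERIV_cmult[OF DERIV_chain2[OF flat_exp_has_derivative this, of "P m"], of "(-1) ^ m"]
    show ?thesis unfolding G_def P_Suc by simp
  qed
  have P_0: "P 0 = 1" by (simp add: P_def)
  show ?thesis
  proof (rule that[of "\<lambda>m. leibniz_sum F G m 0 0"])
    show "(leibniz_sum F G m 0 0 has_real_derivative leibniz_sum F G (Suc m) 0 0 x) (at x)" for m x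
      by (intro leibniz_sum_has_derivative F_derivative G_derivative)
    show "0 \<le> leibniz_sum F G 0 0 0 x" for x by (simp add: F_def G_def P_0 flat_exp_def)
    show "leibniz_sum F G 0 0 0 x \<noteq> 0 \<longleftrightarrow> \<bar>x\<bar> < r" for x
      by (auto simp: F_def G_def P_0 flat_exp_def)
    show "leibniz_sum F G m 0 0 x = 0" if abs_x_ge: "r \<le> \<bar>x\<bar>" for m x
    proof -
      have "F i x * G j x = 0" for i j
        using abs_x_ge by (auto simp: F_def G_def flat_exp_def)
      then have "leibniz_sum F G m i j x = 0" for i j
        by (induction m arbitrary: i j) auto
      then show ?thesis .
    qed
  qed
qed

lemma product_has_partial_derivative:
  fixes x i :: "'a::euclidean_space"
  assumes i_Basis: "i \<in> Basis" and F_i_derivative: "\<And>s. (F i has_real_derivative F' s) (at s)"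
  shows "((\<lambda>t. \<Prod>b\<in>Basis. F b ((x + t *\<^sub>R i) \<bullet> b)) has_real_derivative
     F' (x \<bullet> i) * (\<Prod>b\<in>Basis - {i}. F b (x \<bullet> b))) (at 0)"
proof -
  have "((\<lambda>t. F i (x \<bullet> i + t) * (\<Prod>b\<in>Basis - {i}. F b (x \<bullet> b))) has_real_derivative
     F' (x \<bullet> i) * (\<Prod>b\<in>Basis - {i}. F b (x \<bullet> b))) (at 0)"
  proof (rule DERIV_cmult_right)
    have "((\<lambda>t. x \<bullet> i + t) has_real_derivative 1) (at 0)" by (auto intro!: derivative_eq_intros)
    from DERIV_chain2[OF _ this, of "F i" "F' (x \<bullet> i)"] F_i_derivative[of "x \<bullet> i"]
    show "((\<lambda>t. F i (x \<bullet> i + t)) has_real_derivative F' (x \<bullet> i)) (at 0)" by simp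
  qed
  moreover have "(\<Prod>b\<in>Basis. F b ((x + t *\<^sub>R i) \<bullet> b)) = F i (x \<bullet> i + t) * (\<Prod>b\<in>Basis - {i}. F b (x \<bullet> b))" for t
  proof -
    have "(\<Prod>b\<in>Basis. F b ((x + t *\<^sub>R i) \<bullet> b))
        = F i ((x + t *\<^sub>R i) \<bullet> i) * (\<Prod>b\<in>Basis - {i}. F b ((x + t *\<^sub>R i) \<bullet> b))"
      using i_Basis by (intro prod.remove) auto
    also have "(\<Prod>b\<in>Basis - {i}. F b ((x + t *\<^sub>R i) \<bullet> b)) = (\<Prod>b\<in>Basis - {i}. F b (x \<bullet> b))"
      using i_Basis by (intro prod.cong) (auto simp: inner_add_left inner_Basis)
    finally show ?thesis using i_Basis by (simp add: inner_add_left)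
  qed
  ultimately show ?thesis by simp
qed

lemma product_test_function:
  fixes P :: "'a::euclidean_space \<Rightarrow> nat \<Rightarrow> real \<Rightarrow> real"
  assumes P_derivative: "\<And>b m s. (P b m has_real_derivative P b (Suc m) s) (at s)"
    and P_support: "\<And>b s. b \<in> Basis \<Longrightarrow> R < \<bar>s\<bar> \<Longrightarrow> P b 0 s = 0"
  shows "test_function (\<lambda>y. \<Prod>b\<in>Basis. P b 0 (y \<bullet> b))"
    and "i \<in> Basis \<Longrightarrow> pderiv_dir i (\<lambda>y. \<Prod>b\<in>Basis. P b 0 (y \<bullet> b)) y
      = P i 1 (y \<bullet> i) * (\<Prod>b\<in>Basis - {i}. P b 0 (y \<bullet> b))"
proof -
  let ?f = "\<lambda>y. \<Prod>b\<in>Basis. P b 0 (y \<bullet> b)"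
  define D where "D = (\<lambda>\<alpha> y. \<Prod>b\<in>Basis. P b (count_list \<alpha> b) (y \<bullet> b))"
  have contP: "continuous_on UNIV (P b m)" for b m
    using P_derivative by (meson DERIV_isCont continuous_at_imp_continuous_on)
  have "compact (closure {y. ?f y \<noteq> 0})"
  proof -
    have "norm y \<le> real DIM('a) * \<bar>R\<bar>" if "?f y \<noteq> 0" for y
    proof -
      have "\<bar>y \<bullet> b\<bar> \<le> \<bar>R\<bar>" if "b \<in> Basis" for b
        using P_support[OF that, of "y \<bullet> b"] \<open>?f y \<noteq> 0\<close> that by (force simp: not_le[symmetric])
      then have "(\<Sum>b\<in>Basis. \<bar>y \<bullet> b\<bar>) \<le> (\<Sum>b\<in>(Basis::'a set). \<bar>R\<bar>)" by (intro sum_mono)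
      then show ?thesis using norm_le_l1[of y] by simp
    qed
    then have "bounded {y. ?f y \<noteq> 0}" by (auto simp: bounded_iff)
    then show ?thesis by simp
  qed
  moreover have "D [] = ?f" by (simp add: D_def)
  moreover have "continuous_on UNIV (D \<alpha>)" for \<alpha>
    unfolding D_def by (intro continuous_on_prod continuous_on_compose2[OF contP] continuous_intros) auto
  moreover have "((\<lambda>t. D \<alpha> (x + t *\<^sub>R i)) has_real_derivative D (i # \<alpha>) x) (at 0)" if i_Basis: "i \<in> Basis"
    for \<alpha> i x
  proof -
    have "D (i # \<alpha>) x
        = P i (Suc (count_list \<alpha> i)) (x \<bullet> i) * (\<Prod>b\<in>Basis - {i}. P b (count_list (i # \<alpha>) b) (x \<bullet> b))"
      unfolding D_def using i_Basis by (subst prod.remove[of _ i]) auto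
    also have "(\<Prod>b\<in>Basis - {i}. P b (count_list (i # \<alpha>) b) (x \<bullet> b))
        = (\<Prod>b\<in>Basis - {i}. P b (count_list \<alpha> b) (x \<bullet> b))"
      by (intro prod.cong) auto
    finally show ?thesis
      unfolding D_def
      using product_has_partial_derivative[OF i_Basis, of "\<lambda>b. P b (count_list \<alpha> b)", OF P_derivative, of x]
      by simp
  qed
  ultimately show "test_function ?f" unfolding test_function_def by blast
  show "pderiv_dir i ?f y = P i 1 (y \<bullet> i) * (\<Prod>b\<in>Basis - {i}. P b 0 (y \<bullet> b))" if i_Basis: "i \<in> Basis"
    unfolding pderiv_dir_def
    using product_has_partial_derivative[OF i_Basis, of "\<lambda>b. P b 0", OF P_derivative, of y]
    by (simp add: DERIV_imp_deriv)
qed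

section \<open>Averages against a probability kernel\<close>

locale kernel_measure = prob_space P for P :: "'a::euclidean_space measure" +
  assumes sets_kernel [measurable_cong, simp]: "sets P = sets borel"
begin

definition avg :: "real \<Rightarrow> ('a \<Rightarrow> real) \<Rightarrow> 'a \<Rightarrow> real" where
  "avg t f x = (\<integral>z. f (x + t *\<^sub>R z) \<partial>P)"

lemma space_kernel [simp]: "space P = UNIV"
  using sets_eq_imp_space_eq[OF sets_kernel] by simp

lemma kernel_UNIV [simp]: "prob UNIV = 1" "emeasure P UNIV = 1"
  using prob_space emeasure_space_1 by simp_all

lemma abs_integral_le_AE:
  fixes F :: "'a \<Rightarrow> real"
  assumes "F \<in> borel_measurable borel" "AE z in P. \<bar>F z\<bar> \<le> b"
  shows "\<bar>\<integral>z. F z \<partial>P\<bar> \<le> b"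
proof -
  have "\<bar>\<integral>z. F z \<partial>P\<bar> \<le> (\<integral>z. \<bar>F z\<bar> \<partial>P)" by (rule integral_abs_bound)
  also have "\<dots> \<le> (\<integral>z. b \<partial>P)"
  proof (rule integral_mono_AE)
    show "integrable P (\<lambda>z. \<bar>F z\<bar>)" using assms by (intro integrable_const_bound[where B=b]) auto
  qed (use assms in auto)
  finally show ?thesis by simp
qed

lemma avg_abs_le:
  fixes f :: "'a \<Rightarrow> real"
  assumes "f \<in> borel_measurable borel" "\<And>x. \<bar>f x\<bar> \<le> S"
  shows "\<bar>avg t f x\<bar> \<le> S"
  unfolding avg_def using assms by (intro abs_integral_le_AE) auto

lemma avg_measurable [measurable]:
  fixes f :: "'a \<Rightarrow> real"
  assumes [measurable]: "f \<in> borel_measurable borel"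
  shows "avg t f \<in> borel_measurable borel"
  unfolding avg_def by measurable

lemma integrable_avg:
  fixes f :: "'a \<Rightarrow> real"
  assumes [measurable]: "f \<in> borel_measurable borel" and "\<And>x. \<bar>f x\<bar> \<le> S"
  shows "integrable P (\<lambda>z. f (x + t *\<^sub>R z))"
  using assms by (intro integrable_const_bound[where B=S]) auto

lemma avg_diff:
  fixes f g :: "'a \<Rightarrow> real"
  assumes [measurable]: "f \<in> borel_measurable borel" "g \<in> borel_measurable borel"
    and "\<And>x. \<bar>f x\<bar> \<le> S" "\<And>x. \<bar>g x\<bar> \<le> S'"
  shows "avg t (\<lambda>x. f x - g x) x = avg t f x - avg t g x"
  unfolding avg_def using integrable_avg[of f S x t] integrable_avg[of g S' x t] assms by auto

lemma avg_minus_const: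
  fixes f :: "'a \<Rightarrow> real"
  assumes [measurable]: "f \<in> borel_measurable borel" and "\<And>x. \<bar>f x\<bar> \<le> S"
  shows "avg t f x - c = (\<integral>z. f (x + t *\<^sub>R z) - c \<partial>P)"
  unfolding avg_def using integrable_avg[of f S x t] assms by simp

lemma Dh2_avg:
  fixes f :: "'a \<Rightarrow> real"
  assumes [measurable]: "f \<in> borel_measurable borel" and f_bounded: "\<And>x. \<bar>f x\<bar> \<le> S"
  shows "Dh2 h (avg t f) x = avg t (Dh2 h f) x"
proof -
  note int = integrable_avg[OF assms]
  show ?thesis
    using int[of "x + h" t] int[of x t] int[of "x - h" t] by (simp add: Dh2_eq avg_def algebra_simps)
qed

lemma zygmund_bounded_avg:
  fixes f :: "'a \<Rightarrow> real"
  assumes [measurable]: "f \<in> borel_measurable borel" and f_bounded: "\<And>x. \<bar>f x\<bar> \<le> S"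
    and f_zygmund: "zygmund_bounded M f"
  shows "zygmund_bounded M (avg t f)"
  unfolding zygmund_bounded_def Dh2_avg[OF assms(1,2)]
  by (intro allI avg_abs_le zygmund_boundedD[OF f_zygmund]) measurable

lemma continuous_on_avg:
  fixes f :: "'a \<Rightarrow> real"
  assumes cont: "continuous_on UNIV f" and f_bounded: "\<And>x. \<bar>f x\<bar> \<le> S"
  shows "continuous_on UNIV (avg t f)"
proof -
  have [measurable]: "f \<in> borel_measurable borel" using cont by (rule borel_measurable_continuous_onI)
  have "isCont (avg t f) x" for x
    unfolding continuous_at_sequentially
  proof (intro allI impI)
    fix s assume s_tendsto: "s \<longlonglongrightarrow> x"
    have "(\<lambda>n. \<integral>z. f (s n + t *\<^sub>R z) \<partial>P) \<longlonglongrightarrow> (\<integral>z. f (x + t *\<^sub>R z) \<partial>P)"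
    proof (rule integral_dominated_convergence[where w="\<lambda>_. S"])
      show "AE z in P. (\<lambda>n. f (s n + t *\<^sub>R z)) \<longlonglongrightarrow> f (x + t *\<^sub>R z)"
        using cont s_tendsto
        by (intro AE_I2 isCont_tendsto_compose[of _ f] tendsto_intros)
          (auto simp: continuous_on_eq_continuous_at)
      show "AE z in P. norm (f (s n + t *\<^sub>R z)) \<le> S" for n using f_bounded by simp
    qed auto
    then show "(avg t f \<circ> s) \<longlonglongrightarrow> avg t f x" by (simp add: avg_def comp_def)
  qed
  then show ?thesis by (simp add: continuous_on_eq_continuous_at)
qed

lemma nn_integral_avg_powr_le:
  fixes f :: "'a \<Rightarrow> real"
  assumes [measurable]: "f \<in> borel_measurable borel" and p_ge_1: "1 \<le> p"
  shows "(\<integral>\<^sup>+x. ennreal (\<bar>avg t f x\<bar> powr p) \<partial>lborel) \<le> (\<integral>\<^sup>+x. ennreal (\<bar>f x\<bar> powr p) \<partial>lborel)"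
proof -
  interpret pair_sigma_finite lborel P ..
  have "(\<integral>\<^sup>+x. ennreal (\<bar>avg t f x\<bar> powr p) \<partial>lborel)
      \<le> (\<integral>\<^sup>+x. (\<integral>\<^sup>+z. ennreal (\<bar>f (x + t *\<^sub>R z)\<bar> powr p) \<partial>P) \<partial>lborel)"
    unfolding avg_def using p_ge_1 by (intro nn_integral_mono jensen_powr) auto
  also have "\<dots> = (\<integral>\<^sup>+z. (\<integral>\<^sup>+x. ennreal (\<bar>f (x + t *\<^sub>R z)\<bar> powr p) \<partial>lborel) \<partial>P)"
    by (rule Fubini'[symmetric]) measurable
  also have "\<dots> = (\<integral>\<^sup>+z. (\<integral>\<^sup>+x. ennreal (\<bar>f x\<bar> powr p) \<partial>lborel) \<partial>P)"
    by (intro nn_integral_cong nn_integral_lborel_shift[of "\<lambda>x. ennreal (\<bar>f x\<bar> powr p)"]) measurable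
  finally show ?thesis by simp
qed

end

section \<open>Weak derivatives\<close>

lemma test_function_support:
  assumes "test_function \<phi>"
  shows "continuous_on UNIV \<phi>" and "i \<in> Basis \<Longrightarrow> continuous_on UNIV (pderiv_dir i \<phi>)"
    and "i \<in> Basis \<Longrightarrow> ((\<lambda>t. \<phi> (x + t *\<^sub>R i)) has_real_derivative pderiv_dir i \<phi> x) (at 0)"
    and "\<exists>R. (\<forall>x. R < norm x \<longrightarrow> \<phi> x = 0) \<and> (\<forall>i\<in>Basis. \<forall>x. R < norm x \<longrightarrow> pderiv_dir i \<phi> x = 0)"
proof -
  obtain D :: "'a list \<Rightarrow> 'a \<Rightarrow> real" where D_Nil: "D [] = \<phi>" and D_continuous: "\<And>\<alpha>. continuous_on UNIV (D \<alpha>)"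
    and D_derivative: "\<And>\<alpha> i x. i \<in> Basis \<Longrightarrow> ((\<lambda>t. D \<alpha> (x + t *\<^sub>R i)) has_real_derivative D (i # \<alpha>) x) (at 0)"
    and cpt: "compact (closure {x. \<phi> x \<noteq> 0})"
    using assms unfolding test_function_def by blast
  have pderiv_eq: "pderiv_dir i \<phi> x = D [i] x" if "i \<in> Basis" for i x
    unfolding pderiv_dir_def using D_derivative[OF that, of "[]" x] by (simp add: D_Nil DERIV_imp_deriv)
  show "continuous_on UNIV \<phi>" using D_continuous[of "[]"] by (simp add: D_Nil)
  show "continuous_on UNIV (pderiv_dir i \<phi>)" if "i \<in> Basis"
    using D_continuous[of "[i]"] pderiv_eq[OF that] by (metis ext)
  show "((\<lambda>t. \<phi> (x + t *\<^sub>R i)) has_real_derivative pderiv_dir i \<phi> x) (at 0)" if "i \<in> Basis" for i x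
    using D_derivative[OF that, of "[]" x] pderiv_eq[OF that] by (simp add: D_Nil)
  then have der: "((\<lambda>t. \<phi> (x + t *\<^sub>R i)) has_real_derivative pderiv_dir i \<phi> x) (at 0)" if "i \<in> Basis" for i x
    using that by blast
  have "bounded {x. \<phi> x \<noteq> 0}"
    using cpt bounded_subset[OF compact_imp_bounded closure_subset] by blast
  then obtain R where \<phi>_support: "\<And>x. \<phi> x \<noteq> 0 \<Longrightarrow> norm x \<le> R" by (auto simp: bounded_iff)
  have "pderiv_dir i \<phi> x = 0" if i_Basis: "i \<in> Basis" and norm_x_gt: "R < norm x" for i x
  proof -
    have "((\<lambda>t::real. norm (x + t *\<^sub>R i)) \<longlongrightarrow> norm (x + 0 *\<^sub>R i)) (nhds 0)"
      by (intro tendsto_intros filterlim_ident)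
    then have "eventually (\<lambda>t. R < norm (x + t *\<^sub>R i)) (nhds 0)" using norm_x_gt order_tendstoD(1) by fastforce
    then have "eventually (\<lambda>t. \<phi> (x + t *\<^sub>R i) = 0) (nhds 0)"
      by eventually_elim (use \<phi>_support in force)
    then have "((\<lambda>t. \<phi> (x + t *\<^sub>R i)) has_real_derivative 0) (at 0)"
      by (subst DERIV_cong_ev[OF refl _ refl]) auto
    then show ?thesis using DERIV_unique[OF der[OF i_Basis, of x]] by blast
  qed
  then show "\<exists>R. (\<forall>x. R < norm x \<longrightarrow> \<phi> x = 0) \<and> (\<forall>i\<in>Basis. \<forall>x. R < norm x \<longrightarrow> pderiv_dir i \<phi> x = 0)"
    using \<phi>_support by (intro exI[of _ R]) force
qed

lemma integrable_bounded_support: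
  fixes f :: "'a::euclidean_space \<Rightarrow> real"
  assumes [measurable]: "f \<in> borel_measurable borel" and f_bounded: "\<And>x. \<bar>f x\<bar> \<le> K"
    and f_support: "\<And>x. R < norm x \<Longrightarrow> f x = 0"
  shows "integrable lborel f"
proof (rule Bochner_Integration.integrable_bound)
  have "emeasure lborel (cball (0::'a) R) < \<infinity>" by (intro emeasure_bounded_finite bounded_cball)
  then show "integrable lborel (\<lambda>x::'a. K * indicator (cball 0 R) x :: real)"
    by (intro integrable_mult_right integrable_real_indicator) auto
  show "AE x in lborel. norm (f x) \<le> norm (K * indicator (cball 0 R) x :: real)"
  proof (intro AE_I2)
    fix x
    have "0 \<le> K" using f_bounded[of x] by linarith
    then show "norm (f x) \<le> norm (K * indicator (cball 0 R) x :: real)"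
      using f_bounded[of x] f_support[of x] by (auto simp: indicator_def not_le)
  qed
qed simp

lemma integral_tendsto_bounded_support:
  fixes s :: "nat \<Rightarrow> 'a::euclidean_space \<Rightarrow> real"
  assumes [measurable]: "\<And>m. s m \<in> borel_measurable borel" "f \<in> borel_measurable borel"
    and lim: "\<And>x. (\<lambda>m. s m x) \<longlonglongrightarrow> f x"
    and s_bounded: "\<And>m x. \<bar>s m x\<bar> \<le> K" and s_support: "\<And>m x. R < norm x \<Longrightarrow> s m x = 0"
  shows "(\<lambda>m. \<integral>x. s m x \<partial>lborel) \<longlonglongrightarrow> (\<integral>x. f x \<partial>lborel)"
proof (rule integral_dominated_convergence[where w="\<lambda>x. K * indicator (cball 0 R) x"])
  have "emeasure lborel (cball (0::'a) R) < \<infinity>" by (intro emeasure_bounded_finite bounded_cball)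
  then show "integrable lborel (\<lambda>x::'a. K * indicator (cball 0 R) x)"
    by (intro integrable_mult_right integrable_real_indicator) auto
  show "AE x in lborel. norm (s m x) \<le> K * indicator (cball 0 R) x" for m
    using s_bounded s_support by (intro AE_I2) (auto simp: indicator_def not_le)
qed (use lim in auto)

lemma lborel_integral_reflect:
  fixes f :: "'a::euclidean_space \<Rightarrow> real"
  assumes [measurable]: "f \<in> borel_measurable borel"
  shows "(\<integral>x. f (t - x) \<partial>lborel) = (\<integral>x. f x \<partial>lborel)"
  by (subst (2) lborel_affine[of "-1" t]) (simp_all add: density_1 integral_distr)

lemma Lp_borel_version:
  fixes g :: "'a::euclidean_space \<Rightarrow> real"
  assumes "g \<in> Lp p"
  obtains v where "v \<in> borel_measurable borel" "AE x in lborel. g x = v x"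
    "(\<integral>\<^sup>+x. ennreal (\<bar>v x\<bar> powr p) \<partial>lborel) < \<infinity>"
proof -
  have g_Lp: "g \<in> borel_measurable lebesgue" "integrable lebesgue (\<lambda>x. \<bar>g x\<bar> powr p)"
    using assms by (auto simp: Lp_def)
  obtain v where v_version: "v \<in> borel_measurable lborel" "AE x in lborel. g x = v x"
    using completion_ex_borel_measurable_real[OF g_Lp(1)] by auto
  have "(\<integral>\<^sup>+x. ennreal (\<bar>v x\<bar> powr p) \<partial>lborel) = (\<integral>\<^sup>+x. ennreal (\<bar>g x\<bar> powr p) \<partial>lborel)"
    using v_version(2) by (intro nn_integral_cong_AE) auto
  also have "\<dots> = (\<integral>\<^sup>+x. ennreal (\<bar>g x\<bar> powr p) \<partial>lebesgue)" by (simp add: nn_integral_completion)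
  also have "\<dots> < \<infinity>" using g_Lp(2) by (simp add: nn_integral_eq_integral)
  finally show ?thesis using that[of v] v_version by simp
qed

lemma integrable_mult_bounded_support:
  fixes f F :: "'a::euclidean_space \<Rightarrow> real"
  assumes [measurable]: "f \<in> borel_measurable borel" "F \<in> borel_measurable borel"
    and f_bounded: "\<And>x. \<bar>f x\<bar> \<le> B" and F_bounded_support: "\<And>x. \<bar>F x\<bar> \<le> K" "\<And>x. R < norm x \<Longrightarrow> F x = 0"
  shows "integrable lborel (\<lambda>y. f y * F (x - y))"
proof (rule integrable_bounded_support[where K="B * K" and R="norm x + R"])
  show "\<bar>f y * F (x - y)\<bar> \<le> B * K" for y
    unfolding abs_mult using f_bounded[of y] F_bounded_support(1)[of "x - y"]
    by (intro mult_mono) (auto intro: order_trans[OF abs_ge_zero])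
  fix y :: 'a assume "norm x + R < norm y"
  then show "f y * F (x - y) = 0"
    using F_bounded_support(2)[of "x - y"] norm_triangle_ineq2[of y x] by (simp add: norm_minus_commute)
qed simp

lemma integrable_Lp_mult_bounded_support:
  fixes v F :: "'a::euclidean_space \<Rightarrow> real"
  assumes [measurable]: "v \<in> borel_measurable borel" "F \<in> borel_measurable borel"
    and v_finite: "(\<integral>\<^sup>+x. ennreal (\<bar>v x\<bar> powr p) \<partial>lborel) < \<infinity>" and p_ge_1: "1 \<le> p"
    and F_bounded_support: "\<And>x. \<bar>F x\<bar> \<le> K" "\<And>x. R < norm x \<Longrightarrow> F x = 0"
  shows "integrable lborel (\<lambda>y. v y * F (x - y))"
proof (rule Bochner_Integration.integrable_bound)
  have "integrable lborel (\<lambda>y. \<bar>v y\<bar> powr p)" using v_finite by (intro integrableI_bounded) auto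
  moreover have "integrable lborel (\<lambda>y. \<bar>F (x - y)\<bar>)"
    using integrable_mult_bounded_support[of "\<lambda>_. 1" F 1 K R x] F_bounded_support by (intro integrable_abs) simp
  ultimately show "integrable lborel (\<lambda>y. \<bar>F (x - y)\<bar> + K * \<bar>v y\<bar> powr p)" by simp
  show "AE y in lborel. norm (v y * F (x - y)) \<le> norm (\<bar>F (x - y)\<bar> + K * \<bar>v y\<bar> powr p)"
  proof (rule AE_I2)
    fix y
    have "\<bar>v y\<bar> * \<bar>F (x - y)\<bar> \<le> (1 + \<bar>v y\<bar> powr p) * \<bar>F (x - y)\<bar>"
      using abs_le_one_plus_powr[OF p_ge_1] by (intro mult_right_mono) auto
    also have "\<dots> \<le> \<bar>F (x - y)\<bar> + K * \<bar>v y\<bar> powr p"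
      using mult_right_mono[OF F_bounded_support(1)[of "x - y"], of "\<bar>v y\<bar> powr p"] by (simp add: algebra_simps)
    finally show "norm (v y * F (x - y)) \<le> norm (\<bar>F (x - y)\<bar> + K * \<bar>v y\<bar> powr p)"
      by (simp add: abs_mult)
  qed
qed simp

lemma continuous_bounded_support_bounded:
  fixes F :: "'a::euclidean_space \<Rightarrow> real"
  assumes "continuous_on UNIV F" "\<And>z. R < norm z \<Longrightarrow> F z = 0"
  obtains K where "\<And>z. \<bar>F z\<bar> \<le> K"
proof -
  have "compact (F ` cball 0 R)"
    using assms(1) by (intro compact_continuous_image) (auto intro: continuous_on_subset)
  then have "bounded (F ` cball 0 R)" by (rule compact_imp_bounded)
  then obtain K where F_bounded: "\<And>z. norm z \<le> R \<Longrightarrow> \<bar>F z\<bar> \<le> K"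
    unfolding bounded_iff by force
  have "\<bar>F z\<bar> \<le> \<bar>K\<bar>" for z using F_bounded[of z] assms(2)[of z] by (cases "norm z \<le> R") auto
  then show ?thesis by (rule that)
qed

lemma test_function_bounded_support:
  fixes \<phi> :: "'a::euclidean_space \<Rightarrow> real"
  assumes \<phi>_test: "test_function \<phi>" and i_Basis: "i \<in> Basis"
  obtains R K where "0 \<le> K" "\<And>x. \<bar>\<phi> x\<bar> \<le> K" "\<And>x. \<bar>pderiv_dir i \<phi> x\<bar> \<le> K"
    "\<And>x. R < norm x \<Longrightarrow> \<phi> x = 0" "\<And>x. R < norm x \<Longrightarrow> pderiv_dir i \<phi> x = 0"
proof -
  obtain R where \<phi>_support: "\<And>x. R < norm x \<Longrightarrow> \<phi> x = 0" "\<And>x. R < norm x \<Longrightarrow> pderiv_dir i \<phi> x = 0"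
    using test_function_support(4)[OF \<phi>_test] i_Basis by blast
  obtain K where \<phi>_bounded: "\<And>x. \<bar>\<phi> x\<bar> \<le> K"
    using continuous_bounded_support_bounded[OF test_function_support(1)[OF \<phi>_test] \<phi>_support(1)] by blast
  obtain K' where pderiv_bounded: "\<And>x. \<bar>pderiv_dir i \<phi> x\<bar> \<le> K'"
    using continuous_bounded_support_bounded[OF test_function_support(2)[OF \<phi>_test i_Basis] \<phi>_support(2)]
    by blast
  show ?thesis
    by (rule that[of "max K K'" R])
      (use \<phi>_support \<phi>_bounded pderiv_bounded order_trans[OF abs_ge_zero \<phi>_bounded] in
        \<open>auto simp: le_max_iff_disj\<close>)
qed

definition directional :: "'a::euclidean_space \<Rightarrow> ('a \<Rightarrow> 'a \<Rightarrow> real) \<Rightarrow> 'a \<Rightarrow> real" where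
  "directional w v x = (\<Sum>i\<in>Basis. (w \<bullet> i) * v i x)"

lemma directional_measurable [measurable]:
  "(\<And>i. i \<in> Basis \<Longrightarrow> v i \<in> borel_measurable M) \<Longrightarrow> directional w v \<in> borel_measurable M"
  unfolding directional_def[abs_def] by measurable

definition Lp_weak_gradient :: "real \<Rightarrow> ('a::euclidean_space \<Rightarrow> real) \<Rightarrow> ('a \<Rightarrow> 'a \<Rightarrow> real) \<Rightarrow> bool" where
  "Lp_weak_gradient p g v \<longleftrightarrow> (\<forall>i\<in>Basis. v i \<in> borel_measurable borel \<and>
     (\<integral>\<^sup>+x. ennreal (\<bar>v i x\<bar> powr p) \<partial>lborel) < \<infinity> \<and>
     (\<forall>\<phi>. test_function \<phi> \<longrightarrow> (\<integral>x. g x * pderiv_dir i \<phi> x \<partial>lborel) = - (\<integral>x. v i x * \<phi> x \<partial>lborel)))"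

lemma Lp_weak_gradientD:
  assumes "Lp_weak_gradient p g v" "i \<in> Basis"
  shows "v i \<in> borel_measurable borel" "(\<integral>\<^sup>+x. ennreal (\<bar>v i x\<bar> powr p) \<partial>lborel) < \<infinity>"
    and "test_function \<phi> \<Longrightarrow> (\<integral>x. g x * pderiv_dir i \<phi> x \<partial>lborel) = - (\<integral>x. v i x * \<phi> x \<partial>lborel)"
  using assms by (auto simp: Lp_weak_gradient_def)

lemma W1p_borel_derivative:
  fixes g :: "'a::euclidean_space \<Rightarrow> real"
  assumes g_W1p: "g \<in> W1p p" and [measurable]: "g \<in> borel_measurable borel" and i_Basis: "i \<in> Basis"
  obtains v where "v \<in> borel_measurable borel" "(\<integral>\<^sup>+x. ennreal (\<bar>v x\<bar> powr p) \<partial>lborel) < \<infinity>"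
    "\<And>\<phi>. test_function \<phi> \<Longrightarrow> (\<integral>x. g x * pderiv_dir i \<phi> x \<partial>lborel) = - (\<integral>x. v x * \<phi> x \<partial>lborel)"
proof -
  obtain v' where v'_weak: "v' \<in> Lp p" "weak_pderiv i g v'" using g_W1p i_Basis by (auto simp: W1p_def)
  obtain v where v_borel [measurable]: "v \<in> borel_measurable borel" and v_ae_eq: "AE x in lborel. v' x = v x"
    and fin: "(\<integral>\<^sup>+x. ennreal (\<bar>v x\<bar> powr p) \<partial>lborel) < \<infinity>" using Lp_borel_version[OF v'_weak(1)] by blast
  show ?thesis
  proof (rule that[OF v_borel fin])
    fix \<phi> :: "'a \<Rightarrow> real" assume \<phi>_test: "test_function \<phi>"
    have [measurable]: "\<phi> \<in> borel_measurable borel" "pderiv_dir i \<phi> \<in> borel_measurable borel"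
      using test_function_support[OF \<phi>_test] i_Basis by (auto intro: borel_measurable_continuous_onI)
    have "(\<integral>x. g x * pderiv_dir i \<phi> x \<partial>lborel) = (\<integral>x. g x * pderiv_dir i \<phi> x \<partial>lebesgue)"
      by (rule integral_completion[symmetric]) simp
    also have "\<dots> = - (\<integral>x. v' x * \<phi> x \<partial>lebesgue)" using v'_weak(2) \<phi>_test by (simp add: weak_pderiv_def)
    also have "(\<integral>x. v' x * \<phi> x \<partial>lebesgue) = (\<integral>x. v x * \<phi> x \<partial>lebesgue)"
    proof (rule integral_cong_AE)
      show "(\<lambda>x. v' x * \<phi> x) \<in> borel_measurable lebesgue"
        using v'_weak(1) by (intro borel_measurable_times) (auto simp: Lp_def measurable_completion)
      show "(\<lambda>x. v x * \<phi> x) \<in> borel_measurable lebesgue" by (intro measurable_completion) simp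
      show "AE x in lebesgue. v' x * \<phi> x = v x * \<phi> x" using AE_completion[OF v_ae_eq] by auto
    qed
    also have "\<dots> = (\<integral>x. v x * \<phi> x \<partial>lborel)" by (rule integral_completion) simp
    finally show "(\<integral>x. g x * pderiv_dir i \<phi> x \<partial>lborel) = - (\<integral>x. v x * \<phi> x \<partial>lborel)" .
  qed
qed

lemma W1p_Lp_weak_gradient:
  assumes "g \<in> W1p p" "g \<in> borel_measurable borel"
  obtains v where "Lp_weak_gradient p g v"
proof -
  have "\<exists>v. \<forall>i\<in>Basis. v i \<in> borel_measurable borel \<and> (\<integral>\<^sup>+x. ennreal (\<bar>v i x\<bar> powr p) \<partial>lborel) < \<infinity> \<and>
      (\<forall>\<phi>. test_function \<phi> \<longrightarrow> (\<integral>x. g x * pderiv_dir i \<phi> x \<partial>lborel) = - (\<integral>x. v i x * \<phi> x \<partial>lborel))"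
    by (intro bchoice ballI) (erule W1p_borel_derivative[OF assms], blast)
  then show ?thesis using that unfolding Lp_weak_gradient_def by blast
qed

section \<open>Mollification\<close>

locale bump_kernel =
  fixes \<psi> :: "nat \<Rightarrow> real \<Rightarrow> real" and r :: real
  assumes radius_pos: "0 < r"
    and deriv: "\<And>m x. (\<psi> m has_real_derivative \<psi> (Suc m) x) (at x)"
    and nonneg: "\<And>x. 0 \<le> \<psi> 0 x"
    and nonzero_iff: "\<And>x. \<psi> 0 x \<noteq> 0 \<longleftrightarrow> \<bar>x\<bar> < r"
    and vanish: "\<And>m x. r \<le> \<bar>x\<bar> \<Longrightarrow> \<psi> m x = 0"
begin

definition kernel :: "'a::euclidean_space \<Rightarrow> real" where
  "kernel z = (\<Prod>b\<in>Basis. \<psi> 0 (z \<bullet> b))"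

definition kernel_partial :: "'a::euclidean_space \<Rightarrow> 'a \<Rightarrow> real" where
  "kernel_partial i z = \<psi> 1 (z \<bullet> i) * (\<Prod>b\<in>Basis - {i}. \<psi> 0 (z \<bullet> b))"

lemma continuous_bump: "continuous_on UNIV (\<psi> m)"
  using deriv by (meson DERIV_isCont continuous_at_imp_continuous_on)

lemma bump_measurable [measurable]: "\<psi> m \<in> borel_measurable borel"
  using continuous_bump by (rule borel_measurable_continuous_onI)

lemma continuous_kernel: "continuous_on UNIV kernel"
  and continuous_kernel_partial: "continuous_on UNIV (kernel_partial i)"
  and continuous_directional_kernel: "continuous_on UNIV (directional w kernel_partial)"
  unfolding kernel_def[abs_def] kernel_partial_def[abs_def] directional_def[abs_def]
  by (intro continuous_intros continuous_on_compose2[OF continuous_bump] | simp)+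

lemma kernel_measurable [measurable]:
  "kernel \<in> borel_measurable borel" "kernel_partial i \<in> borel_measurable borel"
  using continuous_kernel continuous_kernel_partial by (auto intro: borel_measurable_continuous_onI)

lemma kernel_nonneg: "0 \<le> kernel z"
  unfolding kernel_def using nonneg by (intro prod_nonneg) auto

lemma kernel_support:
  fixes z :: "'a::euclidean_space"
  assumes norm_z_gt: "real DIM('a) * r < norm z"
  shows kernel_eq_0: "kernel z = 0" and kernel_partial_eq_0: "i \<in> Basis \<Longrightarrow> kernel_partial i z = 0"
    and directional_kernel_eq_0: "directional w kernel_partial z = 0"
proof -
  have "\<exists>b\<in>Basis. r \<le> \<bar>z \<bullet> b\<bar>"
  proof (rule ccontr)
    assume "\<not> ?thesis"
    then have "(\<Sum>b\<in>Basis. \<bar>z \<bullet> b\<bar>) \<le> (\<Sum>b\<in>(Basis::'a set). r)" by (intro sum_mono) force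
    then show False using norm_z_gt norm_le_l1[of z] by simp
  qed
  then obtain b where b_bounds: "b \<in> Basis" "r \<le> \<bar>z \<bullet> b\<bar>" by blast
  then show "kernel z = 0" unfolding kernel_def using vanish by (intro prod_zero) auto
  show partial: "kernel_partial i z = 0" if "i \<in> Basis" for i
  proof (cases "i = b")
    case True
    then show ?thesis using vanish[OF b_bounds(2), of 1] by (simp add: kernel_partial_def)
  next
    case False
    then have "(\<Prod>b\<in>Basis - {i}. \<psi> 0 (z \<bullet> b)) = 0" using b_bounds vanish by (intro prod_zero) auto
    then show ?thesis by (simp add: kernel_partial_def)
  qed
  show "directional w kernel_partial z = 0" unfolding directional_def using partial by simp
qed

lemma integrable_kernel: "integrable lborel (kernel :: 'a::euclidean_space \<Rightarrow> real)"
proof -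
  obtain K where "\<And>z :: 'a. \<bar>kernel z\<bar> \<le> K"
    using continuous_bounded_support_bounded[OF continuous_kernel kernel_eq_0] by blast
  then show ?thesis by (intro integrable_bounded_support) (auto intro: kernel_eq_0)
qed

lemma kernel_mass_pos: "0 < (\<integral>z. kernel z \<partial>(lborel :: 'a::euclidean_space measure))"
proof -
  let ?B = "box (- r *\<^sub>R One) (r *\<^sub>R One :: 'a)"
  have pos: "kernel z \<noteq> 0" if "z \<in> ?B" for z :: 'a
  proof -
    have "\<bar>z \<bullet> b\<bar> < r" if "b \<in> Basis" for b using that \<open>z \<in> ?B\<close> by (auto simp: mem_box abs_less_iff)
    then show ?thesis unfolding kernel_def using nonzero_iff by simp
  qed
  have "(\<integral>z. kernel z \<partial>(lborel :: 'a measure)) \<noteq> 0"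
  proof
    assume "(\<integral>z. kernel z \<partial>(lborel :: 'a measure)) = 0"
    then have "AE z in (lborel :: 'a measure). kernel z = 0"
      using integrable_kernel kernel_nonneg by (subst (asm) integral_nonneg_eq_0_iff_AE) auto
    then have "AE z in lborel. z \<notin> ?B" by eventually_elim (use pos in blast)
    then have "emeasure lborel ?B = 0"
      by (subst (asm) AE_iff_measurable[where N="?B"]) auto
    moreover have "emeasure lborel ?B = ennreal (\<Prod>b\<in>Basis. (r *\<^sub>R One - - r *\<^sub>R One :: 'a) \<bullet> b)"
      using radius_pos by (intro emeasure_lborel_box) auto
    moreover have "(\<Prod>b\<in>Basis. (r *\<^sub>R One - - r *\<^sub>R One :: 'a) \<bullet> b) > 0"
      using radius_pos by (intro prod_pos) (auto simp: inner_diff_left inner_add_left)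
    ultimately show False by (metis ennreal_eq_0_iff not_le)
  qed
  moreover have "0 \<le> (\<integral>z. kernel z \<partial>(lborel :: 'a measure))"
    by (intro Bochner_Integration.integral_nonneg kernel_nonneg)
  ultimately show ?thesis by simp
qed

definition mollifier :: "'a::euclidean_space measure" where
  "mollifier = density lborel (\<lambda>z. ennreal (kernel z / (\<integral>z. kernel z \<partial>(lborel :: 'a measure))))"

lemma mollifier_density_nonneg:
  "0 \<le> kernel z / (\<integral>z. kernel z \<partial>(lborel :: 'a measure))" for z :: "'a::euclidean_space"
  using kernel_nonneg kernel_mass_pos by (rule divide_nonneg_pos)

lemma kernel_measure_mollifier: "kernel_measure (mollifier :: 'a::euclidean_space measure)"
proof (intro kernel_measure.intro prob_spaceI kernel_measure_axioms.intro)
  let ?c = "\<integral>z. kernel z \<partial>(lborel :: 'a measure)"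
  have "emeasure (mollifier :: 'a measure) (space mollifier)
      = (\<integral>\<^sup>+z. ennreal (kernel z / ?c) \<partial>(lborel :: 'a measure))"
    unfolding mollifier_def by (subst emeasure_density) auto
  also have "\<dots> = ennreal (\<integral>z. kernel z / ?c \<partial>(lborel :: 'a measure))"
    by (intro nn_integral_eq_integral integrable_divide integrable_kernel AE_I2 mollifier_density_nonneg)
  also have "\<dots> = 1" using kernel_mass_pos[where 'a='a] by simp
  finally show "emeasure (mollifier :: 'a measure) (space mollifier) = 1" .
qed (simp add: mollifier_def)

sublocale mollifier: kernel_measure "mollifier :: 'a::euclidean_space measure"
  by (rule kernel_measure_mollifier)

lemma avg_mollifier_eq:
  fixes F :: "'a::euclidean_space \<Rightarrow> real"
  assumes [measurable]: "F \<in> borel_measurable borel"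
  shows "mollifier.avg (- 1) F x
    = (\<integral>y. F y * kernel (x - y) \<partial>lborel) / (\<integral>z. kernel z \<partial>(lborel :: 'a measure))"
proof -
  let ?c = "\<integral>z. kernel z \<partial>(lborel :: 'a measure)"
  have "mollifier.avg (- 1) F x = (\<integral>z. (kernel z / ?c) * F (x - z) \<partial>lborel)"
    unfolding mollifier.avg_def unfolding mollifier_def
    by (subst integral_density) (auto intro!: AE_I2 mollifier_density_nonneg)
  also have "\<dots> = (\<integral>y. (kernel (x - y) / ?c) * F (x - (x - y)) \<partial>lborel)"
    by (rule lborel_integral_reflect[symmetric]) simp
  also have "\<dots> = (\<integral>y. F y * kernel (x - y) / ?c \<partial>lborel)" by (intro Bochner_Integration.integral_cong) auto
  finally show ?thesis by simp
qed

lemma avg_mollifier_close: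
  fixes g :: "'a::euclidean_space \<Rightarrow> real"
  assumes [measurable]: "g \<in> borel_measurable borel" and g_bounded: "\<And>x. \<bar>g x\<bar> \<le> B"
    and close: "\<And>z. norm z \<le> real DIM('a) * r \<Longrightarrow> \<bar>g (x - z) - g x\<bar> \<le> \<epsilon>"
  shows "\<bar>mollifier.avg (- 1) g x - g x\<bar> \<le> \<epsilon>"
  unfolding mollifier.avg_minus_const[OF assms(1,2)]
proof (rule mollifier.abs_integral_le_AE)
  let ?c = "\<integral>z. kernel z \<partial>(lborel :: 'a measure)"
  have "AE z in (lborel :: 'a measure). 0 < ennreal (kernel z / ?c) \<longrightarrow> \<bar>g (x + - 1 *\<^sub>R z) - g x\<bar> \<le> \<epsilon>"
  proof (intro AE_I2 impI)
    fix z :: 'a assume "0 < ennreal (kernel z / ?c)"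
    then have "norm z \<le> real DIM('a) * r" using kernel_eq_0[of z] by (cases "norm z \<le> real DIM('a) * r") auto
    then show "\<bar>g (x + - 1 *\<^sub>R z) - g x\<bar> \<le> \<epsilon>" using close by simp
  qed
  then show "AE z in mollifier. \<bar>g (x + - 1 *\<^sub>R z) - g x\<bar> \<le> \<epsilon>"
    unfolding mollifier_def by (subst AE_density) auto
qed simp

lemma kernel_test_function:
  fixes x :: "'a::euclidean_space"
  shows "test_function (\<lambda>y. kernel (x - y))"
    and "i \<in> Basis \<Longrightarrow> pderiv_dir i (\<lambda>y. kernel (x - y)) y = - kernel_partial i (x - y)"
proof -
  let ?P = "\<lambda>b m s. (-1) ^ m * \<psi> m (x \<bullet> b - s)"
  have der: "(?P b m has_real_derivative ?P b (Suc m) s) (at s)" for b m s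
  proof -
    have "((\<lambda>s. x \<bullet> b - s) has_real_derivative -1) (at s)" by (auto intro!: derivative_eq_intros)
    from DERIV_cmult[OF DERIV_chain2[OF deriv this], of "(-1) ^ m" m] show ?thesis by simp
  qed
  have out: "?P b 0 s = 0" if "b \<in> Basis" "norm x + r < \<bar>s\<bar>" for b s
  proof -
    have "r \<le> \<bar>x \<bullet> b - s\<bar>" using that Basis_le_norm[OF that(1), of x] by linarith
    then show ?thesis using vanish by simp
  qed
  have prod_eq_kernel: "(\<lambda>y. \<Prod>b\<in>Basis. ?P b 0 (y \<bullet> b)) = (\<lambda>y. kernel (x - y))"
    by (simp add: kernel_def inner_diff_left)
  show "test_function (\<lambda>y. kernel (x - y))"
    using product_test_function(1)[of ?P "norm x + r", OF der out] unfolding prod_eq_kernel .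
  show "pderiv_dir i (\<lambda>y. kernel (x - y)) y = - kernel_partial i (x - y)" if "i \<in> Basis"
    using product_test_function(2)[of ?P "norm x + r" i y, OF der out that] unfolding prod_eq_kernel
    by (simp add: kernel_partial_def inner_diff_left)
qed

lemma avg_mollifier_gradient:
  fixes g :: "'a::euclidean_space \<Rightarrow> real"
  assumes [measurable]: "g \<in> borel_measurable borel" and g_bounded: "\<And>x. \<bar>g x\<bar> \<le> B" and p_ge_1: "1 \<le> p"
    and v_gradient: "Lp_weak_gradient p g v"
  shows "mollifier.avg (- 1) (directional w v) x
    = (\<integral>y. g y * directional w kernel_partial (x - y) \<partial>lborel) / (\<integral>z. kernel z \<partial>(lborel :: 'a measure))"
proof -
  obtain K where kernel_bounded: "\<And>z :: 'a. \<bar>kernel z\<bar> \<le> K"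
    using continuous_bounded_support_bounded[OF continuous_kernel kernel_eq_0] by blast
  have [measurable]: "v i \<in> borel_measurable borel" if "i \<in> Basis" for i
    using Lp_weak_gradientD(1)[OF v_gradient that] .
  have int_v: "integrable lborel (\<lambda>y. v i y * kernel (x - y))" if "i \<in> Basis" for i
    using Lp_weak_gradientD(1,2)[OF v_gradient that] p_ge_1 kernel_bounded
    by (intro integrable_Lp_mult_bounded_support[where K=K and R="real DIM('a) * r"]) (auto intro: kernel_eq_0)
  have int_g: "integrable lborel (\<lambda>y. g y * kernel_partial i (x - y))" if i_Basis: "i \<in> Basis" for i
  proof -
    obtain L where "\<And>z. \<bar>kernel_partial i z\<bar> \<le> L"
      using continuous_bounded_support_bounded[OF continuous_kernel_partial kernel_partial_eq_0[OF _ i_Basis]]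
      by blast
    then show ?thesis
      using g_bounded kernel_partial_eq_0[OF _ i_Basis]
      by (intro integrable_mult_bounded_support[where B=B and K=L and R="real DIM('a) * r"]) auto
  qed
  have by_parts: "(\<integral>y. v i y * kernel (x - y) \<partial>lborel) = (\<integral>y. g y * kernel_partial i (x - y) \<partial>lborel)"
    if "i \<in> Basis" for i
    using Lp_weak_gradientD(3)[OF v_gradient that kernel_test_function(1)[of x]]
      kernel_test_function(2)[OF that, of x] by simp
  have "(\<integral>y. directional w v y * kernel (x - y) \<partial>lborel)
      = (\<integral>y. (\<Sum>i\<in>Basis. (w \<bullet> i) * (v i y * kernel (x - y))) \<partial>lborel)"
    by (simp add: directional_def sum_distrib_right mult.assoc)
  also have "\<dots> = (\<Sum>i\<in>Basis. (w \<bullet> i) * (\<integral>y. g y * kernel_partial i (x - y) \<partial>lborel))"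
    using int_v by (subst Bochner_Integration.integral_sum) (auto simp: by_parts)
  also have "\<dots> = (\<integral>y. (\<Sum>i\<in>Basis. (w \<bullet> i) * (g y * kernel_partial i (x - y))) \<partial>lborel)"
    using int_g by (subst Bochner_Integration.integral_sum) auto
  also have "\<dots> = (\<integral>y. g y * directional w kernel_partial (x - y) \<partial>lborel)"
    by (intro Bochner_Integration.integral_cong) (auto simp: directional_def sum_distrib_left mult_ac)
  finally show ?thesis by (simp add: avg_mollifier_eq)
qed

lemma kernel_has_directional_derivative:
  "((\<lambda>\<tau>. kernel (x + \<tau> *\<^sub>R w - y)) has_real_derivative directional w kernel_partial (x + \<tau> *\<^sub>R w - y)) (at \<tau>)"
proof -
  have "((\<lambda>\<tau>. \<psi> 0 ((x + \<tau> *\<^sub>R w - y) \<bullet> i)) has_real_derivative \<psi> 1 ((x + \<tau> *\<^sub>R w - y) \<bullet> i) * (w \<bullet> i)) (at \<tau>)"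
    for i
  proof -
    have "((\<lambda>\<tau>. (x + \<tau> *\<^sub>R w - y) \<bullet> i) has_real_derivative (w \<bullet> i)) (at \<tau>)"
      unfolding inner_add_left inner_diff_left inner_scaleR_left by (auto intro!: derivative_eq_intros)
    from DERIV_chain2[OF deriv[of 0] this] show ?thesis by simp
  qed
  from has_field_derivative_prod[where A=Basis, OF this] show ?thesis
    unfolding kernel_def directional_def kernel_partial_def by (simp add: mult_ac)
qed

lemma integral_directional_kernel:
  assumes "a \<le> b"
  shows "(\<integral>\<tau>. indicator {a..<b} \<tau> * directional w kernel_partial (x + \<tau> *\<^sub>R w - y) \<partial>lborel)
    = kernel (x + b *\<^sub>R w - y) - kernel (x + a *\<^sub>R w - y)"
proof -
  let ?D = "\<lambda>\<tau>. directional w kernel_partial (x + \<tau> *\<^sub>R w - y)"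
  have "continuous_on UNIV ?D"
    by (intro continuous_on_compose2[OF continuous_directional_kernel] continuous_intros) auto
  then have "isCont ?D \<tau>" for \<tau> by (simp add: continuous_on_eq_continuous_at)
  then have "(\<integral>\<tau>. ?D \<tau> * indicator {a..b} \<tau> \<partial>lborel) = kernel (x + b *\<^sub>R w - y) - kernel (x + a *\<^sub>R w - y)"
    using assms kernel_has_directional_derivative by (intro integral_FTC_Icc_real) auto
  moreover have "(\<integral>\<tau>. indicator {a..<b} \<tau> * ?D \<tau> \<partial>lborel) = (\<integral>\<tau>. ?D \<tau> * indicator {a..b} \<tau> \<partial>lborel)"
    using AE_lborel_singleton[of b]
    by (intro integral_cong_AE) (auto simp: indicator_def elim!: eventually_mono)
  ultimately show ?thesis by simp
qed

lemma integrable_strip_directional_kernel: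
  fixes g :: "'a::euclidean_space \<Rightarrow> real"
  assumes [measurable]: "g \<in> borel_measurable borel" and g_bounded: "\<And>x. \<bar>g x\<bar> \<le> B"
  shows "integrable (lborel \<Otimes>\<^sub>M lborel)
    (\<lambda>(\<tau>, y). indicator {a..<b} \<tau> * (g y * directional w kernel_partial (x + \<tau> *\<^sub>R w - y)))"
    (is "integrable _ ?F")
  unfolding lborel_prod
proof -
  let ?D = "directional w kernel_partial"
  let ?R = "real DIM('a) * r" and ?c = "\<bar>a\<bar> + \<bar>b\<bar>"
  obtain K where D_bounded: "\<And>z. \<bar>?D z\<bar> \<le> K"
    using continuous_bounded_support_bounded[OF continuous_directional_kernel directional_kernel_eq_0] by blast
  show "integrable lborel ?F"
  proof (rule integrable_bounded_support[where K="B * K" and R="?c + (norm x + ?c * norm w + ?R)"])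
    have "?F \<in> borel_measurable (borel \<Otimes>\<^sub>M borel)" by measurable
    then show "?F \<in> borel_measurable borel" by (simp add: borel_prod)
    show "\<bar>?F z\<bar> \<le> B * K" for z
    proof -
      have "\<bar>g (snd z)\<bar> * \<bar>?D (x + fst z *\<^sub>R w - snd z)\<bar> \<le> B * K"
        using g_bounded[of "snd z"] D_bounded by (intro mult_mono) (auto intro: order_trans[OF abs_ge_zero])
      moreover from this have "0 \<le> B * K" by (rule order_trans[rotated]) simp
      ultimately show ?thesis by (auto simp: case_prod_beta abs_mult indicator_def)
    qed
    fix z :: "real \<times> 'a" assume norm_z_gt: "?c + (norm x + ?c * norm w + ?R) < norm z"
    show "?F z = 0"
    proof (cases "fst z \<in> {a..<b}")
      case True
      then have fst_le: "\<bar>fst z\<bar> \<le> ?c" by auto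
      have "norm (x + fst z *\<^sub>R w) \<le> norm x + ?c * norm w"
        using norm_triangle_ineq[of x "fst z *\<^sub>R w"] mult_right_mono[OF fst_le, of "norm w"] by simp
      moreover have "norm z \<le> \<bar>fst z\<bar> + norm (snd z)"
        using norm_Pair_le[of "fst z" "snd z"] by simp
      ultimately have "?R < norm (x + fst z *\<^sub>R w - snd z)"
        using norm_z_gt fst_le norm_triangle_ineq2[of "snd z" "x + fst z *\<^sub>R w"]
        by (simp add: norm_minus_commute)
      then show ?thesis
        using directional_kernel_eq_0[of "x + fst z *\<^sub>R w - snd z" w] by (simp add: case_prod_beta)
    qed (simp add: case_prod_beta)
  qed
qed

lemma line_primitive_avg_mollifier:
  fixes g :: "'a::euclidean_space \<Rightarrow> real"
  assumes [measurable]: "g \<in> borel_measurable borel" and g_bounded: "\<And>x. \<bar>g x\<bar> \<le> B" and p_ge_1: "1 \<le> p"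
    and v_gradient: "Lp_weak_gradient p g v"
  shows "line_primitive w (mollifier.avg (- 1) g) (mollifier.avg (- 1) (directional w v))"
  unfolding line_primitive_def
proof (intro allI impI)
  fix x and a b :: real assume a_le_b: "a \<le> b"
  let ?c = "\<integral>z. kernel z \<partial>(lborel :: 'a measure)" and ?D = "directional w kernel_partial"
  let ?F = "\<lambda>\<tau> y. indicator {a..<b} \<tau> * (g y * ?D (x + \<tau> *\<^sub>R w - y))"
  obtain K where kernel_bounded: "\<And>z :: 'a. \<bar>kernel z\<bar> \<le> K"
    using continuous_bounded_support_bounded[OF continuous_kernel kernel_eq_0] by blast
  have int: "integrable lborel (\<lambda>y. g y * kernel (x' - y))" for x'
    using g_bounded kernel_bounded
    by (intro integrable_mult_bounded_support[where B=B and K=K and R="real DIM('a) * r"])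
      (auto intro: kernel_eq_0)
  have "mollifier.avg (- 1) g (x + b *\<^sub>R w) - mollifier.avg (- 1) g (x + a *\<^sub>R w)
      = (\<integral>y. g y * (\<integral>\<tau>. indicator {a..<b} \<tau> * ?D (x + \<tau> *\<^sub>R w - y) \<partial>lborel) \<partial>lborel) / ?c"
    unfolding integral_directional_kernel[OF a_le_b] using int[of "x + b *\<^sub>R w"] int[of "x + a *\<^sub>R w"]
    by (simp add: avg_mollifier_eq right_diff_distrib diff_divide_distrib)
  also have "(\<integral>y. g y * (\<integral>\<tau>. indicator {a..<b} \<tau> * ?D (x + \<tau> *\<^sub>R w - y) \<partial>lborel) \<partial>lborel)
      = (\<integral>y. (\<integral>\<tau>. ?F \<tau> y \<partial>lborel) \<partial>lborel)"
    by (simp add: mult.left_commute flip: integral_mult_right_zero)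
  also have "\<dots> = (\<integral>\<tau>. (\<integral>y. ?F \<tau> y \<partial>lborel) \<partial>lborel)"
    by (rule lborel_pair.Fubini_integral[OF integrable_strip_directional_kernel[OF assms(1) g_bounded]])
  also have "\<dots> / ?c = (\<integral>\<tau>. indicator {a..<b} \<tau> * mollifier.avg (- 1) (directional w v) (x + \<tau> *\<^sub>R w) \<partial>lborel)"
    by (simp add: avg_mollifier_gradient[OF assms])
  finally show "mollifier.avg (- 1) g (x + b *\<^sub>R w) - mollifier.avg (- 1) g (x + a *\<^sub>R w)
      = (\<integral>\<tau>. indicator {a..<b} \<tau> * mollifier.avg (- 1) (directional w v) (x + \<tau> *\<^sub>R w) \<partial>lborel)" .
qed

end

lemma mollify:
  fixes g :: "'a::euclidean_space \<Rightarrow> real"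
  assumes r_pos: "0 < r" and p_ge_1: "1 \<le> p" and cont: "continuous_on UNIV g" and g_bounded: "\<And>x. \<bar>g x\<bar> \<le> B"
    and g_zygmund: "zygmund_bounded M g" and v_gradient: "Lp_weak_gradient p g v"
  obtains G V where "continuous_on UNIV G" "\<And>x. \<bar>G x\<bar> \<le> B" "zygmund_bounded M G"
    "\<And>x \<epsilon>. (\<And>z. norm z \<le> real DIM('a) * r \<Longrightarrow> \<bar>g (x - z) - g x\<bar> \<le> \<epsilon>) \<Longrightarrow> \<bar>G x - g x\<bar> \<le> \<epsilon>"
    "V \<in> borel_measurable borel" "line_primitive w G V"
    "(\<integral>\<^sup>+x. ennreal (\<bar>V x\<bar> powr p) \<partial>lborel) \<le> (\<integral>\<^sup>+x. ennreal (\<bar>directional w v x\<bar> powr p) \<partial>lborel)"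
proof -
  obtain \<psi> where "bump_kernel \<psi> r"
    using smooth_bump[OF r_pos] r_pos unfolding bump_kernel_def by metis
  then interpret bump_kernel \<psi> r .
  have [measurable]: "g \<in> borel_measurable borel" using cont by (rule borel_measurable_continuous_onI)
  have [measurable]: "directional w v \<in> borel_measurable borel"
    using Lp_weak_gradientD(1)[OF v_gradient] by measurable
  show ?thesis
  proof (rule that[of "mollifier.avg (- 1) g" "mollifier.avg (- 1) (directional w v)"])
    show "line_primitive w (mollifier.avg (- 1) g) (mollifier.avg (- 1) (directional w v))"
      using line_primitive_avg_mollifier[OF _ g_bounded p_ge_1 v_gradient] by simp
    show "zygmund_bounded M (mollifier.avg (- 1) g)"
      using mollifier.zygmund_bounded_avg[OF _ g_bounded g_zygmund] by simp
    show "\<bar>mollifier.avg (- 1) g x - g x\<bar> \<le> \<epsilon>"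
      if "\<And>z. norm z \<le> real DIM('a) * r \<Longrightarrow> \<bar>g (x - z) - g x\<bar> \<le> \<epsilon>" for x \<epsilon>
      using avg_mollifier_close[OF _ g_bounded that] by simp
  qed (use p_ge_1 g_bounded cont in
    \<open>auto intro: mollifier.continuous_on_avg mollifier.avg_abs_le mollifier.nn_integral_avg_powr_le\<close>)
qed

section \<open>Sobolev functions have a finite square function\<close>

lemma nn_integral_abs_powr_sum_finite:
  fixes f :: "'i \<Rightarrow> 'b \<Rightarrow> real"
  assumes "finite A" "0 < p" and [measurable]: "\<And>i. i \<in> A \<Longrightarrow> f i \<in> borel_measurable M"
    and fin: "\<And>i. i \<in> A \<Longrightarrow> (\<integral>\<^sup>+x. ennreal (\<bar>f i x\<bar> powr p) \<partial>M) < \<infinity>"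
  shows "(\<integral>\<^sup>+x. ennreal (\<bar>\<Sum>i\<in>A. f i x\<bar> powr p) \<partial>M) < \<infinity>"
proof -
  have "ennreal (\<bar>\<Sum>i\<in>A. f i x\<bar> powr p) \<le> ennreal (real (card A) powr p) * (\<Sum>i\<in>A. ennreal (\<bar>f i x\<bar> powr p))"
    for x
  proof -
    have "ennreal (\<bar>\<Sum>i\<in>A. f i x\<bar> powr p) \<le> ennreal ((\<Sum>i\<in>A. \<bar>f i x\<bar>) powr p)"
      using assms by (intro ennreal_leI powr_mono2) auto
    also have "\<dots> = enn_powr (\<Sum>i\<in>A. ennreal \<bar>f i x\<bar>) p"
      by (simp add: sum_nonneg)
    also have "\<dots> \<le> ennreal (real (card A) powr p) * (\<Sum>i\<in>A. enn_powr (ennreal \<bar>f i x\<bar>) p)"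
      using assms by (intro enn_powr_sum_le) auto
    finally show ?thesis by simp
  qed
  then have "(\<integral>\<^sup>+x. ennreal (\<bar>\<Sum>i\<in>A. f i x\<bar> powr p) \<partial>M)
     \<le> (\<integral>\<^sup>+x. ennreal (real (card A) powr p) * (\<Sum>i\<in>A. ennreal (\<bar>f i x\<bar> powr p)) \<partial>M)"
    by (intro nn_integral_mono)
  also have "\<dots> = ennreal (real (card A) powr p) * (\<Sum>i\<in>A. \<integral>\<^sup>+x. ennreal (\<bar>f i x\<bar> powr p) \<partial>M)"
    by (subst nn_integral_cmult, measurable) (subst nn_integral_sum, auto)
  also have "\<dots> < \<infinity>"
    using fin assms(1) by (auto simp: ennreal_mult_less_top)
  finally show ?thesis .
qed

lemma nn_integral_directional_powr_finite:
  assumes p_pos: "0 < p" and v_gradient: "Lp_weak_gradient p g v"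
  shows "(\<integral>\<^sup>+x. ennreal (\<bar>directional w v x\<bar> powr p) \<partial>lborel) < \<infinity>"
  unfolding directional_def
proof (rule nn_integral_abs_powr_sum_finite)
  fix i :: 'a assume i_Basis: "i \<in> Basis"
  note Lp_weak_gradientD(1)[OF v_gradient i_Basis, measurable]
  show "(\<lambda>x. (w \<bullet> i) * v i x) \<in> borel_measurable lborel" by measurable
  have "(\<integral>\<^sup>+x. ennreal (\<bar>(w \<bullet> i) * v i x\<bar> powr p) \<partial>lborel)
      = ennreal (\<bar>w \<bullet> i\<bar> powr p) * (\<integral>\<^sup>+x. ennreal (\<bar>v i x\<bar> powr p) \<partial>lborel)"
    by (subst nn_integral_cmult[symmetric]) (auto simp: abs_mult powr_mult ennreal_mult)
  also have "\<dots> < \<infinity>" using Lp_weak_gradientD(2)[OF v_gradient i_Basis] by (simp add: ennreal_mult_less_top)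
  finally show "(\<integral>\<^sup>+x. ennreal (\<bar>(w \<bullet> i) * v i x\<bar> powr p) \<partial>lborel) < \<infinity>" .
qed (use p_pos in auto)

lemma Dh2_line: "Dh2 h (\<lambda>\<tau>. G (s + \<tau> *\<^sub>R w)) \<tau> = Dh2 (h *\<^sub>R w) G (s + \<tau> *\<^sub>R w)" for h :: real
  by (simp add: Dh2_eq algebra_simps)

lemma large_jump_line:
  "large_jump (\<lambda>\<tau>. G (s + \<tau> *\<^sub>R w)) 1 \<delta> k \<tau> \<longleftrightarrow> large_jump G w \<delta> k (s + \<tau> *\<^sub>R w)" for \<tau> :: real
  by (simp add: large_jump_def Dh2_line)

lemma zygmund_bounded_line:
  assumes G_zygmund: "zygmund_bounded M G" and M_nonneg: "0 \<le> M" and norm_w_le: "norm w \<le> c"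
  shows "zygmund_bounded (M * c) (\<lambda>\<tau>::real. G (s + \<tau> *\<^sub>R w))"
  unfolding zygmund_bounded_def Dh2_line
proof (intro allI)
  fix \<tau> h :: real
  have "\<bar>Dh2 (h *\<^sub>R w) G (s + \<tau> *\<^sub>R w)\<bar> \<le> M * (\<bar>h\<bar> * norm w)"
    using zygmund_boundedD[OF G_zygmund, of "h *\<^sub>R w" "s + \<tau> *\<^sub>R w"] by simp
  also have "\<dots> \<le> M * (\<bar>h\<bar> * c)" using M_nonneg norm_w_le by (intro mult_left_mono) auto
  finally show "\<bar>Dh2 (h *\<^sub>R w) G (s + \<tau> *\<^sub>R w)\<bar> \<le> M * c * norm h" by (simp add: mult_ac)
qed

lemma line_primitive_line:
  assumes "line_primitive w G V"
  shows "line_primitive 1 (\<lambda>\<tau>::real. G (s + \<tau> *\<^sub>R w)) (\<lambda>\<tau>. V (s + \<tau> *\<^sub>R w))"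
  unfolding line_primitive_def
  using line_primitiveD[OF assms, of _ _ "s + x *\<^sub>R w" for x] by (simp add: scaleR_left_distrib add.assoc)

lemma nn_integral_skew_translate:
  fixes F :: "'a::euclidean_space \<times> 'b::euclidean_space \<Rightarrow> ennreal" and T :: "'b \<Rightarrow> 'a"
  assumes [measurable]: "F \<in> borel_measurable (borel \<Otimes>\<^sub>M borel)" "T \<in> borel_measurable borel"
  shows "(\<integral>\<^sup>+s. (\<integral>\<^sup>+u. F (s + T u, u) \<partial>cube_measure) \<partial>lborel) = (\<integral>\<^sup>+s. (\<integral>\<^sup>+u. F (s, u) \<partial>cube_measure) \<partial>lborel)"
proof -
  interpret cube: prob_space "cube_measure :: 'b measure" by (rule prob_space_cube_measure)
  interpret pair_sigma_finite lborel "cube_measure :: 'b measure" ..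
  have "(\<integral>\<^sup>+s. (\<integral>\<^sup>+u. F (s + T u, u) \<partial>cube_measure) \<partial>lborel) = (\<integral>\<^sup>+u. (\<integral>\<^sup>+s. F (s + T u, u) \<partial>lborel) \<partial>cube_measure)"
    by (rule Fubini'[symmetric]) measurable
  also have "\<dots> = (\<integral>\<^sup>+u. (\<integral>\<^sup>+s. F (s, u) \<partial>lborel) \<partial>cube_measure)"
    by (intro nn_integral_cong nn_integral_lborel_shift[of "\<lambda>s. F (s, _)"]) measurable
  also have "\<dots> = (\<integral>\<^sup>+s. (\<integral>\<^sup>+u. F (s, u) \<partial>cube_measure) \<partial>lborel)"
    by (rule Fubini') measurable
  finally show ?thesis .
qed

definition line_count_powr ::
  "real \<Rightarrow> ('a::euclidean_space \<Rightarrow> real) \<Rightarrow> 'a \<Rightarrow> real \<Rightarrow> nat \<Rightarrow> 'a \<times> real \<Rightarrow> ennreal" where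
  "line_count_powr q G w \<delta> K = (\<lambda>(s, u).
     ennreal (real (count_upto (\<lambda>k u. large_jump G w \<delta> k (s + cell_centre k u *\<^sub>R w)) K u) powr q))"

lemma line_count_powr_measurable [measurable]:
  assumes [measurable]: "G \<in> borel_measurable borel"
  shows "line_count_powr q G w \<delta> K \<in> borel_measurable (borel \<Otimes>\<^sub>M borel)"
  unfolding line_count_powr_def count_upto_eq_sum by measurable

lemma nn_integral_line_count_powr_le:
  fixes p \<delta> M :: real and w :: "'a::euclidean_space"
  assumes p_gt_1: "1 < p" and \<delta>_pos: "0 < \<delta>" and M_pos: "0 < M"
  obtains C where "0 \<le> C"
    "\<And>G V B K. continuous_on UNIV G \<Longrightarrow> (\<And>x. \<bar>G x\<bar> \<le> B) \<Longrightarrow> zygmund_bounded M G \<Longrightarrow>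
      V \<in> borel_measurable borel \<Longrightarrow> line_primitive w G V \<Longrightarrow>
      (\<integral>\<^sup>+s. (\<integral>\<^sup>+u. line_count_powr (p / 2) G w \<delta> K (s, u) \<partial>cube_measure) \<partial>lborel)
       \<le> ennreal C * (\<integral>\<^sup>+x. ennreal (\<bar>V x\<bar> powr p) \<partial>lborel)"
proof -
  have M_norm_pos: "0 < M * (norm w + 1)" using M_pos by (simp add: add_nonneg_pos)
  obtain C where C_nonneg: "0 \<le> C"
    and line: "\<And>(\<phi> :: real \<Rightarrow> real) \<psi> B K. continuous_on UNIV \<phi> \<Longrightarrow> (\<And>t. \<bar>\<phi> t\<bar> \<le> B) \<Longrightarrow>
      zygmund_bounded (M * (norm w + 1)) \<phi> \<Longrightarrow> \<psi> \<in> borel_measurable borel \<Longrightarrow> line_primitive 1 \<phi> \<psi> \<Longrightarrow>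
      count_moment cube_measure (p / 2) (\<lambda>k u. large_jump \<phi> 1 \<delta> k (cell_centre k u)) K
       \<le> ennreal C * (\<integral>\<^sup>+\<tau>. ennreal (\<bar>\<psi> \<tau>\<bar> powr p) \<partial>cube_measure)"
    by (rule line_count_moment_le[OF p_gt_1 \<delta>_pos M_norm_pos]) (rule that; blast)
  show ?thesis
  proof (rule that[OF C_nonneg])
    fix G V :: "'a \<Rightarrow> real" and B K
    assume cont: "continuous_on UNIV G" and G_bounded: "\<And>x. \<bar>G x\<bar> \<le> B" and zyg: "zygmund_bounded M G"
      and [measurable]: "V \<in> borel_measurable borel" and V_primitive: "line_primitive w G V"
    interpret cube: prob_space "cube_measure :: real measure" by (rule prob_space_cube_measure)
    have "(\<integral>\<^sup>+u. line_count_powr (p / 2) G w \<delta> K (s, u) \<partial>cube_measure)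
        \<le> ennreal C * (\<integral>\<^sup>+\<tau>. ennreal (\<bar>V (s + \<tau> *\<^sub>R w)\<bar> powr p) \<partial>cube_measure)" for s
      using line[of "\<lambda>\<tau>. G (s + \<tau> *\<^sub>R w)" B "\<lambda>\<tau>. V (s + \<tau> *\<^sub>R w)" K]
        zygmund_bounded_line[OF zyg, of w "norm w + 1" s] line_primitive_line[OF V_primitive, of s] G_bounded
          M_pos
        continuous_on_compose2[OF cont, of UNIV "\<lambda>\<tau>::real. s + \<tau> *\<^sub>R w"]
      by (simp add: line_count_powr_def count_moment_def large_jump_line continuous_intros)
    then have "(\<integral>\<^sup>+s. (\<integral>\<^sup>+u. line_count_powr (p / 2) G w \<delta> K (s, u) \<partial>cube_measure) \<partial>lborel)
        \<le> (\<integral>\<^sup>+s. ennreal C * (\<integral>\<^sup>+\<tau>. ennreal (\<bar>V (s + \<tau> *\<^sub>R w)\<bar> powr p) \<partial>cube_measure) \<partial>lborel)"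
      by (intro nn_integral_mono)
    also have "\<dots> = ennreal C * (\<integral>\<^sup>+s. (\<integral>\<^sup>+\<tau>. ennreal (\<bar>V (s + \<tau> *\<^sub>R w)\<bar> powr p) \<partial>cube_measure) \<partial>lborel)"
      by (rule nn_integral_cmult) measurable
    also have "\<dots> = ennreal C * (\<integral>\<^sup>+s. ennreal (\<bar>V s\<bar> powr p) \<partial>lborel)"
      using nn_integral_skew_translate[of "\<lambda>(s, \<tau>). ennreal (\<bar>V s\<bar> powr p)" "\<lambda>u. u *\<^sub>R w"] by simp
    finally show "(\<integral>\<^sup>+s. (\<integral>\<^sup>+u. line_count_powr (p / 2) G w \<delta> K (s, u) \<partial>cube_measure) \<partial>lborel)
        \<le> ennreal C * (\<integral>\<^sup>+x. ennreal (\<bar>V x\<bar> powr p) \<partial>lborel)" .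
  qed
qed

lemma tendsto_of_close_averages:
  fixes g :: "'a::real_normed_vector \<Rightarrow> real"
  assumes cont: "continuous_on UNIV g"
    and close: "\<And>m \<epsilon>. (\<And>z. norm z \<le> c * (1 / (real m + 1)) \<Longrightarrow> \<bar>g (x - z) - g x\<bar> \<le> \<epsilon>) \<Longrightarrow> \<bar>G m - g x\<bar> \<le> \<epsilon>"
  shows "G \<longlonglongrightarrow> g x"
proof (rule LIMSEQ_I)
  fix \<epsilon> :: real assume \<epsilon>_pos: "0 < \<epsilon>"
  have "isCont g x" using cont by (simp add: continuous_on_eq_continuous_at)
  then obtain d where d_bounds: "0 < d" "\<And>y. dist y x < d \<Longrightarrow> dist (g y) (g x) < \<epsilon> / 2"
    using \<epsilon>_pos unfolding continuous_at_eps_delta by (metis half_gt_zero)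
  obtain m0 where m0_large: "c / d < real m0" using reals_Archimedean2 by blast
  have "norm (G m - g x) < \<epsilon>" if "m0 \<le> m" for m
  proof -
    have "c / d < real m + 1" using m0_large that by linarith
    then have "c * (1 / (real m + 1)) < d" using d_bounds(1) by (simp add: field_simps)
    then have "\<bar>g (x - z) - g x\<bar> \<le> \<epsilon> / 2" if "norm z \<le> c * (1 / (real m + 1))" for z
      using d_bounds(2)[of "x - z"] that by (simp add: dist_norm abs_le_iff less_imp_le)
    then have "\<bar>G m - g x\<bar> \<le> \<epsilon> / 2" by (rule close)
    then show ?thesis using \<epsilon>_pos by simp
  qed
  then show "\<exists>m0. \<forall>m\<ge>m0. norm (G m - g x) < \<epsilon>" by blast
qed

lemma line_count_powr_le_liminf:
  assumes q_nonneg: "0 \<le> q" and lim: "\<And>x. (\<lambda>m. G m x) \<longlonglongrightarrow> g x"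
  shows "line_count_powr q g w \<delta> K z \<le> liminf (\<lambda>m. line_count_powr q (G m) w \<delta> K z)"
proof (rule Liminf_bounded)
  have "eventually (\<lambda>m. large_jump (G m) w \<delta> k x) sequentially" if "large_jump g w \<delta> k x" for k x
  proof -
    have "(\<lambda>m. \<bar>Dh2 ((1 / 2 ^ Suc k) *\<^sub>R w) (G m) x\<bar>) \<longlonglongrightarrow> \<bar>Dh2 ((1 / 2 ^ Suc k) *\<^sub>R w) g x\<bar>"
      unfolding Dh2_eq by (intro tendsto_intros lim)
    then show ?thesis using that order_tendstoD(1) unfolding large_jump_def by blast
  qed
  then have "eventually (\<lambda>m. \<forall>k\<in>{..<K}. large_jump g w \<delta> k (x k) \<longrightarrow> large_jump (G m) w \<delta> k (x k)) sequentially"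
    for x by (intro eventually_ball_finite) (auto elim: eventually_mono)
  from this[of "\<lambda>k. fst z + cell_centre k (snd z) *\<^sub>R w"]
  show "eventually (\<lambda>m. line_count_powr q g w \<delta> K z \<le> line_count_powr q (G m) w \<delta> K z) sequentially"
    unfolding line_count_powr_def case_prod_beta
    by eventually_elim (use q_nonneg in \<open>auto intro!: ennreal_leI powr_mono2 count_upto_mono\<close>)
qed

lemma nn_integral_line_count_powr_limit:
  fixes G :: "nat \<Rightarrow> 'a::euclidean_space \<Rightarrow> real"
  assumes q_nonneg: "0 \<le> q"
    and lim: "\<And>x. (\<lambda>m. G m x) \<longlonglongrightarrow> g x" and [measurable]: "\<And>m. G m \<in> borel_measurable borel"
    and counts_le: "\<And>m. (\<integral>\<^sup>+s. (\<integral>\<^sup>+u. line_count_powr q (G m) w \<delta> K (s, u) \<partial>cube_measure) \<partial>lborel) \<le> D"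
  shows "(\<integral>\<^sup>+s. (\<integral>\<^sup>+u. line_count_powr q g w \<delta> K (s, u) \<partial>cube_measure) \<partial>lborel) \<le> D"
proof -
  interpret cube: prob_space "cube_measure :: real measure" by (rule prob_space_cube_measure)
  have "(\<integral>\<^sup>+s. (\<integral>\<^sup>+u. line_count_powr q g w \<delta> K (s, u) \<partial>cube_measure) \<partial>lborel)
      \<le> (\<integral>\<^sup>+s. (\<integral>\<^sup>+u. liminf (\<lambda>m. line_count_powr q (G m) w \<delta> K (s, u)) \<partial>cube_measure) \<partial>lborel)"
    by (intro nn_integral_mono line_count_powr_le_liminf q_nonneg lim)
  also have "\<dots> \<le> (\<integral>\<^sup>+s. liminf (\<lambda>m. \<integral>\<^sup>+u. line_count_powr q (G m) w \<delta> K (s, u) \<partial>cube_measure) \<partial>lborel)"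
    by (intro nn_integral_mono nn_integral_liminf) measurable
  also have "\<dots> \<le> liminf (\<lambda>m. \<integral>\<^sup>+s. (\<integral>\<^sup>+u. line_count_powr q (G m) w \<delta> K (s, u) \<partial>cube_measure) \<partial>lborel)"
    by (intro nn_integral_liminf) measurable
  also have "\<dots> \<le> liminf (\<lambda>m. D)" by (intro Liminf_mono always_eventually allI counts_le)
  finally show ?thesis by (simp add: Liminf_const)
qed

lemma close_functions_line_count_bounded:
  fixes g :: "'a::euclidean_space \<Rightarrow> real"
  assumes p_gt_1: "1 < p" and g_mem: "g \<in> W1p p" "g \<in> Lambda1" and \<delta>_pos: "0 < \<delta>"
  obtains D :: ennreal where "D < \<infinity>"
    "\<And>r. 0 < r \<Longrightarrow> \<exists>G. continuous_on UNIV G \<and>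
      (\<forall>K. (\<integral>\<^sup>+s. (\<integral>\<^sup>+u. line_count_powr (p / 2) G w \<delta> K (s, u) \<partial>cube_measure) \<partial>lborel) \<le> D) \<and>
      (\<forall>x \<epsilon>. (\<forall>z. norm z \<le> real DIM('a) * r \<longrightarrow> \<bar>g (x - z) - g x\<bar> \<le> \<epsilon>) \<longrightarrow> \<bar>G x - g x\<bar> \<le> \<epsilon>)"
proof -
  have cont: "continuous_on UNIV g" using g_mem(2) by (simp add: Lambda1_def)
  then have "g \<in> borel_measurable borel" by (rule borel_measurable_continuous_onI)
  then obtain v where v_gradient: "Lp_weak_gradient p g v" using W1p_Lp_weak_gradient[OF g_mem(1)] by blast
  obtain M where M_zygmund: "1 \<le> M" "zygmund_bounded M g" using Lambda1_zygmund_bounded[OF g_mem(2)] by blast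
  then have M_pos: "0 < M" by simp
  obtain C where "0 \<le> C" and bound: "\<And>G V B K. continuous_on UNIV G \<Longrightarrow> (\<And>x. \<bar>G x\<bar> \<le> B) \<Longrightarrow>
      zygmund_bounded M G \<Longrightarrow> V \<in> borel_measurable borel \<Longrightarrow> line_primitive w G V \<Longrightarrow>
      (\<integral>\<^sup>+s. (\<integral>\<^sup>+u. line_count_powr (p / 2) G w \<delta> K (s, u) \<partial>cube_measure) \<partial>lborel)
       \<le> ennreal C * (\<integral>\<^sup>+x. ennreal (\<bar>V x\<bar> powr p) \<partial>lborel)"
    by (rule nn_integral_line_count_powr_le[OF p_gt_1 \<delta>_pos M_pos, of w]) (rule that; blast)
  define D where "D = ennreal C * (\<integral>\<^sup>+x. ennreal (\<bar>directional w v x\<bar> powr p) \<partial>lborel)"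
  show ?thesis
  proof (rule that)
    show "D < \<infinity>"
      using p_gt_1 nn_integral_directional_powr_finite[OF _ v_gradient, of w]
      by (simp add: D_def ennreal_mult_less_top)
    fix r :: real assume r_pos: "0 < r"
    obtain G V where G_regular: "continuous_on UNIV G" "\<And>x. \<bar>G x\<bar> \<le> Lambda1_norm g" "zygmund_bounded M G"
      and close: "\<And>x \<epsilon>. (\<And>z. norm z \<le> real DIM('a) * r \<Longrightarrow> \<bar>g (x - z) - g x\<bar> \<le> \<epsilon>) \<Longrightarrow> \<bar>G x - g x\<bar> \<le> \<epsilon>"
      and V_primitive: "V \<in> borel_measurable borel" "line_primitive w G V"
        "(\<integral>\<^sup>+x. ennreal (\<bar>V x\<bar> powr p) \<partial>lborel) \<le> (\<integral>\<^sup>+x. ennreal (\<bar>directional w v x\<bar> powr p) \<partial>lborel)"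
      by (rule mollify[of r p g "Lambda1_norm g" M v w])
        (use p_gt_1 r_pos cont Lambda1_norm_ge_abs[OF g_mem(2)] M_zygmund v_gradient in auto)
    have "(\<integral>\<^sup>+s. (\<integral>\<^sup>+u. line_count_powr (p / 2) G w \<delta> K (s, u) \<partial>cube_measure) \<partial>lborel) \<le> D" for K
      unfolding D_def
      by (rule order_trans[OF bound[OF G_regular V_primitive(1,2)]]) (intro mult_left_mono V_primitive(3), simp)
    then show "\<exists>G. continuous_on UNIV G \<and>
        (\<forall>K. (\<integral>\<^sup>+s. (\<integral>\<^sup>+u. line_count_powr (p / 2) G w \<delta> K (s, u) \<partial>cube_measure) \<partial>lborel) \<le> D) \<and>
        (\<forall>x \<epsilon>. (\<forall>z. norm z \<le> real DIM('a) * r \<longrightarrow> \<bar>g (x - z) - g x\<bar> \<le> \<epsilon>) \<longrightarrow> \<bar>G x - g x\<bar> \<le> \<epsilon>)"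
      using G_regular(1) close by (intro exI[of _ G]) blast
  qed
qed

lemma nn_integral_line_count_powr_bounded:
  fixes g :: "'a::euclidean_space \<Rightarrow> real"
  assumes p_gt_1: "1 < p" and g_mem: "g \<in> W1p p" "g \<in> Lambda1" and \<delta>_pos: "0 < \<delta>"
  obtains D :: ennreal where "D < \<infinity>"
    "\<And>K. (\<integral>\<^sup>+s. (\<integral>\<^sup>+u. line_count_powr (p / 2) g w \<delta> K (s, u) \<partial>cube_measure) \<partial>lborel) \<le> D"
proof -
  have cont: "continuous_on UNIV g" using g_mem(2) by (simp add: Lambda1_def)
  obtain D :: ennreal where "D < \<infinity>" and approx: "\<And>r. 0 < r \<Longrightarrow> \<exists>G. continuous_on UNIV G \<and>
      (\<forall>K. (\<integral>\<^sup>+s. (\<integral>\<^sup>+u. line_count_powr (p / 2) G w \<delta> K (s, u) \<partial>cube_measure) \<partial>lborel) \<le> D) \<and>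
      (\<forall>x \<epsilon>. (\<forall>z. norm z \<le> real DIM('a) * r \<longrightarrow> \<bar>g (x - z) - g x\<bar> \<le> \<epsilon>) \<longrightarrow> \<bar>G x - g x\<bar> \<le> \<epsilon>)"
    by (rule close_functions_line_count_bounded[OF p_gt_1 g_mem \<delta>_pos, of w]) (rule that; blast)
  have "0 < 1 / (real m + 1)" for m by (simp add: add_nonneg_pos)
  from approx[OF this] obtain G where G_approx: "\<And>m. continuous_on UNIV (G m)"
    "\<And>m K. (\<integral>\<^sup>+s. (\<integral>\<^sup>+u. line_count_powr (p / 2) (G m) w \<delta> K (s, u) \<partial>cube_measure) \<partial>lborel) \<le> D"
    "\<And>m x \<epsilon>. (\<And>z. norm z \<le> real DIM('a) * (1 / (real m + 1)) \<Longrightarrow> \<bar>g (x - z) - g x\<bar> \<le> \<epsilon>)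
      \<Longrightarrow> \<bar>G m x - g x\<bar> \<le> \<epsilon>"
    by metis
  have lim: "(\<lambda>m. G m x) \<longlonglongrightarrow> g x" for x
    by (rule tendsto_of_close_averages[OF cont]) (rule G_approx(3))
  have "(\<integral>\<^sup>+s. (\<integral>\<^sup>+u. line_count_powr (p / 2) g w \<delta> K (s, u) \<partial>cube_measure) \<partial>lborel) \<le> D" for K
    by (rule nn_integral_line_count_powr_limit[OF _ lim _ G_approx(2)])
      (use p_gt_1 G_approx(1) in \<open>auto intro: borel_measurable_continuous_onI\<close>)
  then show ?thesis by (rule that[OF \<open>D < \<infinity>\<close>])
qed

lemma large_jump_nearby:
  assumes modulus: "Dh2_modulus (norm w) \<delta> \<kappa> g" and \<kappa>_nonneg: "0 \<le> \<kappa>"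
    and jump: "large_jump g w (2 * \<delta>) k x" and near: "norm (x' - x) \<le> \<kappa> / 2 ^ Suc k"
  shows "large_jump g w \<delta> k x'"
proof -
  define t where "t = (1 / 2 ^ Suc k :: real)"
  have t_pos: "0 < t" by (simp add: t_def)
  then have "\<bar>Dh2 (t *\<^sub>R w) g x' - Dh2 (t *\<^sub>R w) g x\<bar> \<le> \<delta> * t"
    using near \<kappa>_nonneg by (intro Dh2_modulusD[OF modulus]) (auto simp: t_def)
  moreover have "2 * (\<delta> * t) < \<bar>Dh2 (t *\<^sub>R w) g x\<bar>" using jump by (simp add: large_jump_def t_def)
  ultimately have "\<delta> * t < \<bar>Dh2 (t *\<^sub>R w) g x'\<bar>" by linarith
  then show ?thesis by (simp add: large_jump_def t_def)
qed

(* Only the scales at which the position u falls near the centre of its cell are compared; thinning the events to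
  these scales costs a constant factor. *)
lemma count_powr_le_line_average:
  fixes g :: "'a::euclidean_space \<Rightarrow> real"
  assumes q_pos: "0 < q" and modulus: "Dh2_modulus (norm w) \<delta> \<kappa> g" and \<kappa>_bounds: "0 < \<kappa>" "\<kappa> \<le> 1/2"
  defines "\<kappa>' \<equiv> \<kappa> / (2 * (norm w + 1))"
  shows "ennreal (real (count_upto (large_jump g w (2 * \<delta>)) K x) powr q)
    \<le> ennreal (thinning_const q (1 / (2 * \<kappa>')))
       * (\<integral>\<^sup>+u. line_count_powr q g w \<delta> K (x + u *\<^sub>R - w, u) \<partial>cube_measure)"
proof -
  interpret cube: prob_space "cube_measure :: real measure" by (rule prob_space_cube_measure)
  let ?e = "\<lambda>k (u::real). large_jump g w (2 * \<delta>) k x"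
  let ?e' = "\<lambda>k u. ?e k u \<and> cell_pos k u \<in> central_box \<kappa>'"
  have norm_w_pos: "0 < norm w + 1" by (simp add: add_nonneg_pos)
  then have \<kappa>'_pos: "0 < \<kappa>'" using \<kappa>_bounds by (simp add: \<kappa>'_def)
  have "2 * \<kappa>' * (norm w + 1) = \<kappa>" using norm_w_pos by (simp add: \<kappa>'_def field_simps)
  then have "2 * \<kappa>' * norm w + 2 * \<kappa>' = \<kappa>" by (simp only: distrib_left mult_1_right)
  moreover have "0 \<le> \<kappa>' * norm w" using \<kappa>'_pos by simp
  ultimately have \<kappa>'w: "2 * \<kappa>' * norm w \<le> \<kappa>" and "\<kappa>' < 1/2"
    using \<kappa>_bounds \<kappa>'_pos by linarith+
  then have thin: "thinning cube_measure (1 / (2 * \<kappa>')) ?e ?e'"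
    using thinning_central_box[of ?e \<kappa>'] \<kappa>'_pos by simp
  have "large_jump g w \<delta> k (x - u *\<^sub>R w + cell_centre k u *\<^sub>R w)" if "?e' k u" for k u
  proof (rule large_jump_nearby[OF modulus])
    have "norm (x - u *\<^sub>R w + cell_centre k u *\<^sub>R w - x) = norm ((u - cell_centre k u) *\<^sub>R w)"
      by (subst norm_minus_cancel[symmetric]) (simp add: algebra_simps)
    also have "\<dots> \<le> \<kappa>' / 2 ^ k * norm w"
      using mult_right_mono[OF norm_diff_cell_centre_le[of k u \<kappa>'], of "norm w"] that by simp
    also have "\<dots> = (2 * \<kappa>' * norm w) / 2 ^ Suc k" by simp
    also have "\<dots> \<le> \<kappa> / 2 ^ Suc k" using \<kappa>'w by (intro divide_right_mono) auto
    finally show "norm (x - u *\<^sub>R w + cell_centre k u *\<^sub>R w - x) \<le> \<kappa> / 2 ^ Suc k" .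
  qed (use \<kappa>_bounds that in auto)
  then have thinned_le: "count_moment cube_measure q ?e' K
      \<le> (\<integral>\<^sup>+u. line_count_powr q g w \<delta> K (x + u *\<^sub>R - w, u) \<partial>cube_measure)"
    unfolding count_moment_def line_count_powr_def using q_pos
    by (intro nn_integral_mono) (auto intro!: ennreal_leI powr_mono2 count_upto_mono)
  have "ennreal (real (count_upto (large_jump g w (2 * \<delta>)) K x) powr q) = count_moment cube_measure q ?e K"
    by (simp add: count_moment_def count_upto_def)
  also have "\<dots> \<le> ennreal (thinning_const q (1 / (2 * \<kappa>'))) * count_moment cube_measure q ?e' K"
    using q_pos \<kappa>'_pos thin by (intro cube.count_moment_le_thinned) auto
  also have "\<dots> \<le> ennreal (thinning_const q (1 / (2 * \<kappa>')))
       * (\<integral>\<^sup>+u. line_count_powr q g w \<delta> K (x + u *\<^sub>R - w, u) \<partial>cube_measure)"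
    by (rule mult_left_mono[OF thinned_le]) simp
  finally show ?thesis .
qed

lemma count_moment_large_jump_bounded:
  fixes g :: "'a::euclidean_space \<Rightarrow> real"
  assumes p_gt_1: "1 < p" and g_mem: "g \<in> W1p p" "g \<in> Lambda1" and \<delta>_pos: "0 < \<delta>"
  obtains D :: ennreal where "D < \<infinity>" "\<And>K. count_moment lborel (p / 2) (large_jump g w (2 * \<delta>)) K \<le> D"
proof -
  have "continuous_on UNIV g" using g_mem(2) by (simp add: Lambda1_def)
  then have [measurable]: "g \<in> borel_measurable borel" by (rule borel_measurable_continuous_onI)
  obtain D :: ennreal where D_bounds: "D < \<infinity>"
    "\<And>K. (\<integral>\<^sup>+s. (\<integral>\<^sup>+u. line_count_powr (p / 2) g w \<delta> K (s, u) \<partial>cube_measure) \<partial>lborel) \<le> D"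
    by (rule nn_integral_line_count_powr_bounded[OF p_gt_1 g_mem \<delta>_pos, of w]) (rule that; blast)
  obtain M where M_zygmund: "1 \<le> M" "zygmund_bounded M g" using Lambda1_zygmund_bounded[OF g_mem(2)] by blast
  obtain \<kappa> where \<kappa>_bounds: "0 < \<kappa>" "\<kappa> \<le> 1/2" and modulus: "Dh2_modulus (norm w) \<delta> \<kappa> g"
    by (rule Dh2_modulus_exists[OF M_zygmund(2) _ norm_ge_zero \<delta>_pos]) (use M_zygmund in auto)
  define c where "c = ennreal (thinning_const (p / 2) (1 / (2 * (\<kappa> / (2 * (norm w + 1))))))"
  show ?thesis
  proof (rule that[of "c * D"])
    show "c * D < \<infinity>" using D_bounds(1) by (simp add: c_def ennreal_mult_less_top)
    fix K
    have "count_moment lborel (p / 2) (large_jump g w (2 * \<delta>)) K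
        \<le> (\<integral>\<^sup>+x. c * (\<integral>\<^sup>+u. line_count_powr (p / 2) g w \<delta> K (x + u *\<^sub>R - w, u) \<partial>cube_measure) \<partial>lborel)"
      unfolding count_moment_def c_def using p_gt_1 \<kappa>_bounds modulus
      by (intro nn_integral_mono count_powr_le_line_average) auto
    also have "\<dots> = c * (\<integral>\<^sup>+x. (\<integral>\<^sup>+u. line_count_powr (p / 2) g w \<delta> K (x + u *\<^sub>R - w, u) \<partial>cube_measure) \<partial>lborel)"
    proof (rule nn_integral_cmult)
      interpret cube: prob_space "cube_measure :: real measure" by (rule prob_space_cube_measure)
      show "(\<lambda>x. \<integral>\<^sup>+u. line_count_powr (p / 2) g w \<delta> K (x + u *\<^sub>R - w, u) \<partial>cube_measure)
          \<in> borel_measurable lborel"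
        by measurable
    qed
    also have "(\<integral>\<^sup>+x. (\<integral>\<^sup>+u. line_count_powr (p / 2) g w \<delta> K (x + u *\<^sub>R - w, u) \<partial>cube_measure) \<partial>lborel)
        = (\<integral>\<^sup>+x. (\<integral>\<^sup>+u. line_count_powr (p / 2) g w \<delta> K (x, u) \<partial>cube_measure) \<partial>lborel)"
      by (rule nn_integral_skew_translate) measurable
    also have "c * \<dots> \<le> c * D" by (intro mult_left_mono D_bounds) auto
    finally show "count_moment lborel (p / 2) (large_jump g w (2 * \<delta>)) K \<le> c * D" .
  qed
qed

lemma dyadic_bracket:
  fixes y :: real
  assumes "0 < y" "y \<le> 1"
  obtains k where "1 / 2 ^ Suc k < y" "y \<le> 1 / 2 ^ k"
proof -
  have ex_scale: "\<exists>n. 1 / 2 ^ n < y"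
    using real_arch_pow_inv[OF assms(1), of "1/2"] by (auto simp: power_one_over)
  define n where "n = (LEAST n. 1 / 2 ^ n < y)"
  have scale_less: "1 / 2 ^ n < y" unfolding n_def using ex_scale by (rule LeastI_ex)
  then obtain k where n_Suc: "n = Suc k" using assms by (cases n) auto
  then have "\<not> 1 / 2 ^ k < y" using not_less_Least[of k "\<lambda>n. 1 / 2 ^ n < y"] by (simp add: n_def[symmetric])
  then show ?thesis using that[of k] scale_less n_Suc by simp
qed

lemma large_jump_of_Delta2:
  fixes g :: "'a::euclidean_space \<Rightarrow> real"
  assumes modulus: "Dh2_modulus 2 (\<epsilon> / 2) \<kappa> g" and \<kappa>_pos: "0 < \<kappa>" and \<epsilon>_pos: "0 < \<epsilon>"
    and W_net: "cball 0 2 \<subseteq> (\<Union>w\<in>W. ball w \<kappa>)"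
    and y_bounds: "1 / 2 ^ Suc k < y" "y \<le> 1 / 2 ^ k" "\<epsilon> * y < Delta2 g x y"
  shows "\<exists>w\<in>W. large_jump g w (\<epsilon> / 2) k x"
proof -
  define t where "t = (1 / 2 ^ Suc k :: real)"
  have t_bounds: "0 < t" "y \<le> 2 * t" "t < y" using y_bounds by (auto simp: t_def)
  obtain h where h_large: "norm h = y" "\<epsilon> * y < \<bar>Dh2 h g x\<bar>" using less_Delta2D[OF _ y_bounds(3)] t_bounds
    by auto
  have "norm ((1 / t) *\<^sub>R h) \<le> 2" using t_bounds h_large by (simp add: field_simps)
  then have "(1 / t) *\<^sub>R h \<in> (\<Union>w\<in>W. ball w \<kappa>)" by (intro subsetD[OF W_net]) (simp only: mem_cball_0)
  then obtain w where w_bounds: "w \<in> W" "dist w ((1 / t) *\<^sub>R h) < \<kappa>" by auto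
  have "t *\<^sub>R w - h = t *\<^sub>R (w - (1 / t) *\<^sub>R h)" using t_bounds by (simp add: scaleR_diff_right)
  then have "norm (t *\<^sub>R w - h) = t * norm (w - (1 / t) *\<^sub>R h)" using t_bounds by simp
  also have "\<dots> \<le> t * \<kappa>" using w_bounds t_bounds by (intro mult_left_mono) (auto simp: dist_norm)
  finally have "\<bar>Dh2 (t *\<^sub>R w) g x - Dh2 h g x\<bar> \<le> \<epsilon> / 2 * t"
    using t_bounds h_large \<kappa>_pos by (intro Dh2_modulusD[OF modulus]) (auto simp: mult.commute)
  moreover have "\<epsilon> * t < \<epsilon> * y" using t_bounds \<epsilon>_pos by simp
  ultimately have "\<epsilon> / 2 * t < \<bar>Dh2 (t *\<^sub>R w) g x\<bar>" using h_large by linarith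
  then show ?thesis using w_bounds(1) by (auto simp: large_jump_def t_def)
qed

lemma nn_integral_dyadic_shell:
  "(\<integral>\<^sup>+(y::real). ennreal (2 ^ Suc k) * indicator {1 / 2 ^ Suc k..1 / 2 ^ k} y \<partial>lborel) = 1"
proof -
  have "emeasure lborel {1 / 2 ^ Suc k..1 / 2 ^ k :: real} = ennreal (1 / 2 ^ k - 1 / 2 ^ Suc k)"
    by (intro emeasure_lborel_Icc) (simp add: field_simps)
  also have "1 / 2 ^ k - 1 / 2 ^ Suc k = (1 / 2 ^ Suc k :: real)" by (simp add: field_simps)
  finally have shell: "emeasure lborel {1 / 2 ^ Suc k..1 / 2 ^ k :: real} = ennreal (1 / 2 ^ Suc k)" .
  have "ennreal (2 ^ Suc k) * ennreal (1 / 2 ^ Suc k) = 1" by (subst ennreal_mult[symmetric]) auto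
  then show ?thesis unfolding shell[symmetric] by (subst nn_integral_cmult_indicator) simp_all
qed

lemma le_suminf_ennreal: "f k \<le> (\<Sum>k. f k)" for f :: "nat \<Rightarrow> ennreal"
  using sum_le_suminf[of f "{k}"] by simp

lemma sq_inner_le_counts:
  fixes g :: "'a::euclidean_space \<Rightarrow> real"
  assumes g_Lambda1: "g \<in> Lambda1" and \<epsilon>_pos: "0 < \<epsilon>"
  obtains W where "finite W" "\<And>x. sq_inner g \<epsilon> x \<le> (\<Sum>w\<in>W. \<Sum>k. of_bool (large_jump g w (\<epsilon> / 2) k x))"
proof -
  obtain M where M_zygmund: "1 \<le> M" "zygmund_bounded M g" using Lambda1_zygmund_bounded[OF g_Lambda1] by blast
  obtain \<kappa> where \<kappa>_pos: "0 < \<kappa>" and modulus: "Dh2_modulus 2 (\<epsilon> / 2) \<kappa> g"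
    by (rule Dh2_modulus_exists[OF M_zygmund(2), where R=2 and \<eta>="\<epsilon> / 2"]) (use M_zygmund \<epsilon>_pos in auto)
  obtain W where W_net: "finite W" "cball (0::'a) 2 \<subseteq> (\<Union>w\<in>W. ball w \<kappa>)"
    using compact_cball[of "0::'a" 2] \<kappa>_pos unfolding compact_eq_totally_bounded by blast
  let ?shell = "\<lambda>k (y::real). ennreal (2 ^ Suc k) * indicator {1 / 2 ^ Suc k..1 / 2 ^ k} y"
  show ?thesis
  proof (rule that[OF W_net(1)])
    fix x
    let ?S = "\<lambda>y. \<Sum>w\<in>W. \<Sum>k. of_bool (large_jump g w (\<epsilon> / 2) k x) * ?shell k y"
    have "indicator {y \<in> {0<..1}. Delta2 g x y / y > \<epsilon>} y * ennreal (1 / y) \<le> ?S y" for y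
    proof (cases "y \<in> {y \<in> {0<..1}. Delta2 g x y / y > \<epsilon>}")
      case True
      then have y_bounds: "0 < y" "y \<le> 1" "\<epsilon> * y < Delta2 g x y" by (auto simp: field_simps)
      obtain k where k_bounds: "1 / 2 ^ Suc k < y" "y \<le> 1 / 2 ^ k" using dyadic_bracket[OF y_bounds(1,2)] .
      obtain w where w_bounds: "w \<in> W" "large_jump g w (\<epsilon> / 2) k x"
        using large_jump_of_Delta2[OF modulus \<kappa>_pos \<epsilon>_pos W_net(2) k_bounds y_bounds(3)] by blast
      have "ennreal (1 / y) \<le> ennreal (2 ^ Suc k)" using k_bounds y_bounds
        by (intro ennreal_leI) (simp add: field_simps)
      also have "\<dots> = of_bool (large_jump g w (\<epsilon> / 2) k x) * ?shell k y" using w_bounds k_bounds by simp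
      also have "\<dots> \<le> (\<Sum>k. of_bool (large_jump g w (\<epsilon> / 2) k x) * ?shell k y)"
        by (rule le_suminf_ennreal)
      also have "\<dots> \<le> ?S y" using w_bounds W_net(1) by (intro member_le_sum) auto
      finally show ?thesis using True by simp
    qed simp
    then have "sq_inner g \<epsilon> x \<le> (\<integral>\<^sup>+y. ?S y \<partial>lborel)"
      unfolding sq_inner_def by (intro nn_integral_mono)
    also have "\<dots> = (\<Sum>w\<in>W. \<Sum>k. of_bool (large_jump g w (\<epsilon> / 2) k x) * (\<integral>\<^sup>+y. ?shell k y \<partial>lborel))"
      by (subst nn_integral_sum, measurable)
        (subst nn_integral_suminf, measurable, subst nn_integral_cmult, auto)
    finally show "sq_inner g \<epsilon> x \<le> (\<Sum>w\<in>W. \<Sum>k. of_bool (large_jump g w (\<epsilon> / 2) k x))"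
      by (simp only: nn_integral_dyadic_shell mult_1_right)
  qed
qed

theorem W1p_Lambda1_sq_Lp_finite:
  fixes g :: "'a::euclidean_space \<Rightarrow> real"
  assumes p_gt_1: "1 < p" and g_mem: "g \<in> W1p p" "g \<in> Lambda1" and \<epsilon>_pos: "0 < \<epsilon>"
  shows "sq_Lp_finite p g \<epsilon>"
proof -
  have "continuous_on UNIV g" using g_mem(2) by (simp add: Lambda1_def)
  then have [measurable]: "g \<in> borel_measurable borel" by (rule borel_measurable_continuous_onI)
  have p_half_pos: "0 < p / 2" using p_gt_1 by simp
  obtain W where W_counts: "finite W"
    "\<And>x. sq_inner g \<epsilon> x \<le> (\<Sum>w\<in>W. \<Sum>k. of_bool (large_jump g w (\<epsilon> / 2) k x))"
    by (rule sq_inner_le_counts[OF g_mem(2) \<epsilon>_pos]) (rule that; blast)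
  let ?N = "\<lambda>w x. \<Sum>k. of_bool (large_jump g w (\<epsilon> / 2) k x)"
  have fin: "(\<integral>\<^sup>+x. enn_powr (?N w x) (p / 2) \<partial>lborel) < \<infinity>" for w
  proof -
    obtain D :: ennreal where D_bounds: "D < \<infinity>"
      "\<And>K. count_moment lborel (p / 2) (large_jump g w (2 * (\<epsilon> / 4))) K \<le> D"
      by (rule count_moment_large_jump_bounded[OF p_gt_1 g_mem, of "\<epsilon> / 4" w]) (use \<epsilon>_pos in auto)
    then have "(SUP K. count_moment lborel (p / 2) (large_jump g w (\<epsilon> / 2)) K) \<le> D"
      by (intro SUP_least) simp
    then show ?thesis
      using D_bounds(1)
      by (subst nn_integral_enn_powr_suminf_of_bool[OF p_half_pos]) (auto intro: le_less_trans)
  qed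
  have "(\<integral>\<^sup>+x. enn_powr (sq_inner g \<epsilon> x) (p / 2) \<partial>lebesgue) = (\<integral>\<^sup>+x. enn_powr (sq_inner g \<epsilon> x) (p / 2) \<partial>lborel)"
    by (rule nn_integral_completion)
  also have "\<dots> \<le> (\<integral>\<^sup>+x. enn_powr (\<Sum>w\<in>W. ?N w x) (p / 2) \<partial>lborel)"
    using p_half_pos W_counts by (intro nn_integral_mono enn_powr_mono) auto
  also have "\<dots> < \<infinity>" using W_counts(1) p_half_pos fin by (intro nn_integral_enn_powr_sum_finite) auto
  finally show ?thesis by (simp add: sq_Lp_finite_def)
qed

section \<open>The tent kernel\<close>

definition tent :: "'a::euclidean_space \<Rightarrow> real" where
  "tent z = (\<Prod>b\<in>Basis. max 0 (1 - \<bar>z \<bullet> b\<bar>))"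

definition half_cube :: "'a::euclidean_space set" where
  "half_cube = cbox (- (1/2) *\<^sub>R One) ((1/2) *\<^sub>R One)"

lemma half_cube_iff: "v \<in> half_cube \<longleftrightarrow> (\<forall>b\<in>Basis. \<bar>v \<bullet> b\<bar> \<le> 1/2)"
  by (auto simp: half_cube_def mem_box abs_le_iff)

lemma half_cube_measurable [measurable]: "half_cube \<in> sets borel"
  by (simp add: half_cube_def)

lemma tent_measurable [measurable]: "tent \<in> borel_measurable borel"
  unfolding tent_def[abs_def] by measurable

lemma tent_nonneg: "0 \<le> tent z"
  unfolding tent_def by (intro prod_nonneg) auto

lemma tent_le_1: "tent z \<le> 1"
  unfolding tent_def by (intro prod_le_1) auto

lemma tent_uminus: "tent (- z) = tent z"
  by (simp add: tent_def)

lemma tent_eq_0: "b \<in> Basis \<Longrightarrow> 1 \<le> \<bar>z \<bullet> b\<bar> \<Longrightarrow> tent z = 0"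
  unfolding tent_def by (intro prod_zero bexI[of _ b]) auto

lemma half_cube_uminus: "- v \<in> half_cube \<longleftrightarrow> v \<in> half_cube"
  by (simp add: half_cube_iff)

lemma tent_support:
  fixes z :: "'a::euclidean_space"
  assumes "tent z \<noteq> 0"
  shows "norm z \<le> real DIM('a)"
proof -
  have "\<bar>z \<bullet> b\<bar> \<le> 1" if "b \<in> Basis" for b using tent_eq_0[OF that, of z] assms by linarith
  then have "(\<Sum>b\<in>Basis. \<bar>z \<bullet> b\<bar>) \<le> (\<Sum>b\<in>(Basis::'a set). 1)" by (intro sum_mono)
  then show ?thesis using norm_le_l1[of z] by simp
qed

lemma tent_ge: "1 - (\<Sum>b\<in>Basis. \<bar>z \<bullet> b\<bar>) \<le> tent z"
proof (cases "\<forall>b\<in>Basis. \<bar>z \<bullet> b\<bar> \<le> 1")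
  case True
  have "1 - (\<Sum>b\<in>Basis. \<bar>z \<bullet> b\<bar>) \<le> (\<Prod>b\<in>Basis. 1 - \<bar>z \<bullet> b\<bar>)"
    by (rule Weierstrass_prod_ineq) (use True in auto)
  also have "\<dots> = tent z" unfolding tent_def using True by (intro prod.cong) auto
  finally show ?thesis .
next
  case False
  then obtain b where b_bounds: "b \<in> Basis" "1 < \<bar>z \<bullet> b\<bar>" by auto
  then have "1 < (\<Sum>b\<in>Basis. \<bar>z \<bullet> b\<bar>)" using member_le_sum[of b Basis "\<lambda>b. \<bar>z \<bullet> b\<bar>"] by fastforce
  then show ?thesis using tent_nonneg[of z] by linarith
qed

lemma nn_integral_half_cube_convolution:
  "(\<integral>\<^sup>+v. indicator half_cube v * indicator half_cube (z - v) \<partial>lborel) = ennreal (tent z)"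
proof -
  let ?l = "\<Sum>b\<in>Basis. max (- 1/2) (z \<bullet> b - 1/2) *\<^sub>R b" and ?u = "\<Sum>b\<in>Basis. min (1/2) (z \<bullet> b + 1/2) *\<^sub>R b"
  have "indicator half_cube v * indicator half_cube (z - v) = (indicator (cbox ?l ?u) v :: ennreal)" for v
  proof -
    have "v \<in> half_cube \<and> z - v \<in> half_cube \<longleftrightarrow> v \<in> cbox ?l ?u"
    proof -
      have "\<bar>a\<bar> \<le> 1/2 \<and> \<bar>c - a\<bar> \<le> 1/2 \<longleftrightarrow> max (- 1/2) (c - 1/2) \<le> a \<and> a \<le> min (1/2) (c + 1/2)" for a c :: real
        by (auto simp: max_def min_def abs_if split: if_splits)
      from this[of "v \<bullet> b" "z \<bullet> b" for b] show ?thesis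
        unfolding half_cube_iff mem_box ball_conj_distrib[symmetric]
        by (intro ball_cong refl) (simp add: inner_diff_left)
    qed
    then show ?thesis by (auto simp: indicator_def)
  qed
  then have "(\<integral>\<^sup>+v. indicator half_cube v * indicator half_cube (z - v) \<partial>lborel) = emeasure lborel (cbox ?l ?u)"
    by simp
  also have "\<dots> = ennreal (tent z)"
  proof (cases "\<forall>b\<in>Basis. \<bar>z \<bullet> b\<bar> \<le> 1")
    case True
    have "?l \<bullet> b \<le> ?u \<bullet> b" if "b \<in> Basis" for b using True that by (auto simp: abs_le_iff max_def min_def)
    then have "emeasure lborel (cbox ?l ?u) = ennreal (\<Prod>b\<in>Basis. (?u - ?l) \<bullet> b)" by (rule emeasure_lborel_cbox)
    also have "(\<Prod>b\<in>Basis. (?u - ?l) \<bullet> b) = tent z"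
      unfolding tent_def using True
      by (intro prod.cong refl) (auto simp: inner_diff_left max_def min_def abs_if split: if_splits)
    finally show ?thesis .
  next
    case False
    then obtain b where b_bounds: "b \<in> Basis" "1 < \<bar>z \<bullet> b\<bar>" by auto
    then have "?u \<bullet> b < ?l \<bullet> b" by (auto simp: max_def min_def abs_if split: if_splits)
    then have "cbox ?l ?u = {}" using b_bounds by (auto simp: box_eq_empty)
    then show ?thesis using tent_eq_0[of b z] b_bounds by simp
  qed
  finally show ?thesis .
qed

lemma emeasure_half_cube: "emeasure lborel (half_cube :: 'a::euclidean_space set) = 1"
proof -
  have "indicator half_cube v * indicator half_cube (0 - v) = (indicator half_cube v :: ennreal)" for v :: 'a
    by (auto simp: indicator_def half_cube_iff)
  then show ?thesis using nn_integral_half_cube_convolution[of "0::'a"] by (simp add: tent_def)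
qed

lemma nn_integral_tent: "(\<integral>\<^sup>+z. ennreal (tent z) \<partial>(lborel :: 'a::euclidean_space measure)) = 1"
proof -
  let ?c = "indicator half_cube :: 'a \<Rightarrow> ennreal"
  have "(\<integral>\<^sup>+z. ennreal (tent z) \<partial>(lborel :: 'a measure)) = (\<integral>\<^sup>+z. (\<integral>\<^sup>+v. ?c v * ?c (z - v) \<partial>lborel) \<partial>lborel)"
    by (simp add: nn_integral_half_cube_convolution)
  also have "\<dots> = (\<integral>\<^sup>+v. (\<integral>\<^sup>+z. ?c v * ?c (z - v) \<partial>lborel) \<partial>lborel)"
    by (rule lborel_pair.Fubini') measurable
  also have "\<dots> = (\<integral>\<^sup>+v. ?c v \<partial>lborel)"
  proof (rule nn_integral_cong)
    fix v :: 'a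
    have "(\<integral>\<^sup>+z. ?c (z - v) \<partial>lborel) = 1"
      using nn_integral_lborel_shift[of ?c "- v"] emeasure_half_cube[where 'a='a] by simp
    then show "(\<integral>\<^sup>+z. ?c v * ?c (z - v) \<partial>lborel) = ?c v" by (simp add: nn_integral_cmult)
  qed
  finally show ?thesis using emeasure_half_cube[where 'a='a] by simp
qed

definition cube_shift :: "'a::euclidean_space \<Rightarrow> 'a \<Rightarrow> real" where
  "cube_shift h v = indicator half_cube (v + h) - indicator half_cube v"

lemma cube_shift_measurable [measurable]: "cube_shift h \<in> borel_measurable borel"
  unfolding cube_shift_def[abs_def] by measurable

lemma nn_integral_cube_shift:
  fixes h :: "'a::euclidean_space"
  shows "(\<integral>\<^sup>+v. ennreal \<bar>cube_shift h v\<bar> \<partial>lborel) \<le> ennreal (2 * real DIM('a) * norm h)"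
proof -
  let ?c = "indicator half_cube :: 'a \<Rightarrow> real" and ?e = "indicator half_cube :: 'a \<Rightarrow> ennreal"
  have reflect: "?e (- h - v) = ?e (v + h)" for v
    using half_cube_uminus[of "v + h"] by (simp add: indicator_def algebra_simps)
  have overlap: "(\<integral>\<^sup>+v. ?e v * ?e (v + h) \<partial>lborel) = ennreal (tent h)"
    using nn_integral_half_cube_convolution[of "- h"] by (simp add: reflect tent_uminus)
  have mass: "(\<integral>\<^sup>+v. ?e (v + h) \<partial>lborel) = 1" "(\<integral>\<^sup>+v. ?e v \<partial>lborel) = 1"
    using nn_integral_lborel_shift[of ?e h] emeasure_half_cube[where 'a='a] by simp_all
  have "ennreal \<bar>cube_shift h v\<bar> + 2 * (?e v * ?e (v + h)) = ?e (v + h) + ?e v" for v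
    by (auto simp: cube_shift_def indicator_def)
  then have "(\<integral>\<^sup>+v. ennreal \<bar>cube_shift h v\<bar> + 2 * (?e v * ?e (v + h)) \<partial>lborel)
      = (\<integral>\<^sup>+v. ?e (v + h) + ?e v \<partial>lborel)"
    by simp
  also have "\<dots> = 2" using mass by (subst nn_integral_add) auto
  finally have "(\<integral>\<^sup>+v. ennreal \<bar>cube_shift h v\<bar> \<partial>lborel) + 2 * ennreal (tent h) = 2"
    using overlap by (subst (asm) nn_integral_add) (auto simp: nn_integral_cmult)
  then have "(\<integral>\<^sup>+v. ennreal \<bar>cube_shift h v\<bar> \<partial>lborel) = ennreal (2 - 2 * tent h)"
    using tent_nonneg[of h] tent_le_1[of h]
    by (cases "\<integral>\<^sup>+v. ennreal \<bar>cube_shift h v\<bar> \<partial>lborel")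
       (auto simp: ennreal_mult[symmetric] ennreal_plus[symmetric] simp del: ennreal_plus
         simp flip: ennreal_numeral)
  also have "\<dots> \<le> ennreal (2 * real DIM('a) * norm h)"
  proof (rule ennreal_leI)
    have "(\<Sum>b\<in>Basis. \<bar>h \<bullet> b\<bar>) \<le> (\<Sum>b\<in>(Basis::'a set). norm h)" by (intro sum_mono Basis_le_norm)
    then show "2 - 2 * tent h \<le> 2 * real DIM('a) * norm h" using tent_ge[of h] by simp
  qed
  finally show ?thesis .
qed

lemma tent_eq_integral: "tent z = (\<integral>v. indicator half_cube v * indicator half_cube (z - v) \<partial>lborel)"
  and integrable_half_cube_convolution:
    "integrable lborel (\<lambda>v. indicator half_cube v * indicator half_cube (z - v) :: real)"
proof -
  let ?f = "\<lambda>v. indicator half_cube v * indicator half_cube (z - v) :: real"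
  have mass: "(\<integral>\<^sup>+v. ennreal (?f v) \<partial>lborel) = ennreal (tent z)"
    unfolding nn_integral_half_cube_convolution[symmetric]
    by (intro nn_integral_cong) (auto simp: indicator_def)
  show int: "integrable lborel ?f"
    by (intro integrableI_nonneg) (auto simp: mass)
  have "ennreal (tent z) = ennreal (\<integral>v. ?f v \<partial>lborel)"
    unfolding mass[symmetric] by (rule nn_integral_eq_integral[OF int]) auto
  then show "tent z = (\<integral>v. ?f v \<partial>lborel)" using tent_nonneg[of z] by simp
qed

lemma lborel_integral_shift:
  fixes f :: "'a::euclidean_space \<Rightarrow> real"
  assumes [measurable]: "f \<in> borel_measurable borel"
  shows "(\<integral>x. f (x + t) \<partial>lborel) = (\<integral>x. f x \<partial>lborel)"
  by (subst (2) lborel_affine[of 1 t]) (simp_all add: density_1 integral_distr add.commute)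

lemma integrable_lborel_shift:
  fixes f :: "'a::euclidean_space \<Rightarrow> real"
  assumes "integrable lborel f"
  shows "integrable lborel (\<lambda>x. f (x + t))"
proof -
  have [measurable]: "f \<in> borel_measurable borel" using assms by auto
  show ?thesis
  proof (rule integrableI_bounded)
    show "(\<integral>\<^sup>+x. ennreal (norm (f (x + t))) \<partial>lborel) < \<infinity>"
      using assms nn_integral_lborel_shift[of "\<lambda>x. ennreal (norm (f x))" t]
      by (auto simp: integrable_iff_bounded)
  qed simp
qed

lemma cube_convolution_shift:
  "integrable lborel (\<lambda>v. cube_shift h v * indicator half_cube (z - v))"
  "tent (z + h) - tent z = (\<integral>v. cube_shift h v * indicator half_cube (z - v) \<partial>lborel)"
proof -
  let ?c = "indicator half_cube :: 'a \<Rightarrow> real"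
  have int_shift: "integrable lborel (\<lambda>v. ?c (v + h) * ?c (z - v))"
    using integrable_lborel_shift[OF integrable_half_cube_convolution[of "z + h"], of h] by simp
  have tent_shift: "tent (z + h) = (\<integral>v. ?c (v + h) * ?c (z - v) \<partial>lborel)"
    unfolding tent_eq_integral[of "z + h"]
    using lborel_integral_shift[of "\<lambda>v. ?c v * ?c (z + h - v)" h] by simp
  have split: "cube_shift h v * ?c (z - v) = ?c (v + h) * ?c (z - v) - ?c v * ?c (z - v)" for v
    by (simp add: cube_shift_def algebra_simps)
  show "integrable lborel (\<lambda>v. cube_shift h v * ?c (z - v))"
    unfolding split by (intro Bochner_Integration.integrable_diff int_shift integrable_half_cube_convolution)
  show "tent (z + h) - tent z = (\<integral>v. cube_shift h v * ?c (z - v) \<partial>lborel)"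
    unfolding split tent_shift tent_eq_integral[of z]
    by (rule Bochner_Integration.integral_diff[OF int_shift integrable_half_cube_convolution[of z], symmetric])
qed

lemma nn_integral_abs_convolution_le:
  fixes F G :: "'a::euclidean_space \<Rightarrow> real"
  assumes [measurable]: "F \<in> borel_measurable borel" "G \<in> borel_measurable borel"
  shows "(\<integral>\<^sup>+z. ennreal \<bar>\<integral>v. F v * G (z - v) \<partial>lborel\<bar> \<partial>lborel)
    \<le> (\<integral>\<^sup>+v. ennreal \<bar>F v\<bar> \<partial>lborel) * (\<integral>\<^sup>+v. ennreal \<bar>G v\<bar> \<partial>lborel)"
proof -
  have "(\<integral>\<^sup>+z. ennreal \<bar>\<integral>v. F v * G (z - v) \<partial>lborel\<bar> \<partial>lborel)
      \<le> (\<integral>\<^sup>+z. (\<integral>\<^sup>+v. ennreal \<bar>F v\<bar> * ennreal \<bar>G (z - v)\<bar> \<partial>lborel) \<partial>lborel)"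
  proof (rule nn_integral_mono)
    fix z
    show "ennreal \<bar>\<integral>v. F v * G (z - v) \<partial>lborel\<bar> \<le> (\<integral>\<^sup>+v. ennreal \<bar>F v\<bar> * ennreal \<bar>G (z - v)\<bar> \<partial>lborel)"
      using integral_norm_bound_ennreal[of lborel "\<lambda>v. F v * G (z - v)"]
      by (cases "integrable lborel (\<lambda>v. F v * G (z - v))")
         (auto simp: abs_mult ennreal_mult not_integrable_integral_eq)
  qed
  also have "\<dots> = (\<integral>\<^sup>+v. (\<integral>\<^sup>+z. ennreal \<bar>F v\<bar> * ennreal \<bar>G (z - v)\<bar> \<partial>lborel) \<partial>lborel)"
    by (rule lborel_pair.Fubini') measurable
  also have "\<dots> = (\<integral>\<^sup>+v. ennreal \<bar>F v\<bar> * (\<integral>\<^sup>+z. ennreal \<bar>G z\<bar> \<partial>lborel) \<partial>lborel)"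
  proof (rule nn_integral_cong)
    fix v
    show "(\<integral>\<^sup>+z. ennreal \<bar>F v\<bar> * ennreal \<bar>G (z - v)\<bar> \<partial>lborel) = ennreal \<bar>F v\<bar> * (\<integral>\<^sup>+z. ennreal \<bar>G z\<bar> \<partial>lborel)"
      using nn_integral_lborel_shift[of "\<lambda>z. ennreal \<bar>G z\<bar>" "- v"] by (simp add: nn_integral_cmult)
  qed
  also have "\<dots> = (\<integral>\<^sup>+v. ennreal \<bar>F v\<bar> \<partial>lborel) * (\<integral>\<^sup>+v. ennreal \<bar>G v\<bar> \<partial>lborel)"
    by (rule nn_integral_multc) measurable
  finally show ?thesis .
qed

lemma tent_first_modulus:
  fixes h :: "'a::euclidean_space"
  shows "(\<integral>\<^sup>+z. ennreal \<bar>tent (z + h) - tent z\<bar> \<partial>lborel) \<le> ennreal (2 * real DIM('a) * norm h)"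
proof -
  have "(\<integral>\<^sup>+z. ennreal \<bar>tent (z + h) - tent z\<bar> \<partial>lborel)
     \<le> (\<integral>\<^sup>+v. ennreal \<bar>cube_shift h v\<bar> \<partial>lborel) * (\<integral>\<^sup>+v. ennreal \<bar>indicator half_cube v\<bar> \<partial>(lborel :: 'a measure))"
    unfolding cube_convolution_shift(2) by (rule nn_integral_abs_convolution_le) measurable
  also have "(\<integral>\<^sup>+v. ennreal \<bar>indicator half_cube v\<bar> \<partial>(lborel :: 'a measure)) = 1"
    using emeasure_half_cube[where 'a='a] by (simp add: ennreal_indicator)
  finally show ?thesis using nn_integral_cube_shift[of h] by simp
qed

(* tent is the convolution square of half_cube, so its second difference is the convolution square of a first
  difference. *)
lemma tent_second_modulus:
  fixes h :: "'a::euclidean_space"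
  shows "(\<integral>\<^sup>+z. ennreal \<bar>tent (z + h) - 2 * tent z + tent (z - h)\<bar> \<partial>lborel)
      \<le> ennreal ((2 * real DIM('a) * norm h)\<^sup>2)"
proof -
  let ?c = "indicator half_cube :: 'a \<Rightarrow> real"
  have second_difference:
    "tent (z + h) - 2 * tent z + tent (z - h) = (\<integral>v. cube_shift h v * cube_shift h (z - h - v) \<partial>lborel)" for z
  proof -
    have "tent (z + h) - 2 * tent z + tent (z - h)
        = (tent (z + h) - tent z) - (tent ((z - h) + h) - tent (z - h))" by simp
    also have "\<dots> = (\<integral>v. cube_shift h v * ?c (z - v) - cube_shift h v * ?c (z - h - v) \<partial>lborel)"
      unfolding cube_convolution_shift(2)
      using cube_convolution_shift(1)[of h z] cube_convolution_shift(1)[of h "z - h"] by simp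
    also have "\<dots> = (\<integral>v. cube_shift h v * cube_shift h (z - h - v) \<partial>lborel)"
    proof -
      have "cube_shift h (z - h - v) = ?c (z - v) - ?c (z - h - v)" for v by (simp add: cube_shift_def)
      then show ?thesis by (simp add: right_diff_distrib)
    qed
    finally show ?thesis .
  qed
  have "(\<integral>\<^sup>+z. ennreal \<bar>tent (z + h) - 2 * tent z + tent (z - h)\<bar> \<partial>lborel)
      = (\<integral>\<^sup>+z. ennreal \<bar>\<integral>v. cube_shift h v * (\<lambda>y. cube_shift h (y - h)) (z - v) \<partial>lborel\<bar> \<partial>lborel)"
    unfolding second_difference by (intro nn_integral_cong) (simp add: algebra_simps)
  also have "\<dots> \<le> (\<integral>\<^sup>+v. ennreal \<bar>cube_shift h v\<bar> \<partial>lborel) * (\<integral>\<^sup>+v. ennreal \<bar>cube_shift h (v - h)\<bar> \<partial>lborel)"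
    by (rule nn_integral_abs_convolution_le) measurable
  also have "(\<integral>\<^sup>+v. ennreal \<bar>cube_shift h (v - h)\<bar> \<partial>lborel) = (\<integral>\<^sup>+v. ennreal \<bar>cube_shift h v\<bar> \<partial>lborel)"
    using nn_integral_lborel_shift[of "\<lambda>v. ennreal \<bar>cube_shift h v\<bar>" "- h"] by simp
  also have "(\<integral>\<^sup>+v. ennreal \<bar>cube_shift h v\<bar> \<partial>lborel) * \<dots>
      \<le> ennreal (2 * real DIM('a) * norm h) * ennreal (2 * real DIM('a) * norm h)"
    by (intro mult_mono nn_integral_cube_shift) auto
  also have "\<dots> = ennreal ((2 * real DIM('a) * norm h)\<^sup>2)"
    by (simp add: ennreal_mult[symmetric] power2_eq_square)
  finally show ?thesis .
qed

definition tent_measure :: "'a::euclidean_space measure" where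
  "tent_measure = density lborel (\<lambda>z. ennreal (tent z))"

lemma kernel_measure_tent_measure: "kernel_measure (tent_measure :: 'a::euclidean_space measure)"
proof (intro kernel_measure.intro prob_spaceI kernel_measure_axioms.intro)
  show "emeasure (tent_measure :: 'a measure) (space tent_measure) = 1"
    using nn_integral_tent[where 'a='a] by (simp add: tent_measure_def emeasure_density)
qed (simp add: tent_measure_def)

interpretation tent: kernel_measure "tent_measure :: 'a::euclidean_space measure"
  by (rule kernel_measure_tent_measure)

abbreviation tent_avg :: "real \<Rightarrow> ('a::euclidean_space \<Rightarrow> real) \<Rightarrow> 'a \<Rightarrow> real" where
  "tent_avg \<equiv> tent.avg"

lemma tent_integral_abs_le:
  fixes F :: "'a::euclidean_space \<Rightarrow> real"
  assumes "F \<in> borel_measurable borel" and F_le_b: "\<And>z. norm z \<le> real DIM('a) \<Longrightarrow> \<bar>F z\<bar> \<le> b"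
  shows "\<bar>\<integral>z. F z \<partial>tent_measure\<bar> \<le> b"
proof (rule tent.abs_integral_le_AE)
  show "AE z in tent_measure. \<bar>F z\<bar> \<le> b"
    unfolding tent_measure_def using F_le_b tent_support[where 'a='a] by (subst AE_density) (auto intro!: AE_I2)
qed fact

lemma tent_integral_eq:
  assumes [measurable]: "F \<in> borel_measurable borel"
  shows "(\<integral>z. F z \<partial>tent_measure) = (\<integral>z. tent z * F z \<partial>lborel)"
  unfolding tent_measure_def using tent_nonneg by (subst integral_density) auto

lemma integrable_tent: "integrable lborel (tent :: 'a::euclidean_space \<Rightarrow> real)"
  using nn_integral_tent[where 'a='a] tent_nonneg by (intro integrableI_nonneg) auto

lemma integrable_tent_times:
  assumes [measurable]: "F \<in> borel_measurable borel" and F_bounded: "\<And>x. \<bar>F x\<bar> \<le> S"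
  shows "integrable lborel (\<lambda>z. tent (z + h) * F z)"
proof (rule Bochner_Integration.integrable_bound)
  show "integrable lborel (\<lambda>z. S * tent (z + h))"
    by (intro integrable_mult_right integrable_lborel_shift integrable_tent)
  show "AE z in lborel. norm (tent (z + h) * F z) \<le> norm (S * tent (z + h))"
  proof (intro AE_I2)
    fix z
    have "\<bar>F z\<bar> \<le> \<bar>S\<bar>" using F_bounded[of z] by linarith
    then have "\<bar>tent (z + h)\<bar> * \<bar>F z\<bar> \<le> \<bar>tent (z + h)\<bar> * \<bar>S\<bar>" by (intro mult_left_mono) auto
    then show "norm (tent (z + h) * F z) \<le> norm (S * tent (z + h))" by (simp add: abs_mult mult.commute)
  qed
qed simp

lemma tent_avg_shift:
  fixes f :: "'a::euclidean_space \<Rightarrow> real"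
  assumes [measurable]: "f \<in> borel_measurable borel" and t_pos: "t > 0"
  shows "tent_avg t f (x + h) = (\<integral>z. tent (z + - (1 / t) *\<^sub>R h) * f (x + t *\<^sub>R z) \<partial>lborel)"
proof -
  have "tent_avg t f (x + h) = (\<integral>z. tent z * f (x + h + t *\<^sub>R z) \<partial>lborel)"
    unfolding tent.avg_def by (rule tent_integral_eq) simp
  also have "\<dots> = (\<integral>z. tent (z + - (1 / t) *\<^sub>R h) * f (x + h + t *\<^sub>R (z + - (1 / t) *\<^sub>R h)) \<partial>lborel)"
    by (rule lborel_integral_shift[symmetric]) simp
  also have "\<dots> = (\<integral>z. tent (z + - (1 / t) *\<^sub>R h) * f (x + t *\<^sub>R z) \<partial>lborel)"
    using t_pos by (simp add: algebra_simps)
  finally show ?thesis .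
qed

lemma abs_integral_kernel_le:
  fixes F k :: "'a::euclidean_space \<Rightarrow> real"
  assumes [measurable]: "F \<in> borel_measurable borel" "k \<in> borel_measurable borel" and F_bounded: "\<And>x. \<bar>F x\<bar> \<le> S"
    and k_mass: "(\<integral>\<^sup>+z. ennreal \<bar>k z\<bar> \<partial>lborel) \<le> ennreal L" and L_nonneg: "L \<ge> 0"
  shows "\<bar>\<integral>z. k z * F z \<partial>lborel\<bar> \<le> S * L"
proof -
  have S_nonneg: "S \<ge> 0" using F_bounded[of 0] by linarith
  have abs_k_integrable: "integrable lborel (\<lambda>z. \<bar>k z\<bar>)" using k_mass
    by (intro integrableI_bounded) (auto simp: le_less_trans)
  have integral_abs_k_le: "(\<integral>z. \<bar>k z\<bar> \<partial>lborel) \<le> L" using k_mass L_nonneg abs_k_integrable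
    by (simp add: nn_integral_eq_integral)
  have kernel_mult_le: "\<bar>k z\<bar> * \<bar>F z\<bar> \<le> S * \<bar>k z\<bar>" for z
    using mult_left_mono[OF F_bounded[of z], of "\<bar>k z\<bar>"] by (simp add: mult.commute)
  have "\<bar>\<integral>z. k z * F z \<partial>lborel\<bar> \<le> (\<integral>z. \<bar>k z * F z\<bar> \<partial>lborel)" by (rule integral_abs_bound)
  also have "\<dots> \<le> (\<integral>z. S * \<bar>k z\<bar> \<partial>lborel)"
  proof (rule integral_mono)
    show "integrable lborel (\<lambda>z. \<bar>k z * F z\<bar>)"
      by (rule Bochner_Integration.integrable_bound[OF integrable_mult_right[OF abs_k_integrable, of S]])
        (use kernel_mult_le S_nonneg in \<open>auto simp: abs_mult\<close>)
  qed (use abs_k_integrable kernel_mult_le in \<open>auto simp: abs_mult\<close>)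
  also have "\<dots> \<le> S * L" using integral_abs_k_le S_nonneg by (simp add: mult_left_mono)
  finally show ?thesis .
qed

lemma tent_avg_lipschitz:
  fixes f :: "'a::euclidean_space \<Rightarrow> real"
  assumes [measurable]: "f \<in> borel_measurable borel" and f_bounded: "\<And>x. \<bar>f x\<bar> \<le> S" and t_pos: "t > 0"
  shows "\<bar>tent_avg t f (x + h) - tent_avg t f x\<bar> \<le> S * (2 * real DIM('a) * (norm h / t))"
proof -
  let ?h = "- (1 / t) *\<^sub>R h"
  have "tent_avg t f (x + h) - tent_avg t f x = (\<integral>z. (tent (z + ?h) - tent z) * f (x + t *\<^sub>R z) \<partial>lborel)"
    unfolding tent_avg_shift[OF assms(1) t_pos] using tent_avg_shift[OF assms(1) t_pos, of x 0]
      integrable_tent_times[of "\<lambda>z. f (x + t *\<^sub>R z)" S ?h] integrable_tent_times[of "\<lambda>z. f (x + t *\<^sub>R z)" S 0]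
        f_bounded
    by (simp add: left_diff_distrib)
  also have "\<bar>\<dots>\<bar> \<le> S * (2 * real DIM('a) * norm ?h)"
    using f_bounded by (intro abs_integral_kernel_le tent_first_modulus) auto
  also have "norm ?h = norm h / t" using t_pos by simp
  finally show ?thesis .
qed

lemma tent_avg_Dh2:
  fixes f :: "'a::euclidean_space \<Rightarrow> real"
  assumes [measurable]: "f \<in> borel_measurable borel" and f_bounded: "\<And>x. \<bar>f x\<bar> \<le> S" and t_pos: "t > 0"
  shows "\<bar>Dh2 h (tent_avg t f) x\<bar> \<le> S * (2 * real DIM('a) * (norm h / t))\<^sup>2"
proof -
  define h' where "h' = - (1 / t) *\<^sub>R h"
  let ?f = "\<lambda>z. f (x + t *\<^sub>R z)"
  have int_shift: "integrable lborel (\<lambda>z. tent (z + v) * ?f z)" for v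
    using f_bounded by (intro integrable_tent_times) auto
  have int: "integrable lborel (\<lambda>z. tent z * ?f z)" "integrable lborel (\<lambda>z. tent (z - h') * ?f z)"
    using int_shift[of 0] int_shift[of "- h'"] by simp_all
  have "Dh2 h (tent_avg t f) x
      = (\<integral>z. tent (z + h') * ?f z \<partial>lborel) - 2 * (\<integral>z. tent z * ?f z \<partial>lborel) +
        (\<integral>z. tent (z - h') * ?f z \<partial>lborel)"
    unfolding Dh2_eq using tent_avg_shift[OF assms(1) t_pos, of x h] tent_avg_shift[OF assms(1) t_pos, of x 0]
      tent_avg_shift[OF assms(1) t_pos, of x "- h"]
    by (simp add: h'_def)
  also have "\<dots> = (\<integral>z. tent (z + h') * ?f z - 2 * (tent z * ?f z) + tent (z - h') * ?f z \<partial>lborel)"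
    using int_shift[of h'] int by simp
  also have "\<dots> = (\<integral>z. (tent (z + h') - 2 * tent z + tent (z - h')) * ?f z \<partial>lborel)"
    by (intro Bochner_Integration.integral_cong) (auto simp: algebra_simps)
  also have "\<bar>\<dots>\<bar> \<le> S * (2 * real DIM('a) * norm h')\<^sup>2"
    using f_bounded by (intro abs_integral_kernel_le tent_second_modulus) auto
  also have "norm h' = norm h / t" using t_pos by (simp add: h'_def)
  finally show ?thesis .
qed

lemma continuous_on_tent_avg:
  fixes f :: "'a::euclidean_space \<Rightarrow> real"
  assumes [measurable]: "f \<in> borel_measurable borel" and f_bounded: "\<And>x. \<bar>f x\<bar> \<le> S" and t_pos: "t > 0"
  shows "continuous_on UNIV (tent_avg t f)"
proof -
  define L where "L = S * (2 * real DIM('a) / t)"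
  have "0 \<le> S" using f_bounded[of 0] by linarith
  have "L-lipschitz_on UNIV (tent_avg t f)"
  proof (rule lipschitz_onI)
    show "dist (tent_avg t f x) (tent_avg t f y) \<le> L * dist x y" for x y
      using tent_avg_lipschitz[OF assms, of y "x - y"] by (simp add: dist_norm L_def)
    show "0 \<le> L" using \<open>0 \<le> S\<close> t_pos by (simp add: L_def)
  qed
  then show ?thesis by (rule lipschitz_on_continuous_on)
qed

lemma tent_avg_commute:
  fixes f :: "'a::euclidean_space \<Rightarrow> real"
  assumes [measurable]: "f \<in> borel_measurable borel" and f_bounded: "\<And>x. \<bar>f x\<bar> \<le> S"
  shows "tent_avg s (tent_avg t f) x = tent_avg t (tent_avg s f) x"
proof -
  interpret P: pair_prob_space "tent_measure :: 'a measure" "tent_measure :: 'a measure" ..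
  have "integrable (tent_measure \<Otimes>\<^sub>M tent_measure) (\<lambda>(z, y). f (x + s *\<^sub>R z + t *\<^sub>R y))"
    using f_bounded by (intro P.integrable_const_bound[where B=S]) auto
  from P.Fubini_integral[OF this] show ?thesis
    unfolding tent.avg_def by (simp add: add_ac)
qed

lemma tent_avg_minus_id:
  fixes f :: "'a::euclidean_space \<Rightarrow> real"
  assumes [measurable]: "f \<in> borel_measurable borel" and f_bounded: "\<And>x. \<bar>f x\<bar> \<le> S"
  shows "tent_avg t f x - f x = (\<integral>z. Dh2 (t *\<^sub>R z) f x \<partial>tent_measure) / 2"
proof -
  have int: "integrable tent_measure (\<lambda>z. f (x + t *\<^sub>R z))" for t
    using f_bounded by (intro tent.integrable_avg) auto
  have reflect: "(\<integral>z. f (x - t *\<^sub>R z) \<partial>tent_measure) = tent_avg t f x"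
  proof -
    have "(\<integral>z. f (x - t *\<^sub>R z) \<partial>tent_measure) = (\<integral>z. tent z * f (x - t *\<^sub>R z) \<partial>lborel)"
      by (rule tent_integral_eq) simp
    also have "\<dots> = (\<integral>z. tent (0 - z) * f (x - t *\<^sub>R (0 - z)) \<partial>lborel)"
      by (rule lborel_integral_reflect[symmetric]) simp
    also have "\<dots> = (\<integral>z. tent z * f (x + t *\<^sub>R z) \<partial>lborel)" by (simp add: tent_uminus)
    also have "\<dots> = tent_avg t f x" unfolding tent.avg_def by (rule tent_integral_eq[symmetric]) simp
    finally show ?thesis .
  qed
  have "(\<integral>z. Dh2 (t *\<^sub>R z) f x \<partial>tent_measure) = tent_avg t f x - 2 * f x + tent_avg t f x"
    unfolding Dh2_eq using int[of t] int[of "- t"] reflect by (simp add: tent.avg_def)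
  then show ?thesis by simp
qed

definition tent_deriv :: "'a::euclidean_space \<Rightarrow> 'a \<Rightarrow> real" where
  "tent_deriv i z = (if -1 \<le> z \<bullet> i \<and> z \<bullet> i < 1 then (if z \<bullet> i < 0 then 1 else -1) else 0)
     * (\<Prod>b\<in>Basis - {i}. max 0 (1 - \<bar>z \<bullet> b\<bar>))"

definition tent_avg_deriv :: "'a::euclidean_space \<Rightarrow> real \<Rightarrow> ('a \<Rightarrow> real) \<Rightarrow> 'a \<Rightarrow> real" where
  "tent_avg_deriv i t f x = - (1 / t) * (\<integral>z. tent_deriv i z * f (x + t *\<^sub>R z) \<partial>lborel)"

lemma tent_deriv_measurable [measurable]: "tent_deriv i \<in> borel_measurable borel"
  unfolding tent_deriv_def[abs_def] by measurable

lemma tent_avg_deriv_measurable [measurable]: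
  assumes [measurable]: "f \<in> borel_measurable borel"
  shows "tent_avg_deriv i t f \<in> borel_measurable borel"
  unfolding tent_avg_deriv_def[abs_def] by measurable

lemma tent_split: "i \<in> Basis \<Longrightarrow> tent z = max 0 (1 - \<bar>z \<bullet> i\<bar>) * (\<Prod>b\<in>Basis - {i}. max 0 (1 - \<bar>z \<bullet> b\<bar>))"
  unfolding tent_def by (rule prod.remove) auto

lemma tent_direction:
  assumes i_Basis: "i \<in> Basis"
  shows "tent (z + r *\<^sub>R i) - tent z
      = (max 0 (1 - \<bar>z \<bullet> i + r\<bar>) - max 0 (1 - \<bar>z \<bullet> i\<bar>)) * (\<Prod>b\<in>Basis - {i}. max 0 (1 - \<bar>z \<bullet> b\<bar>))"
proof -
  have "(\<Prod>b\<in>Basis - {i}. max 0 (1 - \<bar>(z + r *\<^sub>R i) \<bullet> b\<bar>)) = (\<Prod>b\<in>Basis - {i}. max 0 (1 - \<bar>z \<bullet> b\<bar>))"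
    using i_Basis by (intro prod.cong) (auto simp: inner_add_left inner_Basis)
  then show ?thesis using i_Basis by (simp add: tent_split[OF i_Basis] inner_add_left left_diff_distrib)
qed

lemma prod_max_abs_le_1: "\<bar>\<Prod>b\<in>A. max 0 (1 - \<bar>z \<bullet> b\<bar>)\<bar> \<le> (1::real)"
  unfolding abs_prod by (intro prod_le_1) auto

lemma tent_difference_bound:
  assumes i_Basis: "i \<in> Basis"
  shows "\<bar>tent (z + r *\<^sub>R i) - tent z\<bar> \<le> \<bar>r\<bar>"
proof -
  have max_diff: "\<bar>max 0 (1 - b) - max 0 (1 - a)\<bar> \<le> \<bar>b - a\<bar>" for a b :: real
    by (simp add: max_def abs_minus_commute)
  have "\<bar>max 0 (1 - \<bar>z \<bullet> i + r\<bar>) - max 0 (1 - \<bar>z \<bullet> i\<bar>)\<bar> \<le> \<bar>\<bar>z \<bullet> i + r\<bar> - \<bar>z \<bullet> i\<bar>\<bar>" by (rule max_diff)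
  also have "\<dots> \<le> \<bar>r\<bar>" using abs_triangle_ineq3[of "z \<bullet> i + r" "z \<bullet> i"] by simp
  finally have "\<bar>max 0 (1 - \<bar>z \<bullet> i + r\<bar>) - max 0 (1 - \<bar>z \<bullet> i\<bar>)\<bar>
      * \<bar>\<Prod>b\<in>Basis - {i}. max 0 (1 - \<bar>z \<bullet> b\<bar>)\<bar> \<le> \<bar>r\<bar> * 1"
    by (rule mult_mono[OF _ prod_max_abs_le_1]) (rule abs_ge_zero)+
  then show ?thesis unfolding tent_direction[OF i_Basis] abs_mult by (simp only: mult_1_right)
qed

lemma tent_right_derivative:
  assumes i_Basis: "i \<in> Basis" and \<rho>_bounds: "\<And>m. 0 < \<rho> m" "\<rho> \<longlonglongrightarrow> 0"
  shows "(\<lambda>m. (tent (z + \<rho> m *\<^sub>R i) - tent z) / \<rho> m) \<longlonglongrightarrow> tent_deriv i z"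
proof -
  define s where "s = z \<bullet> i"
  define d where "d = (if -1 \<le> s \<and> s < 1 then (if s < 0 then 1 else -1) else 0 :: real)"
  define gap where "gap = (if s < -1 then -1 - s else if s < 0 then - s else if s < 1 then 1 - s else 1)"
  have gap: "gap > 0" by (auto simp: gap_def)
  have quotient: "(tent (z + r *\<^sub>R i) - tent z) / r = tent_deriv i z" if r_bounds: "0 < r" "r < gap" for r
  proof -
    consider "s < -1" | "-1 \<le> s" "s < 0" | "0 \<le> s" "s < 1" | "1 \<le> s" by linarith
    then have "max 0 (1 - \<bar>s + r\<bar>) - max 0 (1 - \<bar>s\<bar>) = r * d"
      using r_bounds by cases (simp_all add: gap_def d_def)
    then show ?thesis
      unfolding tent_direction[OF i_Basis] tent_deriv_def s_def[symmetric] d_def[symmetric] using r_bounds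
      by simp
  qed
  have "eventually (\<lambda>m. tent_deriv i z = (tent (z + \<rho> m *\<^sub>R i) - tent z) / \<rho> m) sequentially"
    using order_tendstoD(2)[OF \<rho>_bounds(2) gap] by eventually_elim (use quotient \<rho>_bounds(1) in auto)
  then show ?thesis by (rule Lim_transform_eventually[OF tendsto_const])
qed

lemma tent_difference_eq_0:
  fixes z :: "'a::euclidean_space"
  assumes i_Basis: "i \<in> Basis" and \<rho>_nonneg: "0 \<le> \<rho>" and norm_z_gt: "real DIM('a) + \<rho> < norm z"
  shows "tent (z + \<rho> *\<^sub>R i) - tent z = 0"
proof -
  have "norm z \<le> norm (z + \<rho> *\<^sub>R i) + \<rho>"
    using norm_triangle_ineq4[of "z + \<rho> *\<^sub>R i" "\<rho> *\<^sub>R i"] \<rho>_nonneg i_Basis by simp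
  then have "real DIM('a) < norm (z + \<rho> *\<^sub>R i)" "real DIM('a) < norm z" using norm_z_gt \<rho>_nonneg by linarith+
  then have "tent (z + \<rho> *\<^sub>R i) = 0" "tent z = 0" using tent_support not_less by blast+
  then show ?thesis by simp
qed

lemma tent_avg_difference:
  fixes f :: "'a::euclidean_space \<Rightarrow> real"
  assumes [measurable]: "f \<in> borel_measurable borel" and f_bounded: "\<And>x. \<bar>f x\<bar> \<le> S" and t_pos: "0 < t"
  shows "(tent_avg t f (x - r *\<^sub>R i) - tent_avg t f x) / r
    = 1 / t * (\<integral>z. (tent (z + (r / t) *\<^sub>R i) - tent z) / (r / t) * f (x + t *\<^sub>R z) \<partial>lborel)"
proof -
  let ?f = "\<lambda>z. f (x + t *\<^sub>R z)" and ?\<rho> = "r / t"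
  have "integrable lborel (\<lambda>z. tent (z + ?\<rho> *\<^sub>R i) * ?f z)" "integrable lborel (\<lambda>z. tent z * ?f z)"
    using integrable_tent_times[of ?f S "?\<rho> *\<^sub>R i"] integrable_tent_times[of ?f S 0] f_bounded by simp_all
  then have "tent_avg t f (x - r *\<^sub>R i) - tent_avg t f x = (\<integral>z. (tent (z + ?\<rho> *\<^sub>R i) - tent z) * ?f z \<partial>lborel)"
    using tent_avg_shift[OF assms(1) t_pos, of x "- (r *\<^sub>R i)"] tent_avg_shift[OF assms(1) t_pos, of x 0]
    by (simp add: left_diff_distrib)
  then have "(tent_avg t f (x - r *\<^sub>R i) - tent_avg t f x) / r
      = 1 / t * ((\<integral>z. (tent (z + ?\<rho> *\<^sub>R i) - tent z) * ?f z \<partial>lborel) / ?\<rho>)"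
    using t_pos by simp
  also have "(\<integral>z. (tent (z + ?\<rho> *\<^sub>R i) - tent z) * ?f z \<partial>lborel) / ?\<rho>
      = (\<integral>z. (tent (z + ?\<rho> *\<^sub>R i) - tent z) / ?\<rho> * ?f z \<partial>lborel)"
    by (simp only: integral_divide_zero[symmetric] times_divide_eq_left)
  finally show ?thesis .
qed

lemma tent_avg_difference_quotient:
  fixes f :: "'a::euclidean_space \<Rightarrow> real"
  assumes [measurable]: "f \<in> borel_measurable borel" and f_bounded: "\<And>x. \<bar>f x\<bar> \<le> S" and t_pos: "0 < t"
    and i_Basis: "i \<in> Basis"
    and r_bounds: "\<And>m. 0 < r m" "\<And>m. r m \<le> 1" "r \<longlonglongrightarrow> 0"
  shows "(\<lambda>m. (tent_avg t f (x - r m *\<^sub>R i) - tent_avg t f x) / r m) \<longlonglongrightarrow> - tent_avg_deriv i t f x"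
proof -
  let ?q = "\<lambda>m z. (tent (z + (r m / t) *\<^sub>R i) - tent z) / (r m / t)"
  have ratio_bounds: "0 < r m / t" "r m / t \<le> 1 / t" for m using r_bounds t_pos
    by (auto simp: divide_right_mono)
  have "(\<lambda>m. r m / t) \<longlonglongrightarrow> 0" using tendsto_divide[OF r_bounds(3) tendsto_const[of t]] t_pos by simp
  then have lim: "(\<lambda>m. ?q m z) \<longlonglongrightarrow> tent_deriv i z" for z
    using ratio_bounds(1) by (intro tent_right_derivative[OF i_Basis])
  have "(\<lambda>m. \<integral>z. ?q m z * f (x + t *\<^sub>R z) \<partial>lborel) \<longlonglongrightarrow> (\<integral>z. tent_deriv i z * f (x + t *\<^sub>R z) \<partial>lborel)"
  proof (rule integral_tendsto_bounded_support[where K=S and R="real DIM('a) + 1 / t"])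
    show "(\<lambda>m. ?q m z * f (x + t *\<^sub>R z)) \<longlonglongrightarrow> tent_deriv i z * f (x + t *\<^sub>R z)" for z
      by (intro tendsto_mult tendsto_const lim)
    show "\<bar>?q m z * f (x + t *\<^sub>R z)\<bar> \<le> S" for m z
    proof -
      have "\<bar>?q m z\<bar> \<le> 1"
        unfolding abs_divide using tent_difference_bound[OF i_Basis, of z "r m / t"] ratio_bounds(1)[of m]
        by (intro divide_le_eq_1[THEN iffD2]) auto
      then have "\<bar>?q m z\<bar> * \<bar>f (x + t *\<^sub>R z)\<bar> \<le> 1 * S" using f_bounded by (intro mult_mono) auto
      then show ?thesis by (simp only: abs_mult mult_1)
    qed
    show "?q m z * f (x + t *\<^sub>R z) = 0" if "real DIM('a) + 1 / t < norm z" for m z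
      using tent_difference_eq_0[OF i_Basis, of "r m / t" z] ratio_bounds[of m] that
      by (simp only: div_0 mult_zero_left)
  qed measurable
  then have "(\<lambda>m. 1 / t * (\<integral>z. ?q m z * f (x + t *\<^sub>R z) \<partial>lborel))
      \<longlonglongrightarrow> 1 / t * (\<integral>z. tent_deriv i z * f (x + t *\<^sub>R z) \<partial>lborel)"
    by (rule tendsto_mult_left)
  then show ?thesis
    unfolding tent_avg_difference[OF assms(1) f_bounded t_pos] tent_avg_deriv_def
    by (simp only: mult_minus_left minus_minus)
qed

lemma test_function_line_derivative:
  assumes "test_function \<phi>" "i \<in> Basis"
  shows "((\<lambda>s. \<phi> (x + s *\<^sub>R i)) has_real_derivative pderiv_dir i \<phi> (x + s *\<^sub>R i)) (at s)"
proof -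
  have "((\<lambda>t. \<phi> ((x + s *\<^sub>R i) + t *\<^sub>R i)) has_real_derivative pderiv_dir i \<phi> (x + s *\<^sub>R i)) (at 0)"
    by (rule test_function_support(3)[OF assms])
  then have "((\<lambda>t. \<phi> (x + (s + t) *\<^sub>R i)) has_real_derivative pderiv_dir i \<phi> (x + s *\<^sub>R i)) (at 0)"
    by (simp add: algebra_simps)
  then show ?thesis using DERIV_shift[of "\<lambda>s. \<phi> (x + s *\<^sub>R i)" _ 0 s] by (simp add: add.commute)
qed

lemma test_function_difference_le:
  assumes \<phi>_test: "test_function \<phi>" and i_Basis: "i \<in> Basis" and pderiv_bounded: "\<And>x. \<bar>pderiv_dir i \<phi> x\<bar> \<le> K"
    and r_pos: "0 < r"
  shows "\<bar>(\<phi> (x + r *\<^sub>R i) - \<phi> x) / r\<bar> \<le> K"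
proof -
  have "\<exists>z>0. z < r \<and> \<phi> (x + r *\<^sub>R i) - \<phi> (x + 0 *\<^sub>R i) = (r - 0) * pderiv_dir i \<phi> (x + z *\<^sub>R i)"
    using r_pos test_function_line_derivative[OF \<phi>_test i_Basis] by (intro MVT2) auto
  then show ?thesis using pderiv_bounded r_pos by (auto simp: abs_mult)
qed

lemma tendsto_integral_test_function_quotient:
  fixes F :: "'a::euclidean_space \<Rightarrow> real"
  assumes [measurable]: "F \<in> borel_measurable borel" and F_bounded: "\<And>x. \<bar>F x\<bar> \<le> S"
    and \<phi>_test: "test_function \<phi>" and i_Basis: "i \<in> Basis" and r_bounds: "\<And>m. 0 < r m" "\<And>m. r m \<le> 1" "r \<longlonglongrightarrow> 0"
  shows "(\<lambda>m. \<integral>x. F x * ((\<phi> (x + r m *\<^sub>R i) - \<phi> x) / r m) \<partial>lborel) \<longlonglongrightarrow> (\<integral>x. F x * pderiv_dir i \<phi> x \<partial>lborel)"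
proof -
  have [measurable]: "\<phi> \<in> borel_measurable borel" "pderiv_dir i \<phi> \<in> borel_measurable borel"
    using test_function_support(1)[OF \<phi>_test] test_function_support(2)[OF \<phi>_test i_Basis]
    by (simp_all add: borel_measurable_continuous_onI)
  obtain R K where \<phi>_bounded: "0 \<le> K" "\<And>x. \<bar>\<phi> x\<bar> \<le> K" "\<And>x. \<bar>pderiv_dir i \<phi> x\<bar> \<le> K"
    and \<phi>_support: "\<And>x. R < norm x \<Longrightarrow> \<phi> x = 0" "\<And>x. R < norm x \<Longrightarrow> pderiv_dir i \<phi> x = 0"
    by (rule test_function_bounded_support[OF \<phi>_test i_Basis]) (rule that; assumption)
  have S_nonneg: "0 \<le> S" using F_bounded[of 0] by linarith
  show ?thesis
  proof (rule integral_tendsto_bounded_support[where K="S * K" and R="R + 1"])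
    show "(\<lambda>m. F x * ((\<phi> (x + r m *\<^sub>R i) - \<phi> x) / r m)) \<longlonglongrightarrow> F x * pderiv_dir i \<phi> x" for x
    proof (intro tendsto_mult tendsto_const)
      have "((\<lambda>h. (\<phi> (x + h *\<^sub>R i) - \<phi> x) / h) \<longlongrightarrow> pderiv_dir i \<phi> x) (at 0)"
        using test_function_support(3)[OF \<phi>_test i_Basis, of x] by (simp add: DERIV_def)
      then show "(\<lambda>m. (\<phi> (x + r m *\<^sub>R i) - \<phi> x) / r m) \<longlonglongrightarrow> pderiv_dir i \<phi> x"
      proof (rule filterlim_compose)
        have "r m \<noteq> 0" for m using r_bounds(1)[of m] by simp
        then show "filterlim r (at 0) sequentially" using r_bounds(3) by (simp add: filterlim_at)
      qed
    qed
    show "\<bar>F x * ((\<phi> (x + r m *\<^sub>R i) - \<phi> x) / r m)\<bar> \<le> S * K" for m x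
      unfolding abs_mult
      by (intro mult_mono F_bounded test_function_difference_le[OF \<phi>_test i_Basis \<phi>_bounded(3) r_bounds(1)]
        S_nonneg) simp
    fix m and x :: 'a assume norm_x_gt: "R + 1 < norm x"
    have "norm x \<le> norm (x + r m *\<^sub>R i) + r m"
      using norm_triangle_ineq4[of "x + r m *\<^sub>R i" "r m *\<^sub>R i"] r_bounds(1)[of m] i_Basis by simp
    then have "R < norm (x + r m *\<^sub>R i)" "R < norm x" using norm_x_gt r_bounds(2)[of m] by linarith+
    then show "F x * ((\<phi> (x + r m *\<^sub>R i) - \<phi> x) / r m) = 0" using \<phi>_support by simp
  qed measurable
qed

lemma integral_mult_difference_quotient_test_function:
  fixes F :: "'a::euclidean_space \<Rightarrow> real"
  assumes [measurable]: "F \<in> borel_measurable borel" and F_bounded: "\<And>x. \<bar>F x\<bar> \<le> S"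
    and \<phi>_test: "test_function \<phi>" and i_Basis: "i \<in> Basis"
  shows "(\<integral>x. F x * ((\<phi> (x + r *\<^sub>R i) - \<phi> x) / r) \<partial>lborel) = (\<integral>x. (F (x - r *\<^sub>R i) - F x) / r * \<phi> x \<partial>lborel)"
proof -
  have [measurable]: "\<phi> \<in> borel_measurable borel"
    using test_function_support(1)[OF \<phi>_test] by (rule borel_measurable_continuous_onI)
  obtain R K where \<phi>_bounded: "0 \<le> K" "\<And>x. \<bar>\<phi> x\<bar> \<le> K" and \<phi>_support: "\<And>x. R < norm x \<Longrightarrow> \<phi> x = 0"
    by (rule test_function_bounded_support[OF \<phi>_test i_Basis]) (rule that; assumption)
  have S_nonneg: "0 \<le> S" using F_bounded[of 0] by linarith
  have int: "integrable lborel (\<lambda>x. F (x - v) * \<phi> x)" for v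
    using \<phi>_support F_bounded \<phi>_bounded S_nonneg
    by (intro integrable_bounded_support[where K="S * K" and R=R]) (auto simp: abs_mult intro!: mult_mono)
  have "integrable lborel (\<lambda>x. F x * \<phi> (x + r *\<^sub>R i))"
    using integrable_lborel_shift[OF int[of "r *\<^sub>R i"], of "r *\<^sub>R i"] by simp
  then have "(\<integral>x. F x * ((\<phi> (x + r *\<^sub>R i) - \<phi> x) / r) \<partial>lborel)
      = ((\<integral>x. F x * \<phi> (x + r *\<^sub>R i) \<partial>lborel) - (\<integral>x. F x * \<phi> x \<partial>lborel)) / r"
    using int[of 0] by (simp only: times_divide_eq_right right_diff_distrib integral_divide_zero diff_zero
        Bochner_Integration.integral_diff)
  also have "\<dots> = ((\<integral>x. F (x - r *\<^sub>R i) * \<phi> x \<partial>lborel) - (\<integral>x. F x * \<phi> x \<partial>lborel)) / r"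
    using lborel_integral_shift[of "\<lambda>x. F (x - r *\<^sub>R i) * \<phi> x" "r *\<^sub>R i"] by simp
  also have "\<dots> = (\<integral>x. F (x - r *\<^sub>R i) * \<phi> x - F x * \<phi> x \<partial>lborel) / r"
    using int[of 0] int[of "r *\<^sub>R i"] by simp
  also have "\<dots> = (\<integral>x. (F (x - r *\<^sub>R i) - F x) / r * \<phi> x \<partial>lborel)"
    by (subst integral_divide_zero[symmetric]) (simp add: left_diff_distrib)
  finally show ?thesis .
qed

lemma weak_pderivI_difference_quotient:
  fixes F G :: "'a::euclidean_space \<Rightarrow> real"
  assumes [measurable]: "F \<in> borel_measurable borel" "G \<in> borel_measurable borel" and i_Basis: "i \<in> Basis"
    and F_bounded: "\<And>x. \<bar>F x\<bar> \<le> S" and F_lipschitz: "\<And>x r. 0 < r \<Longrightarrow> \<bar>F (x - r *\<^sub>R i) - F x\<bar> \<le> L * r"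
    and r_bounds: "\<And>m. 0 < r m" "\<And>m. r m \<le> 1" "r \<longlonglongrightarrow> 0"
    and lim: "\<And>x. (\<lambda>m. (F (x - r m *\<^sub>R i) - F x) / r m) \<longlonglongrightarrow> - G x"
    and \<phi>_test: "test_function \<phi>"
  shows "(\<integral>x. F x * pderiv_dir i \<phi> x \<partial>lborel) = - (\<integral>x. G x * \<phi> x \<partial>lborel)"
proof -
  have [measurable]: "\<phi> \<in> borel_measurable borel"
    using test_function_support(1)[OF \<phi>_test] by (rule borel_measurable_continuous_onI)
  obtain R K where \<phi>_bounded: "0 \<le> K" "\<And>x. \<bar>\<phi> x\<bar> \<le> K" and \<phi>_support: "\<And>x. R < norm x \<Longrightarrow> \<phi> x = 0"
    by (rule test_function_bounded_support[OF \<phi>_test i_Basis]) (rule that; assumption)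
  have "(\<lambda>m. \<integral>x. (F (x - r m *\<^sub>R i) - F x) / r m * \<phi> x \<partial>lborel) \<longlonglongrightarrow> (\<integral>x. - G x * \<phi> x \<partial>lborel)"
  proof (rule integral_tendsto_bounded_support[where K="L * K" and R=R])
    show "(\<lambda>m. (F (x - r m *\<^sub>R i) - F x) / r m * \<phi> x) \<longlonglongrightarrow> - G x * \<phi> x" for x
      by (intro tendsto_mult tendsto_const lim)
    show "\<bar>(F (x - r m *\<^sub>R i) - F x) / r m * \<phi> x\<bar> \<le> L * K" for m x
    proof -
      have "\<bar>(F (x - r m *\<^sub>R i) - F x) / r m\<bar> \<le> L"
        using F_lipschitz[OF r_bounds(1)[of m], of x] r_bounds(1)[of m] by (simp add: field_simps)
      moreover from this have "0 \<le> L" by linarith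
      ultimately show ?thesis unfolding abs_mult by (intro mult_mono \<phi>_bounded(2)) simp_all
    qed
  qed (use \<phi>_support in auto)
  moreover have "(\<lambda>m. \<integral>x. (F (x - r m *\<^sub>R i) - F x) / r m * \<phi> x \<partial>lborel) \<longlonglongrightarrow> (\<integral>x. F x * pderiv_dir i \<phi> x \<partial>lborel)"
    using tendsto_integral_test_function_quotient[OF assms(1) F_bounded \<phi>_test i_Basis r_bounds]
    by (simp only: integral_mult_difference_quotient_test_function[OF assms(1) F_bounded \<phi>_test i_Basis])
  ultimately have "(\<integral>x. F x * pderiv_dir i \<phi> x \<partial>lborel) = (\<integral>x. - G x * \<phi> x \<partial>lborel)"
    by (rule LIMSEQ_unique[rotated])
  then show ?thesis by simp
qed

lemma tent_avg_weak_derivative: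
  fixes f :: "'a::euclidean_space \<Rightarrow> real"
  assumes [measurable]: "f \<in> borel_measurable borel" and f_bounded: "\<And>x. \<bar>f x\<bar> \<le> S" and t_pos: "0 < t"
    and i_Basis: "i \<in> Basis"
    and \<phi>_test: "test_function \<phi>"
  shows "(\<integral>x. tent_avg t f x * pderiv_dir i \<phi> x \<partial>lborel) = - (\<integral>x. tent_avg_deriv i t f x * \<phi> x \<partial>lborel)"
proof -
  let ?r = "\<lambda>m. inverse (real (Suc m))"
  have r_bounds: "0 < ?r m" "?r m \<le> 1" for m by (auto simp: inverse_le_1_iff)
  show ?thesis
  proof (rule weak_pderivI_difference_quotient[OF _ _ i_Basis _ _ r_bounds LIMSEQ_inverse_real_of_nat _ \<phi>_test])
    show "\<bar>tent_avg t f x\<bar> \<le> S" for x by (rule tent.avg_abs_le[OF assms(1) f_bounded])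
    show "\<bar>tent_avg t f (x - r *\<^sub>R i) - tent_avg t f x\<bar> \<le> S * (2 * real DIM('a) / t) * r" if "0 < r" for x r
      using tent_avg_lipschitz[OF assms(1) f_bounded t_pos, of x "- (r *\<^sub>R i)"] that i_Basis by simp
    show "(\<lambda>m. (tent_avg t f (x - ?r m *\<^sub>R i) - tent_avg t f x) / ?r m) \<longlonglongrightarrow> - tent_avg_deriv i t f x" for x
      by (rule tent_avg_difference_quotient[OF assms(1) f_bounded t_pos i_Basis r_bounds
        LIMSEQ_inverse_real_of_nat])
  qed measurable
qed

section \<open>The derivative of a tent average as an average of Haar functions\<close>

lemma distr_cell_pos:
  "distr cube_measure cube_measure (cell_pos k) = (cube_measure :: 'a::euclidean_space measure)"
proof (rule measure_eqI)
  fix A :: "'a set" assume "A \<in> sets (distr cube_measure cube_measure (cell_pos k))"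
  then have [measurable]: "A \<in> sets borel" by simp
  have "emeasure (distr cube_measure cube_measure (cell_pos k)) A
      = (\<integral>\<^sup>+u. indicator A u \<partial>distr cube_measure cube_measure (cell_pos k))"
    by simp
  also have "\<dots> = (\<integral>\<^sup>+u. 1 * indicator A (cell_pos k u) \<partial>cube_measure)"
    by (subst nn_integral_distr) auto
  also have "\<dots> = (\<integral>\<^sup>+u. 1 \<partial>(cube_measure :: 'a measure)) * (\<integral>\<^sup>+u. indicator A u \<partial>cube_measure)"
    by (rule nn_integral_cell_independent) auto
  also have "\<dots> = emeasure cube_measure A" by simp
  finally show "emeasure (distr cube_measure cube_measure (cell_pos k)) A = emeasure cube_measure A" .
qed simp

definition haar :: "'a::euclidean_space \<Rightarrow> 'a \<Rightarrow> real" where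
  "haar i v = (if v \<bullet> i < 1/2 then 1 else -1) * (\<Prod>b\<in>Basis - {i}. max 0 (1 - \<bar>2 * (v \<bullet> b) - 1\<bar>))"

lemma haar_measurable [measurable]: "haar i \<in> borel_measurable borel"
  unfolding haar_def[abs_def] by measurable

lemma haar_abs_le_1: "\<bar>haar i v\<bar> \<le> 1"
proof -
  have "\<bar>\<Prod>b\<in>Basis - {i}. max 0 (1 - \<bar>2 * (v \<bullet> b) - 1\<bar>)\<bar> \<le> (1::real)"
    unfolding abs_prod by (intro prod_le_1) auto
  then show ?thesis by (simp add: haar_def abs_mult)
qed

lemma tent_deriv_rescaled:
  fixes v :: "'a::euclidean_space"
  assumes i_Basis: "i \<in> Basis"
  shows "tent_deriv i (2 *\<^sub>R v - One) = indicator unit_cube v * haar i v"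
proof -
  have coord: "(2 *\<^sub>R v - One) \<bullet> b = 2 * (v \<bullet> b) - 1" if "b \<in> Basis" for b
    using that by (simp add: inner_diff_left)
  have other_coords: "(\<Prod>b\<in>Basis - {i}. max 0 (1 - \<bar>(2 *\<^sub>R v - One) \<bullet> b\<bar>))
      = (\<Prod>b\<in>Basis - {i}. max 0 (1 - \<bar>2 * (v \<bullet> b) - 1\<bar>))"
    using coord by (intro prod.cong) auto
  show ?thesis
  proof (cases "v \<in> unit_cube")
    case True
    then have "0 \<le> v \<bullet> i" "v \<bullet> i < 1" using i_Basis by (auto simp: unit_cube_def)
    then show ?thesis using True unfolding tent_deriv_def other_coords haar_def coord[OF i_Basis] by auto
  next
    case False
    then obtain b where b_bounds: "b \<in> Basis" "\<not> (0 \<le> v \<bullet> b \<and> v \<bullet> b < 1)" by (auto simp: unit_cube_def)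
    show ?thesis
    proof (cases "b = i")
      case True
      then show ?thesis using b_bounds False unfolding tent_deriv_def coord[OF i_Basis] by auto
    next
      case other: False
      have "(\<Prod>b\<in>Basis - {i}. max 0 (1 - \<bar>2 * (v \<bullet> b) - 1\<bar>)) = 0"
        using b_bounds other by (intro prod_zero bexI[of _ b]) (auto simp: max_def abs_if)
      then show ?thesis using False unfolding tent_deriv_def other_coords by simp
    qed
  qed
qed

lemma lborel_integral_affine:
  fixes f :: "'a::euclidean_space \<Rightarrow> real"
  assumes [measurable]: "f \<in> borel_measurable borel" and c_pos: "c > 0"
  shows "(\<integral>x. f x \<partial>lborel) = c ^ DIM('a) * (\<integral>x. f (t + c *\<^sub>R x) \<partial>lborel)"
  using c_pos by (subst lborel_affine[of c t]) (simp_all add: integral_density integral_distr)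

lemma tent_avg_deriv_eq_haar_integral:
  fixes f :: "'a::euclidean_space \<Rightarrow> real"
  assumes [measurable]: "f \<in> borel_measurable borel" and i_Basis: "i \<in> Basis"
  shows "tent_avg_deriv i (1 / 2 ^ Suc k) f x
    = - (2 ^ Suc DIM('a)) * (\<integral>u. haar i (cell_pos k u) * (2 ^ k * f (x + u - cell_centre k u)) \<partial>cube_measure)"
proof -
  let ?t = "1 / 2 ^ Suc k :: real"
  let ?f = "\<lambda>v. f (x + (1 / 2 ^ k) *\<^sub>R (v - (1/2) *\<^sub>R One))"
  let ?\<Phi> = "\<lambda>v. haar i v * (2 ^ k * ?f v)"
  have recentre: "x + ?t *\<^sub>R (- One + 2 *\<^sub>R v) = x + (1 / 2 ^ k) *\<^sub>R (v - (1/2) *\<^sub>R One)" for v :: 'a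
    by (simp add: algebra_simps)
  have "(\<integral>z. tent_deriv i z * f (x + ?t *\<^sub>R z) \<partial>lborel)
     = 2 ^ DIM('a) * (\<integral>v. tent_deriv i (- One + 2 *\<^sub>R v) * f (x + ?t *\<^sub>R (- One + 2 *\<^sub>R v)) \<partial>lborel)"
    by (rule lborel_integral_affine) auto
  also have "(\<integral>v. tent_deriv i (- One + 2 *\<^sub>R v) * f (x + ?t *\<^sub>R (- One + 2 *\<^sub>R v)) \<partial>lborel)
     = (\<integral>v. indicator unit_cube v * (haar i v * ?f v) \<partial>lborel)"
    using tent_deriv_rescaled[OF i_Basis] unfolding recentre by (simp add: mult.assoc)
  also have "\<dots> = (\<integral>v. haar i v * ?f v \<partial>cube_measure)"
    unfolding cube_measure_def ennreal_indicator[symmetric] by (subst integral_density) auto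
  finally have "tent_avg_deriv i ?t f x = - (2 ^ Suc DIM('a)) * (2 ^ k * (\<integral>v. haar i v * ?f v \<partial>cube_measure))"
    unfolding tent_avg_deriv_def by simp
  also have "2 ^ k * (\<integral>v. haar i v * ?f v \<partial>cube_measure) = (\<integral>v. ?\<Phi> v \<partial>cube_measure)"
    by (subst integral_mult_right_zero[symmetric]) (simp add: mult.left_commute)
  also have "\<dots> = (\<integral>v. ?\<Phi> v \<partial>distr cube_measure cube_measure (cell_pos k))" by (simp only: distr_cell_pos)
  also have "\<dots> = (\<integral>u. ?\<Phi> (cell_pos k u) \<partial>cube_measure)" by (rule integral_distr) measurable
  also have "\<dots> = (\<integral>u. haar i (cell_pos k u) * (2 ^ k * f (x + u - cell_centre k u)) \<partial>cube_measure)"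
    unfolding cell_centre_diff[symmetric] by (simp add: algebra_simps)
  finally show ?thesis .
qed

lemma haar_flip:
  assumes i_Basis: "i \<in> Basis"
  shows "haar i (cell_pos k (cell_flip i k u)) = - haar i (cell_pos k u)"
    and "j < k \<Longrightarrow> haar i (cell_pos j (cell_flip i k u)) = haar i (cell_pos j u)"
proof -
  have "(\<Prod>b\<in>Basis - {i}. max 0 (1 - \<bar>2 * (cell_pos j (cell_flip i k u) \<bullet> b) - 1\<bar>))
      = (\<Prod>b\<in>Basis - {i}. max 0 (1 - \<bar>2 * (cell_pos j u \<bullet> b) - 1\<bar>))" for j
    using cell_pos_cell_flip_other[OF _ i_Basis] by (intro prod.cong) auto
  then show "haar i (cell_pos k (cell_flip i k u)) = - haar i (cell_pos k u)"
    "j < k \<Longrightarrow> haar i (cell_pos j (cell_flip i k u)) = haar i (cell_pos j u)"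
    unfolding haar_def
    using cell_pos_cell_flip_half[OF i_Basis, of k u] cell_pos_cell_flip_less[OF i_Basis, of j k u] by auto
qed

lemma abs_haar_mult_le: "\<bar>y\<bar> \<le> A \<Longrightarrow> \<bar>haar i v * y\<bar> \<le> A"
  using mult_mono[OF haar_abs_le_1[of i v], of "\<bar>y\<bar>" A] by (simp add: abs_mult)

lemma flip_martingale_haar:
  fixes a :: "nat \<Rightarrow> 'a::euclidean_space \<Rightarrow> real"
  assumes i_Basis: "i \<in> Basis" and [measurable]: "\<And>k. a k \<in> borel_measurable borel"
    and a_le_1: "\<And>k x. \<bar>a k x\<bar> \<le> 1"
  shows "flip_martingale cube_measure (cell_flip i) (\<lambda>_. 0)
    (\<lambda>k u. haar i (cell_pos k u) * a k (s - cell_centre k u)) (\<lambda>k u. a k (s - cell_centre k u) \<noteq> 0)"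
proof (rule flip_martingale.intro[OF prob_space_cube_measure], unfold_locales)
  note centre = cell_centre_cell_flip[OF i_Basis]
  show "cell_flip i k \<in> measurable cube_measure cube_measure" for k by measurable
  show "distr cube_measure cube_measure (cell_flip i k) = cube_measure" for k
    by (rule distr_cell_flip[OF i_Basis])
  show "\<bar>haar i (cell_pos k u) * a k (s - cell_centre k u)\<bar> \<le> 1" for k u by (rule abs_haar_mult_le[OF a_le_1])
  show "haar i (cell_pos k (cell_flip i k u)) * a k (s - cell_centre k (cell_flip i k u))
     = - (haar i (cell_pos k u) * a k (s - cell_centre k u))" for k u
    using haar_flip(1)[OF i_Basis] centre[of k k u] by simp
  show "haar i (cell_pos j (cell_flip i k u)) * a j (s - cell_centre j (cell_flip i k u))
     = haar i (cell_pos j u) * a j (s - cell_centre j u)" if "j < k" for j k u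
    using haar_flip(2)[OF i_Basis that] centre[of j k u] that by simp
  show "(a j (s - cell_centre j (cell_flip i k u)) \<noteq> 0) = (a j (s - cell_centre j u) \<noteq> 0)" if "j \<le> k" for j k u
    using centre[OF that] by simp
qed auto

definition near_support :: "real \<Rightarrow> (nat \<Rightarrow> 'a::euclidean_space \<Rightarrow> real) \<Rightarrow> nat \<Rightarrow> 'a \<Rightarrow> bool" where
  "near_support \<kappa> b k x \<longleftrightarrow> (\<exists>c. b k c \<noteq> 0 \<and> dist x c < \<kappa> / 2 ^ k)"

lemma near_support_measurable [measurable]: "Measurable.pred borel (near_support \<kappa> b k)"
proof -
  have "{x. near_support \<kappa> b k x} = (\<Union>c\<in>{c. b k c \<noteq> 0}. ball c (\<kappa> / 2 ^ k))"
    by (auto simp: near_support_def dist_commute)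
  then have "open {x. near_support \<kappa> b k x}" by auto
  then show ?thesis by (simp add: pred_def borel_open)
qed

definition haar_sum :: "'a::euclidean_space \<Rightarrow> (nat \<Rightarrow> 'a \<Rightarrow> real) \<Rightarrow> nat \<Rightarrow> 'a \<Rightarrow> 'a \<Rightarrow> real" where
  "haar_sum i a K s u = (\<Sum>k<K. haar i (cell_pos k u) * a k (s - cell_centre k u))"

(* Thinning to the positions near the centres of the cells turns the condition at cell_centre k u into one near u. *)
lemma count_moment_cell_centre_le:
  fixes a :: "nat \<Rightarrow> 'a::euclidean_space \<Rightarrow> real"
  assumes [measurable]: "\<And>k. a k \<in> borel_measurable borel" and q_pos: "0 < q"
    and \<rho>_bounds: "0 < \<rho>" "\<rho> < 1/2" "real DIM('a) * \<rho> < \<kappa>"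
  shows "count_moment cube_measure q (\<lambda>k u. a k (s - cell_centre k u) \<noteq> 0) K
    \<le> ennreal (thinning_const q (1 / (2 * \<rho>) ^ DIM('a)))
       * count_moment cube_measure q (\<lambda>k u. near_support \<kappa> a k (s - u)) K"
proof -
  interpret cube: prob_space "cube_measure :: 'a measure" by (rule prob_space_cube_measure)
  let ?e = "\<lambda>k u. a k (s - cell_centre k u) \<noteq> 0"
  let ?e' = "\<lambda>k u. ?e k u \<and> cell_pos k u \<in> central_box \<rho>"
  have "near_support \<kappa> a k (s - u)" if "?e' k u" for k u
  proof -
    have "dist (s - u) (s - cell_centre k u) = norm (u - cell_centre k u)"
      by (simp add: dist_norm norm_minus_commute)
    also have "\<dots> \<le> real DIM('a) * \<rho> / 2 ^ k" using that by (intro norm_diff_cell_centre_le) simp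
    also have "\<dots> < \<kappa> / 2 ^ k" using \<rho>_bounds by (simp add: divide_strict_right_mono)
    finally show ?thesis unfolding near_support_def using that by blast
  qed
  then have near: "count_moment cube_measure q ?e' K
      \<le> count_moment cube_measure q (\<lambda>k u. near_support \<kappa> a k (s - u)) K"
    using q_pos by (intro count_moment_mono) auto
  have "thinning cube_measure (1 / (2 * \<rho>) ^ DIM('a)) ?e ?e'"
    using \<rho>_bounds by (intro thinning_central_box) (auto simp: cell_centre_def)
  then have "count_moment cube_measure q ?e K
      \<le> ennreal (thinning_const q (1 / (2 * \<rho>) ^ DIM('a))) * count_moment cube_measure q ?e' K"
    using q_pos \<rho>_bounds by (intro cube.count_moment_le_thinned) auto
  also have "\<dots> \<le> ennreal (thinning_const q (1 / (2 * \<rho>) ^ DIM('a)))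
       * count_moment cube_measure q (\<lambda>k u. near_support \<kappa> a k (s - u)) K"
    by (rule mult_left_mono[OF near]) simp
  finally show ?thesis .
qed

lemma nn_integral_haar_sum_le:
  fixes p \<kappa> :: real
  assumes p_gt_1: "1 < p" and \<kappa>_pos: "0 < \<kappa>"
  obtains C :: ennreal where "C < \<infinity>"
    "\<And>(a :: nat \<Rightarrow> 'a::euclidean_space \<Rightarrow> real) i s K. i \<in> Basis \<Longrightarrow> (\<And>k. a k \<in> borel_measurable borel) \<Longrightarrow>
       (\<And>k x. \<bar>a k x\<bar> \<le> 1) \<Longrightarrow>
       (\<integral>\<^sup>+u. ennreal (\<bar>haar_sum i a K s u\<bar> powr p) \<partial>cube_measure)
       \<le> C * count_moment cube_measure (p / 2) (\<lambda>k u. near_support \<kappa> a k (s - u)) K"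
proof -
  have p_half_gt_half: "1/2 < p / 2" using p_gt_1 by simp
  obtain C' where "0 \<le> C'" and square_function: "\<And>(M :: 'a measure) T d e K.
      flip_martingale M T (\<lambda>_. 0) d e \<Longrightarrow> (\<And>k \<omega>. \<not> e k \<omega> \<Longrightarrow> d k \<omega> = 0) \<Longrightarrow>
      (\<integral>\<^sup>+\<omega>. ennreal (\<bar>\<Sum>k<K. d k \<omega>\<bar> powr (2 * (p / 2))) \<partial>M) \<le> ennreal C' * count_moment M (p / 2) e K"
    by (rule square_function_upper[OF p_half_gt_half, where 'b='a]) (rule that; blast)
  define \<rho> where "\<rho> = min (1/4) (\<kappa> / (2 * real DIM('a)))"
  have "real DIM('a) * \<rho> \<le> real DIM('a) * (\<kappa> / (2 * real DIM('a)))" by (intro mult_left_mono) (auto simp: \<rho>_def)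
  also have "\<dots> < \<kappa>" using \<kappa>_pos by simp
  finally have \<rho>_bounds: "0 < \<rho>" "\<rho> < 1/2" "real DIM('a) * \<rho> < \<kappa>" using \<kappa>_pos by (auto simp: \<rho>_def)
  define c where "c = ennreal (thinning_const (p / 2) (1 / (2 * \<rho>) ^ DIM('a)))"
  show ?thesis
  proof (rule that[of "ennreal C' * c"])
    show "ennreal C' * c < \<infinity>" by (simp add: c_def ennreal_mult_less_top)
    fix a :: "nat \<Rightarrow> 'a \<Rightarrow> real" and i s :: 'a and K
    assume i_Basis: "i \<in> Basis" and a_admissible: "\<And>k. a k \<in> borel_measurable borel" "\<And>k x. \<bar>a k x\<bar> \<le> 1"
    have "(\<integral>\<^sup>+u. ennreal (\<bar>haar_sum i a K s u\<bar> powr (2 * (p / 2))) \<partial>cube_measure)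
        \<le> ennreal C' * count_moment cube_measure (p / 2) (\<lambda>k u. a k (s - cell_centre k u) \<noteq> 0) K"
      unfolding haar_sum_def by (rule square_function[OF flip_martingale_haar[OF i_Basis a_admissible]]) simp
    also have "\<dots> \<le> ennreal C' * (c * count_moment cube_measure (p / 2) (\<lambda>k u. near_support \<kappa> a k (s - u)) K)"
      unfolding c_def using p_gt_1
      by (intro mult_left_mono count_moment_cell_centre_le a_admissible \<rho>_bounds) auto
    finally show "(\<integral>\<^sup>+u. ennreal (\<bar>haar_sum i a K s u\<bar> powr p) \<partial>cube_measure)
        \<le> ennreal C' * c * count_moment cube_measure (p / 2) (\<lambda>k u. near_support \<kappa> a k (s - u)) K"
      by (simp add: mult.assoc)
  qed
qed

section \<open>Convergence of tent series in the Sobolev space\<close>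

lemma exists_geometric_subsequence:
  fixes \<epsilon> :: "nat \<Rightarrow> ennreal"
  assumes lim: "\<epsilon> \<longlonglongrightarrow> 0" and \<rho>_pos: "0 < \<rho>"
  obtains r where "strict_mono r" "\<And>n. \<epsilon> (r n) < ennreal (\<rho> ^ n)"
proof -
  have ex_small_index: "\<exists>j>m. \<epsilon> j < ennreal (\<rho> ^ n)" for n m
  proof -
    have "(0::ennreal) < ennreal (\<rho> ^ n)" using \<rho>_pos by simp
    from order_tendstoD(2)[OF lim this] obtain N where "\<And>j. j \<ge> N \<Longrightarrow> \<epsilon> j < ennreal (\<rho> ^ n)"
      by (auto simp: eventually_sequentially)
    then show ?thesis by (intro exI[of _ "Suc (max N m)"]) auto
  qed
  obtain r where "\<And>n. \<epsilon> (r n) < ennreal (\<rho> ^ n)" "\<And>n. r n < r (Suc n)"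
    using dependent_nat_choice[of "\<lambda>n j. \<epsilon> j < ennreal (\<rho> ^ n)" "\<lambda>n i j. i < j"] ex_small_index by blast
  then show ?thesis by (intro that[of r]) (auto simp: strict_mono_Suc_iff)
qed

lemma summable_of_suminf_powr_finite:
  fixes d :: "nat \<Rightarrow> real"
  assumes p_pos: "0 < p" and fin: "(\<Sum>i. ennreal (\<bar>2 ^ i * d i\<bar> powr p)) \<noteq> \<infinity>"
  shows "summable d"
proof -
  obtain s where s_bounds: "0 \<le> s" "(\<Sum>i. ennreal (\<bar>2 ^ i * d i\<bar> powr p)) = ennreal s"
    by (rule ennreal_cases[of "\<Sum>i. ennreal (\<bar>2 ^ i * d i\<bar> powr p)"])
      (use fin in \<open>simp_all only: infinity_ennreal_def not_True_eq_False\<close>)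
  have d_le: "\<bar>d i\<bar> \<le> s powr (1 / p) * (1/2) ^ i" for i
  proof -
    have "ennreal (\<bar>2 ^ i * d i\<bar> powr p) \<le> ennreal s"
      unfolding s_bounds(2)[symmetric] by (rule le_suminf_ennreal[of "\<lambda>i. ennreal (\<bar>2 ^ i * d i\<bar> powr p)"])
    then have "(\<bar>2 ^ i * d i\<bar> powr p) powr (1 / p) \<le> s powr (1 / p)"
      using p_pos s_bounds(1) by (intro powr_mono2) (simp_all add: ennreal_le_iff)
    then have "\<bar>2 ^ i * d i\<bar> \<le> s powr (1 / p)" using p_pos by (simp add: powr_powr)
    then have "\<bar>d i\<bar> \<le> s powr (1 / p) / 2 ^ i" by (simp add: abs_mult pos_le_divide_eq mult.commute)
    then show ?thesis by (simp add: power_one_over)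
  qed
  have "summable (\<lambda>i. s powr (1 / p) * (1/2) ^ i)" by (intro summable_mult summable_geometric) auto
  then show ?thesis by (rule summable_comparison_test'[where N=0]) (simp add: d_le)
qed

lemma AE_summable_of_geometric_powr:
  fixes d :: "nat \<Rightarrow> 'b \<Rightarrow> real"
  assumes p_pos: "0 < p" and [measurable]: "\<And>i. d i \<in> borel_measurable M"
    and d_geometric: "\<And>i. (\<integral>\<^sup>+x. ennreal (\<bar>d i x\<bar> powr p) \<partial>M) \<le> ennreal (((1/4) powr p) ^ i)"
  shows "AE x in M. summable (\<lambda>i. d i x)"
proof -
  have rescaled: "(\<integral>\<^sup>+x. ennreal (\<bar>2 ^ i * d i x\<bar> powr p) \<partial>M) \<le> ennreal (((1/2) powr p) ^ i)" for i
  proof -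
    have "(\<integral>\<^sup>+x. ennreal (\<bar>2 ^ i * d i x\<bar> powr p) \<partial>M)
        = ennreal ((2 ^ i) powr p) * (\<integral>\<^sup>+x. ennreal (\<bar>d i x\<bar> powr p) \<partial>M)"
      by (subst nn_integral_cmult[symmetric]) (auto simp: ennreal_mult abs_mult powr_mult)
    also have "\<dots> \<le> ennreal ((2 ^ i) powr p) * ennreal (((1/4) powr p) ^ i)"
      by (intro mult_left_mono d_geometric) simp
    also have "(2 ^ i :: real) powr p = (2 powr p) ^ i"
      by (simp add: powr_power powr_powr mult.commute flip: powr_realpow)
    also have "ennreal ((2 powr p) ^ i) * ennreal (((1/4) powr p) ^ i)
        = ennreal ((2 powr p) ^ i * ((1/4) powr p) ^ i)"
      by (rule ennreal_mult[symmetric]) simp_all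
    also have "(2 powr p) ^ i * ((1/4 :: real) powr p) ^ i = ((1/2) powr p) ^ i"
      unfolding power_mult_distrib[symmetric] powr_mult[symmetric] by simp
    finally show ?thesis .
  qed
  have "(\<integral>\<^sup>+x. (\<Sum>i. ennreal (\<bar>2 ^ i * d i x\<bar> powr p)) \<partial>M) = (\<Sum>i. \<integral>\<^sup>+x. ennreal (\<bar>2 ^ i * d i x\<bar> powr p) \<partial>M)"
    by (rule nn_integral_suminf) measurable
  also have "\<dots> \<le> (\<Sum>i. ennreal (((1/2) powr p) ^ i))" by (intro suminf_le rescaled summableI)
  also have "\<dots> < \<infinity>"
  proof -
    have "(1/2 :: real) powr p < 1" using p_pos powr_less_mono2[of p "1/2" 1] by simp
    then have "summable (\<lambda>i. ((1/2 :: real) powr p) ^ i)" by (intro summable_geometric) auto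
    then have "(\<Sum>i. ennreal (((1/2) powr p) ^ i)) \<noteq> top" by (rule ennreal_suminf_neq_top) simp
    then show ?thesis by (simp only: less_top[symmetric] infinity_ennreal_def not_False_eq_True)
  qed
  finally have "AE x in M. (\<Sum>i. ennreal (\<bar>2 ^ i * d i x\<bar> powr p)) \<noteq> \<infinity>" by (intro nn_integral_PInf_AE) auto
  then show ?thesis by (rule eventually_mono) (rule summable_of_suminf_powr_finite[OF p_pos])
qed

lemma nn_integral_powr_diff_le_liminf:
  fixes F :: "nat \<Rightarrow> 'b \<Rightarrow> real"
  assumes p_pos: "0 < p" and [measurable]: "\<And>i. F i \<in> borel_measurable M" "h \<in> borel_measurable M"
    and lim: "AE x in M. (\<lambda>i. F i x) \<longlonglongrightarrow> v x"
    and diff_le: "eventually (\<lambda>i. (\<integral>\<^sup>+x. ennreal (\<bar>F i x - h x\<bar> powr p) \<partial>M) \<le> c) sequentially"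
  shows "(\<integral>\<^sup>+x. ennreal (\<bar>v x - h x\<bar> powr p) \<partial>M) \<le> c"
proof -
  have "(\<integral>\<^sup>+x. ennreal (\<bar>v x - h x\<bar> powr p) \<partial>M) \<le> (\<integral>\<^sup>+x. liminf (\<lambda>i. ennreal (\<bar>F i x - h x\<bar> powr p)) \<partial>M)"
  proof (rule nn_integral_mono_AE)
    show "AE x in M. ennreal (\<bar>v x - h x\<bar> powr p) \<le> liminf (\<lambda>i. ennreal (\<bar>F i x - h x\<bar> powr p))"
      using lim
    proof eventually_elim
      case (elim x)
      then have "(\<lambda>i. \<bar>F i x - h x\<bar>) \<longlonglongrightarrow> \<bar>v x - h x\<bar>" by (intro tendsto_intros)
      then have "(\<lambda>i. \<bar>F i x - h x\<bar> powr p) \<longlonglongrightarrow> \<bar>v x - h x\<bar> powr p"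
        using p_pos by (intro tendsto_powr') (auto intro: tendsto_const)
      then have "(\<lambda>i. ennreal (\<bar>F i x - h x\<bar> powr p)) \<longlonglongrightarrow> ennreal (\<bar>v x - h x\<bar> powr p)"
        by (rule tendsto_ennrealI)
      from lim_imp_Liminf[OF _ this] show ?case by (simp only: sequentially_bot not_False_eq_True order_refl)
    qed
  qed
  also have "\<dots> \<le> liminf (\<lambda>i. \<integral>\<^sup>+x. ennreal (\<bar>F i x - h x\<bar> powr p) \<partial>M)"
    by (rule nn_integral_liminf) measurable
  also have "\<dots> \<le> liminf (\<lambda>i. c)" by (rule Liminf_mono[OF diff_le])
  also have "\<dots> = c" by (simp add: Liminf_const)
  finally show ?thesis .
qed

lemma Lp_complete:
  fixes G :: "nat \<Rightarrow> 'b \<Rightarrow> real" and \<epsilon> :: "nat \<Rightarrow> ennreal"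
  assumes p_pos: "0 < p" and [measurable]: "\<And>k. G k \<in> borel_measurable M"
    and cauchy: "\<And>J K. J \<le> K \<Longrightarrow> (\<integral>\<^sup>+x. ennreal (\<bar>G K x - G J x\<bar> powr p) \<partial>M) \<le> \<epsilon> J"
    and lim: "\<epsilon> \<longlonglongrightarrow> 0"
  obtains v where "v \<in> borel_measurable M" "\<And>J. (\<integral>\<^sup>+x. ennreal (\<bar>v x - G J x\<bar> powr p) \<partial>M) \<le> \<epsilon> J"
proof -
  obtain r where r_subseq: "strict_mono r" "\<And>n. \<epsilon> (r n) < ennreal (((1/4) powr p) ^ n)"
    using exists_geometric_subsequence[OF lim, of "(1/4) powr p"] by auto
  have "AE x in M. summable (\<lambda>i. G (r (Suc i)) x - G (r i) x)"
  proof (rule AE_summable_of_geometric_powr[OF p_pos])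
    fix i
    have "r i \<le> r (Suc i)" using r_subseq(1) by (simp add: strict_mono_less_eq)
    then show "(\<integral>\<^sup>+x. ennreal (\<bar>G (r (Suc i)) x - G (r i) x\<bar> powr p) \<partial>M) \<le> ennreal (((1/4) powr p) ^ i)"
      using cauchy r_subseq(2)[of i] by (meson less_imp_le order_trans)
  qed measurable
  then have converges: "AE x in M. (\<lambda>i. G (r i) x) \<longlonglongrightarrow> lim (\<lambda>i. G (r i) x)"
  proof eventually_elim
    case (elim x)
    then have "convergent (\<lambda>n. \<Sum>i<n. G (r (Suc i)) x - G (r i) x)" by (simp add: summable_iff_convergent)
    then have "convergent (\<lambda>n. (G (r n) x - G (r 0) x) + G (r 0) x)"
      by (intro convergent_add convergent_const) (simp only: sum_lessThan_telescope[of "\<lambda>i. G (r i) x"])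
    then show ?case by (simp add: convergent_LIMSEQ_iff)
  qed
  show ?thesis
  proof (rule that)
    show "(\<lambda>x. lim (\<lambda>i. G (r i) x)) \<in> borel_measurable M" by measurable
    show "(\<integral>\<^sup>+x. ennreal (\<bar>lim (\<lambda>i. G (r i) x) - G J x\<bar> powr p) \<partial>M) \<le> \<epsilon> J" for J
    proof (rule nn_integral_powr_diff_le_liminf[OF p_pos _ _ converges])
      have "eventually (\<lambda>i. J \<le> r i) sequentially"
        using filterlim_subseq[OF r_subseq(1)] by (simp add: filterlim_at_top)
      then show "eventually (\<lambda>i. (\<integral>\<^sup>+x. ennreal (\<bar>G (r i) x - G J x\<bar> powr p) \<partial>M) \<le> \<epsilon> J) sequentially"
        by eventually_elim (rule cauchy)
    qed measurable
  qed
qed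

lemma nn_integral_count_moment_translate:
  fixes e :: "nat \<Rightarrow> 'a::euclidean_space \<Rightarrow> bool"
  assumes [measurable]: "\<And>k. Measurable.pred borel (e k)"
  shows "(\<integral>\<^sup>+s. count_moment cube_measure q (\<lambda>k u. e k (s - u)) K \<partial>lborel) = count_moment lborel q e K"
proof -
  have "(\<integral>\<^sup>+s. count_moment cube_measure q (\<lambda>k u. e k (s - u)) K \<partial>lborel)
      = (\<integral>\<^sup>+s. (\<integral>\<^sup>+(u::'a). ennreal (real (count_upto e K (s + - u)) powr q) \<partial>cube_measure) \<partial>lborel)"
    by (simp add: count_moment_def count_upto_def)
  also have "\<dots> = (\<integral>\<^sup>+s. (\<integral>\<^sup>+(u::'a). ennreal (real (count_upto e K s) powr q) \<partial>cube_measure) \<partial>lborel)"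
    using nn_integral_skew_translate[of "\<lambda>(s, u). ennreal (real (count_upto e K s) powr q)" "\<lambda>u. - u"] by simp
  also have "\<dots> = count_moment lborel q e K" by (simp add: count_moment_def)
  finally show ?thesis .
qed

lemma near_support_scale:
  assumes "\<And>k. c k \<noteq> 0"
  shows "near_support \<kappa> (\<lambda>k x. c k * b k x) = near_support \<kappa> b"
  using assms by (intro ext) (simp add: near_support_def)

lemma haar_sum_measurable [measurable (raw)]:
  assumes [measurable]: "\<And>k. a k \<in> borel_measurable borel" "f \<in> borel_measurable N" "h \<in> borel_measurable N"
  shows "(\<lambda>z. haar_sum i a K (f z) (h z)) \<in> borel_measurable N"
  unfolding haar_sum_def by measurable

lemma sum_tent_avg_deriv_eq_haar_sum:
  fixes b :: "nat \<Rightarrow> 'a::euclidean_space \<Rightarrow> real"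
  assumes [measurable]: "\<And>k. b k \<in> borel_measurable borel" and b_le: "\<And>k x. \<bar>2 ^ k * b k x\<bar> \<le> A"
    and i_Basis: "i \<in> Basis"
  shows "(\<Sum>k<K. tent_avg_deriv i (1 / 2 ^ Suc k) (b k) x)
    = (\<integral>u. - (2 ^ Suc DIM('a)) * haar_sum i (\<lambda>k x. 2 ^ k * b k x) K (x + u) u \<partial>cube_measure)"
proof -
  interpret cube: prob_space "cube_measure :: 'a measure" by (rule prob_space_cube_measure)
  let ?h = "\<lambda>k u. haar i (cell_pos k u) * (2 ^ k * b k (x + u - cell_centre k u))"
  have int: "integrable cube_measure (?h k)" for k
    by (rule cube.integrable_const_bound[where B=A]) (simp_all add: abs_haar_mult_le[OF b_le])
  have "(\<Sum>k<K. tent_avg_deriv i (1 / 2 ^ Suc k) (b k) x)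
      = - (2 ^ Suc DIM('a)) * (\<Sum>k<K. \<integral>u. ?h k u \<partial>cube_measure)"
    by (simp only: tent_avg_deriv_eq_haar_integral[OF assms(1) i_Basis] sum_distrib_left)
  also have "(\<Sum>k<K. \<integral>u. ?h k u \<partial>cube_measure) = (\<integral>u. (\<Sum>k<K. ?h k u) \<partial>cube_measure)"
    by (rule Bochner_Integration.integral_sum[symmetric]) (rule int)
  finally show ?thesis by (simp only: haar_sum_def integral_mult_right_zero)
qed

lemma nn_integral_sum_tent_avg_deriv_le_haar_sum:
  fixes b :: "nat \<Rightarrow> 'a::euclidean_space \<Rightarrow> real"
  assumes [measurable]: "\<And>k. b k \<in> borel_measurable borel" and b_le: "\<And>k x. \<bar>2 ^ k * b k x\<bar> \<le> A"
    and i_Basis: "i \<in> Basis" and p_ge_1: "1 \<le> p"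
  shows "(\<integral>\<^sup>+x. ennreal (\<bar>\<Sum>k<K. tent_avg_deriv i (1 / 2 ^ Suc k) (b k) x\<bar> powr p) \<partial>lborel)
    \<le> (\<integral>\<^sup>+s. (\<integral>\<^sup>+u. ennreal (\<bar>2 ^ Suc DIM('a) * haar_sum i (\<lambda>k x. 2 ^ k * b k x) K s u\<bar> powr p)
        \<partial>cube_measure) \<partial>lborel)"
proof -
  interpret cube: prob_space "cube_measure :: 'a measure" by (rule prob_space_cube_measure)
  let ?H = "\<lambda>s u. - (2 ^ Suc DIM('a)) * haar_sum i (\<lambda>k x. 2 ^ k * b k x) K s u"
  have "(\<integral>\<^sup>+x. ennreal (\<bar>\<Sum>k<K. tent_avg_deriv i (1 / 2 ^ Suc k) (b k) x\<bar> powr p) \<partial>lborel)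
      \<le> (\<integral>\<^sup>+x. (\<integral>\<^sup>+u. ennreal (\<bar>?H (x + u) u\<bar> powr p) \<partial>cube_measure) \<partial>lborel)"
    unfolding sum_tent_avg_deriv_eq_haar_sum[OF assms(1) b_le i_Basis]
    using p_ge_1 by (intro nn_integral_mono cube.jensen_powr) auto
  also have "\<dots> = (\<integral>\<^sup>+s. (\<integral>\<^sup>+u. ennreal (\<bar>?H s u\<bar> powr p) \<partial>cube_measure) \<partial>lborel)"
    by (rule nn_integral_skew_translate[of "\<lambda>(s, u). ennreal (\<bar>?H s u\<bar> powr p)" "\<lambda>u. u", unfolded prod.case])
      measurable
  finally show ?thesis by (simp only: abs_mult abs_minus_cancel)
qed

lemma nn_integral_sum_tent_avg_deriv_le:
  fixes p \<kappa> A :: real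
  assumes p_gt_1: "1 < p" and \<kappa>_pos: "0 < \<kappa>" and A_pos: "0 < A"
  obtains C :: ennreal where "C < \<infinity>"
    "\<And>(b :: nat \<Rightarrow> 'a::euclidean_space \<Rightarrow> real) i K. i \<in> Basis \<Longrightarrow> (\<And>k. b k \<in> borel_measurable borel) \<Longrightarrow>
       (\<And>k x. \<bar>2 ^ k * b k x\<bar> \<le> A) \<Longrightarrow>
       (\<integral>\<^sup>+x. ennreal (\<bar>\<Sum>k<K. tent_avg_deriv i (1 / 2 ^ Suc k) (b k) x\<bar> powr p) \<partial>lborel)
       \<le> C * count_moment lborel (p / 2) (near_support \<kappa> b) K"
proof -
  interpret cube: prob_space "cube_measure :: 'a measure" by (rule prob_space_cube_measure)
  obtain C :: ennreal where C_finite: "C < \<infinity>" and haar_le: "\<And>(a :: nat \<Rightarrow> 'a \<Rightarrow> real) i s K. i \<in> Basis \<Longrightarrow>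
      (\<And>k. a k \<in> borel_measurable borel) \<Longrightarrow> (\<And>k x. \<bar>a k x\<bar> \<le> 1) \<Longrightarrow>
      (\<integral>\<^sup>+u. ennreal (\<bar>haar_sum i a K s u\<bar> powr p) \<partial>cube_measure)
      \<le> C * count_moment cube_measure (p / 2) (\<lambda>k u. near_support \<kappa> a k (s - u)) K"
    by (rule nn_integral_haar_sum_le[OF p_gt_1 \<kappa>_pos, where 'a='a]) (rule that; blast)
  define c where "c = 2 ^ Suc DIM('a) * A"
  have c_pos: "0 < c" using A_pos by (simp add: c_def)
  show ?thesis
  proof (rule that[of "ennreal (c powr p) * C"])
    show "ennreal (c powr p) * C < \<infinity>" using C_finite by (simp add: ennreal_mult_less_top)
    fix b :: "nat \<Rightarrow> 'a \<Rightarrow> real" and i :: 'a and K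
    assume i_Basis: "i \<in> Basis" and b_borel [measurable]: "\<And>k. b k \<in> borel_measurable borel"
      and b_le: "\<And>k x. \<bar>2 ^ k * b k x\<bar> \<le> A"
    let ?a = "\<lambda>k x. (2 ^ k / A) * b k x"
    let ?H = "\<lambda>s u. haar_sum i ?a K s u"
    let ?N = "\<lambda>s. count_moment cube_measure (p / 2) (\<lambda>k u. near_support \<kappa> b k (s - u)) K"
    have a_le: "\<bar>?a k x\<bar> \<le> 1" for k x using b_le[of k x] A_pos by (simp add: abs_mult)
    have scaled: "2 ^ Suc DIM('a) * haar_sum i (\<lambda>k x. 2 ^ k * b k x) K s u = c * ?H s u" for s u
      using A_pos by (simp add: haar_sum_def c_def sum_distrib_left mult.assoc)
    have "(\<integral>\<^sup>+x. ennreal (\<bar>\<Sum>k<K. tent_avg_deriv i (1 / 2 ^ Suc k) (b k) x\<bar> powr p) \<partial>lborel)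
        \<le> (\<integral>\<^sup>+s. (\<integral>\<^sup>+u. ennreal (\<bar>c * ?H s u\<bar> powr p) \<partial>cube_measure) \<partial>lborel)"
      unfolding scaled[symmetric]
      by (rule nn_integral_sum_tent_avg_deriv_le_haar_sum[OF b_borel b_le i_Basis less_imp_le[OF p_gt_1]])
    also have "\<dots> = (\<integral>\<^sup>+s. ennreal (c powr p) * (\<integral>\<^sup>+u. ennreal (\<bar>?H s u\<bar> powr p) \<partial>cube_measure) \<partial>lborel)"
      using c_pos by (simp add: abs_mult powr_mult ennreal_mult nn_integral_cmult)
    also have "\<dots> \<le> (\<integral>\<^sup>+s. ennreal (c powr p) * (C * ?N s) \<partial>lborel)"
    proof (intro nn_integral_mono mult_left_mono)
      have "near_support \<kappa> ?a = near_support \<kappa> b" using A_pos by (intro near_support_scale) simp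
      then show "(\<integral>\<^sup>+u. ennreal (\<bar>?H s u\<bar> powr p) \<partial>cube_measure) \<le> C * ?N s" for s
        using haar_le[OF i_Basis, of ?a K s] a_le by simp
    qed simp
    also have "\<dots> = ennreal (c powr p) * C * (\<integral>\<^sup>+s. ?N s \<partial>lborel)"
      unfolding count_moment_def count_upto_eq_sum mult.assoc[symmetric] by (rule nn_integral_cmult) measurable
    also have "(\<integral>\<^sup>+s. ?N s \<partial>lborel) = count_moment lborel (p / 2) (near_support \<kappa> b) K"
      by (rule nn_integral_count_moment_translate) measurable
    finally show "(\<integral>\<^sup>+x. ennreal (\<bar>\<Sum>k<K. tent_avg_deriv i (1 / 2 ^ Suc k) (b k) x\<bar> powr p) \<partial>lborel)
       \<le> ennreal (c powr p) * C * count_moment lborel (p / 2) (near_support \<kappa> b) K" .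
  qed
qed

lemma of_bool_suminf_tail_tendsto_0:
  assumes "(\<Sum>k. of_bool (P k)) \<noteq> (\<top>::ennreal)"
  shows "(\<lambda>J. \<Sum>k. of_bool (J \<le> k \<and> P k) :: ennreal) \<longlonglongrightarrow> 0"
proof -
  have "(\<Sum>k. ennreal (of_bool (P k))) \<noteq> \<top>" using assms by (simp add: of_bool_def if_distrib cong: if_cong)
  then have "summable (\<lambda>k. of_bool (P k) :: real)" by (intro summable_suminf_not_top) auto
  from order_tendstoD(2)[OF summable_LIMSEQ_zero[OF this], of "1/2"]
  obtain N where tail_lt: "\<And>k. k \<ge> N \<Longrightarrow> (of_bool (P k) :: real) < 1/2" by (auto simp: eventually_sequentially)
  have "\<not> (J \<le> k \<and> P k)" if "J \<ge> N" for J k using tail_lt[of k] that by (cases "P k") auto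
  then have "(\<Sum>k. of_bool (J \<le> k \<and> P k) :: ennreal) = 0" if "J \<ge> N" for J
    using that by (subst suminf_cong[where g="\<lambda>_. 0"]) (simp_all only: of_bool_eq(1) suminf_zero)
  then have "eventually (\<lambda>J. (\<Sum>k. of_bool (J \<le> k \<and> P k) :: ennreal) = 0) sequentially"
    unfolding eventually_sequentially by blast
  then show ?thesis by (rule tendsto_eventually)
qed

lemma tendsto_enn_powr_0:
  assumes "f \<longlonglongrightarrow> 0" "0 < r"
  shows "(\<lambda>n. enn_powr (f n) r) \<longlonglongrightarrow> 0"
proof (rule order_tendstoI)
  fix a :: ennreal assume a_pos: "0 < a"
  define a' where "a' = min a 1"
  have a'_bounds: "0 < a'" "a' \<le> a" "a' < \<top>" using a_pos by (auto simp: a'_def min_less_iff_disj)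
  then obtain c where a_eq: "a' = ennreal c" "0 < c" by (cases a') auto
  have "0 < ennreal ((c / 2) powr (1 / r))" using a_eq by simp
  from order_tendstoD(2)[OF assms(1) this]
  show "eventually (\<lambda>n. enn_powr (f n) r < a) sequentially"
  proof eventually_elim
    case (elim n)
    have "enn_powr (f n) r \<le> enn_powr (ennreal ((c / 2) powr (1 / r))) r"
      using elim assms(2) by (intro enn_powr_mono) auto
    also have "\<dots> = ennreal (c / 2)" using a_eq assms(2) by (simp add: powr_powr)
    also have "\<dots> < ennreal c" using a_eq by (intro ennreal_lessI) auto
    finally show ?case using a'_bounds a_eq by simp
  qed
qed simp

lemma nn_integral_enn_powr_tail_tendsto_0:
  assumes q_pos: "0 < q" and [measurable]: "\<And>k. Measurable.pred M (e k)"
    and fin: "(\<integral>\<^sup>+x. enn_powr (\<Sum>k. of_bool (e k x)) q \<partial>M) < \<infinity>"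
  shows "(\<lambda>J. \<integral>\<^sup>+x. enn_powr (\<Sum>k. of_bool (J \<le> k \<and> e k x)) q \<partial>M) \<longlonglongrightarrow> 0"
proof -
  have "(\<lambda>J. \<integral>\<^sup>+x. enn_powr (\<Sum>k. of_bool (J \<le> k \<and> e k x)) q \<partial>M) \<longlonglongrightarrow> (\<integral>\<^sup>+x. 0 \<partial>M)"
  proof (rule nn_integral_dominated_convergence[where w="\<lambda>x. enn_powr (\<Sum>k. of_bool (e k x)) q"])
    show "AE x in M. enn_powr (\<Sum>k. of_bool (j \<le> k \<and> e k x)) q \<le> enn_powr (\<Sum>k. of_bool (e k x)) q" for j
      using q_pos by (intro AE_I2 enn_powr_mono suminf_le summableI) auto
    have "AE x in M. enn_powr (\<Sum>k. of_bool (e k x)) q \<noteq> \<infinity>"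
      using fin by (intro nn_integral_PInf_AE) auto
    then show "AE x in M. (\<lambda>J. enn_powr (\<Sum>k. of_bool (J \<le> k \<and> e k x)) q) \<longlonglongrightarrow> 0"
    proof eventually_elim
      case (elim x)
      then have "(\<Sum>k. of_bool (e k x)) \<noteq> (\<top>::ennreal)" by (metis enn_powr_top infinity_ennreal_def)
      from of_bool_suminf_tail_tendsto_0[OF this] show ?case using q_pos by (intro tendsto_enn_powr_0) auto
    qed
  qed (use fin in auto)
  then show ?thesis by simp
qed

lemma nn_integral_mult_bounded_support_threshold_le:
  fixes h \<phi> :: "'a::euclidean_space \<Rightarrow> real"
  assumes [measurable]: "h \<in> borel_measurable borel" and p_ge_1: "1 \<le> p" and \<tau>_pos: "0 < \<tau>"
    and \<phi>_bounded_support: "\<And>x. \<bar>\<phi> x\<bar> \<le> K" "\<And>x. R < norm x \<Longrightarrow> \<phi> x = 0"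
  shows "(\<integral>\<^sup>+x. ennreal \<bar>h x * \<phi> x\<bar> \<partial>lborel) \<le> ennreal K * (ennreal \<tau> * emeasure lborel (cball (0::'a) R)
    + ennreal (\<tau> powr (1 - p)) * (\<integral>\<^sup>+x. ennreal (\<bar>h x\<bar> powr p) \<partial>lborel))"
proof -
  let ?B = "cball (0::'a) R"
  have K_nonneg: "0 \<le> K" using \<phi>_bounded_support(1)[of 0] by linarith
  have [measurable]: "?B \<in> sets borel" by simp
  have ball_integral: "(\<integral>\<^sup>+x. ennreal \<tau> * indicator ?B x \<partial>lborel) = ennreal \<tau> * emeasure lborel ?B"
    by (rule nn_integral_cmult_indicator) simp
  have powr_integral: "(\<integral>\<^sup>+x. ennreal (\<tau> powr (1 - p)) * ennreal (\<bar>h x\<bar> powr p) \<partial>lborel)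
      = ennreal (\<tau> powr (1 - p)) * (\<integral>\<^sup>+x. ennreal (\<bar>h x\<bar> powr p) \<partial>lborel)"
    by (rule nn_integral_cmult) measurable
  have "\<bar>h x * \<phi> x\<bar> \<le> K * (\<tau> * indicator ?B x + \<tau> powr (1 - p) * \<bar>h x\<bar> powr p)" for x
  proof (cases "x \<in> ?B")
    case True
    have "\<bar>h x\<bar> * \<bar>\<phi> x\<bar> \<le> (\<tau> + \<tau> powr (1 - p) * \<bar>h x\<bar> powr p) * K"
      using abs_le_powr_threshold[OF \<tau>_pos p_ge_1] \<phi>_bounded_support(1) \<tau>_pos by (intro mult_mono) auto
    then show ?thesis using True by (simp add: abs_mult mult.commute)
  qed (use \<phi>_bounded_support(2)[of x] K_nonneg in auto)
  then have "(\<integral>\<^sup>+x. ennreal \<bar>h x * \<phi> x\<bar> \<partial>lborel)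
      \<le> (\<integral>\<^sup>+x. ennreal (K * (\<tau> * indicator ?B x + \<tau> powr (1 - p) * \<bar>h x\<bar> powr p)) \<partial>lborel)"
    by (intro nn_integral_mono ennreal_leI)
  also have "\<dots> = (\<integral>\<^sup>+x. ennreal K * (ennreal \<tau> * indicator ?B x
      + ennreal (\<tau> powr (1 - p)) * ennreal (\<bar>h x\<bar> powr p)) \<partial>lborel)"
    using K_nonneg \<tau>_pos
    by (simp only: ennreal_mult ennreal_plus ennreal_indicator powr_ge_zero indicator_pos_le
        mult_nonneg_nonneg add_nonneg_nonneg less_imp_le)
  also have "\<dots> = ennreal K * (\<integral>\<^sup>+x. ennreal \<tau> * indicator ?B x
      + ennreal (\<tau> powr (1 - p)) * ennreal (\<bar>h x\<bar> powr p) \<partial>lborel)"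
    by (rule nn_integral_cmult) measurable
  also have "\<dots> = ennreal K * ((\<integral>\<^sup>+x. ennreal \<tau> * indicator ?B x \<partial>lborel)
      + (\<integral>\<^sup>+x. ennreal (\<tau> powr (1 - p)) * ennreal (\<bar>h x\<bar> powr p) \<partial>lborel))"
    by (subst nn_integral_add) simp_all
  finally show ?thesis unfolding ball_integral powr_integral .
qed

lemma nn_integral_mult_bounded_support_le:
  fixes h \<phi> :: "'a::euclidean_space \<Rightarrow> real"
  assumes h_borel: "h \<in> borel_measurable borel" and p_ge_1: "1 \<le> p"
    and h_le: "(\<integral>\<^sup>+x. ennreal (\<bar>h x\<bar> powr p) \<partial>lborel) \<le> ennreal e" and e_pos: "0 < e"
    and \<phi>_bounded_support: "\<And>x. \<bar>\<phi> x\<bar> \<le> K" "\<And>x. R < norm x \<Longrightarrow> \<phi> x = 0"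
  shows "(\<integral>\<^sup>+x. ennreal \<bar>h x * \<phi> x\<bar> \<partial>lborel)
    \<le> ennreal (K * (measure lborel (cball (0::'a) R) + 1) * e powr (1 / p))"
proof -
  let ?B = "cball (0::'a) R" and ?\<tau> = "e powr (1 / p)"
  have K_nonneg: "0 \<le> K" using \<phi>_bounded_support(1)[of 0] by linarith
  have emeasure_ball: "emeasure lborel ?B = ennreal (measure lborel ?B)"
    using emeasure_bounded_finite[of ?B] by (simp add: emeasure_eq_ennreal_measure)
  have \<tau>_pos: "0 < ?\<tau>" using e_pos by simp
  have "?\<tau> powr (1 - p) * e = ?\<tau> powr (1 - p) * ?\<tau> powr p" using p_ge_1 e_pos by (simp add: powr_powr)
  also have "\<dots> = ?\<tau>" using \<tau>_pos by (simp only: powr_add[symmetric]) simp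
  finally have threshold: "?\<tau> powr (1 - p) * e = ?\<tau>" .
  have "(\<integral>\<^sup>+x. ennreal \<bar>h x * \<phi> x\<bar> \<partial>lborel) \<le> ennreal K * (ennreal ?\<tau> * emeasure lborel ?B
      + ennreal (?\<tau> powr (1 - p)) * (\<integral>\<^sup>+x. ennreal (\<bar>h x\<bar> powr p) \<partial>lborel))"
    by (rule nn_integral_mult_bounded_support_threshold_le[OF h_borel p_ge_1 \<tau>_pos \<phi>_bounded_support])
  also have "\<dots> \<le> ennreal K * (ennreal ?\<tau> * emeasure lborel ?B + ennreal (?\<tau> powr (1 - p)) * ennreal e)"
    by (intro mult_left_mono add_left_mono h_le) auto
  also have "\<dots> = ennreal (K * (?\<tau> * measure lborel ?B + ?\<tau> powr (1 - p) * e))"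
    unfolding emeasure_ball using K_nonneg e_pos by (simp add: ennreal_mult)
  finally show ?thesis unfolding threshold by (simp add: algebra_simps)
qed

lemma tendsto_integral_mult_bounded_support:
  fixes G :: "nat \<Rightarrow> 'a::euclidean_space \<Rightarrow> real"
  assumes [measurable]: "\<And>k. G k \<in> borel_measurable borel" "v \<in> borel_measurable borel"
    "\<phi> \<in> borel_measurable borel"
    and p_ge_1: "1 \<le> p" and G_finite: "\<And>k. (\<integral>\<^sup>+x. ennreal (\<bar>G k x\<bar> powr p) \<partial>lborel) < \<infinity>"
    and v_finite: "(\<integral>\<^sup>+x. ennreal (\<bar>v x\<bar> powr p) \<partial>lborel) < \<infinity>"
    and close: "\<And>k. (\<integral>\<^sup>+x. ennreal (\<bar>v x - G k x\<bar> powr p) \<partial>lborel) \<le> \<epsilon> k"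
    and \<epsilon>_bounds: "\<And>k. \<epsilon> k < \<infinity>" "\<epsilon> \<longlonglongrightarrow> 0"
    and \<phi>_bounded_support: "\<And>x. \<bar>\<phi> x\<bar> \<le> K" "\<And>x. R < norm x \<Longrightarrow> \<phi> x = 0"
  shows "(\<lambda>k. \<integral>x. G k x * \<phi> x \<partial>lborel) \<longlonglongrightarrow> (\<integral>x. v x * \<phi> x \<partial>lborel)"
proof (rule tendsto_L1_int)
  have integrable: "integrable lborel (\<lambda>x. w x * \<phi> x)"
    if "w \<in> borel_measurable borel" "(\<integral>\<^sup>+x. ennreal (\<bar>w x\<bar> powr p) \<partial>lborel) < \<infinity>" for w :: "'a \<Rightarrow> real"
    using integrable_Lp_mult_bounded_support[of w "\<lambda>x. \<phi> (- x)" p K R 0] that p_ge_1 \<phi>_bounded_support by simp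
  show "integrable lborel (\<lambda>x. G k x * \<phi> x)" for k by (rule integrable[OF _ G_finite]) measurable
  show "integrable lborel (\<lambda>x. v x * \<phi> x)" by (rule integrable[OF _ v_finite]) measurable
  define e where "e k = enn2real (\<epsilon> k) + inverse (real (Suc k))" for k
  have e_bounds: "0 < e k" "\<epsilon> k \<le> ennreal (e k)" for k
    using \<epsilon>_bounds(1)[of k] by (auto simp: e_def add_nonneg_pos less_top ennreal_plus simp del: of_nat_Suc)
  have "e \<longlonglongrightarrow> 0 + 0"
    unfolding e_def using tendsto_enn2real[of \<epsilon> 0] \<epsilon>_bounds(2)
    by (intro tendsto_add LIMSEQ_inverse_real_of_nat) auto
  then have "(\<lambda>k. e k powr (1 / p)) \<longlonglongrightarrow> 0"
    using tendsto_powr'[of e 0 sequentially "\<lambda>_. 1 / p" "1 / p"] p_ge_1 e_bounds(1) by (simp add: less_imp_le)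
  then have bound_0: "(\<lambda>k. ennreal (K * (measure lborel (cball (0::'a) R) + 1) * e k powr (1 / p))) \<longlonglongrightarrow> ennreal 0"
    by (intro tendsto_ennrealI tendsto_mult_right_zero)
  show "(\<lambda>k. \<integral>\<^sup>+x. ennreal (norm (G k x * \<phi> x - v x * \<phi> x)) \<partial>lborel) \<longlonglongrightarrow> 0"
  proof (rule tendsto_sandwich[OF always_eventually always_eventually tendsto_const
        bound_0[unfolded ennreal_0]]; rule allI)
    fix k
    have "norm (G k x * \<phi> x - v x * \<phi> x) = \<bar>(v x - G k x) * \<phi> x\<bar>" for x
      by (simp add: left_diff_distrib abs_minus_commute)
    then show "(\<integral>\<^sup>+x. ennreal (norm (G k x * \<phi> x - v x * \<phi> x)) \<partial>lborel)
        \<le> ennreal (K * (measure lborel (cball (0::'a) R) + 1) * e k powr (1 / p))"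
      using nn_integral_mult_bounded_support_le[OF _ p_ge_1 order_trans[OF close e_bounds(2)] e_bounds(1)
        \<phi>_bounded_support] by simp
  qed simp
qed

lemma W1pI_borel:
  fixes g :: "'a::euclidean_space \<Rightarrow> real"
  assumes [measurable]: "g \<in> borel_measurable borel" and g_finite: "(\<integral>\<^sup>+x. ennreal (\<bar>g x\<bar> powr p) \<partial>lborel) < \<infinity>"
    and v_gradient: "Lp_weak_gradient p g v"
  shows "g \<in> W1p p"
proof -
  have LpI: "w \<in> Lp p" if [measurable]: "w \<in> borel_measurable borel"
    and w_finite: "(\<integral>\<^sup>+x. ennreal (\<bar>w x\<bar> powr p) \<partial>lborel) < \<infinity>" for w :: "'a \<Rightarrow> real"
  proof -
    have "integrable lborel (\<lambda>x. \<bar>w x\<bar> powr p)" using w_finite by (intro integrableI_bounded) auto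
    then show ?thesis unfolding Lp_def by (auto simp: integrable_completion measurable_completion)
  qed
  have "v i \<in> Lp p \<and> weak_pderiv i g (v i)" if i_Basis: "i \<in> Basis" for i
  proof
    show "v i \<in> Lp p" using Lp_weak_gradientD(1,2)[OF v_gradient i_Basis] by (rule LpI)
    have [measurable]: "v i \<in> borel_measurable borel" by (rule Lp_weak_gradientD(1)[OF v_gradient i_Basis])
    show "weak_pderiv i g (v i)"
      unfolding weak_pderiv_def
    proof (intro allI impI)
      fix \<phi> :: "'a \<Rightarrow> real" assume \<phi>_test: "test_function \<phi>"
      have [measurable]: "\<phi> \<in> borel_measurable borel" "pderiv_dir i \<phi> \<in> borel_measurable borel"
        using test_function_support(1)[OF \<phi>_test] test_function_support(2)[OF \<phi>_test i_Basis]
        by (simp_all add: borel_measurable_continuous_onI)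
      show "(\<integral>x. g x * pderiv_dir i \<phi> x \<partial>lebesgue) = - (\<integral>x. v i x * \<phi> x \<partial>lebesgue)"
        using Lp_weak_gradientD(3)[OF v_gradient i_Basis \<phi>_test] by (simp add: integral_completion)
    qed
  qed
  then show ?thesis unfolding W1p_def using LpI[OF assms(1) g_finite] by blast
qed

locale tent_series =
  fixes b :: "nat \<Rightarrow> 'a::euclidean_space \<Rightarrow> real" and A :: real
  assumes coeff_measurable [measurable]: "\<And>k. b k \<in> borel_measurable borel"
    and coeff_le: "\<And>k x. \<bar>b k x\<bar> \<le> A * (1/2) ^ k"
begin

definition summand :: "nat \<Rightarrow> 'a \<Rightarrow> real" where
  "summand k = tent_avg (1 / 2 ^ Suc k) (b k)"

definition series :: "'a \<Rightarrow> real" where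
  "series x = (\<Sum>k. summand k x)"

lemma bound_nonneg: "0 \<le> A"
  using coeff_le[of 0 0] by simp

lemma summand_measurable [measurable]: "summand k \<in> borel_measurable borel"
  unfolding summand_def by measurable

lemma series_measurable [measurable]: "series \<in> borel_measurable borel"
  unfolding series_def[abs_def] by measurable

lemma abs_summand_le: "\<bar>summand k x\<bar> \<le> A * (1/2) ^ k"
  unfolding summand_def by (rule tent.avg_abs_le[OF coeff_measurable coeff_le])

lemma bound_sums: "(\<lambda>k. A * (1/2) ^ k) sums (2 * A)"
  using sums_mult[OF geometric_sums[of "1/2::real"], of A] by (simp add: mult.commute)

lemma summable_abs_summand: "summable (\<lambda>k. \<bar>summand k x\<bar>)"
  by (rule summable_comparison_test'[OF sums_summable[OF bound_sums], where N=0])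
    (simp only: real_norm_def abs_abs abs_summand_le)

lemma series_sums: "(\<lambda>k. summand k x) sums series x"
  unfolding series_def by (rule summable_sums[OF summable_rabs_cancel[OF summable_abs_summand]])

lemma sum_abs_summand_le: "(\<Sum>k<K. \<bar>summand k x\<bar>) \<le> 2 * A"
proof -
  have "(\<Sum>k<K. \<bar>summand k x\<bar>) \<le> (\<Sum>k<K. A * (1/2) ^ k)" by (intro sum_mono abs_summand_le)
  also have "\<dots> \<le> (\<Sum>k. A * (1/2) ^ k)"
    using bound_nonneg by (intro sum_le_suminf sums_summable[OF bound_sums]) auto
  finally show ?thesis by (simp only: sums_unique[OF bound_sums, symmetric])
qed

lemma abs_partial_sum_le: "\<bar>\<Sum>k<K. summand k x\<bar> \<le> 2 * A"
  using sum_abs[of "\<lambda>k. summand k x" "{..<K}"] sum_abs_summand_le[of x K] by linarith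

lemma abs_series_le: "\<bar>series x\<bar> \<le> 2 * A"
  using LIMSEQ_le_const2[OF tendsto_rabs[OF series_sums[unfolded sums_def]]] abs_partial_sum_le by blast

definition partial_deriv :: "'a \<Rightarrow> nat \<Rightarrow> 'a \<Rightarrow> real" where
  "partial_deriv i K x = (\<Sum>k<K. tent_avg_deriv i (1 / 2 ^ Suc k) (b k) x)"

lemma partial_deriv_measurable [measurable]: "partial_deriv i K \<in> borel_measurable borel"
  unfolding partial_deriv_def[abs_def] by measurable

lemma scaled_coeff_le: "\<bar>2 ^ k * b k x\<bar> \<le> A"
  using coeff_le[of k x] by (simp add: abs_mult power_one_over pos_le_divide_eq mult.commute)

lemma abs_tent_avg_deriv_le:
  assumes i_Basis: "i \<in> Basis"
  shows "\<bar>tent_avg_deriv i (1 / 2 ^ Suc k) (b k) x\<bar> \<le> 2 ^ Suc DIM('a) * A"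
proof -
  interpret cube: prob_space "cube_measure :: 'a measure" by (rule prob_space_cube_measure)
  let ?h = "\<lambda>u. haar i (cell_pos k u) * (2 ^ k * b k (x + u - cell_centre k u))"
  have h_le: "\<bar>?h u\<bar> \<le> A" for u by (rule abs_haar_mult_le[OF scaled_coeff_le])
  have int: "integrable cube_measure ?h" by (rule cube.integrable_const_bound[where B=A]) (use h_le in auto)
  have "\<bar>\<integral>u. ?h u \<partial>cube_measure\<bar> \<le> (\<integral>u. \<bar>?h u\<bar> \<partial>cube_measure)" by (rule integral_abs_bound)
  also have "\<dots> \<le> (\<integral>u. A \<partial>(cube_measure :: 'a measure))"
    by (intro integral_mono integrable_abs int cube.integrable_const h_le)
  also have "\<dots> = A" using cube.prob_space by simp
  finally have "\<bar>\<integral>u. ?h u \<partial>cube_measure\<bar> \<le> A" .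
  then have "\<bar>- (2 ^ Suc DIM('a))\<bar> * \<bar>\<integral>u. ?h u \<partial>cube_measure\<bar> \<le> 2 ^ Suc DIM('a) * A"
    by (intro mult_mono) auto
  then show ?thesis by (simp only: tent_avg_deriv_eq_haar_integral[OF coeff_measurable i_Basis] abs_mult)
qed

lemma partial_sum_weak_derivative:
  assumes i_Basis: "i \<in> Basis" and \<phi>_test: "test_function \<phi>"
  shows "(\<integral>x. (\<Sum>k<K. summand k x) * pderiv_dir i \<phi> x \<partial>lborel) = - (\<integral>x. partial_deriv i K x * \<phi> x \<partial>lborel)"
proof -
  have [measurable]: "\<phi> \<in> borel_measurable borel" "pderiv_dir i \<phi> \<in> borel_measurable borel"
    using test_function_support(1)[OF \<phi>_test] test_function_support(2)[OF \<phi>_test i_Basis]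
    by (simp_all add: borel_measurable_continuous_onI)
  obtain R B where \<phi>_bounded: "0 \<le> B" "\<And>x. \<bar>\<phi> x\<bar> \<le> B" "\<And>x. \<bar>pderiv_dir i \<phi> x\<bar> \<le> B"
    and \<phi>_support: "\<And>x. R < norm x \<Longrightarrow> \<phi> x = 0" "\<And>x. R < norm x \<Longrightarrow> pderiv_dir i \<phi> x = 0"
    by (rule test_function_bounded_support[OF \<phi>_test i_Basis]) (rule that; assumption)
  have int_summand: "integrable lborel (\<lambda>x. summand k x * pderiv_dir i \<phi> x)" for k
    by (rule integrable_bounded_support[where K="A * (1/2) ^ k * B" and R=R])
      (use abs_summand_le[of k] \<phi>_bounded \<phi>_support bound_nonneg in \<open>auto simp: abs_mult intro!: mult_mono\<close>)
  have int_deriv: "integrable lborel (\<lambda>x. tent_avg_deriv i (1 / 2 ^ Suc k) (b k) x * \<phi> x)" for k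
    by (rule integrable_bounded_support[where K="2 ^ Suc DIM('a) * A * B" and R=R])
      (use abs_tent_avg_deriv_le[OF i_Basis, of k] \<phi>_bounded \<phi>_support bound_nonneg in
        \<open>auto simp: abs_mult intro!: mult_mono\<close>)
  have "(\<integral>x. (\<Sum>k<K. summand k x) * pderiv_dir i \<phi> x \<partial>lborel)
      = (\<Sum>k<K. \<integral>x. summand k x * pderiv_dir i \<phi> x \<partial>lborel)"
    unfolding sum_distrib_right by (rule Bochner_Integration.integral_sum) (rule int_summand)
  also have "\<dots> = (\<Sum>k<K. - (\<integral>x. tent_avg_deriv i (1 / 2 ^ Suc k) (b k) x * \<phi> x \<partial>lborel))"
    unfolding summand_def
    by (intro sum.cong refl tent_avg_weak_derivative[OF coeff_measurable coeff_le _ i_Basis \<phi>_test]) simp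
  also have "\<dots> = - (\<Sum>k<K. \<integral>x. tent_avg_deriv i (1 / 2 ^ Suc k) (b k) x * \<phi> x \<partial>lborel)" by (simp add: sum_negf)
  also have "(\<Sum>k<K. \<integral>x. tent_avg_deriv i (1 / 2 ^ Suc k) (b k) x * \<phi> x \<partial>lborel)
      = (\<integral>x. partial_deriv i K x * \<phi> x \<partial>lborel)"
    unfolding partial_deriv_def sum_distrib_right
    by (rule Bochner_Integration.integral_sum[symmetric]) (rule int_deriv)
  finally show ?thesis .
qed

lemma series_weak_derivative:
  assumes p_ge_1: "1 \<le> p" and i_Basis: "i \<in> Basis" and \<phi>_test: "test_function \<phi>"
    and [measurable]: "v \<in> borel_measurable borel" and v_finite: "(\<integral>\<^sup>+x. ennreal (\<bar>v x\<bar> powr p) \<partial>lborel) < \<infinity>"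
    and deriv: "\<And>K. (\<integral>\<^sup>+x. ennreal (\<bar>partial_deriv i K x\<bar> powr p) \<partial>lborel) < \<infinity>"
    and close: "\<And>K. (\<integral>\<^sup>+x. ennreal (\<bar>v x - partial_deriv i K x\<bar> powr p) \<partial>lborel) \<le> \<epsilon> K"
    and \<epsilon>_bounds: "\<And>K. \<epsilon> K < \<infinity>" "\<epsilon> \<longlonglongrightarrow> 0"
  shows "(\<integral>x. series x * pderiv_dir i \<phi> x \<partial>lborel) = - (\<integral>x. v x * \<phi> x \<partial>lborel)"
proof -
  have [measurable]: "\<phi> \<in> borel_measurable borel" "pderiv_dir i \<phi> \<in> borel_measurable borel"
    using test_function_support(1)[OF \<phi>_test] test_function_support(2)[OF \<phi>_test i_Basis]
    by (simp_all add: borel_measurable_continuous_onI)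
  obtain R B where \<phi>_bounded: "0 \<le> B" "\<And>x. \<bar>\<phi> x\<bar> \<le> B" "\<And>x. \<bar>pderiv_dir i \<phi> x\<bar> \<le> B"
    and \<phi>_support: "\<And>x. R < norm x \<Longrightarrow> \<phi> x = 0" "\<And>x. R < norm x \<Longrightarrow> pderiv_dir i \<phi> x = 0"
    by (rule test_function_bounded_support[OF \<phi>_test i_Basis]) (rule that; assumption)
  have "(\<lambda>K. \<integral>x. (\<Sum>k<K. summand k x) * pderiv_dir i \<phi> x \<partial>lborel) \<longlonglongrightarrow> (\<integral>x. series x * pderiv_dir i \<phi> x \<partial>lborel)"
  proof (rule integral_tendsto_bounded_support[where K="2 * A * B" and R=R])
    show "(\<lambda>K. (\<Sum>k<K. summand k x) * pderiv_dir i \<phi> x) \<longlonglongrightarrow> series x * pderiv_dir i \<phi> x" for x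
      by (intro tendsto_mult tendsto_const series_sums[unfolded sums_def])
    show "\<bar>(\<Sum>k<K. summand k x) * pderiv_dir i \<phi> x\<bar> \<le> 2 * A * B" for K x
      unfolding abs_mult using bound_nonneg by (intro mult_mono abs_partial_sum_le \<phi>_bounded(3)) simp_all
  qed (simp_all add: \<phi>_support(2))
  moreover have "(\<lambda>K. - (\<integral>x. partial_deriv i K x * \<phi> x \<partial>lborel)) \<longlonglongrightarrow> - (\<integral>x. v x * \<phi> x \<partial>lborel)"
    by (intro tendsto_minus
      tendsto_integral_mult_bounded_support[OF _ _ _ p_ge_1 deriv v_finite close \<epsilon>_bounds \<phi>_bounded(2)
        \<phi>_support(1)]) measurable
  ultimately show ?thesis
    unfolding partial_sum_weak_derivative[OF i_Basis \<phi>_test] by (rule LIMSEQ_unique)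
qed

lemma nn_integral_abs_coeff_le:
  assumes \<kappa>_pos: "0 < \<kappa>" and q_pos: "0 < q"
  shows "(\<integral>\<^sup>+x. ennreal \<bar>b k x\<bar> \<partial>lborel)
    \<le> ennreal (A * (1/2) ^ k) * (\<integral>\<^sup>+x. enn_powr (\<Sum>k. of_bool (near_support \<kappa> b k x)) q \<partial>lborel)"
proof -
  let ?N = "\<lambda>x. \<Sum>k. of_bool (near_support \<kappa> b k x) :: ennreal"
  have "ennreal \<bar>b k x\<bar> \<le> ennreal (A * (1/2) ^ k) * enn_powr (?N x) q" for x
  proof (cases "b k x = 0")
    case False
    then have "near_support \<kappa> b k x" unfolding near_support_def using \<kappa>_pos by (intro exI[of _ x]) auto
    then have "1 \<le> ?N x" using le_suminf_ennreal[of "\<lambda>k. of_bool (near_support \<kappa> b k x)" k] by simp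
    then have "enn_powr (ennreal 1) q \<le> enn_powr (?N x) q" using q_pos by (intro enn_powr_mono) auto
    then have "1 \<le> enn_powr (?N x) q" by (subst (asm) enn_powr_ennreal) auto
    then have "ennreal (A * (1/2) ^ k) * 1 \<le> ennreal (A * (1/2) ^ k) * enn_powr (?N x) q"
      by (intro mult_left_mono) auto
    then show ?thesis by (intro order_trans[OF ennreal_leI[OF coeff_le]]) simp
  qed simp
  then have "(\<integral>\<^sup>+x. ennreal \<bar>b k x\<bar> \<partial>lborel) \<le> (\<integral>\<^sup>+x. ennreal (A * (1/2) ^ k) * enn_powr (?N x) q \<partial>lborel)"
    by (rule nn_integral_mono)
  also have "\<dots> = ennreal (A * (1/2) ^ k) * (\<integral>\<^sup>+x. enn_powr (?N x) q \<partial>lborel)"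
    by (rule nn_integral_cmult) measurable
  finally show ?thesis .
qed

lemma nn_integral_abs_series_finite:
  assumes \<kappa>_pos: "0 < \<kappa>" and q_pos: "0 < q"
    and fin: "(\<integral>\<^sup>+x. enn_powr (\<Sum>k. of_bool (near_support \<kappa> b k x)) q \<partial>lborel) < \<infinity>"
  shows "(\<integral>\<^sup>+x. ennreal \<bar>series x\<bar> \<partial>lborel) < \<infinity>"
proof -
  let ?D = "\<integral>\<^sup>+x. enn_powr (\<Sum>k. of_bool (near_support \<kappa> b k x)) q \<partial>lborel"
  have abs_summand_L1: "(\<integral>\<^sup>+x. ennreal \<bar>summand k x\<bar> \<partial>lborel) \<le> ennreal (A * (1/2) ^ k) * ?D" for k
  proof -
    have "(\<integral>\<^sup>+x. ennreal \<bar>summand k x\<bar> \<partial>lborel) \<le> (\<integral>\<^sup>+x. ennreal \<bar>b k x\<bar> \<partial>lborel)"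
      unfolding summand_def using tent.nn_integral_avg_powr_le[OF coeff_measurable, of 1] by simp
    also have "\<dots> \<le> ennreal (A * (1/2) ^ k) * ?D" by (rule nn_integral_abs_coeff_le[OF \<kappa>_pos q_pos])
    finally show ?thesis .
  qed
  have "ennreal \<bar>series x\<bar> \<le> (\<Sum>k. ennreal \<bar>summand k x\<bar>)" for x
    unfolding series_def using summable_abs_summand[of x]
    by (simp only: suminf_ennreal2[OF abs_ge_zero]) (intro ennreal_leI summable_rabs)
  then have "(\<integral>\<^sup>+x. ennreal \<bar>series x\<bar> \<partial>lborel) \<le> (\<integral>\<^sup>+x. (\<Sum>k. ennreal \<bar>summand k x\<bar>) \<partial>lborel)"
    by (rule nn_integral_mono)
  also have "\<dots> = (\<Sum>k. \<integral>\<^sup>+x. ennreal \<bar>summand k x\<bar> \<partial>lborel)" by (rule nn_integral_suminf) measurable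
  also have "\<dots> \<le> (\<Sum>k. ennreal (A * (1/2) ^ k) * ?D)" by (intro suminf_le summableI abs_summand_L1)
  also have "\<dots> = (\<Sum>k. ennreal (A * (1/2) ^ k)) * ?D" by (rule ennreal_suminf_multc)
  also have "\<dots> < \<infinity>"
  proof -
    have "(\<Sum>k. ennreal (A * (1/2) ^ k)) \<noteq> top"
      using sums_summable[OF bound_sums] bound_nonneg by (intro ennreal_suminf_neq_top) auto
    then show ?thesis using fin by (simp only: ennreal_mult_less_top less_top infinity_ennreal_def) blast
  qed
  finally show ?thesis .
qed

lemma nn_integral_series_powr_finite:
  assumes series_L1: "(\<integral>\<^sup>+x. ennreal \<bar>series x\<bar> \<partial>lborel) < \<infinity>" and p_ge_1: "1 \<le> p"
  shows "(\<integral>\<^sup>+x. ennreal (\<bar>series x\<bar> powr p) \<partial>lborel) < \<infinity>"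
proof -
  have "\<bar>series x\<bar> powr p \<le> (2 * A) powr (p - 1) * \<bar>series x\<bar>" for x
  proof -
    have "\<bar>series x\<bar> powr p = \<bar>series x\<bar> powr (p - 1) * \<bar>series x\<bar>"
      by (cases "series x = 0") (auto simp: powr_diff)
    also have "\<dots> \<le> (2 * A) powr (p - 1) * \<bar>series x\<bar>"
      using abs_series_le p_ge_1 by (intro mult_right_mono powr_mono2) auto
    finally show ?thesis .
  qed
  then have "(\<integral>\<^sup>+x. ennreal (\<bar>series x\<bar> powr p) \<partial>lborel)
      \<le> (\<integral>\<^sup>+x. ennreal ((2 * A) powr (p - 1)) * ennreal \<bar>series x\<bar> \<partial>lborel)"
    by (intro nn_integral_mono) (simp only: ennreal_mult[symmetric] powr_ge_zero abs_ge_zero ennreal_leI)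
  also have "\<dots> = ennreal ((2 * A) powr (p - 1)) * (\<integral>\<^sup>+x. ennreal \<bar>series x\<bar> \<partial>lborel)"
    by (rule nn_integral_cmult) measurable
  also have "\<dots> < \<infinity>" using series_L1 by (simp add: ennreal_mult_less_top)
  finally show ?thesis .
qed

lemma partial_deriv_diff_eq:
  assumes "J \<le> K"
  shows "partial_deriv i K x - partial_deriv i J x
    = (\<Sum>k<K. tent_avg_deriv i (1 / 2 ^ Suc k) (\<lambda>x. of_bool (J \<le> k) * b k x) x)"
proof -
  have vanishes: "tent_avg_deriv i t (\<lambda>x. 0) x = 0" for t x by (simp add: tent_avg_deriv_def)
  have "(\<Sum>k<K. tent_avg_deriv i (1 / 2 ^ Suc k) (\<lambda>x. of_bool (J \<le> k) * b k x) x)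
      = (\<Sum>k\<in>{J..<K}. tent_avg_deriv i (1 / 2 ^ Suc k) (b k) x)"
    by (rule sum.mono_neutral_cong_right) (auto simp: vanishes)
  then show ?thesis
    unfolding partial_deriv_def
    using sum_diff_nat_ivl[of 0 J K "\<lambda>k. tent_avg_deriv i (1 / 2 ^ Suc k) (b k) x"] assms
    by (simp add: atLeast0LessThan)
qed

lemma nn_integral_partial_deriv_diff_le:
  assumes p_gt_1: "1 < p" and \<kappa>_pos: "0 < \<kappa>"
  obtains C :: ennreal where "C < \<infinity>"
    "\<And>i J K. i \<in> Basis \<Longrightarrow> J \<le> K \<Longrightarrow>
       (\<integral>\<^sup>+x. ennreal (\<bar>partial_deriv i K x - partial_deriv i J x\<bar> powr p) \<partial>lborel)
       \<le> C * (\<integral>\<^sup>+x. enn_powr (\<Sum>k. of_bool (J \<le> k \<and> near_support \<kappa> b k x)) (p / 2) \<partial>lborel)"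
proof -
  have "0 < A + 1" using bound_nonneg by simp
  then obtain C :: ennreal where C_finite: "C < \<infinity>" and sum_le: "\<And>(c :: nat \<Rightarrow> 'a \<Rightarrow> real) i K. i \<in> Basis \<Longrightarrow>
      (\<And>k. c k \<in> borel_measurable borel) \<Longrightarrow> (\<And>k x. \<bar>2 ^ k * c k x\<bar> \<le> A + 1) \<Longrightarrow>
      (\<integral>\<^sup>+x. ennreal (\<bar>\<Sum>k<K. tent_avg_deriv i (1 / 2 ^ Suc k) (c k) x\<bar> powr p) \<partial>lborel)
      \<le> C * count_moment lborel (p / 2) (near_support \<kappa> c) K"
    by (rule nn_integral_sum_tent_avg_deriv_le[OF p_gt_1 \<kappa>_pos, where 'a='a]) (rule that; blast)
  show ?thesis
  proof (rule that[OF C_finite])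
    fix i :: 'a and J K :: nat assume i_Basis: "i \<in> Basis" and J_le_K: "J \<le> K"
    let ?c = "\<lambda>k x. of_bool (J \<le> k) * b k x" and ?e = "\<lambda>k x. J \<le> k \<and> near_support \<kappa> b k x"
    have c_le: "\<bar>2 ^ k * ?c k x\<bar> \<le> A + 1" for k x
      using scaled_coeff_le[of k x] bound_nonneg by (cases "J \<le> k") auto
    have near: "near_support \<kappa> ?c = ?e" by (intro ext) (auto simp: near_support_def)
    have "(\<integral>\<^sup>+x. ennreal (\<bar>partial_deriv i K x - partial_deriv i J x\<bar> powr p) \<partial>lborel)
        \<le> C * count_moment lborel (p / 2) ?e K"
      unfolding partial_deriv_diff_eq[OF J_le_K] near[symmetric] by (rule sum_le[OF i_Basis _ c_le]) measurable
    also have "\<dots> \<le> C * (\<integral>\<^sup>+x. enn_powr (\<Sum>k. of_bool (?e k x)) (p / 2) \<partial>lborel)"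
    proof (rule mult_left_mono)
      show "count_moment lborel (p / 2) ?e K \<le> (\<integral>\<^sup>+x. enn_powr (\<Sum>k. of_bool (?e k x)) (p / 2) \<partial>lborel)"
        using p_gt_1 by (subst nn_integral_enn_powr_suminf_of_bool) (auto intro: SUP_upper)
    qed simp
    finally show "(\<integral>\<^sup>+x. ennreal (\<bar>partial_deriv i K x - partial_deriv i J x\<bar> powr p) \<partial>lborel)
        \<le> C * (\<integral>\<^sup>+x. enn_powr (\<Sum>k. of_bool (?e k x)) (p / 2) \<partial>lborel)" .
  qed
qed

lemma series_Lp_weak_gradient:
  assumes p_gt_1: "1 < p" and \<kappa>_pos: "0 < \<kappa>"
    and fin: "(\<integral>\<^sup>+x. enn_powr (\<Sum>k. of_bool (near_support \<kappa> b k x)) (p / 2) \<partial>lborel) < \<infinity>"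
  obtains v where "Lp_weak_gradient p series v"
proof -
  obtain C :: ennreal where C_finite: "C < \<infinity>" and cauchy: "\<And>i J K. i \<in> Basis \<Longrightarrow> J \<le> K \<Longrightarrow>
      (\<integral>\<^sup>+x. ennreal (\<bar>partial_deriv i K x - partial_deriv i J x\<bar> powr p) \<partial>lborel)
      \<le> C * (\<integral>\<^sup>+x. enn_powr (\<Sum>k. of_bool (J \<le> k \<and> near_support \<kappa> b k x)) (p / 2) \<partial>lborel)"
    by (rule nn_integral_partial_deriv_diff_le[OF p_gt_1 \<kappa>_pos]) (rule that; blast)
  define \<epsilon> where "\<epsilon> J = C * (\<integral>\<^sup>+x. enn_powr (\<Sum>k. of_bool (J \<le> k \<and> near_support \<kappa> b k x)) (p / 2) \<partial>lborel)" for J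
  have "\<epsilon> \<longlonglongrightarrow> C * 0"
    unfolding \<epsilon>_def using C_finite p_gt_1 fin
    by (intro tendsto_mult_ennreal tendsto_const nn_integral_enn_powr_tail_tendsto_0) auto
  then have \<epsilon>_0: "\<epsilon> \<longlonglongrightarrow> 0" by simp
  have \<epsilon>_fin: "\<epsilon> J < \<infinity>" for J
  proof -
    have "(\<integral>\<^sup>+x. enn_powr (\<Sum>k. of_bool (J \<le> k \<and> near_support \<kappa> b k x)) (p / 2) \<partial>lborel)
        \<le> (\<integral>\<^sup>+x. enn_powr (\<Sum>k. of_bool (near_support \<kappa> b k x)) (p / 2) \<partial>lborel)"
      using p_gt_1 by (intro nn_integral_mono enn_powr_mono suminf_le summableI) auto
    then show ?thesis using fin C_finite unfolding \<epsilon>_def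
      by (auto simp: ennreal_mult_less_top dest: le_less_trans)
  qed
  have "\<exists>v. v \<in> borel_measurable borel \<and> (\<integral>\<^sup>+x. ennreal (\<bar>v x\<bar> powr p) \<partial>lborel) < \<infinity> \<and>
    (\<forall>\<phi>. test_function \<phi> \<longrightarrow> (\<integral>x. series x * pderiv_dir i \<phi> x \<partial>lborel) = - (\<integral>x. v x * \<phi> x \<partial>lborel))"
    if i_Basis: "i \<in> Basis" for i
  proof -
    have deriv_fin: "(\<integral>\<^sup>+x. ennreal (\<bar>partial_deriv i K x\<bar> powr p) \<partial>lborel) < \<infinity>" for K
      using cauchy[OF i_Basis, of 0 K] \<epsilon>_fin[of 0] by (auto simp: \<epsilon>_def partial_deriv_def dest: le_less_trans)
    obtain v where v_borel: "v \<in> borel_measurable lborel"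
      and close: "\<And>J. (\<integral>\<^sup>+x. ennreal (\<bar>v x - partial_deriv i J x\<bar> powr p) \<partial>lborel) \<le> \<epsilon> J"
      by (rule Lp_complete[OF _ _ cauchy[OF i_Basis, folded \<epsilon>_def] \<epsilon>_0]) (use p_gt_1 that in auto)
    have v_fin: "(\<integral>\<^sup>+x. ennreal (\<bar>v x\<bar> powr p) \<partial>lborel) < \<infinity>"
      using close[of 0] \<epsilon>_fin[of 0] by (auto simp: partial_deriv_def dest: le_less_trans)
    have "(\<integral>x. series x * pderiv_dir i \<phi> x \<partial>lborel) = - (\<integral>x. v x * \<phi> x \<partial>lborel)" if "test_function \<phi>" for \<phi>
      by (rule series_weak_derivative[OF _ i_Basis that _ v_fin deriv_fin close \<epsilon>_fin \<epsilon>_0])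
        (use p_gt_1 v_borel in auto)
    then show ?thesis using v_borel v_fin by auto
  qed
  then have "\<exists>v. Lp_weak_gradient p series v" unfolding Lp_weak_gradient_def by (intro bchoice ballI)
  then show ?thesis using that by blast
qed

theorem series_W1p:
  assumes "1 < p" "0 < \<kappa>" "(\<integral>\<^sup>+x. enn_powr (\<Sum>k. of_bool (near_support \<kappa> b k x)) (p / 2) \<partial>lborel) < \<infinity>"
  shows "series \<in> W1p p"
proof -
  have "(\<integral>\<^sup>+x. ennreal \<bar>series x\<bar> \<partial>lborel) < \<infinity>"
    using assms by (intro nn_integral_abs_series_finite[where q="p / 2"]) auto
  then have "(\<integral>\<^sup>+x. ennreal (\<bar>series x\<bar> powr p) \<partial>lborel) < \<infinity>"
    using assms(1) by (intro nn_integral_series_powr_finite) auto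
  moreover obtain v where "Lp_weak_gradient p series v" by (rule series_Lp_weak_gradient[OF assms])
  ultimately show ?thesis by (rule W1pI_borel[OF series_measurable])
qed

end

section \<open>Decomposition into tent averages\<close>

lemma sum_le_two_scale:
  fixes w :: "nat \<Rightarrow> real"
  assumes a_bounds: "\<And>k. w k \<le> a * 2 ^ k" "0 \<le> a" and c_bounds: "\<And>k. w k \<le> c * (1/2) ^ k" "0 \<le> c"
  shows "(\<Sum>k<K. w k) \<le> a * 2 ^ m + 2 * c * (1/2) ^ m"
proof -
  have low: "(\<Sum>k<K. w k) \<le> a * 2 ^ K" for K
  proof (induction K)
    case (Suc K)
    then show ?case using a_bounds(1)[of K] by simp
  qed (use a_bounds(2) in simp)
  have high: "(\<Sum>k<K. w k) \<le> a * 2 ^ m + 2 * c * (1/2) ^ m - 2 * c * (1/2) ^ K" if "m \<le> K" for K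
    using that
  proof (induction K rule: dec_induct)
    case base
    then show ?case using low[of m] by simp
  next
    case (step K)
    then show ?case using c_bounds(1)[of K] by simp
  qed
  show ?thesis
  proof (cases "m \<le> K")
    case True
    then show ?thesis using high[OF True] c_bounds(2) by (simp add: add_increasing2 order_trans)
  next
    case False
    then have "a * 2 ^ K \<le> a * 2 ^ m" using a_bounds(2) by (intro mult_left_mono power_increasing) auto
    moreover have "0 \<le> 2 * c * (1/2) ^ m" using c_bounds(2) by simp
    ultimately show ?thesis using low[of K] by linarith
  qed
qed

context tent_series
begin

lemma abs_Dh2_summand_le: "\<bar>Dh2 h (summand k) x\<bar> \<le> 4 * A * (1/2) ^ k"
  using Dh2_bounded[of "summand k" "A * (1/2) ^ k" h x] abs_summand_le by simp

lemma abs_Dh2_summand_le_smooth: "\<bar>Dh2 h (summand k) x\<bar> \<le> 16 * (real DIM('a))\<^sup>2 * A * (norm h)\<^sup>2 * 2 ^ k"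
proof -
  have "\<bar>Dh2 h (summand k) x\<bar> \<le> A * (1/2) ^ k * (2 * real DIM('a) * (norm h / (1 / 2 ^ Suc k)))\<^sup>2"
    unfolding summand_def by (intro tent_avg_Dh2 coeff_le coeff_measurable) simp
  also have "\<dots> = 16 * (real DIM('a))\<^sup>2 * A * (norm h)\<^sup>2 * ((1/2) ^ k * 2 ^ k) * 2 ^ k"
    by (simp add: power2_eq_square)
  also have "(1/2) ^ k * 2 ^ k = (1::real)" by (simp add: power_mult_distrib[symmetric])
  finally show ?thesis by simp
qed

lemma abs_Dh2_partial_sum_le:
  assumes "norm h \<le> 1"
  shows "\<bar>Dh2 h (\<lambda>x. \<Sum>k<K. summand k x) x\<bar> \<le> (8 + 32 * (real DIM('a))\<^sup>2) * A * norm h"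
proof (cases "h = 0")
  case False
  then obtain j where j_bounds: "1 / 2 ^ Suc j < norm h" "norm h \<le> 1 / 2 ^ j"
    using dyadic_bracket[of "norm h"] assms by auto
  have "Dh2 h (\<lambda>x. \<Sum>k<K. summand k x) x = (\<Sum>k<K. Dh2 h (summand k) x)"
    by (simp add: Dh2_eq sum.distrib sum_subtractf sum_distrib_left)
  then have "\<bar>Dh2 h (\<lambda>x. \<Sum>k<K. summand k x) x\<bar> \<le> (\<Sum>k<K. \<bar>Dh2 h (summand k) x\<bar>)" by (simp add: sum_abs)
  also have "\<dots> \<le> 16 * (real DIM('a))\<^sup>2 * A * (norm h)\<^sup>2 * 2 ^ Suc j + 2 * (4 * A) * (1/2) ^ Suc j"
    using bound_nonneg by (intro sum_le_two_scale abs_Dh2_summand_le abs_Dh2_summand_le_smooth) auto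
  also have "\<dots> = 32 * (real DIM('a))\<^sup>2 * A * norm h * (norm h * 2 ^ j) + 8 * A * (1 / 2 ^ Suc j)"
    by (simp add: power2_eq_square power_one_over)
  also have "\<dots> \<le> 32 * (real DIM('a))\<^sup>2 * A * norm h * 1 + 8 * A * norm h"
    using j_bounds bound_nonneg by (intro add_mono mult_left_mono) (auto simp: pos_le_divide_eq)
  finally show ?thesis by (simp add: algebra_simps)
qed (simp add: Dh2_eq)

lemma abs_Dh2_series_le:
  assumes "norm h \<le> 1"
  shows "\<bar>Dh2 h series x\<bar> \<le> (8 + 32 * (real DIM('a))\<^sup>2) * A * norm h"
proof (rule LIMSEQ_le_const2)
  show "(\<lambda>K. \<bar>Dh2 h (\<lambda>x. \<Sum>k<K. summand k x) x\<bar>) \<longlonglongrightarrow> \<bar>Dh2 h series x\<bar>"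
    unfolding Dh2_eq by (intro tendsto_intros series_sums[unfolded sums_def])
qed (use abs_Dh2_partial_sum_le[OF assms] in blast)

lemma continuous_on_series: "continuous_on UNIV series"
proof (rule uniform_limit_theorem)
  show "uniform_limit UNIV (\<lambda>K x. \<Sum>k<K. summand k x) series sequentially"
    unfolding series_def
    by (rule Weierstrass_m_test[OF _ sums_summable[OF bound_sums]]) (simp add: abs_summand_le)
  show "\<forall>\<^sub>F K in sequentially. continuous_on UNIV (\<lambda>x. \<Sum>k<K. summand k x)"
    unfolding summand_def
    by (intro always_eventually allI continuous_on_sum continuous_on_tent_avg[OF coeff_measurable coeff_le])
      simp
qed simp

theorem series_Lambda1: "series \<in> Lambda1"
  and Lambda1_norm_series_le: "Lambda1_norm series \<le> (10 + 32 * (real DIM('a))\<^sup>2) * A"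
  using Lambda1I[OF continuous_on_series abs_series_le abs_Dh2_series_le] by (simp_all add: algebra_simps)

end

lemma tent_avg_minus_id_le:
  fixes f :: "'a::euclidean_space \<Rightarrow> real"
  assumes [measurable]: "f \<in> borel_measurable borel" and f_bounded: "\<And>x. \<bar>f x\<bar> \<le> S"
    and Dh2_le_b: "\<And>z. norm z \<le> real DIM('a) \<Longrightarrow> \<bar>Dh2 (t *\<^sub>R z) f x\<bar> \<le> b"
  shows "\<bar>tent_avg t f x - f x\<bar> \<le> b / 2"
proof -
  have "\<bar>\<integral>z. Dh2 (t *\<^sub>R z) f x \<partial>tent_measure\<bar> \<le> b"
    by (rule tent_integral_abs_le[OF _ Dh2_le_b]) (simp_all add: Dh2_eq)
  then show ?thesis unfolding tent_avg_minus_id[OF assms(1) f_bounded] by simp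
qed

lemma tent_avg_tendsto_0_at_infinity:
  fixes f :: "'a::euclidean_space \<Rightarrow> real"
  assumes f_C0: "f \<in> C0" and t_nonneg: "0 \<le> t"
  shows "(tent_avg t f \<longlongrightarrow> 0) at_infinity"
proof (rule tendstoI)
  fix \<eta> :: real assume \<eta>_pos: "0 < \<eta>"
  have [measurable]: "f \<in> borel_measurable borel" using f_C0
    by (auto simp: C0_def intro: borel_measurable_continuous_onI)
  have "eventually (\<lambda>x. dist (f x) 0 < \<eta> / 2) at_infinity"
    using f_C0 \<eta>_pos unfolding C0_def by (intro tendstoD) auto
  then obtain R where f_small: "\<And>x. R \<le> norm x \<Longrightarrow> \<bar>f x\<bar> < \<eta> / 2" by (auto simp: eventually_at_infinity)
  have "\<bar>tent_avg t f x\<bar> \<le> \<eta> / 2" if norm_x_ge: "R + t * real DIM('a) \<le> norm x" for x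
    unfolding tent.avg_def
  proof (rule tent_integral_abs_le)
    fix z :: 'a assume norm_z_le: "norm z \<le> real DIM('a)"
    have "norm (t *\<^sub>R z) \<le> t * real DIM('a)" using norm_z_le t_nonneg by (simp add: mult_left_mono)
    moreover have "norm x \<le> norm (x + t *\<^sub>R z) + norm (t *\<^sub>R z)"
      using norm_triangle_ineq4[of "x + t *\<^sub>R z" "t *\<^sub>R z"] by simp
    ultimately show "\<bar>f (x + t *\<^sub>R z)\<bar> \<le> \<eta> / 2" using f_small[of "x + t *\<^sub>R z"] norm_x_ge by linarith
  qed simp
  then have "dist (tent_avg t f x) 0 < \<eta>" if "R + t * real DIM('a) \<le> norm x" for x
    using that \<eta>_pos by (fastforce simp: dist_real_def)
  then show "eventually (\<lambda>x. dist (tent_avg t f x) 0 < \<eta>) at_infinity" by (auto simp: eventually_at_infinity)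
qed

definition tent_piece :: "('a::euclidean_space \<Rightarrow> real) \<Rightarrow> nat \<Rightarrow> 'a \<Rightarrow> real" where
  "tent_piece f k x =
     (if k = 0 then tent_avg (1/4) f x else tent_avg (1 / 2 ^ (k + 2)) f x - tent_avg (1 / 2 ^ k) f x)"

lemma tent_piece_measurable [measurable]:
  assumes [measurable]: "f \<in> borel_measurable borel"
  shows "tent_piece f k \<in> borel_measurable borel"
  unfolding tent_piece_def by measurable

lemma tent_piece_tendsto_0_at_infinity:
  assumes "f \<in> C0"
  shows "(tent_piece f k \<longlongrightarrow> 0) at_infinity"
  using tendsto_diff[OF tent_avg_tendsto_0_at_infinity[OF assms, of "1 / 2 ^ (k + 2)"]
      tent_avg_tendsto_0_at_infinity[OF assms, of "1 / 2 ^ k"]]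
    tent_avg_tendsto_0_at_infinity[OF assms, of "1/4"]
  by (cases "k = 0") (simp_all add: tent_piece_def[abs_def])

lemma sum_tent_avg_tent_piece:
  fixes f :: "'a::euclidean_space \<Rightarrow> real"
  assumes f_bounded_borel [measurable]: "f \<in> borel_measurable borel" and f_bounded: "\<And>x. \<bar>f x\<bar> \<le> S"
  shows "(\<Sum>k<Suc K. tent_avg (1 / 2 ^ Suc k) (tent_piece f k) x)
    = tent_avg (1 / 2 ^ Suc K) (tent_avg (1 / 2 ^ (K + 2)) f) x"
proof (induction K)
  case 0
  have "tent_piece f 0 = tent_avg (1 / 4) f" by (rule ext) (simp add: tent_piece_def)
  then show ?case by simp
next
  case (Suc K)
  let ?t = "\<lambda>k. 1 / 2 ^ k :: real"
  have piece: "tent_piece f (Suc K) = (\<lambda>x. tent_avg (?t (Suc K + 2)) f x - tent_avg (?t (Suc K)) f x)"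
    by (rule ext) (simp add: tent_piece_def)
  have "tent_avg (?t (Suc (Suc K))) (tent_piece f (Suc K)) x
    = tent_avg (?t (Suc (Suc K))) (tent_avg (?t (Suc K + 2)) f) x
      - tent_avg (?t (Suc (Suc K))) (tent_avg (?t (Suc K)) f) x"
    unfolding piece by (rule tent.avg_diff[where S=S and S'=S]) (auto intro!: tent.avg_abs_le f_bounded)
  moreover have "tent_avg (?t (Suc (Suc K))) (tent_avg (?t (Suc K)) f) x
      = tent_avg (?t (Suc K)) (tent_avg (?t (K + 2)) f) x"
    using tent_avg_commute[OF f_bounded_borel f_bounded, of "?t (Suc (Suc K))" "?t (Suc K)" x] by simp
  ultimately show ?case using Suc by (simp only: sum.lessThan_Suc[of _ "Suc K"])
qed

lemma tent_avg_dist_le: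
  fixes f :: "'a::euclidean_space \<Rightarrow> real"
  assumes f_bounded_borel: "f \<in> borel_measurable borel" "\<And>x. \<bar>f x\<bar> \<le> S"
    and M_zygmund: "zygmund_bounded M f" "0 \<le> M" and t_nonneg: "0 \<le> t"
  shows "\<bar>tent_avg t f x - f x\<bar> \<le> M * real DIM('a) * t / 2"
proof (rule tent_avg_minus_id_le[OF f_bounded_borel])
  fix z :: 'a assume "norm z \<le> real DIM('a)"
  then have "M * norm (t *\<^sub>R z) \<le> M * (t * real DIM('a))" using t_nonneg M_zygmund(2)
    by (auto intro!: mult_left_mono)
  then show "\<bar>Dh2 (t *\<^sub>R z) f x\<bar> \<le> M * real DIM('a) * t"
    using zygmund_boundedD[OF M_zygmund(1), of "t *\<^sub>R z" x] by (simp add: mult_ac)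
qed

lemma tent_piece_abs_le:
  fixes f :: "'a::euclidean_space \<Rightarrow> real"
  assumes f_bounded_borel: "f \<in> borel_measurable borel" and f_bounded: "\<And>x. \<bar>f x\<bar> \<le> S"
    and M_zygmund: "zygmund_bounded M f" "0 \<le> M"
  shows "\<bar>tent_piece f k x\<bar> \<le> (S + M * real DIM('a)) * (1/2) ^ k"
proof (cases "k = 0")
  case True
  have "\<bar>tent_avg (1/4) f x\<bar> \<le> S" by (rule tent.avg_abs_le[OF f_bounded_borel f_bounded])
  then show ?thesis using True M_zygmund by (simp add: tent_piece_def add_increasing2)
next
  case False
  let ?b = "M * real DIM('a) * (1/2) ^ k"
  have "0 \<le> S" using f_bounded[of 0] by linarith
  have dist: "\<bar>tent_avg (1 / 2 ^ j) f x - f x\<bar> \<le> M * real DIM('a) * (1/2) ^ j / 2" for j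
    using tent_avg_dist_le[OF f_bounded_borel f_bounded M_zygmund, of "1 / 2 ^ j" x]
    by (simp add: power_one_over)
  have "M * real DIM('a) * (1/2) ^ (k + 2) \<le> ?b" using M_zygmund by (intro mult_left_mono power_decreasing) auto
  then have "\<bar>tent_avg (1 / 2 ^ (k + 2)) f x - tent_avg (1 / 2 ^ k) f x\<bar> \<le> ?b"
    using dist[of "k + 2"] dist[of k] by linarith
  also have "?b \<le> (S + M * real DIM('a)) * (1/2) ^ k" using \<open>0 \<le> S\<close> by simp
  finally show ?thesis using False by (simp add: tent_piece_def)
qed

lemma tent_piece_sums:
  fixes f :: "'a::euclidean_space \<Rightarrow> real"
  assumes f_bounded_borel [measurable]: "f \<in> borel_measurable borel" and f_bounded: "\<And>x. \<bar>f x\<bar> \<le> S"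
    and M_zygmund: "zygmund_bounded M f" "0 \<le> M"
  shows "(\<lambda>k. tent_avg (1 / 2 ^ Suc k) (tent_piece f k) x) sums f x"
proof -
  let ?c = "M * real DIM('a)"
  have dist: "\<bar>tent_avg (1 / 2 ^ j) f z - f z\<bar> \<le> ?c * (1/2) ^ j / 2" for j z
    using tent_avg_dist_le[OF f_bounded_borel f_bounded M_zygmund, of "1 / 2 ^ j" z]
    by (simp add: power_one_over)
  have double_dist: "\<bar>tent_avg (1 / 2 ^ Suc K) (tent_avg (1 / 2 ^ (K + 2)) f) x - f x\<bar> \<le> ?c * (1/2) ^ K" for K
  proof -
    let ?g = "tent_avg (1 / 2 ^ (K + 2)) f"
    have "tent_avg (1 / 2 ^ Suc K) (\<lambda>z. ?g z - f z) x
        = tent_avg (1 / 2 ^ Suc K) ?g x - tent_avg (1 / 2 ^ Suc K) f x"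
      by (rule tent.avg_diff[where S=S and S'=S]) (auto intro!: tent.avg_abs_le f_bounded)
    moreover have "\<bar>tent_avg (1 / 2 ^ Suc K) (\<lambda>z. ?g z - f z) x\<bar> \<le> ?c * (1/2) ^ (K + 2) / 2"
      by (rule tent.avg_abs_le[OF _ dist]) measurable
    moreover have "?c * (1/2) ^ (K + 2) \<le> ?c * (1/2) ^ K" "?c * (1/2) ^ Suc K \<le> ?c * (1/2) ^ K"
      using M_zygmund by (intro mult_left_mono power_decreasing; simp)+
    ultimately show ?thesis using dist[of "Suc K" x] by linarith
  qed
  have "(\<lambda>K. \<Sum>k<Suc K. tent_avg (1 / 2 ^ Suc k) (tent_piece f k) x) \<longlonglongrightarrow> f x"
    unfolding sum_tent_avg_tent_piece[OF f_bounded_borel f_bounded]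
  proof (rule LIM_zero_cancel, rule tendsto_rabs_zero_cancel, rule tendsto_sandwich[where f="\<lambda>_. 0"])
    have "(\<lambda>K. ?c * (1/2) ^ K) \<longlonglongrightarrow> ?c * 0" by (intro tendsto_intros LIMSEQ_realpow_zero) auto
    then show "(\<lambda>K. ?c * (1/2) ^ K) \<longlonglongrightarrow> 0" by simp
    show "\<forall>\<^sub>F K in sequentially. \<bar>tent_avg (1 / 2 ^ Suc K) (tent_avg (1 / 2 ^ (K + 2)) f) x - f x\<bar>
        \<le> ?c * (1/2) ^ K"
      using double_dist by (intro always_eventually allI)
  qed simp_all
  then show ?thesis unfolding sums_def by (rule LIMSEQ_imp_Suc)
qed

lemma tent_piece_large:
  fixes f :: "'a::euclidean_space \<Rightarrow> real"
  assumes f_bounded_borel [measurable]: "f \<in> borel_measurable borel" and f_bounded: "\<And>x. \<bar>f x\<bar> \<le> S"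
    and k_ge_1: "1 \<le> k" and large: "b < \<bar>tent_piece f k x\<bar>"
  obtains h where "norm h \<le> real DIM('a) / 2 ^ k" "b < \<bar>Dh2 h f x\<bar>"
proof (rule ccontr)
  assume no_large: "\<not> thesis"
  note found = that
  have small: "\<bar>Dh2 h f x\<bar> \<le> b" if "norm h \<le> real DIM('a) / 2 ^ k" for h
    using no_large found that by force
  have "\<bar>tent_avg t f x - f x\<bar> \<le> b / 2" if t_bounds: "0 \<le> t" "t \<le> 1 / 2 ^ k" for t
  proof (rule tent_avg_minus_id_le[OF f_bounded_borel f_bounded])
    fix z :: 'a assume "norm z \<le> real DIM('a)"
    then have "t * norm z \<le> 1 / 2 ^ k * real DIM('a)" using t_bounds by (intro mult_mono) auto
    then show "\<bar>Dh2 (t *\<^sub>R z) f x\<bar> \<le> b" using t_bounds by (intro small) simp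
  qed
  from this[of "1 / 2 ^ (k + 2)"] this[of "1 / 2 ^ k"]
  have "\<bar>tent_avg (1 / 2 ^ (k + 2)) f x - f x\<bar> \<le> b / 2" "\<bar>tent_avg (1 / 2 ^ k) f x - f x\<bar> \<le> b / 2"
    by (simp_all add: field_simps)
  then have "\<bar>tent_avg (1 / 2 ^ (k + 2)) f x - tent_avg (1 / 2 ^ k) f x\<bar> \<le> b" by linarith
  then show False using large k_ge_1 by (simp add: tent_piece_def)
qed

section \<open>From the square function to the supports\<close>

lemma open_Delta2_superlevel:
  fixes f :: "'a::euclidean_space \<Rightarrow> real"
  assumes f_cont_bounded: "continuous_on UNIV f" "bounded (range f)"
  shows "open {(x, y). 0 < y \<and> \<epsilon> < Delta2 f x y / y}"
proof -
  have "{(x, y). 0 < y \<and> \<epsilon> < Delta2 f x y / y}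
    = (\<Union>u\<in>{u. norm u = 1}. {z. 0 < snd z \<and> \<epsilon> * snd z < \<bar>Dh2 (snd z *\<^sub>R u) f (fst z)\<bar>})" (is "?L = ?R")
  proof (intro equalityI subsetI)
    fix z assume "z \<in> ?L"
    then have snd_large: "0 < snd z" "\<epsilon> * snd z < Delta2 f (fst z) (snd z)" by (auto simp: field_simps)
    obtain h where h_large: "norm h = snd z" "\<epsilon> * snd z < \<bar>Dh2 h f (fst z)\<bar>"
      by (rule less_Delta2D[OF _ snd_large(2)]) (use snd_large in auto)
    have "snd z *\<^sub>R ((1 / snd z) *\<^sub>R h) = h" using snd_large by simp
    then show "z \<in> ?R" using h_large snd_large by (intro UN_I[of "(1 / snd z) *\<^sub>R h"]) auto
  next
    fix z assume "z \<in> ?R"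
    then obtain u where u_large: "norm u = 1" "0 < snd z" "\<epsilon> * snd z < \<bar>Dh2 (snd z *\<^sub>R u) f (fst z)\<bar>" by auto
    have "\<bar>Dh2 (snd z *\<^sub>R u) f (fst z)\<bar> \<le> Delta2 f (fst z) (snd z)"
      by (rule Delta2_ge[OF f_cont_bounded(2)]) (use u_large in simp)
    then show "z \<in> ?L" using u_large by (auto simp: field_simps)
  qed
  moreover have "open \<dots>"
  proof (intro open_UN ballI open_Collect_conj open_Collect_less)
    fix u :: 'a
    show "continuous_on UNIV (\<lambda>z. \<bar>Dh2 (snd z *\<^sub>R u) f (fst z)\<bar>)"
      unfolding Dh2_eq by (intro continuous_intros continuous_on_compose2[OF f_cont_bounded(1)]) auto
  qed (auto intro!: continuous_intros)
  ultimately show ?thesis by simp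
qed

definition sq_density :: "('a::euclidean_space \<Rightarrow> real) \<Rightarrow> real \<Rightarrow> 'a \<Rightarrow> real \<Rightarrow> ennreal" where
  "sq_density f \<epsilon> x y = indicator {y \<in> {0<..1}. Delta2 f x y / y > \<epsilon>} y * ennreal (1 / y)"

lemma sq_inner_eq_integral_density: "sq_inner f \<epsilon> x = (\<integral>\<^sup>+y. sq_density f \<epsilon> x y \<partial>lborel)"
  by (simp add: sq_inner_def sq_density_def)

lemma sq_density_measurable:
  fixes f :: "'a::euclidean_space \<Rightarrow> real"
  assumes f_cont_bounded: "continuous_on UNIV f" "bounded (range f)"
  shows "(\<lambda>(x, y). sq_density f \<epsilon> x y) \<in> borel_measurable (borel \<Otimes>\<^sub>M borel)"
proof -
  define U where "U = {(x, y). 0 < y \<and> \<epsilon> < Delta2 f x y / y}"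
  have [measurable]: "U \<in> sets (borel \<Otimes>\<^sub>M borel)"
    unfolding U_def borel_prod by (intro borel_open open_Delta2_superlevel f_cont_bounded)
  have "(\<lambda>(x, y). sq_density f \<epsilon> x y) = (\<lambda>z. indicator U z * (indicator {0<..1} (snd z) * ennreal (1 / snd z)))"
    by (auto simp: sq_density_def U_def indicator_def fun_eq_iff)
  moreover have "\<dots> \<in> borel_measurable (borel \<Otimes>\<^sub>M borel)" by measurable
  ultimately show ?thesis by simp
qed

lemma sq_inner_measurable:
  fixes f :: "'a::euclidean_space \<Rightarrow> real"
  assumes f_cont_bounded: "continuous_on UNIV f" "bounded (range f)"
  shows "sq_inner f \<epsilon> \<in> borel_measurable borel"
  unfolding sq_inner_eq_integral_density[abs_def]
  by (rule lborel.borel_measurable_nn_integral)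
    (use sq_density_measurable[OF f_cont_bounded] in
      \<open>simp add: measurable_cong_sets[OF sets_pair_measure_cong[OF refl sets_lborel] refl]\<close>)

lemma count_dyadic_scales_le:
  fixes \<kappa> n y :: real
  assumes \<kappa>_pos: "0 < \<kappa>" and n_nonneg: "0 \<le> n" and n_less: "n < \<kappa> * 2 ^ N"
  shows "(\<Sum>k. of_bool (\<kappa> / 2 ^ k \<le> y \<and> y \<le> n / 2 ^ k) :: ennreal) \<le> of_nat N"
proof (cases "\<exists>k. \<kappa> / 2 ^ k \<le> y \<and> y \<le> n / 2 ^ k")
  case True
  define near where "near k \<longleftrightarrow> \<kappa> / 2 ^ k \<le> y \<and> y \<le> n / 2 ^ k" for k :: nat
  define j where "j = (LEAST k. near k)"
  have "near j" unfolding j_def by (rule LeastI_ex) (use True in \<open>simp add: near_def\<close>)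
  have "k \<in> {j..<j + N}" if "near k" for k
  proof -
    have "j \<le> k" unfolding j_def by (rule Least_le[of near, OF that])
    moreover have "k < j + N"
    proof (rule ccontr)
      assume "\<not> k < j + N"
      then have "(2::real) ^ (j + N) \<le> 2 ^ k" by (intro power_increasing) auto
      then have "n / 2 ^ k \<le> n / 2 ^ (j + N)" using n_nonneg by (intro divide_left_mono) auto
      then have "y \<le> n / 2 ^ (j + N)" using that by (simp add: near_def)
      also have "\<dots> < \<kappa> / 2 ^ j" using n_less by (simp add: power_add field_simps)
      finally show False using \<open>near j\<close> by (simp add: near_def)
    qed
    ultimately show ?thesis by simp
  qed
  then have "(\<Sum>k. of_bool (near k) :: ennreal) = (\<Sum>k\<in>{j..<j + N}. of_bool (near k))"
    by (intro suminf_finite) auto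
  also have "\<dots> \<le> of_nat (card {j..<j + N}) * 1" by (intro sum_bounded_above) auto
  finally show ?thesis by (simp add: near_def)
next
  case False
  then have "(\<Sum>k. of_bool (\<kappa> / 2 ^ k \<le> y \<and> y \<le> n / 2 ^ k) :: ennreal) = (\<Sum>k. 0)" by (intro suminf_cong) simp
  then show ?thesis by simp
qed

lemma suminf_of_bool_split:
  "(\<Sum>k. of_bool (P k) :: ennreal) = (\<Sum>k<m. of_bool (P k)) + (\<Sum>k. of_bool (m \<le> k \<and> P k))"
proof -
  have "(\<Sum>k. of_bool (P k) :: ennreal) = (\<Sum>k. of_bool (k < m \<and> P k) + of_bool (m \<le> k \<and> P k))"
    by (intro suminf_cong) auto
  also have "\<dots> = (\<Sum>k. of_bool (k < m \<and> P k)) + (\<Sum>k. of_bool (m \<le> k \<and> P k))"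
    by (rule suminf_add[OF summableI summableI, symmetric])
  also have "(\<Sum>k. of_bool (k < m \<and> P k) :: ennreal) = (\<Sum>k<m. of_bool (k < m \<and> P k))"
    by (rule suminf_finite) auto
  also have "\<dots> = (\<Sum>k<m. of_bool (P k))" by (rule sum.cong) auto
  finally show ?thesis .
qed

locale oscillation_scale =
  fixes f :: "'a::euclidean_space \<Rightarrow> real" and M \<epsilon> \<kappa> :: real
  assumes continuous: "continuous_on UNIV f" and bounded_range: "bounded (range f)"
    and zygmund: "zygmund_bounded M f" and M_ge_1: "1 \<le> M" and \<epsilon>_pos: "0 < \<epsilon>"
    and \<kappa>_bounds: "0 < \<kappa>" "\<kappa> \<le> \<epsilon> / (2 * M)" and modulus: "Dh2_modulus (real DIM('a)) \<epsilon> \<kappa> f"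
begin

lemma norm_gt_of_large_Dh2:
  assumes t_pos: "0 < t" and large: "(real DIM('a) + 1) * \<epsilon> * t < \<bar>Dh2 h f c\<bar>"
  shows "2 * (\<kappa> * t) < norm h"
proof -
  have "2 * M * \<kappa> \<le> \<epsilon>" using \<kappa>_bounds M_ge_1 by (simp add: field_simps)
  also have "\<epsilon> \<le> (real DIM('a) + 1) * \<epsilon>" using \<epsilon>_pos by simp
  finally have "2 * M * \<kappa> * t \<le> (real DIM('a) + 1) * \<epsilon> * t" using t_pos by (intro mult_right_mono) auto
  also have "\<dots> < M * norm h" using large zygmund_boundedD[OF zygmund, of h c] by linarith
  finally have "M * (2 * (\<kappa> * t)) < M * norm h" by (simp add: mult_ac)
  then show ?thesis using M_ge_1 by (simp add: mult_less_cancel_left)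
qed

lemma Delta2_gt_near_large_Dh2:
  assumes t_pos: "0 < t" and h_bounds: "norm h \<le> real DIM('a) * t" "(real DIM('a) + 1) * \<epsilon> * t < \<bar>Dh2 h f c\<bar>"
    and near: "norm (x - c) \<le> \<kappa> * t" and y_bounds: "norm h - \<kappa> * t \<le> y" "y \<le> norm h" "0 < y"
  shows "\<epsilon> * y < Delta2 f x y"
proof -
  define h' where "h' = (y / norm h) *\<^sub>R h"
  have h_pos: "0 < norm h" using y_bounds by linarith
  then have norm_h': "norm h' = y" using y_bounds by (simp add: h'_def)
  have "h' - h = (y / norm h - 1) *\<^sub>R h" by (simp add: h'_def algebra_simps)
  then have "norm (h' - h) = \<bar>y / norm h - 1\<bar> * norm h" by simp
  also have "\<dots> = norm h - y" using h_pos y_bounds by (simp add: abs_if field_simps)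
  finally have "norm (h' - h) \<le> \<kappa> * t" using y_bounds by simp
  then have "\<bar>Dh2 h' f x - Dh2 h f c\<bar> \<le> \<epsilon> * t" by (rule Dh2_modulusD[OF modulus t_pos h_bounds(1) near])
  then have "real DIM('a) * \<epsilon> * t < \<bar>Dh2 h' f x\<bar>" using h_bounds(2) by (simp add: algebra_simps)
  moreover have "\<epsilon> * y \<le> \<epsilon> * (real DIM('a) * t)" using y_bounds h_bounds(1) \<epsilon>_pos by (intro mult_left_mono) auto
  moreover have "\<bar>Dh2 h' f x\<bar> \<le> Delta2 f x y" by (rule Delta2_ge[OF bounded_range norm_h'])
  ultimately show ?thesis by (simp add: mult_ac)
qed

lemma sq_density_mass_ge:
  assumes t_bounds: "0 < t" "real DIM('a) * t \<le> 1"
    and h_bounds: "norm h \<le> real DIM('a) * t" "(real DIM('a) + 1) * \<epsilon> * t < \<bar>Dh2 h f c\<bar>"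
    and near: "norm (x - c) \<le> \<kappa> * t"
  shows "ennreal (\<kappa> / real DIM('a))
    \<le> (\<integral>\<^sup>+y. of_bool (\<kappa> * t \<le> y \<and> y \<le> real DIM('a) * t) * sq_density f \<epsilon> x y \<partial>lborel)"
proof -
  let ?n = "real DIM('a)" and ?I = "{norm h - \<kappa> * t..norm h}"
  have \<kappa>_t_pos: "0 < \<kappa> * t" using \<kappa>_bounds t_bounds by simp
  have "ennreal (\<kappa> / ?n) = ennreal (1 / (?n * t)) * ennreal (\<kappa> * t)"
    using t_bounds \<kappa>_bounds by (simp add: ennreal_mult[symmetric])
  also have "\<dots> = (\<integral>\<^sup>+y. ennreal (1 / (?n * t)) * indicator ?I y \<partial>lborel)"
    using \<kappa>_t_pos by (subst nn_integral_cmult_indicator) auto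
  also have "\<dots> \<le> (\<integral>\<^sup>+y. of_bool (\<kappa> * t \<le> y \<and> y \<le> ?n * t) * sq_density f \<epsilon> x y \<partial>lborel)"
  proof (rule nn_integral_mono)
    fix y :: real
    show "ennreal (1 / (?n * t)) * indicator ?I y \<le> of_bool (\<kappa> * t \<le> y \<and> y \<le> ?n * t) * sq_density f \<epsilon> x y"
    proof (cases "y \<in> ?I")
      case True
      then have y_bounds: "norm h - \<kappa> * t \<le> y" "y \<le> norm h" by auto
      then have y_range: "\<kappa> * t \<le> y" "0 < y" "y \<le> ?n * t" "y \<le> 1"
        using norm_gt_of_large_Dh2[OF t_bounds(1) h_bounds(2)] \<kappa>_t_pos h_bounds(1) t_bounds by linarith+
      have "\<epsilon> < Delta2 f x y / y"
        using Delta2_gt_near_large_Dh2[OF t_bounds(1) h_bounds near y_bounds y_range(2)] y_range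
        by (simp add: field_simps)
      moreover have "1 / (?n * t) \<le> 1 / y" using y_range by (intro divide_left_mono) auto
      ultimately show ?thesis using True y_range by (simp add: sq_density_def ennreal_leI)
    qed simp
  qed
  finally show ?thesis .
qed

lemma sq_density_mass_ge_near_support:
  assumes b_large: "\<And>c. b k c \<noteq> 0 \<Longrightarrow> (real DIM('a) + 1) * \<epsilon> / 2 ^ k < \<bar>tent_piece f k c\<bar>"
    and k_bounds: "1 \<le> k" "real DIM('a) \<le> 2 ^ k" and near: "near_support \<kappa> b k x"
  shows "ennreal (\<kappa> / real DIM('a))
    \<le> (\<integral>\<^sup>+y. of_bool (\<kappa> / 2 ^ k \<le> y \<and> y \<le> real DIM('a) / 2 ^ k) * sq_density f \<epsilon> x y \<partial>lborel)"
proof -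
  have "f \<in> borel_measurable borel" by (rule borel_measurable_continuous_onI[OF continuous])
  obtain S where "\<And>x. \<bar>f x\<bar> \<le> S" using bounded_range by (auto simp: bounded_iff)
  obtain c where c_bounds: "b k c \<noteq> 0" "dist x c < \<kappa> / 2 ^ k" using near by (auto simp: near_support_def)
  obtain h where h_bounds: "norm h \<le> real DIM('a) / 2 ^ k" "(real DIM('a) + 1) * \<epsilon> / 2 ^ k < \<bar>Dh2 h f c\<bar>"
    by (rule tent_piece_large[OF \<open>f \<in> borel_measurable borel\<close> \<open>\<And>x. \<bar>f x\<bar> \<le> S\<close>
      k_bounds(1) b_large[OF c_bounds(1)]])
  show ?thesis
    using sq_density_mass_ge[of "1 / 2 ^ k" h c x] h_bounds c_bounds(2) k_bounds(2) by (simp add: dist_norm)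
qed

lemma near_support_tail_le:
  assumes b_large: "\<And>k c. b k c \<noteq> 0 \<Longrightarrow> (real DIM('a) + 1) * \<epsilon> / 2 ^ k < \<bar>tent_piece f k c\<bar>"
    and m_bounds: "1 \<le> m" "real DIM('a) \<le> 2 ^ m" and DIM_less: "real DIM('a) < \<kappa> * 2 ^ N"
  shows "(\<Sum>k. of_bool (m \<le> k \<and> near_support \<kappa> b k x)) \<le> ennreal (real DIM('a) / \<kappa> * real N) * sq_inner f \<epsilon> x"
proof -
  let ?n = "real DIM('a)" and ?P = "\<lambda>k. m \<le> k \<and> near_support \<kappa> b k x"
  let ?near = "\<lambda>k y. \<kappa> / 2 ^ k \<le> y \<and> y \<le> ?n / 2 ^ k"
  have [measurable]: "sq_density f \<epsilon> x \<in> borel_measurable borel"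
    using measurable_compose[OF measurable_Pair1'
      sq_density_measurable[OF continuous bounded_range, of \<epsilon>], of x]
        by simp
  have mass: "ennreal (\<kappa> / ?n) * of_bool (?P k) \<le> (\<integral>\<^sup>+y. of_bool (?near k y) * sq_density f \<epsilon> x y \<partial>lborel)" for k
  proof (cases "?P k")
    case True
    then have "(2::real) ^ m \<le> 2 ^ k" by (intro power_increasing) auto
    then have "1 \<le> k" "real DIM('a) \<le> 2 ^ k" using True m_bounds by linarith+
    then show ?thesis using sq_density_mass_ge_near_support[of b k x] b_large True by simp
  qed auto
  have "ennreal (\<kappa> / ?n) * (\<Sum>k. of_bool (?P k)) = (\<Sum>k. ennreal (\<kappa> / ?n) * of_bool (?P k))" by simp
  also have "\<dots> \<le> (\<Sum>k. \<integral>\<^sup>+y. of_bool (?near k y) * sq_density f \<epsilon> x y \<partial>lborel)"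
    by (intro suminf_le summableI mass)
  also have "\<dots> = (\<integral>\<^sup>+y. (\<Sum>k. of_bool (?near k y) * sq_density f \<epsilon> x y) \<partial>lborel)"
    by (rule nn_integral_suminf[symmetric]) measurable
  also have "\<dots> \<le> (\<integral>\<^sup>+y. of_nat N * sq_density f \<epsilon> x y \<partial>lborel)"
    by (intro nn_integral_mono)
      (simp only: ennreal_suminf_multc count_dyadic_scales_le[OF \<kappa>_bounds(1) of_nat_0_le_iff DIM_less]
        mult_right_mono zero_le)
  also have "\<dots> = of_nat N * sq_inner f \<epsilon> x" unfolding sq_inner_eq_integral_density
    by (rule nn_integral_cmult) measurable
  finally have "ennreal (?n / \<kappa>) * (ennreal (\<kappa> / ?n) * (\<Sum>k. of_bool (?P k)))
      \<le> ennreal (?n / \<kappa>) * (of_nat N * sq_inner f \<epsilon> x)"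
    by (intro mult_left_mono) auto
  then show ?thesis
    using \<kappa>_bounds by (simp add: mult.assoc[symmetric] ennreal_mult[symmetric] ennreal_of_nat_eq_real_of_nat)
qed

end

lemma near_support_count_le:
  fixes f :: "'a::euclidean_space \<Rightarrow> real"
  assumes f_Lambda1: "f \<in> Lambda1" and \<epsilon>_pos: "0 < \<epsilon>"
  obtains \<kappa> C :: real and m :: nat where "0 < \<kappa>" "0 < C"
    "\<And>b x. (\<And>k c. b k c \<noteq> 0 \<Longrightarrow> (real DIM('a) + 1) * \<epsilon> / 2 ^ k < \<bar>tent_piece f k c\<bar>) \<Longrightarrow>
       (\<Sum>k. of_bool (near_support \<kappa> b k x)) \<le>
         (\<Sum>k<m. of_bool (near_support \<kappa> b k x)) + ennreal C * sq_inner f \<epsilon> x"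
proof -
  obtain M where M_zygmund: "1 \<le> M" "zygmund_bounded M f" using Lambda1_zygmund_bounded[OF f_Lambda1] by blast
  obtain \<kappa>\<^sub>0 where \<kappa>\<^sub>0: "0 < \<kappa>\<^sub>0" "Dh2_modulus (real DIM('a)) \<epsilon> \<kappa>\<^sub>0 f"
    by (rule Dh2_modulus_exists[OF M_zygmund(2), where R="real DIM('a)" and \<eta>=\<epsilon>]) (use M_zygmund \<epsilon>_pos in auto)
  define \<kappa> where "\<kappa> = min \<kappa>\<^sub>0 (\<epsilon> / (2 * M))"
  have \<kappa>_pos: "0 < \<kappa>" using \<kappa>\<^sub>0 \<epsilon>_pos M_zygmund by (simp add: \<kappa>_def)
  have "Dh2_modulus (real DIM('a)) \<epsilon> \<kappa> f"
    by (rule Dh2_modulus_antimono[OF \<kappa>\<^sub>0(2)]) (simp add: \<kappa>_def)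
  then interpret scale: oscillation_scale f M \<epsilon> \<kappa>
    using f_Lambda1 M_zygmund \<epsilon>_pos \<kappa>_pos by unfold_locales (auto simp: Lambda1_def \<kappa>_def)
  obtain N where "real DIM('a) / \<kappa> < 2 ^ N" using real_arch_pow[of 2 "real DIM('a) / \<kappa>"] by auto
  then have "real DIM('a) < \<kappa> * 2 ^ N" using \<kappa>_pos by (simp add: pos_divide_less_eq mult.commute)
  also have "\<dots> \<le> \<kappa> * 2 ^ Suc N" using \<kappa>_pos by simp
  finally have DIM_less: "real DIM('a) < \<kappa> * 2 ^ Suc N" .
  obtain m where DIM_less_2_m: "real DIM('a) < 2 ^ m" using real_arch_pow[of 2 "real DIM('a)"] by auto
  have "m \<noteq> 0" using DIM_less_2_m DIM_positive[where 'a='a] by (intro notI) (simp add: Suc_le_eq)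
  show ?thesis
  proof (rule that[OF \<kappa>_pos])
    show "0 < real DIM('a) / \<kappa> * real (Suc N)" using \<kappa>_pos by simp
    show "(\<Sum>k. of_bool (near_support \<kappa> b k x))
        \<le> (\<Sum>k<m. of_bool (near_support \<kappa> b k x)) + ennreal (real DIM('a) / \<kappa> * real (Suc N)) * sq_inner f \<epsilon> x"
      if "\<And>k c. b k c \<noteq> 0 \<Longrightarrow> (real DIM('a) + 1) * \<epsilon> / 2 ^ k < \<bar>tent_piece f k c\<bar>" for b x
      unfolding suminf_of_bool_split[of "\<lambda>k. near_support \<kappa> b k x" m]
      using that DIM_less_2_m \<open>m \<noteq> 0\<close> DIM_less by (intro add_left_mono scale.near_support_tail_le) auto
  qed
qed

section \<open>The distance formula\<close>

definition large_piece :: "('a::euclidean_space \<Rightarrow> real) \<Rightarrow> real \<Rightarrow> nat \<Rightarrow> 'a \<Rightarrow> real" where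
  "large_piece f \<Lambda> k x = (if \<Lambda> / 2 ^ k < \<bar>tent_piece f k x\<bar> then tent_piece f k x else 0)"

lemma large_piece_measurable [measurable]:
  assumes [measurable]: "f \<in> borel_measurable borel"
  shows "large_piece f \<Lambda> k \<in> borel_measurable borel"
  unfolding large_piece_def[abs_def] by measurable

lemma bounded_near_support_large_piece:
  assumes f_C0: "f \<in> C0" and \<Lambda>_pos: "0 < \<Lambda>"
  shows "bounded {x. near_support \<kappa> (large_piece f \<Lambda>) k x}"
proof -
  have "eventually (\<lambda>x. dist (tent_piece f k x) 0 < \<Lambda> / 2 ^ k) at_infinity"
    using \<Lambda>_pos by (intro tendstoD tent_piece_tendsto_0_at_infinity[OF f_C0]) simp
  then obtain R where piece_small: "\<And>x. R \<le> norm x \<Longrightarrow> \<bar>tent_piece f k x\<bar> < \<Lambda> / 2 ^ k"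
    by (auto simp: eventually_at_infinity)
  have "norm x \<le> R + \<kappa> / 2 ^ k" if near: "near_support \<kappa> (large_piece f \<Lambda>) k x" for x
  proof -
    obtain z where z_bounds: "large_piece f \<Lambda> k z \<noteq> 0" "dist x z < \<kappa> / 2 ^ k" using near
      by (auto simp: near_support_def)
    then have "\<Lambda> / 2 ^ k < \<bar>tent_piece f k z\<bar>" by (simp add: large_piece_def split: if_splits)
    then have "norm z < R" using piece_small[of z] by linarith
    then show ?thesis using z_bounds(2) norm_triangle_ineq2[of x z] by (simp add: dist_norm)
  qed
  then show ?thesis unfolding bounded_iff by blast
qed

lemma nn_integral_near_support_finite:
  assumes "bounded {x. near_support \<kappa> b k x}" and q_pos: "0 < q"
  shows "(\<integral>\<^sup>+x. enn_powr (of_bool (near_support \<kappa> b k x)) q \<partial>lborel) < \<infinity>"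
proof -
  have "(\<integral>\<^sup>+x. enn_powr (of_bool (near_support \<kappa> b k x)) q \<partial>lborel)
      = (\<integral>\<^sup>+x. indicator {x. near_support \<kappa> b k x} x \<partial>lborel)"
    using q_pos by (intro nn_integral_cong) (auto simp: enn_powr_def indicator_def)
  also have "\<dots> = emeasure lborel {x. near_support \<kappa> b k x}" by (intro nn_integral_indicator) measurable
  also have "\<dots> < \<infinity>" using emeasure_bounded_finite[OF assms(1)] by simp
  finally show ?thesis .
qed

lemma near_support_large_piece_finite:
  fixes f :: "'a::euclidean_space \<Rightarrow> real"
  assumes p_pos: "0 < p" and f_mem: "f \<in> C0" "f \<in> Lambda1" and \<epsilon>_pos: "0 < \<epsilon>" and fin: "sq_Lp_finite p f \<epsilon>"
  defines "\<Lambda> \<equiv> (real DIM('a) + 1) * \<epsilon>"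
  obtains \<kappa> where "0 < \<kappa>"
    "(\<integral>\<^sup>+x. enn_powr (\<Sum>k. of_bool (near_support \<kappa> (large_piece f \<Lambda>) k x)) (p / 2) \<partial>lborel) < \<infinity>"
proof -
  have p_half_pos: "0 < p / 2" and \<Lambda>_pos: "0 < \<Lambda>" using p_pos \<epsilon>_pos by (simp_all add: \<Lambda>_def add_nonneg_pos)
  have [measurable]: "sq_inner f \<epsilon> \<in> borel_measurable borel"
    using f_mem(2) by (intro sq_inner_measurable) (auto simp: Lambda1_def)
  obtain \<kappa> C :: real and m :: nat where \<kappa>_pos: "0 < \<kappa>" and C_pos: "0 < C" and count_le:
    "\<And>b x. (\<And>k c. b k c \<noteq> 0 \<Longrightarrow> (real DIM('a) + 1) * \<epsilon> / 2 ^ k < \<bar>tent_piece f k c\<bar>) \<Longrightarrow>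
       (\<Sum>k. of_bool (near_support \<kappa> b k x)) \<le>
         (\<Sum>k<m. of_bool (near_support \<kappa> b k x)) + ennreal C * sq_inner f \<epsilon> x"
    by (rule near_support_count_le[OF f_mem(2) \<epsilon>_pos]) (rule that; blast)
  let ?near = "\<lambda>k x. near_support \<kappa> (large_piece f \<Lambda>) k x"
  define F where "F k x = (if k < m then of_bool (?near k x) else ennreal C * sq_inner f \<epsilon> x)" for k x
  have F_measurable [measurable]: "F k \<in> borel_measurable borel" for k
    unfolding F_def[abs_def] by (cases "k < m") simp_all
  have "(\<integral>\<^sup>+x. enn_powr (ennreal C * sq_inner f \<epsilon> x) (p / 2) \<partial>lborel)
      = ennreal (C powr (p / 2)) * (\<integral>\<^sup>+x. enn_powr (sq_inner f \<epsilon> x) (p / 2) \<partial>lborel)"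
    unfolding enn_powr_cmult[OF C_pos p_half_pos] by (rule nn_integral_cmult) measurable
  also have "\<dots> < \<infinity>"
    using fin unfolding sq_Lp_finite_def nn_integral_completion by (simp add: ennreal_mult_less_top)
  finally have "(\<integral>\<^sup>+x. enn_powr (F k x) (p / 2) \<partial>lborel) < \<infinity>" for k
    using nn_integral_near_support_finite[OF
      bounded_near_support_large_piece[OF f_mem(1) \<Lambda>_pos] p_half_pos, of \<kappa> k]
    by (cases "k < m") (simp_all add: F_def)
  then have F_fin: "(\<integral>\<^sup>+x. enn_powr (\<Sum>k<Suc m. F k x) (p / 2) \<partial>lborel) < \<infinity>"
    using p_half_pos by (intro nn_integral_enn_powr_sum_finite) auto
  have "(\<Sum>k. of_bool (?near k x)) \<le> (\<Sum>k<Suc m. F k x)" for x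
    using count_le[of "large_piece f \<Lambda>" x] by (simp add: F_def large_piece_def \<Lambda>_def split: if_splits)
  then have "(\<integral>\<^sup>+x. enn_powr (\<Sum>k. of_bool (?near k x)) (p / 2) \<partial>lborel)
      \<le> (\<integral>\<^sup>+x. enn_powr (\<Sum>k<Suc m. F k x) (p / 2) \<partial>lborel)"
    using p_half_pos by (intro nn_integral_mono enn_powr_mono) auto
  then show ?thesis using F_fin by (intro that[OF \<kappa>_pos]) (rule le_less_trans)
qed

definition dist_const :: "'a::euclidean_space itself \<Rightarrow> real" where
  "dist_const _ = (10 + 32 * (real DIM('a))\<^sup>2) * (real DIM('a) + 1)"

theorem W1p_approximation:
  fixes f :: "'a::euclidean_space \<Rightarrow> real"
  assumes p_gt_1: "1 < p" and f_mem: "f \<in> C0" "f \<in> Lambda1" and \<epsilon>_pos: "0 < \<epsilon>" and fin: "sq_Lp_finite p f \<epsilon>"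
  obtains g where "g \<in> W1p p \<inter> Lambda1" "Lambda1_norm (\<lambda>x. f x - g x) \<le> dist_const TYPE('a) * \<epsilon>"
proof -
  define \<Lambda> where "\<Lambda> = (real DIM('a) + 1) * \<epsilon>"
  have \<Lambda>_pos: "0 < \<Lambda>" using \<epsilon>_pos by (simp add: \<Lambda>_def add_nonneg_pos)
  have f_borel [measurable]: "f \<in> borel_measurable borel"
    using f_mem(2) by (auto simp: Lambda1_def intro: borel_measurable_continuous_onI)
  obtain S where f_bounded: "\<And>x. \<bar>f x\<bar> \<le> S" using f_mem(2) by (auto simp: Lambda1_def bounded_iff)
  obtain M where M_zygmund: "1 \<le> M" "zygmund_bounded M f" using Lambda1_zygmund_bounded[OF f_mem(2)] by blast
  define A where "A = S + M * real DIM('a)"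
  have piece_le: "\<bar>tent_piece f k x\<bar> \<le> A * (1/2) ^ k" for k x
    unfolding A_def using M_zygmund by (intro tent_piece_abs_le f_bounded) auto
  let ?b = "large_piece f \<Lambda>" and ?c = "\<lambda>k x. tent_piece f k x - large_piece f \<Lambda> k x"
  have b_le: "\<bar>?b k x\<bar> \<le> A * (1/2) ^ k" for k x
    using piece_le[of k x] by (auto simp: large_piece_def intro: order_trans[OF abs_ge_zero])
  have c_le: "\<bar>?c k x\<bar> \<le> \<Lambda> * (1/2) ^ k" for k x
    using \<Lambda>_pos by (simp add: large_piece_def power_one_over not_less)
  interpret large: tent_series ?b A by unfold_locales (simp_all add: b_le)
  interpret small: tent_series ?c \<Lambda> by unfold_locales (simp_all add: c_le)
  obtain \<kappa> where "0 < \<kappa>" "(\<integral>\<^sup>+x. enn_powr (\<Sum>k. of_bool (near_support \<kappa> ?b k x)) (p / 2) \<partial>lborel) < \<infinity>"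
    using near_support_large_piece_finite[OF _ f_mem \<epsilon>_pos fin] p_gt_1 unfolding \<Lambda>_def by auto
  then have large_W1p: "large.series \<in> W1p p" by (rule large.series_W1p[OF p_gt_1])
  have decomposition: "f x - large.series x = small.series x" for x
  proof -
    have "(\<lambda>k. tent_avg (1 / 2 ^ Suc k) (tent_piece f k) x - large.summand k x) sums (f x - large.series x)"
      using tent_piece_sums[OF f_borel f_bounded M_zygmund(2)] M_zygmund(1)
      by (intro sums_diff large.series_sums) auto
    moreover have "small.summand k x = tent_avg (1 / 2 ^ Suc k) (tent_piece f k) x - large.summand k x" for k
      unfolding small.summand_def large.summand_def
      by (rule tent.avg_diff[OF tent_piece_measurable[OF f_borel] large.coeff_measurable piece_le b_le])
    ultimately have "(\<lambda>k. small.summand k x) sums (f x - large.series x)" by (simp only:)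
    then show ?thesis using small.series_sums by (rule sums_unique2)
  qed
  show ?thesis
  proof (rule that)
    have "(\<lambda>x. f x - small.series x) = large.series" by (rule ext) (simp add: decomposition[symmetric])
    then have "large.series \<in> Lambda1" using Lambda1_diff[OF f_mem(2) small.series_Lambda1] by simp
    then show "large.series \<in> W1p p \<inter> Lambda1" using large_W1p by blast
    have "(\<lambda>x. f x - large.series x) = small.series" by (rule ext) (rule decomposition)
    then show "Lambda1_norm (\<lambda>x. f x - large.series x) \<le> dist_const TYPE('a) * \<epsilon>"
      using small.Lambda1_norm_series_le by (simp add: dist_const_def \<Lambda>_def mult.assoc)
  qed
qed

lemma sq_Lp_finite_of_Lambda1_norm_le:
  fixes f :: "'a::euclidean_space \<Rightarrow> real"
  assumes f_Lambda1: "f \<in> Lambda1" and norm_le: "Lambda1_norm f \<le> \<epsilon>"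
  shows "sq_Lp_finite p f \<epsilon>"
proof -
  have "Delta2 f x y / y \<le> \<epsilon>" if y_unit: "y \<in> {0<..1}" for x y
  proof -
    have "Delta2 f x y \<le> Lambda1_norm f * y"
      by (rule Delta2_le) (use y_unit Lambda1_norm_ge_Dh2[OF f_Lambda1, of _ x] in auto)
    also have "\<dots> \<le> \<epsilon> * y" using norm_le y_unit by (intro mult_right_mono) auto
    finally show ?thesis using y_unit by (simp add: field_simps)
  qed
  then have "{y \<in> {0<..1}. Delta2 f x y / y > \<epsilon>} = {}" for x unfolding not_less[symmetric] by blast
  then have "sq_inner f \<epsilon> x = 0" for x by (simp add: sq_inner_def)
  then show ?thesis by (simp add: sq_Lp_finite_def enn_powr_def)
qed

lemma sq_inner_le_of_Lambda1_norm_diff_le: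
  fixes f g :: "'a::euclidean_space \<Rightarrow> real"
  assumes g_Lambda1: "g \<in> Lambda1" and diff_Lambda1: "(\<lambda>x. f x - g x) \<in> Lambda1"
    and norm_diff_le: "Lambda1_norm (\<lambda>x. f x - g x) \<le> \<epsilon>"
  shows "sq_inner f (2 * \<epsilon>) x \<le> sq_inner g \<epsilon> x"
proof -
  have "Delta2 g x y / y > \<epsilon>" if y_unit: "y \<in> {0<..1}" and Delta2_gt: "Delta2 f x y / y > 2 * \<epsilon>" for y
  proof -
    have "2 * \<epsilon> * y < Delta2 f x y" using y_unit Delta2_gt by (simp add: field_simps)
    then obtain h where h_large: "norm h = y" "2 * \<epsilon> * y < \<bar>Dh2 h f x\<bar>" using y_unit
      by (auto elim: less_Delta2D[rotated])
    have "\<bar>Dh2 h f x - Dh2 h g x\<bar> \<le> Lambda1_norm (\<lambda>x. f x - g x) * y"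
      using Lambda1_norm_ge_Dh2[OF diff_Lambda1, of h x] h_large y_unit by (simp add: Dh2_diff)
    also have "\<dots> \<le> \<epsilon> * y" using norm_diff_le y_unit by (intro mult_right_mono) auto
    finally have "\<epsilon> * y < \<bar>Dh2 h g x\<bar>" using h_large by linarith
    also have "\<dots> \<le> Delta2 g x y" using g_Lambda1 h_large by (intro Delta2_ge) (auto simp: Lambda1_def)
    finally show ?thesis using y_unit by (simp add: field_simps)
  qed
  then show ?thesis unfolding sq_inner_def
    by (intro nn_integral_mono mult_right_mono) (auto simp: indicator_def)
qed

lemma eps_Lambda_le: "0 < \<epsilon> \<Longrightarrow> sq_Lp_finite p f \<epsilon> \<Longrightarrow> eps_Lambda p f \<le> \<epsilon>"
  unfolding eps_Lambda_def by (rule cInf_lower) (auto intro: bdd_belowI[of _ 0])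

lemma le_eps_Lambda:
  assumes f_Lambda1: "f \<in> Lambda1" and c_le: "\<And>\<epsilon>. 0 < \<epsilon> \<Longrightarrow> sq_Lp_finite p f \<epsilon> \<Longrightarrow> c \<le> \<epsilon>"
  shows "c \<le> eps_Lambda p f"
  unfolding eps_Lambda_def
proof (rule cInf_greatest)
  have "Lambda1_norm f + 1 \<in> {\<epsilon>. 0 < \<epsilon> \<and> sq_Lp_finite p f \<epsilon>}"
    using Lambda1_norm_nonneg[OF f_Lambda1]
      sq_Lp_finite_of_Lambda1_norm_le[OF f_Lambda1, of "Lambda1_norm f + 1" p] by auto
  then show "{\<epsilon>. 0 < \<epsilon> \<and> sq_Lp_finite p f \<epsilon>} \<noteq> {}" by blast
qed (use c_le in auto)

lemma dist_Lambda1_le: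
  assumes f_Lambda1: "f \<in> Lambda1" and V_Lambda1: "V \<subseteq> Lambda1" and g_mem: "g \<in> V"
  shows "dist_Lambda1 f V \<le> Lambda1_norm (\<lambda>x. f x - g x)"
  unfolding dist_Lambda1_def
proof (rule cINF_lower[OF _ g_mem])
  show "bdd_below ((\<lambda>g. Lambda1_norm (\<lambda>x. f x - g x)) ` V)"
    using V_Lambda1 by (intro bdd_belowI2[of _ 0] Lambda1_norm_nonneg Lambda1_diff f_Lambda1) blast
qed

lemma dist_const_pos: "0 < dist_const TYPE('a::euclidean_space)"
  unfolding dist_const_def by (intro mult_pos_pos add_pos_nonneg add_nonneg_pos) auto

theorem dist_Lambda1_le_eps_Lambda:
  fixes f :: "'a::euclidean_space \<Rightarrow> real"
  assumes p_gt_1: "1 < p" and f_mem: "f \<in> C0" "f \<in> Lambda1"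
  shows "dist_Lambda1 f (W1p p \<inter> Lambda1) \<le> dist_const TYPE('a) * eps_Lambda p f"
proof -
  have "dist_Lambda1 f (W1p p \<inter> Lambda1) / dist_const TYPE('a) \<le> eps_Lambda p f"
  proof (rule le_eps_Lambda[OF f_mem(2)])
    fix \<epsilon> :: real assume \<epsilon>_bounds: "0 < \<epsilon>" "sq_Lp_finite p f \<epsilon>"
    obtain g where g_bounds: "g \<in> W1p p \<inter> Lambda1" "Lambda1_norm (\<lambda>x. f x - g x) \<le> dist_const TYPE('a) * \<epsilon>"
      by (rule W1p_approximation[OF p_gt_1 f_mem \<epsilon>_bounds])
    then have "dist_Lambda1 f (W1p p \<inter> Lambda1) \<le> dist_const TYPE('a) * \<epsilon>"
      using dist_Lambda1_le[OF f_mem(2) Int_lower2 g_bounds(1)] by linarith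
    then show "dist_Lambda1 f (W1p p \<inter> Lambda1) / dist_const TYPE('a) \<le> \<epsilon>"
      using dist_const_pos[where 'a='a] by (simp add: pos_divide_le_eq mult.commute)
  qed
  then show ?thesis using dist_const_pos[where 'a='a] by (simp add: pos_divide_le_eq mult.commute)
qed

lemma eps_Lambda_le_Lambda1_norm_diff:
  fixes f g :: "'a::euclidean_space \<Rightarrow> real"
  assumes p_gt_1: "1 < p" and f_Lambda1: "f \<in> Lambda1" and g_mem: "g \<in> W1p p" "g \<in> Lambda1"
  shows "eps_Lambda p f \<le> 2 * Lambda1_norm (\<lambda>x. f x - g x)"
proof (rule field_le_epsilon)
  fix \<eta> :: real assume \<eta>_pos: "0 < \<eta>"
  define \<epsilon> where "\<epsilon> = Lambda1_norm (\<lambda>x. f x - g x) + \<eta> / 2"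
  have diff_Lambda1: "(\<lambda>x. f x - g x) \<in> Lambda1" by (rule Lambda1_diff[OF f_Lambda1 g_mem(2)])
  have \<epsilon>_pos: "0 < \<epsilon>" using Lambda1_norm_nonneg[OF diff_Lambda1] \<eta>_pos by (simp add: \<epsilon>_def)
  have "sq_inner f (2 * \<epsilon>) x \<le> sq_inner g \<epsilon> x" for x
    using \<eta>_pos by (intro sq_inner_le_of_Lambda1_norm_diff_le[OF g_mem(2) diff_Lambda1]) (simp add: \<epsilon>_def)
  then have "(\<integral>\<^sup>+x. enn_powr (sq_inner f (2 * \<epsilon>) x) (p / 2) \<partial>lebesgue)
      \<le> (\<integral>\<^sup>+x. enn_powr (sq_inner g \<epsilon> x) (p / 2) \<partial>lebesgue)"
    using p_gt_1 by (intro nn_integral_mono enn_powr_mono) auto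
  also have "\<dots> < \<infinity>" using W1p_Lambda1_sq_Lp_finite[OF p_gt_1 g_mem \<epsilon>_pos] by (simp add: sq_Lp_finite_def)
  finally have "eps_Lambda p f \<le> 2 * \<epsilon>" using \<epsilon>_pos by (intro eps_Lambda_le) (simp_all add: sq_Lp_finite_def)
  then show "eps_Lambda p f \<le> 2 * Lambda1_norm (\<lambda>x. f x - g x) + \<eta>" by (simp add: \<epsilon>_def)
qed

theorem eps_Lambda_le_dist_Lambda1:
  fixes f :: "'a::euclidean_space \<Rightarrow> real"
  assumes p_gt_1: "1 < p" and f_mem: "f \<in> C0" "f \<in> Lambda1"
  shows "1 / 2 * eps_Lambda p f \<le> dist_Lambda1 f (W1p p \<inter> Lambda1)"
  unfolding dist_Lambda1_def
proof (rule cINF_greatest)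
  have "0 < Lambda1_norm f + 1" "sq_Lp_finite p f (Lambda1_norm f + 1)"
    using Lambda1_norm_nonneg[OF f_mem(2)] by (auto intro: sq_Lp_finite_of_Lambda1_norm_le[OF f_mem(2)])
  then show "W1p p \<inter> Lambda1 \<noteq> ({} :: ('a \<Rightarrow> real) set)" by (rule W1p_approximation[OF p_gt_1 f_mem]) blast
  show "1 / 2 * eps_Lambda p f \<le> Lambda1_norm (\<lambda>x. f x - g x)" if "g \<in> W1p p \<inter> Lambda1" for g
    using eps_Lambda_le_Lambda1_norm_diff[OF p_gt_1 f_mem(2), of g] that by simp
qed

theorem mainTheorem13:
  fixes p :: real
  assumes "1 < p"
  shows "\<exists>C1 C2. C1 > 0 \<and> C2 > 0 \<and>
    (\<forall>f :: 'a::euclidean_space \<Rightarrow> real. f \<in> C0 \<inter> Lambda1 \<longrightarrow>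
       C1 * eps_Lambda p f \<le> dist_Lambda1 f (W1p p \<inter> Lambda1) \<and>
       dist_Lambda1 f (W1p p \<inter> Lambda1) \<le> C2 * eps_Lambda p f)"
proof (intro exI conjI allI impI)
  show "(0::real) < 1 / 2" "0 < dist_const TYPE('a)" by (simp_all add: dist_const_pos)
  fix f :: "'a \<Rightarrow> real" assume "f \<in> C0 \<inter> Lambda1"
  then have f: "f \<in> C0" "f \<in> Lambda1" by simp_all
  show "1 / 2 * eps_Lambda p f \<le> dist_Lambda1 f (W1p p \<inter> Lambda1)"
    by (rule eps_Lambda_le_dist_Lambda1[OF assms f])
  show "dist_Lambda1 f (W1p p \<inter> Lambda1) \<le> dist_const TYPE('a) * eps_Lambda p f"
    by (rule dist_Lambda1_le_eps_Lambda[OF assms f])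
qed

end
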